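(* In any model obtained by adding uncountably many Cohen reals to a model of the Continuum Hypothesis, there are $\gamma$-spaces $X,Y\subseteq\mathbb R$ such that $X\times Y$ satisfies $\mathsf S_1(\Omega,\Omega)$ but not $\mathsf U_{\mathrm{fin}}(\mathrm O,\Gamma)$.
   Context: A cover of $X$ is a family $\mathcal U$ with $X=\bigcup\mathcal U$ such that $X$ is not contained in a single member. $\Omega(X)$: open $\omega$-covers (every finite subset lies in some member); $\Gamma(X)$: open $\gamma$-covers (infinite, each point in all but finitely many members). $X$ is a $\gamma$-space if every member of $\Omega(X)$ contains a member of $\Gamma(X)$. $\mathsf S_1(\Omega,\Omega)$: for every sequence $(\mathcal U_n)$ in $\Omega(X)$ there are $U_n\in\mathcal U_n$ with $\{U_n\}\in\Omega(X)$. $\mathsf U_{\mathrm{fin}}(\mathrm O,\Gamma)$: for every sequence $(\mathcal U_n)$ of open covers none of which contains a finite subcover, there are finite $\mathcal F_n\subseteq\mathcal U_n$ with $\{\bigcup\mathcal F_n:n\in\mathbb N\}\in\Gamma(X)$. *)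

theory Defs
  imports "HOL-Algebra.Ring"
begin

text \<open>
  A model of set theory is a binary relation on a HOL type: \<open>x \<epsilon> y\<close> says that the model
  believes that \<open>x\<close> is an element of \<open>y\<close>.  Everything in the context below is a notion of set
  theory interpreted inside such a model: each quantifier over sets, functions, sequences, covers
  etc. ranges over the elements of the model only.
\<close>

text \<open>First-order formulas of the language of set theory, with variables \<open>v\<^sub>0, v\<^sub>1, \<dots>\<close>
  named by their index.\<close>

datatype fm = Mem nat nat | Eq nat nat | Neg fm | Conj fm fm | Forall nat fm

primrec sat :: "('a \<Rightarrow> 'a \<Rightarrow> bool) \<Rightarrow> (nat \<Rightarrow> 'a) \<Rightarrow> fm \<Rightarrow> bool" where
  "sat E s (Mem i j) \<longleftrightarrow> E (s i) (s j)"
| "sat E s (Eq i j) \<longleftrightarrow> s i = s j"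
| "sat E s (Neg \<phi>) \<longleftrightarrow> \<not> sat E s \<phi>"
| "sat E s (Conj \<phi> \<psi>) \<longleftrightarrow> sat E s \<phi> \<and> sat E s \<psi>"
| "sat E s (Forall i \<phi>) \<longleftrightarrow> (\<forall>x. sat E (s(i := x)) \<phi>)"

context
  fixes E :: "'a \<Rightarrow> 'a \<Rightarrow> bool"  (infix "\<epsilon>" 50)
begin

definition elts :: "'a \<Rightarrow> 'a set" where
  "elts x = {y. y \<epsilon> x}"

definition extensional_model :: bool where
  "extensional_model \<longleftrightarrow> (\<forall>x y. elts x = elts y \<longrightarrow> x = y)"

definition is_Union :: "'a \<Rightarrow> 'a \<Rightarrow> bool" where
  "is_Union x u \<longleftrightarrow> elts u = (\<Union>y \<in> elts x. elts y)"

definition is_Pow :: "'a \<Rightarrow> 'a \<Rightarrow> bool" where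
  "is_Pow x p \<longleftrightarrow> elts p = {y. elts y \<subseteq> elts x}"

text \<open>Kuratowski pairs\<close>
definition is_pair :: "'a \<Rightarrow> 'a \<Rightarrow> 'a \<Rightarrow> bool" where
  "is_pair a b p \<longleftrightarrow> (\<exists>u v. elts u = {a} \<and> elts v = {a, b} \<and> elts p = {u, v})"

definition is_prod :: "'a \<Rightarrow> 'a \<Rightarrow> 'a \<Rightarrow> bool" where
  "is_prod A B C \<longleftrightarrow> elts C = {p. \<exists>a \<in> elts A. \<exists>b \<in> elts B. is_pair a b p}"

definition is_inductive :: "'a \<Rightarrow> bool" where
  "is_inductive w \<longleftrightarrow> (\<exists>z \<in> elts w. elts z = {}) \<and>
     (\<forall>x \<in> elts w. \<exists>y \<in> elts w. elts y = insert x (elts x))"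

definition is_omega :: "'a \<Rightarrow> bool" where
  "is_omega w \<longleftrightarrow> is_inductive w \<and> (\<forall>v. is_inductive v \<longrightarrow> elts w \<subseteq> elts v)"


subsection \<open>The axioms of ZFC\<close>

text \<open>In the two schemes, \<open>s\<close> assigns arbitrary parameters to the variables other than
  \<open>v\<^sub>0\<close> (and \<open>v\<^sub>1\<close>).\<close>

definition separation :: bool where
  "separation \<longleftrightarrow> (\<forall>\<phi> s a. \<exists>b. elts b = {x \<in> elts a. sat (\<epsilon>) (s(0 := x)) \<phi>})"

definition replacement :: bool where
  "replacement \<longleftrightarrow> (\<forall>\<phi> s a.
     (\<forall>x \<in> elts a. \<exists>!y. sat (\<epsilon>) (s(0 := x, 1 := y)) \<phi>) \<longrightarrow>
     (\<exists>b. \<forall>x \<in> elts a. \<exists>y \<in> elts b. sat (\<epsilon>) (s(0 := x, 1 := y)) \<phi>))"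

definition choice :: bool where
  "choice \<longleftrightarrow> (\<forall>a. (\<forall>x \<in> elts a. elts x \<noteq> {}) \<and>
      (\<forall>x \<in> elts a. \<forall>y \<in> elts a. x \<noteq> y \<longrightarrow> elts x \<inter> elts y = {}) \<longrightarrow>
      (\<exists>c. \<forall>x \<in> elts a. \<exists>!y. y \<in> elts x \<inter> elts c))"

definition ZFC :: bool where
  "ZFC \<longleftrightarrow> extensional_model
     \<and> (\<forall>x. elts x \<noteq> {} \<longrightarrow> (\<exists>y \<in> elts x. elts x \<inter> elts y = {}))
     \<and> (\<forall>a b. \<exists>c. elts c = {a, b})
     \<and> (\<forall>x. \<exists>u. is_Union x u)
     \<and> (\<forall>x. \<exists>p. is_Pow x p)
     \<and> (\<exists>w. is_inductive w)
     \<and> separation \<and> replacement \<and> choice"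


subsection \<open>Functions and cardinality\<close>

definition graph :: "'a \<Rightarrow> ('a \<times> 'a) set" where
  "graph f = {(a, b). \<exists>p \<in> elts f. is_pair a b p}"

definition fun_on :: "'a \<Rightarrow> 'a \<Rightarrow> bool" where
  "fun_on f A \<longleftrightarrow> (\<forall>p \<in> elts f. \<exists>a b. is_pair a b p) \<and> Domain (graph f) = elts A \<and>
     single_valued (graph f)"

definition is_map :: "'a \<Rightarrow> 'a \<Rightarrow> 'a \<Rightarrow> bool" where
  "is_map f A B \<longleftrightarrow> fun_on f A \<and> Range (graph f) \<subseteq> elts B"

definition is_injection :: "'a \<Rightarrow> 'a \<Rightarrow> 'a \<Rightarrow> bool" where
  "is_injection f A B \<longleftrightarrow> is_map f A B \<and> single_valued ((graph f)\<inverse>)"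

definition is_bijection :: "'a \<Rightarrow> 'a \<Rightarrow> 'a \<Rightarrow> bool" where
  "is_bijection f A B \<longleftrightarrow> is_injection f A B \<and> Range (graph f) = elts B"

definition is_finite :: "'a \<Rightarrow> bool" where
  "is_finite x \<longleftrightarrow> (\<exists>w n f. is_omega w \<and> n \<in> elts w \<and> is_bijection f x n)"

definition is_countable :: "'a \<Rightarrow> bool" where
  "is_countable x \<longleftrightarrow> (\<exists>w f. is_omega w \<and> is_injection f x w)"

definition CH :: bool where
  "CH \<longleftrightarrow> (\<forall>w p x. is_omega w \<and> is_Pow w p \<and> elts x \<subseteq> elts p \<longrightarrow>
     is_countable x \<or> (\<exists>f. is_bijection f x p))"

definition is_seq :: "'a \<Rightarrow> bool" where
  "is_seq s \<longleftrightarrow> (\<exists>w. is_omega w \<and> fun_on s w)"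


subsection \<open>Forcing\<close>

text \<open>The forcing notion \<open>Fn(I \<times> \<omega>, 2)\<close> of finite partial functions from \<open>I \<times> \<omega>\<close> to
  \<open>2 = {0, 1}\<close>, which adds the Cohen reals \<open>c\<^sub>i : \<omega> \<rightarrow> 2\<close> for \<open>i \<in> I\<close>.\<close>

definition Cohen_conditions :: "'a \<Rightarrow> 'a set" where
  "Cohen_conditions I = {p. is_finite p \<and>
     (\<forall>e \<in> elts p. \<exists>w i n z b. is_omega w \<and> i \<in> elts I \<and> n \<in> elts w \<and>
        is_pair i n z \<and> is_pair z b e \<and>
        (elts b = {} \<or> (\<exists>o'. elts o' = {} \<and> elts b = {o'}))) \<and>
     single_valued (graph p)}"

text \<open>\<open>q\<close> is stronger than \<open>p\<close>\<close>
definition Cohen_le :: "'a \<Rightarrow> 'a \<Rightarrow> bool" where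
  "Cohen_le q p \<longleftrightarrow> elts p \<subseteq> elts q"

definition dense_in :: "'a set \<Rightarrow> ('a \<Rightarrow> 'a \<Rightarrow> bool) \<Rightarrow> 'a \<Rightarrow> bool" where
  "dense_in P leq d \<longleftrightarrow> elts d \<subseteq> P \<and> (\<forall>p \<in> P. \<exists>q \<in> elts d. leq q p)"

text \<open>Genericity over the model: the filter is an arbitrary external subset of \<open>P\<close>, and
  it meets the dense sets that belong to the model.\<close>

definition generic_filter :: "'a set \<Rightarrow> ('a \<Rightarrow> 'a \<Rightarrow> bool) \<Rightarrow> 'a set \<Rightarrow> bool" where
  "generic_filter P leq G \<longleftrightarrow> G \<subseteq> P \<and> G \<noteq> {}
     \<and> (\<forall>p \<in> G. \<forall>q \<in> P. leq p q \<longrightarrow> q \<in> G)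
     \<and> (\<forall>p \<in> G. \<forall>q \<in> G. \<exists>r \<in> G. leq r p \<and> leq r q)
     \<and> (\<forall>d. dense_in P leq d \<longrightarrow> G \<inter> elts d \<noteq> {})"

inductive name :: "'a set \<Rightarrow> 'a \<Rightarrow> bool" for P where
  "(\<And>e. e \<in> elts \<tau> \<Longrightarrow> \<exists>\<sigma> p. name P \<sigma> \<and> p \<in> P \<and> is_pair \<sigma> p e) \<Longrightarrow> name P \<tau>"


subsection \<open>The real line\<close>

text \<open>The operation on elements of the model that is coded by a set \<open>f\<close> of the model which is
  a function on a cartesian product\<close>
definition binop :: "'a \<Rightarrow> 'a \<Rightarrow> 'a \<Rightarrow> 'a" where
  "binop f a b = (THE c. \<exists>p. is_pair a b p \<and> (p, c) \<in> graph f)"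

definition is_binop :: "'a \<Rightarrow> 'a \<Rightarrow> bool" where
  "is_binop f R \<longleftrightarrow> (\<exists>C. is_prod R R C \<and> is_map f C R)"

text \<open>Inside the model, \<open>R\<close> with addition \<open>pl\<close>, multiplication \<open>tm\<close>, constants \<open>ze\<close>, \<open>un\<close> and
  order \<open>leq\<close> is a Dedekind complete ordered field.  Completeness only concerns the subsets of \<open>R\<close>
  that belong to the model.\<close>
definition is_real_line :: "'a \<Rightarrow> 'a \<Rightarrow> 'a \<Rightarrow> 'a \<Rightarrow> 'a \<Rightarrow> 'a \<Rightarrow> bool" where
  "is_real_line R pl tm ze un leq \<longleftrightarrow>
     is_binop pl R \<and> is_binop tm R
     \<and> field \<lparr>carrier = elts R, monoid.mult = binop tm, one = un, zero = ze, add = binop pl\<rparr>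
     \<and> (\<forall>p \<in> elts leq. \<exists>a b. is_pair a b p) \<and> linear_order_on (elts R) (graph leq)
     \<and> (\<forall>a \<in> elts R. \<forall>b \<in> elts R. \<forall>c \<in> elts R.
          (a, b) \<in> graph leq \<longrightarrow> (binop pl a c, binop pl b c) \<in> graph leq)
     \<and> (\<forall>a \<in> elts R. \<forall>b \<in> elts R.
          (ze, a) \<in> graph leq \<and> (ze, b) \<in> graph leq \<longrightarrow> (ze, binop tm a b) \<in> graph leq)
     \<and> (\<forall>S. elts S \<subseteq> elts R \<and> elts S \<noteq> {} \<and> (\<exists>b \<in> elts R. \<forall>x \<in> elts S. (x, b) \<in> graph leq) \<longrightarrow>
          (\<exists>c \<in> elts R. (\<forall>x \<in> elts S. (x, c) \<in> graph leq) \<and>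
             (\<forall>b \<in> elts R. (\<forall>x \<in> elts S. (x, b) \<in> graph leq) \<longrightarrow> (c, b) \<in> graph leq)))"

definition real_open :: "'a \<Rightarrow> 'a \<Rightarrow> 'a \<Rightarrow> bool" where
  "real_open R leq U \<longleftrightarrow> elts U \<subseteq> elts R \<and>
     (\<forall>x \<in> elts U. \<exists>a \<in> elts R. \<exists>b \<in> elts R.
        (a, x) \<in> graph leq - Id \<and> (x, b) \<in> graph leq - Id \<and>
        (\<forall>y \<in> elts R. (a, y) \<in> graph leq - Id \<and> (y, b) \<in> graph leq - Id \<longrightarrow> y \<in> elts U))"

text \<open>A topology on \<open>X\<close> is given as the predicate, on elements of the model, of being an open
  subset of \<open>X\<close>.\<close>

definition sub_open :: "('a \<Rightarrow> bool) \<Rightarrow> 'a \<Rightarrow> 'a \<Rightarrow> bool" where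
  "sub_open opn X U \<longleftrightarrow> (\<exists>V. opn V \<and> elts U = elts V \<inter> elts X)"

definition prod_open ::
    "'a \<Rightarrow> ('a \<Rightarrow> bool) \<Rightarrow> 'a \<Rightarrow> ('a \<Rightarrow> bool) \<Rightarrow> 'a \<Rightarrow> bool" where
  "prod_open X opnX Y opnY U \<longleftrightarrow>
     (\<forall>p \<in> elts U. \<exists>x \<in> elts X. \<exists>y \<in> elts Y. is_pair x y p) \<and>
     (\<forall>p \<in> elts U. \<exists>V W C. opnX V \<and> opnY W \<and> is_prod V W C \<and> p \<in> elts C \<and> elts C \<subseteq> elts U)"


subsection \<open>Covers and selection principles\<close>

definition is_cover :: "'a \<Rightarrow> 'a \<Rightarrow> bool" where
  "is_cover X \<U> \<longleftrightarrow> elts X = (\<Union>U \<in> elts \<U>. elts U) \<and> \<not> (\<exists>U \<in> elts \<U>. elts X \<subseteq> elts U)"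

definition open_cover :: "'a \<Rightarrow> ('a \<Rightarrow> bool) \<Rightarrow> 'a \<Rightarrow> bool" where
  "open_cover X opn \<U> \<longleftrightarrow> is_cover X \<U> \<and> (\<forall>U \<in> elts \<U>. opn U)"

definition omega_cover :: "'a \<Rightarrow> ('a \<Rightarrow> bool) \<Rightarrow> 'a \<Rightarrow> bool" where
  "omega_cover X opn \<U> \<longleftrightarrow> open_cover X opn \<U> \<and>
     (\<forall>F. is_finite F \<and> elts F \<subseteq> elts X \<longrightarrow> (\<exists>U \<in> elts \<U>. elts F \<subseteq> elts U))"

definition gamma_cover :: "'a \<Rightarrow> ('a \<Rightarrow> bool) \<Rightarrow> 'a \<Rightarrow> bool" where
  "gamma_cover X opn \<U> \<longleftrightarrow> open_cover X opn \<U> \<and> \<not> is_finite \<U> \<and>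
     (\<forall>x \<in> elts X. \<exists>\<V>. elts \<V> = {U \<in> elts \<U>. x \<notin> elts U} \<and> is_finite \<V>)"

definition gamma_space :: "'a \<Rightarrow> ('a \<Rightarrow> bool) \<Rightarrow> bool" where
  "gamma_space X opn \<longleftrightarrow>
     (\<forall>\<U>. omega_cover X opn \<U> \<longrightarrow> (\<exists>\<V>. elts \<V> \<subseteq> elts \<U> \<and> gamma_cover X opn \<V>))"

definition S1_Omega_Omega :: "'a \<Rightarrow> ('a \<Rightarrow> bool) \<Rightarrow> bool" where
  "S1_Omega_Omega X opn \<longleftrightarrow>
     (\<forall>s. is_seq s \<and> (\<forall>(n, \<U>) \<in> graph s. omega_cover X opn \<U>) \<longrightarrow>
       (\<exists>t \<V>. is_seq t \<and>
          (\<forall>n \<U> U. (n, \<U>) \<in> graph s \<and> (n, U) \<in> graph t \<longrightarrow> U \<in> elts \<U>) \<and>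
          elts \<V> = Range (graph t) \<and> omega_cover X opn \<V>))"

definition Ufin_O_Gamma :: "'a \<Rightarrow> ('a \<Rightarrow> bool) \<Rightarrow> bool" where
  "Ufin_O_Gamma X opn \<longleftrightarrow>
     (\<forall>s. is_seq s \<and>
        (\<forall>(n, \<U>) \<in> graph s. open_cover X opn \<U> \<and>
           \<not> (\<exists>\<F>. is_finite \<F> \<and> elts \<F> \<subseteq> elts \<U> \<and> is_cover X \<F>)) \<longrightarrow>
       (\<exists>t \<V>. is_seq t \<and>
          (\<forall>n \<U> \<F>. (n, \<U>) \<in> graph s \<and> (n, \<F>) \<in> graph t \<longrightarrow>
             is_finite \<F> \<and> elts \<F> \<subseteq> elts \<U>) \<and>
          elts \<V> = {V. \<exists>\<F> \<in> Range (graph t). is_Union \<F> V} \<and> gamma_cover X opn \<V>))"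

end

text \<open>
  \<open>N\<close> is the generic extension \<open>M[G]\<close> of the well-founded model \<open>M\<close>, up to isomorphism: it is
  extensional and its elements are exactly the values of the \<open>P\<close>-names \<open>\<tau>\<close> of \<open>M\<close>, where
  \<open>val(\<tau>) = {val(\<sigma>) | (\<sigma>, p) \<in> \<tau> for some p \<in> G}\<close>.  As \<open>M\<close> is well-founded, so is \<open>N\<close>, and
  \<open>(N, val)\<close> is determined up to isomorphism (values of non-names aside) by Mostowski's collapse;
  \<open>M\<close> embeds into \<open>N\<close> through the canonical names.
\<close>

definition generic_extension ::
    "('m \<Rightarrow> 'm \<Rightarrow> bool) \<Rightarrow> 'm set \<Rightarrow> 'm set \<Rightarrow> ('n \<Rightarrow> 'n \<Rightarrow> bool) \<Rightarrow> bool" where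
  "generic_extension M P G N \<longleftrightarrow> extensional_model N \<and>
     (\<exists>val. val ` {\<tau>. name M P \<tau>} = UNIV \<and>
        (\<forall>\<tau>. name M P \<tau> \<longrightarrow>
           elts N (val \<tau>) = {val \<sigma> | \<sigma> p e. name M P \<sigma> \<and> p \<in> G \<and> is_pair M \<sigma> p e \<and> e \<in> elts M \<tau>}))"

definition Cohen_extension ::
    "('m \<Rightarrow> 'm \<Rightarrow> bool) \<Rightarrow> 'm \<Rightarrow> ('n \<Rightarrow> 'n \<Rightarrow> bool) \<Rightarrow> bool" where
  "Cohen_extension M I N \<longleftrightarrow>
     (\<exists>G. generic_filter M (Cohen_conditions M I) (Cohen_le M) G \<and>
          generic_extension M (Cohen_conditions M I) G N)"

end

theory Submission
  imports Defs "HOL-Library.Nat_Bijection" "HOL-Library.Infinite_Set" Complex_Main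
begin

text \<open>
  Points of the Cantor space are coded by sets of natural numbers.  By CH, the ground model has a
  construction of length \<open>\<omega>\<^sub>1\<close> of two sets \<open>X\<close> and \<open>Y\<close> whose stages confine all later points
  to agree with one fixed point off a set of numbers that shrinks with the stage.  This handles one sequence of
  candidate \<open>\<omega>\<close>-covers per stage, so that both sets are \<open>\<gamma>\<close>-spaces, while the symmetric difference of a
  point of \<open>X\<close> and a point of \<open>Y\<close> is infinite, and sparse enough to be missed by infinitely many
  intervals of any prescribed partition: a continuous image of \<open>X \<times> Y\<close> is an unbounded family.

  A real of the extension depends on countably many coordinates of the Cohen forcing, hence on a filter on a
  countable order that belongs to the ground model, and there is a further real that is Cohen over it.
  Because the order is countable, a cover in the extension can be replaced by the sequence, indexed by the
  conditions, of the covers that these conditions permit; thus the two sets remain \<open>\<gamma>\<close>-spaces, and likewise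
  no real of the extension bounds the family.  The further Cohen real selects an \<open>\<omega>\<close>-cover from any
  sequence of \<open>\<omega>\<close>-covers, whence \<open>S\<^sub>1(\<Omega>, \<Omega>)\<close> for the product.
\<close>

section \<open>Definable predicates\<close>

text \<open>The obstacle is that the two demands pull apart: a \<gamma>-space has only bounded
  continuous images in the Baire space, so unboundedness must appear for the pair but for neither
  factor. Hence each stage serves \<open>X\<close> and \<open>Y\<close> on disjoint intervals:
  almost all later points of both sets follow the \<open>X\<close>-point on intervals of one kind
  and the \<open>Y\<close>-point on those of the other, and what later pairs differ in is confined
  to a sparse set.

  Covers are awkward to force with, so each is replaced by the real of all codes of clopen sets that
  fit inside its members. Only single reals then have to be decided by countably many coordinates,
  and uncountability of \<open>I\<close> leaves a coordinate outside them. The ground model property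
  is stated for sequences some of whose families are no \<omega>-covers, because a condition outside
  the generic filter may permit too little.

  \<open>M\<close> is an arbitrary well-founded model, so the axiom schemes are reached through
  closure rules for definable predicates. For \<open>N\<close> the axioms collected in
  \<open>zmc\<close> are derived, and the topological part is carried out from these.\<close>

inductive pdf :: "('a \<Rightarrow> 'a \<Rightarrow> bool) \<Rightarrow> ((nat \<Rightarrow> 'a) \<Rightarrow> bool) \<Rightarrow> bool" for E where
  pdf_mem: "pdf E (\<lambda>e. E (e i) (e j))"
| pdf_eq: "pdf E (\<lambda>e. e i = e j)"
| pdf_not: "pdf E Q \<Longrightarrow> pdf E (\<lambda>e. \<not> Q e)"
| pdf_conj: "pdf E Q \<Longrightarrow> pdf E Q' \<Longrightarrow> pdf E (\<lambda>e. Q e \<and> Q' e)"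
| pdf_all: "pdf E Q \<Longrightarrow> pdf E (\<lambda>e. \<forall>x. Q (case_nat x e))"

lemma pdf_rename: "pdf E Q \<Longrightarrow> pdf E (\<lambda>e. Q (\<lambda>n. e (f n)))"
proof (induction arbitrary: f rule: pdf.induct)
  case (pdf_all Q)
  have "pdf E (\<lambda>e. \<forall>x. Q (\<lambda>n. case_nat x e (case_nat 0 (\<lambda>k. Suc (f k)) n)))"
    by (rule pdf.pdf_all[OF pdf_all.IH])
  also have "(\<lambda>e. \<forall>x. Q (\<lambda>n. case_nat x e (case_nat 0 (\<lambda>k. Suc (f k)) n))) =
      (\<lambda>e. \<forall>x. Q (case_nat x (\<lambda>n. e (f n))))"
    by (intro ext all_cong1 arg_cong[of _ _ Q]) (auto split: nat.split)
  finally show ?case .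
qed (auto intro: pdf.intros)

text \<open>Variables of \<open>pdf\<close> are numbered relative to the innermost quantifier, those
  of \<open>fm\<close> have absolute names. The bound \<open>m\<close> on the names in use supplies
  the name of the next quantified variable; it can be had because only the first \<open>K\<close>
  variables matter.\<close>

lemma pdf_fm: "pdf E Q \<Longrightarrow> \<exists>K. (\<forall>e e'. (\<forall>n<K. e n = e' n) \<longrightarrow> Q e = Q e') \<and>
    (\<forall>v m. (\<forall>n<K. v n < m) \<longrightarrow> (\<exists>\<phi>. \<forall>s. sat E s \<phi> \<longleftrightarrow> Q (\<lambda>n. s (v n))))"
proof (induction rule: pdf.induct)
  case (pdf_mem i j)
  show ?case
    by (rule exI[of _ "Suc (max i j)"]) (auto intro: exI[of _ "Mem (v i) (v j)" for v])
next
  case (pdf_eq i j)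
  show ?case
    by (rule exI[of _ "Suc (max i j)"]) (auto intro: exI[of _ "Eq (v i) (v j)" for v])
next
  case (pdf_not Q)
  then obtain K where K: "\<And>e e'. (\<forall>n<K. e n = e' n) \<Longrightarrow> Q e = Q e'"
    "\<And>v m. (\<forall>n<K. v n < m) \<Longrightarrow> (\<exists>\<phi>. \<forall>s. sat E s \<phi> \<longleftrightarrow> Q (\<lambda>n. s (v n)))" by blast
  show ?case
  proof (intro exI[of _ K] conjI allI impI)
    fix v :: "nat \<Rightarrow> nat" and m assume "\<forall>n<K. v n < m"
    then obtain \<phi> where "\<forall>s. sat E s \<phi> \<longleftrightarrow> Q (\<lambda>n. s (v n))" using K(2) by blast
    then show "\<exists>\<phi>. \<forall>s. sat E s \<phi> \<longleftrightarrow> \<not> Q (\<lambda>n. s (v n))" by (intro exI[of _ "Neg \<phi>"]) auto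
  qed (use K(1) in blast)
next
  case (pdf_conj Q Q')
  then obtain K K' where K: "\<And>e e'. (\<forall>n<K. e n = e' n) \<Longrightarrow> Q e = Q e'"
    "\<And>v m. (\<forall>n<K. v n < m) \<Longrightarrow> (\<exists>\<phi>. \<forall>s. sat E s \<phi> \<longleftrightarrow> Q (\<lambda>n. s (v n)))"
   and K': "\<And>e e'. (\<forall>n<K'. e n = e' n) \<Longrightarrow> Q' e = Q' e'"
    "\<And>v m. (\<forall>n<K'. v n < m) \<Longrightarrow> (\<exists>\<phi>. \<forall>s. sat E s \<phi> \<longleftrightarrow> Q' (\<lambda>n. s (v n)))" by blast
  show ?case
  proof (intro exI[of _ "max K K'"] conjI allI impI)
    fix e e' :: "nat \<Rightarrow> 'a" assume "\<forall>n<max K K'. e n = e' n"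
    then show "(Q e \<and> Q' e) = (Q e' \<and> Q' e')" using K(1)[of e e'] K'(1)[of e e'] by auto
  next
    fix v :: "nat \<Rightarrow> nat" and m assume "\<forall>n<max K K'. v n < m"
    then obtain \<phi> \<psi> where "\<forall>s. sat E s \<phi> \<longleftrightarrow> Q (\<lambda>n. s (v n))" "\<forall>s. sat E s \<psi> \<longleftrightarrow> Q' (\<lambda>n. s (v n))"
      using K(2)[of v m] K'(2)[of v m] by auto
    then show "\<exists>\<phi>. \<forall>s. sat E s \<phi> \<longleftrightarrow> Q (\<lambda>n. s (v n)) \<and> Q' (\<lambda>n. s (v n))"
      by (intro exI[of _ "Conj \<phi> \<psi>"]) auto
  qed
next
  case (pdf_all Q)
  then obtain K where K: "\<And>e e'. (\<forall>n<K. e n = e' n) \<Longrightarrow> Q e = Q e'"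
    "\<And>v m. (\<forall>n<K. v n < m) \<Longrightarrow> (\<exists>\<phi>. \<forall>s. sat E s \<phi> \<longleftrightarrow> Q (\<lambda>n. s (v n)))" by blast
  show ?case
  proof (intro exI[of _ K] conjI allI impI)
    fix e e' :: "nat \<Rightarrow> 'a" assume "\<forall>n<K. e n = e' n"
    then have "\<forall>n<K. case_nat x e n = case_nat x e' n" for x by (auto split: nat.split)
    then show "(\<forall>x. Q (case_nat x e)) = (\<forall>x. Q (case_nat x e'))" using K(1) by metis
  next
    fix v :: "nat \<Rightarrow> nat" and m assume v: "\<forall>n<K. v n < m"
    then have "\<forall>n<K. case_nat m v n < Suc m" by (auto simp: less_Suc_eq split: nat.split)
    then obtain \<phi> where \<phi>: "\<forall>s. sat E s \<phi> \<longleftrightarrow> Q (\<lambda>n. s (case_nat m v n))" using K(2) by blast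
    have "Q (\<lambda>n. (s(m := x)) (case_nat m v n)) = Q (case_nat x (\<lambda>n. s (v n)))" for s x
    proof (rule K(1), intro allI impI)
      fix n assume "n < K"
      then show "(s(m := x)) (case_nat m v n) = case_nat x (\<lambda>n. s (v n)) n"
        using v[rule_format, of "n - 1"] by (cases n) auto
    qed
    then show "\<exists>\<phi>. \<forall>s. sat E s \<phi> \<longleftrightarrow> (\<forall>x. Q (case_nat x (\<lambda>n. s (v n))))"
      using \<phi> by (intro exI[of _ "Forall m \<phi>"]) auto
  qed
qed

text \<open>\<open>dfn E Q\<close> says that \<open>Q\<close> is first-order definable with parameters, from the values that \<open>e\<close> gives
  to the variables: \<open>atm\<close> is a variable or a parameter, and \<open>dfi\<close> collects the closure rules, with which
  membership in the scheme of separation is reduced to the shape of a predicate.\<close>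

fun atm :: "nat + 'a \<Rightarrow> (nat \<Rightarrow> 'a) \<Rightarrow> 'a" where
  "atm (Inl k) e = e k"
| "atm (Inr c) e = c"

definition dfn :: "('a \<Rightarrow> 'a \<Rightarrow> bool) \<Rightarrow> ((nat \<Rightarrow> 'a) \<Rightarrow> bool) \<Rightarrow> bool" where
  "dfn E Q \<longleftrightarrow> (\<exists>Q' t. pdf E Q' \<and> (\<forall>e. Q e = Q' (\<lambda>j. atm (t j) e)))"

lemma dfnI: "pdf E Q' \<Longrightarrow> (\<And>e. Q e = Q' (\<lambda>j. atm (t j) e)) \<Longrightarrow> dfn E Q"
  unfolding dfn_def by (rule exI[of _ Q'], rule exI[of _ t]) simp

lemma dfnE: assumes "dfn E Q"
  obtains Q' t where "pdf E Q'" "\<And>e. Q e = Q' (\<lambda>j. atm (t j) e)"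
  using assms unfolding dfn_def by (elim exE conjE) simp

named_theorems dfi

lemma dfn_subst:
  assumes "dfn E Q" and T: "\<And>n. \<exists>u. \<forall>e. T n e = atm u e"
  shows "dfn E (\<lambda>e. Q (\<lambda>n. T n e))"
proof -
  obtain Q' t where Q: "pdf E Q'" "\<And>e. Q e = Q' (\<lambda>j. atm (t j) e)" using assms(1) by (rule dfnE) simp
  obtain u where u: "\<And>n e. T n e = atm (u n) e" using T by metis
  define t' where "t' = (\<lambda>j. case t j of Inl k \<Rightarrow> u k | Inr c \<Rightarrow> Inr c)"
  have "atm (t j) (\<lambda>n. T n e) = atm (t' j) e" for j e
    by (cases "t j") (simp_all add: t'_def u)
  then have "Q (\<lambda>n. T n e) = Q' (\<lambda>j. atm (t' j) e)" for e using Q(2) by simp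
  then show ?thesis by (rule dfnI[OF Q(1)])
qed

lemma dfn_rename: "dfn E Q \<Longrightarrow> dfn E (\<lambda>e. Q (\<lambda>n. e (f n)))"
  by (rule dfn_subst) (auto intro: exI[of _ "Inl k" for k])

lemma dfn_not [dfi]: "dfn E Q \<Longrightarrow> dfn E (\<lambda>e. \<not> Q e)"
proof -
  assume "dfn E Q"
  then obtain Q' t where Q: "pdf E Q'" "\<And>e. Q e = Q' (\<lambda>j. atm (t j) e)" by (rule dfnE) simp
  show ?thesis by (rule dfnI[OF pdf_not[OF Q(1)], of _ t]) (simp add: Q(2))
qed

lemma dfn_conj [dfi]: assumes "dfn E Q1" "dfn E Q2" shows "dfn E (\<lambda>e. Q1 e \<and> Q2 e)"
proof -
  obtain P1 t1 where 1: "pdf E P1" "\<And>e. Q1 e = P1 (\<lambda>j. atm (t1 j) e)" using assms(1) by (rule dfnE) simp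
  obtain P2 t2 where 2: "pdf E P2" "\<And>e. Q2 e = P2 (\<lambda>j. atm (t2 j) e)" using assms(2) by (rule dfnE) simp
  \<comment> \<open>The two lists of atoms are interleaved, one on the even and one on the odd
    positions, so that both conjuncts draw on a single list.\<close>
  have "pdf E (\<lambda>e. P1 (\<lambda>n. e (2*n)) \<and> P2 (\<lambda>n. e (2*n+1)))"
    by (rule pdf_conj[OF pdf_rename[OF 1(1)] pdf_rename[OF 2(1)]])
  then show ?thesis
    by (rule dfnI[of _ _ _ "\<lambda>j. if even j then t1 (j div 2) else t2 (j div 2)"]) (simp add: 1(2) 2(2))
qed

lemma dfn_all [dfi]: assumes "dfn E (\<lambda>e. Q (e 0) (\<lambda>n. e (Suc n)))" shows "dfn E (\<lambda>e. \<forall>x. Q x e)"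
proof -
  obtain P t where P: "pdf E P" "\<And>e. Q (e 0) (\<lambda>n. e (Suc n)) = P (\<lambda>j. atm (t j) e)" using assms by (rule dfnE) simp
  \<comment> \<open>Every position whose atom is the quantified variable is redirected to index 0,
    and the others move up by one. The remaining variables lower their index by one, as the
    quantified one no longer counts.\<close>
  define f where "f = (\<lambda>j. if t j = Inl 0 then 0 else Suc j)"
  define t' where "t' = (\<lambda>j. case t j of Inl k \<Rightarrow> Inl (k - 1) | Inr c \<Rightarrow> Inr c)"
  have eq: "(\<lambda>j. case_nat x (\<lambda>j. atm (t' j) e) (f j)) = (\<lambda>j. atm (t j) (case_nat x e))" for x e
  proof
    fix j show "case_nat x (\<lambda>j. atm (t' j) e) (f j) = atm (t j) (case_nat x e)"
    proof (cases "t j")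
      case (Inl k) then show ?thesis by (cases k) (auto simp: f_def t'_def)
    qed (auto simp: f_def t'_def)
  qed
  have "Q x e = P (\<lambda>j. case_nat x (\<lambda>j. atm (t' j) e) (f j))" for x e
    using P(2)[of "case_nat x e"] unfolding eq by simp
  moreover have "pdf E (\<lambda>e. \<forall>x. P (\<lambda>j. case_nat x e (f j)))"
    using pdf_all[OF pdf_rename[OF P(1)]] .
  ultimately show ?thesis by (intro dfnI[of E "\<lambda>e. \<forall>x. P (\<lambda>j. case_nat x e (f j))" _ t']) auto
qed

lemma dfn_imp [dfi]: assumes "dfn E Q1" "dfn E Q2" shows "dfn E (\<lambda>e. Q1 e \<longrightarrow> Q2 e)"
  using dfn_not[OF dfn_conj[OF assms(1) dfn_not[OF assms(2)]]] by simp

lemma dfn_disj [dfi]: assumes "dfn E Q1" "dfn E Q2" shows "dfn E (\<lambda>e. Q1 e \<or> Q2 e)"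
  using dfn_imp[OF dfn_not[OF assms(1)] assms(2)] by (simp add: disj_imp)

lemma dfn_iff [dfi]: assumes "dfn E Q1" "dfn E Q2" shows "dfn E (\<lambda>e. Q1 e \<longleftrightarrow> Q2 e)"
  using dfn_conj[OF dfn_imp[OF assms] dfn_imp[OF assms(2,1)]] by (simp add: iff_conv_conj_imp)

lemma dfn_ex [dfi]: assumes "dfn E (\<lambda>e. Q (e 0) (\<lambda>n. e (Suc n)))" shows "dfn E (\<lambda>e. \<exists>x. Q x e)"
  using dfn_not[OF dfn_all[OF dfn_not[OF assms]]] by simp

lemma dfn_if [dfi]: assumes "dfn E Q1" "dfn E Q2" "dfn E Q3" shows "dfn E (\<lambda>e. if Q1 e then Q2 e else Q3 e)"
  using dfn_conj[OF dfn_imp[OF assms(1,2)] dfn_imp[OF dfn_not[OF assms(1)] assms(3)]] by simp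

lemma dfn_atoms: "dfn E (\<lambda>e. E (e i) (e j))" "dfn E (\<lambda>e. e i = e j)"
    "dfn E (\<lambda>e. E (e i) c)" "dfn E (\<lambda>e. e i = c)"
proof -
  have *: "pdf E (\<lambda>e. E (e 0) (e 1))" "pdf E (\<lambda>e. e 0 = e 1)" by (rule pdf.intros)+
  have **: "dfn E (\<lambda>e. E (atm t e) (atm u e))" "dfn E (\<lambda>e. atm t e = atm u e)" for t u
    by (rule dfnI[OF *(1), of _ "case_nat t (\<lambda>_. u)"], simp, rule dfnI[OF *(2), of _ "case_nat t (\<lambda>_. u)"], simp)
  show "dfn E (\<lambda>e. E (e i) (e j))" using **(1)[of "Inl i" "Inl j"] by simp
  show "dfn E (\<lambda>e. e i = e j)" using **(2)[of "Inl i" "Inl j"] by simp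
  show "dfn E (\<lambda>e. E (e i) c)" using **(1)[of "Inl i" "Inr c"] by simp
  show "dfn E (\<lambda>e. e i = c)" using **(2)[of "Inl i" "Inr c"] by simp
qed

lemma dfn_const [dfi]: "dfn E (\<lambda>e. c)"
proof -
  have "dfn E (\<lambda>e. e 0 = e 0)" "dfn E (\<lambda>e. \<not> e 0 = e 0)" by (intro dfn_atoms dfi)+
  then show ?thesis by (cases c) auto
qed

text \<open>The language has no function symbols: a term counts as definable when its graph is, with
  the value in variable 0 and the arguments shifted.\<close>

definition dt :: "('a \<Rightarrow> 'a \<Rightarrow> bool) \<Rightarrow> ((nat \<Rightarrow> 'a) \<Rightarrow> 'a) \<Rightarrow> bool" where
  "dt E t \<longleftrightarrow> dfn E (\<lambda>e. e 0 = t (\<lambda>n. e (Suc n)))"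

lemma dt_var [dfi]: "dt E (\<lambda>e. e k)" unfolding dt_def by (rule dfn_atoms)
lemma dt_const [dfi]: "dt E (\<lambda>e. c)" unfolding dt_def by (rule dfn_atoms)

lemma dt_lift: assumes "dt E t" shows "dt E (\<lambda>e. t (\<lambda>n. e (Suc n)))"
proof -
  have "dfn E (\<lambda>e. (\<lambda>n. e (case_nat 0 (\<lambda>n. Suc (Suc n)) n)) 0 = t (\<lambda>n. (\<lambda>n. e (case_nat 0 (\<lambda>n. Suc (Suc n)) n)) (Suc n)))"
    using assms unfolding dt_def by (rule dfn_rename)
  then show ?thesis unfolding dt_def by simp
qed

lemma dfn_sub: assumes "dfn E (\<lambda>e. Q (e 0) (\<lambda>n. e (Suc n)))" "dt E t" shows "dfn E (\<lambda>e. Q (t e) e)"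
proof -
  have "dfn E (\<lambda>e. \<exists>x. x = t e \<and> Q x e)"
    using assms by (intro dfi) (auto simp: dt_def)
  then show ?thesis by simp
qed

lemma dfn_sub1: assumes "dfn E (\<lambda>e. Q (e 0))" "dt E s" shows "dfn E (\<lambda>e. Q (s e))"
  using assms by (rule dfn_sub)

lemma dfn_sub2: assumes "dfn E (\<lambda>e. Q (e 0) (e 1))" "dt E s" "dt E t"
  shows "dfn E (\<lambda>e. Q (s e) (t e))"
proof (rule dfn_sub[OF _ assms(2)], rule dfn_sub[OF _ dt_lift[OF assms(3)]])
  show "dfn E (\<lambda>e. Q (e (Suc 0)) (e 0))"
    using dfn_rename[OF assms(1), of "\<lambda>n. if n = 0 then Suc 0 else 0"] by simp
qed

lemma dfn_sub3: assumes "dfn E (\<lambda>e. Q (e 0) (e 1) (e 2))" "dt E s" "dt E t" "dt E u"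
  shows "dfn E (\<lambda>e. Q (s e) (t e) (u e))"
proof (rule dfn_sub[OF _ assms(2)], rule dfn_sub[OF _ dt_lift[OF assms(3)]],
       rule dfn_sub[OF _ dt_lift[OF dt_lift[OF assms(4)]]])
  show "dfn E (\<lambda>e. Q (e (Suc (Suc 0))) (e (Suc 0)) (e 0))"
    using dfn_rename[OF assms(1), of "\<lambda>n. if n = 0 then Suc (Suc 0) else if n = 1 then 1 else 0"] by simp
qed

lemma dfn_mem [dfi]: "dt E s \<Longrightarrow> dt E t \<Longrightarrow> dfn E (\<lambda>e. E (s e) (t e))"
  by (rule dfn_sub2[where Q=E]) (rule dfn_atoms)

lemma dfn_mem_elts [dfi]: "dt E s \<Longrightarrow> dt E t \<Longrightarrow> dfn E (\<lambda>e. s e \<in> elts E (t e))"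
  unfolding elts_def by (simp add: dfn_mem)

lemma dfn_eq [dfi]: "dt E s \<Longrightarrow> dt E t \<Longrightarrow> dfn E (\<lambda>e. s e = t e)"
  by (rule dfn_sub2[where Q="(=)"]) (rule dfn_atoms)

lemma dfn_ball [dfi]: "dt E t \<Longrightarrow> dfn E (\<lambda>e. Q (e 0) (\<lambda>n. e (Suc n))) \<Longrightarrow> dfn E (\<lambda>e. \<forall>x\<in>elts E (t e). Q x e)"
  unfolding Ball_def by (intro dfi) (auto intro: dt_lift)

lemma dfn_bex [dfi]: "dt E t \<Longrightarrow> dfn E (\<lambda>e. Q (e 0) (\<lambda>n. e (Suc n))) \<Longrightarrow> dfn E (\<lambda>e. \<exists>x\<in>elts E (t e). Q x e)"
  unfolding Bex_def by (intro dfi) (auto intro: dt_lift)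

lemma dfn_subset [dfi]: "dt E s \<Longrightarrow> dt E t \<Longrightarrow> dfn E (\<lambda>e. elts E (s e) \<subseteq> elts E (t e))"
  unfolding subset_eq by (intro dfi) (auto intro: dt_lift)

lemma dfn_elts_eq [dfi]: "dt E s \<Longrightarrow> dfn E (\<lambda>e. Q (e 0) (\<lambda>n. e (Suc n)))
   \<Longrightarrow> dfn E (\<lambda>e. elts E (s e) = {x. Q x e})"
  unfolding set_eq_iff mem_Collect_eq by (intro dfi) (auto intro: dt_lift)

lemma dt_sub: assumes "dt E (\<lambda>e. f (e 0))" "dt E s" shows "dt E (\<lambda>e. f (s e))"
proof -
  have "dfn E (\<lambda>e. e 0 = f (e 1))" using assms(1) by (simp add: dt_def)
  from dfn_sub2[where Q="\<lambda>x y. x = f y", OF this dt_var[of E 0] dt_lift[OF assms(2)]]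
  show ?thesis by (simp add: dt_def)
qed

lemma dtI: "dfn E (\<lambda>e. e 0 = t (\<lambda>n. e (Suc n))) \<Longrightarrow> dt E t"
  by (simp add: dt_def)

lemma separationD:
  assumes "separation E" "dfn E (\<lambda>e. Q (e 0))" shows "\<exists>b. elts E b = {x \<in> elts E a. Q x}"
proof -
  obtain P t where P: "pdf E P" "\<And>e. Q (e 0) = P (\<lambda>j. atm (t j) e)" using assms(2) by (rule dfnE) simp
  obtain K where K: "\<And>e e'. (\<forall>n<K. e n = e' n) \<Longrightarrow> P e = P e'"
    "\<And>v m. (\<forall>n<K. v n < m) \<Longrightarrow> (\<exists>\<phi>. \<forall>s. sat E s \<phi> \<longleftrightarrow> P (\<lambda>n. s (v n)))" using pdf_fm[OF P(1)] by blast
  \<comment> \<open>The predicate is evaluated at a constant assignment, so all its variables may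
    share the index 0; the parameter at position \<open>j\<close> becomes the variable
    \<open>Suc j\<close>.\<close>
  define v where "v = (\<lambda>j. case t j of Inl k \<Rightarrow> 0 | Inr c \<Rightarrow> Suc j)"
  define s where "s = (\<lambda>j. case t (j - 1) of Inl k \<Rightarrow> undefined | Inr c \<Rightarrow> c)"
  have "\<forall>n<K. v n < Suc K" by (auto simp: v_def split: sum.split)
  then obtain \<phi> where \<phi>: "\<forall>s. sat E s \<phi> \<longleftrightarrow> P (\<lambda>n. s (v n))" using K(2) by blast
  have "(\<lambda>n. (s(0 := x)) (v n)) = (\<lambda>j. atm (t j) (\<lambda>_. x))" for x
    by (auto simp: v_def s_def split: sum.split)
  then have "sat E (s(0 := x)) \<phi> = Q x" for x
    using \<phi> P(2)[of "\<lambda>_. x"] by simp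
  moreover obtain b where "elts E b = {x \<in> elts E a. sat E (s(0 := x)) \<phi>}"
    using assms(1)[unfolded separation_def, rule_format, of a s \<phi>] by (elim exE)
  ultimately show ?thesis by auto
qed

lemma replacementD:
  assumes "replacement E" "dfn E (\<lambda>e. Q (e 0) (e 1))" "\<And>x. x \<in> elts E a \<Longrightarrow> \<exists>!y. Q x y"
  shows "\<exists>b. \<forall>x \<in> elts E a. \<exists>y \<in> elts E b. Q x y"
proof -
  obtain P t where P: "pdf E P" "\<And>e. Q (e 0) (e 1) = P (\<lambda>j. atm (t j) e)" using assms(2) by (rule dfnE) simp
  obtain K where K: "\<And>e e'. (\<forall>n<K. e n = e' n) \<Longrightarrow> P e = P e'"
    "\<And>v m. (\<forall>n<K. v n < m) \<Longrightarrow> (\<exists>\<phi>. \<forall>s. sat E s \<phi> \<longleftrightarrow> P (\<lambda>n. s (v n)))" using pdf_fm[OF P(1)] by blast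
  define v where "v = (\<lambda>j. case t j of Inl k \<Rightarrow> (if k = 0 then 0 else 1) | Inr c \<Rightarrow> Suc (Suc j))"
  define s where "s = (\<lambda>j. case t (j - 2) of Inl k \<Rightarrow> undefined | Inr c \<Rightarrow> c)"
  have "\<forall>n<K. v n < Suc (Suc K)" by (auto simp: v_def split: sum.split)
  then obtain \<phi> where \<phi>: "\<forall>s. sat E s \<phi> \<longleftrightarrow> P (\<lambda>n. s (v n))" using K(2) by blast
  have "(\<lambda>n. (s(0 := x, 1 := y)) (v n)) = (\<lambda>j. atm (t j) (\<lambda>k. if k = 0 then x else y))" for x y
    by (auto simp: v_def s_def split: sum.split)
  then have *: "sat E (s(0 := x, 1 := y)) \<phi> = Q x y" for x y
    using \<phi> P(2)[of "\<lambda>k. if k = 0 then x else y"] by simp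
  then have "\<forall>x\<in>elts E a. \<exists>!y. sat E (s(0 := x, 1 := y)) \<phi>" using assms(3) by simp
  then obtain b where "\<forall>x \<in> elts E a. \<exists>y \<in> elts E b. sat E (s(0 := x, 1 := y)) \<phi>"
    using assms(1) unfolding replacement_def by blast
  then show ?thesis using * by auto
qed

section \<open>Set theory inside a well-founded model\<close>

text \<open>Pairing, union and power set ask only for a set that is large enough, since separation
  trims it; generic extensions yield them in this form. Well-foundedness is meant in the sense of
  HOL, which makes the numbers of the model standard.\<close>

locale zm =
  fixes E :: "'a \<Rightarrow> 'a \<Rightarrow> bool"
  assumes wf: "wfp E"
    and ext: "elts E x = elts E y \<Longrightarrow> x = y"
    and sep: "separation E"
    and pair0: "\<exists>c. a \<in> elts E c \<and> b \<in> elts E c"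
    and union0: "\<exists>u. \<forall>y \<in> elts E x. elts E y \<subseteq> elts E u"
    and pow0: "\<exists>p. \<forall>y. elts E y \<subseteq> elts E x \<longrightarrow> y \<in> elts E p"
    and inf0: "\<exists>w. is_inductive E w"
begin

abbreviation el :: "'a \<Rightarrow> 'a set" where "el \<equiv> elts E"

definition isset :: "'a set \<Rightarrow> bool" where "isset S \<longleftrightarrow> (\<exists>x. el x = S)"
definition mk :: "'a set \<Rightarrow> 'a" where "mk S = (THE x. el x = S)"

lemma el_mk [simp]: "isset S \<Longrightarrow> el (mk S) = S"
proof -
  assume "isset S"
  then obtain x where x: "el x = S" unfolding isset_def by (elim exE)
  have "mk S = x" unfolding mk_def using x by (intro the_equality) (auto intro: ext)
  then show ?thesis using x by simp
qed

lemma mk_el [simp]: "mk (el x) = x"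
  unfolding mk_def by (rule the_equality) (auto intro: ext)

lemma isset_el [simp, intro]: "isset (el x)"
  by (auto simp: isset_def)

lemma mk_eq: "el x = S \<Longrightarrow> mk S = x" by auto

lemma mk_inj: "isset S \<Longrightarrow> isset T \<Longrightarrow> mk S = mk T \<longleftrightarrow> S = T"
  by (metis el_mk)

lemma isset_sep: "isset A \<Longrightarrow> dfn E (\<lambda>e. Q (e 0)) \<Longrightarrow> isset {x \<in> A. Q x}"
  using separationD[OF sep, of Q] unfolding isset_def by blast

lemma isset_sub: "dfn E (\<lambda>e. Q (e 0)) \<Longrightarrow> isset A \<Longrightarrow> (\<And>x. Q x \<Longrightarrow> x \<in> A) \<Longrightarrow> isset {x. Q x}"
  using isset_sep[of A Q] by (simp add: Collect_conj_eq Int_absorb1 subset_eq)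

lemma isset_upair: "isset {a, b}"
proof -
  obtain c where "a \<in> el c" "b \<in> el c" using pair0 by blast
  then have "{a, b} = {x \<in> el c. x = a \<or> x = b}" by auto
  also have "isset \<dots>" by (rule isset_sep[OF isset_el]) (intro dfi)
  finally show ?thesis .
qed

lemma isset_Union: assumes "isset A" shows "isset (\<Union>y\<in>A. el y)"
proof -
  obtain a where a: "A = el a" using assms isset_def by auto
  obtain u where "\<forall>y \<in> el a. el y \<subseteq> el u" using union0 by blast
  then have "(\<Union>y\<in>A. el y) = {x \<in> el u. \<exists>y\<in>el a. x \<in> el y}" using a by auto
  also have "isset \<dots>" by (rule isset_sep[OF isset_el]) (intro dfi)
  finally show ?thesis .
qed

lemma isset_Un: assumes "isset A" "isset B" shows "isset (A \<union> B)"
proof -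
  have "(\<Union>y\<in>{mk A, mk B}. el y) = A \<union> B" using assms by auto
  then show ?thesis using isset_Union[OF isset_upair[of "mk A" "mk B"]] by auto
qed

lemma isset_sing: "isset {a}" using isset_upair[of a a] by simp

lemma isset_insert: "isset A \<Longrightarrow> isset (insert a A)"
  using isset_Un[OF isset_sing] by force

lemma isset_empty: "isset {}"
  using isset_sep[OF isset_sing, of "\<lambda>_. False" undefined] by (simp add: dfi)

lemma isset_finite: "finite S \<Longrightarrow> isset S"
  by (induction rule: finite_induct) (auto intro: isset_empty isset_insert)

lemma isset_Pow: assumes "isset A" shows "isset {y. el y \<subseteq> A}"
proof -
  obtain a where a: "A = el a" using assms isset_def by auto
  obtain p where "\<forall>y. el y \<subseteq> el a \<longrightarrow> y \<in> el p" using pow0 by blast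
  then show ?thesis unfolding a by (intro isset_sub[of _ "el p"]) (auto intro: dfi)
qed

lemmas isset_rules = isset_el isset_upair isset_sing isset_Un isset_insert isset_empty isset_Pow

section \<open>Ordered pairs and relations\<close>

definition pr :: "'a \<Rightarrow> 'a \<Rightarrow> 'a" where "pr a b = mk {mk {a}, mk {a, b}}"

lemma el_pr: "el (pr a b) = {mk {a}, mk {a, b}}"
  by (simp add: pr_def isset_rules)

lemma pr_inj [simp]: "pr a b = pr c d \<longleftrightarrow> a = c \<and> b = d"
proof
  assume "pr a b = pr c d"
  then have "{mk {a}, mk {a, b}} = {mk {c}, mk {c, d}}" by (metis el_pr)
  then have "el ` {mk {a}, mk {a, b}} = el ` {mk {c}, mk {c, d}}" by simp
  then have "{{a}, {a, b}} = {{c}, {c, d}}" by (simp add: isset_rules)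
  then show "a = c \<and> b = d" by (metis doubleton_eq_iff insert_absorb2)
qed simp

lemma is_pair_iff: "is_pair E a b p \<longleftrightarrow> p = pr a b"
proof
  assume "is_pair E a b p"
  then obtain u v where "el u = {a}" "el v = {a, b}" "el p = {u, v}" unfolding is_pair_def by blast
  then show "p = pr a b" by (metis mk_el pr_def)
next
  assume "p = pr a b"
  then show "is_pair E a b p" unfolding is_pair_def
    by (intro exI[of _ "mk {a}"] exI[of _ "mk {a, b}"]) (simp add: isset_rules el_pr)
qed

lemma dt_rename: "dt E t \<Longrightarrow> dt E (\<lambda>e. t (\<lambda>n. e (f n)))"
proof -
  assume "dt E t"
  from dfn_rename[OF this[unfolded dt_def], of "case_nat 0 (\<lambda>n. Suc (f n))"]
  show ?thesis by (simp add: dt_def)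
qed

lemma dfn_el_upair: "dt E s \<Longrightarrow> dt E t \<Longrightarrow> dt E (\<lambda>e. mk {s e, t e})"
proof (rule dtI)
  assume st: "dt E s" "dt E t"
  have "e 0 = mk {s (\<lambda>n. e (Suc n)), t (\<lambda>n. e (Suc n))} \<longleftrightarrow>
     (\<forall>x. x \<in> el (e 0) \<longleftrightarrow> x = s (\<lambda>n. e (Suc n)) \<or> x = t (\<lambda>n. e (Suc n)))" for e
    using mk_inj[of "el (e 0)" "{s (\<lambda>n. e (Suc n)), t (\<lambda>n. e (Suc n))}"] by (auto simp: isset_rules)
  moreover have "dfn E (\<lambda>e. \<forall>x. x \<in> el (e 0) \<longleftrightarrow> x = s (\<lambda>n. e (Suc n)) \<or> x = t (\<lambda>n. e (Suc n)))"
    by (intro dfi dt_rename[OF st(1)] dt_rename[OF st(2)])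
  ultimately show "dfn E (\<lambda>e. e 0 = mk {s (\<lambda>n. e (Suc n)), t (\<lambda>n. e (Suc n))})" by simp
qed

lemma dt_pr [dfi]: "dt E s \<Longrightarrow> dt E t \<Longrightarrow> dt E (\<lambda>e. pr (s e) (t e))"
  unfolding pr_def using dfn_el_upair[of s s] by (intro dfn_el_upair) auto

lemma isset_prod: assumes "isset A" "isset B" shows "isset {pr a b | a b. a \<in> A \<and> b \<in> B}"
proof -
  obtain a b where ab: "A = el a" "B = el b" using assms isset_def by auto
  have 1: "isset {y. el y \<subseteq> {y. el y \<subseteq> A \<union> B}}" using assms by (intro isset_rules)
  have "dfn E (\<lambda>e. \<exists>x\<in>el a. \<exists>y\<in>el b. e 0 = pr x y)" by (intro dfi)
  then have "isset {p. \<exists>x\<in>el a. \<exists>y\<in>el b. p = pr x y}"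
    by (rule isset_sub[OF _ 1]) (auto simp: el_pr ab isset_rules)
  moreover have "{p. \<exists>x\<in>el a. \<exists>y\<in>el b. p = pr x y} = {pr a b | a b. a \<in> A \<and> b \<in> B}" by (auto simp: ab)
  ultimately show ?thesis by simp
qed

lemma isset_rel: assumes "isset A" "isset B" "dfn E (\<lambda>e. Q (e 0) (e 1))"
  shows "isset {pr a b | a b. a \<in> A \<and> b \<in> B \<and> Q a b}"
proof -
  have "dfn E (\<lambda>e. \<exists>a b. e 0 = pr a b \<and> Q a b)"
    using dfn_rename[OF assms(3), of "\<lambda>n. if n = 0 then 1 else 0"] by (intro dfi) simp
  from isset_sep[OF isset_prod[OF assms(1,2)] this]
  show ?thesis by (rule back_subst[of isset]) auto
qed

lemma isset_Range: assumes "isset R" shows "isset {b. \<exists>a. pr a b \<in> R}" "isset {a. \<exists>b. pr a b \<in> R}"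
proof -
  obtain r where r: "R = el r" using assms isset_def by auto
  have *: "isset (\<Union>y\<in>(\<Union>y\<in>R. el y). el y)" using assms by (intro isset_Union)
  have **: "pr a b \<in> R \<Longrightarrow> a \<in> (\<Union>y\<in>(\<Union>y\<in>R. el y). el y) \<and> b \<in> (\<Union>y\<in>(\<Union>y\<in>R. el y). el y)" for a b
    by (force simp: el_pr isset_rules)
  have "dfn E (\<lambda>e. \<exists>a. pr a (e 0) \<in> el r)" "dfn E (\<lambda>e. \<exists>a. pr (e 0) a \<in> el r)" by (intro dfi)+
  then show "isset {b. \<exists>a. pr a b \<in> R}" "isset {a. \<exists>b. pr a b \<in> R}"
    unfolding r[symmetric] using ** by (intro isset_sub[OF _ *]; auto simp: r)+
qed

lemma wf_induct [consumes 0, case_names less]: "(\<And>x. (\<And>y. y \<in> el x \<Longrightarrow> Q y) \<Longrightarrow> Q x) \<Longrightarrow> Q x"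
  using wfp_induct_rule[OF wf, of Q x] by (simp add: elts_def)

lemma el_irrefl: "x \<notin> el x" by (induction x rule: wf_induct) auto

lemma minimal: assumes "Q a" obtains b where "Q b" "\<And>y. y \<in> el b \<Longrightarrow> \<not> Q y"
proof -
  have "Q a \<Longrightarrow> \<exists>b. Q b \<and> (\<forall>y\<in>el b. \<not> Q y)" for a
    by (induction a rule: wf_induct) blast
  then show ?thesis using assms that by blast
qed


subsection \<open>Natural numbers and sets of natural numbers\<close>

primrec num :: "nat \<Rightarrow> 'a" where
  "num 0 = mk {}"
| "num (Suc n) = mk (insert (num n) (el (num n)))"

lemma el_num_Suc: "el (num (Suc n)) = insert (num n) (el (num n))"
  by (simp add: isset_insert)

lemma el_num: "el (num n) = num ` {..<n}"
  by (induction n) (simp_all add: isset_empty el_num_Suc lessThan_Suc del: num.simps(2))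

lemma num_inj [simp]: "num m = num n \<longleftrightarrow> m = n"
proof -
  have "m < n \<Longrightarrow> num m \<noteq> num n" for m n
    using el_num[of n] el_irrefl by (metis imageI lessThan_iff)
  then show ?thesis by (metis linorder_neqE_nat)
qed

lemma inductive_iff: "is_inductive E w \<longleftrightarrow> num 0 \<in> el w \<and> (\<forall>x\<in>el w. mk (insert x (el x)) \<in> el w)"
  unfolding is_inductive_def by (auto simp: isset_rules mk_eq) (metis el_mk isset_el isset_insert mk_el isset_empty)+

lemma dfn_inductive [dfi]: "dt E t \<Longrightarrow> dfn E (\<lambda>e. is_inductive E (t e))"
proof (rule dfn_sub1[of E "is_inductive E"])
  show "dfn E (\<lambda>e. is_inductive E (e 0))"
    unfolding is_inductive_def set_eq_iff insert_iff empty_iff by (intro dfi)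
qed

lemma num_in_inductive: "is_inductive E w \<Longrightarrow> num n \<in> el w"
  by (induction n) (auto simp: inductive_iff)

text \<open>The least inductive set has only standard members: a membership-minimal exception could
  be removed and the rest would still be inductive, since the successor of a standard number is
  standard.\<close>

lemma isset_range_num: "isset (range num)"
proof -
  obtain w0 where w0: "is_inductive E w0" using inf0 by blast
  have "isset {x \<in> el w0. \<forall>v. is_inductive E v \<longrightarrow> x \<in> el v}"
    by (rule isset_sep[OF isset_el]) (intro dfi)
  then obtain w where w: "el w = {x \<in> el w0. \<forall>v. is_inductive E v \<longrightarrow> x \<in> el v}" by (auto simp: isset_def)
  have wi: "is_inductive E w" using w0 unfolding inductive_iff w by blast
  have "el w = range num"
  proof (rule ccontr)
    assume "el w \<noteq> range num"
    then obtain x0 where x0: "x0 \<in> el w \<and> x0 \<notin> range num" using num_in_inductive[OF wi] by blast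
    obtain x where x: "x \<in> el w \<and> x \<notin> range num" "\<And>y. y \<in> el x \<Longrightarrow> \<not> (y \<in> el w \<and> y \<notin> range num)"
      by (rule minimal[of "\<lambda>x. x \<in> el w \<and> x \<notin> range num", OF x0]) blast
    have "isset {y \<in> el w. y \<noteq> x}" by (rule isset_sep[OF isset_el]) (intro dfi)
    then obtain v where v: "el v = {y \<in> el w. y \<noteq> x}" by (auto simp: isset_def)
    have "is_inductive E v" unfolding inductive_iff v
    proof (intro conjI ballI CollectI)
      show "num 0 \<in> el w" "num 0 \<noteq> x" using x wi rangeI[of num 0] by (auto simp: inductive_iff simp del: num.simps)
      fix y assume y: "y \<in> {y \<in> el w. y \<noteq> x}"
      then show "mk (insert y (el y)) \<in> el w" using wi by (auto simp: inductive_iff)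
      show "mk (insert y (el y)) \<noteq> x"
      proof
        assume "mk (insert y (el y)) = x"
        then have "y \<in> el x" by (auto simp: isset_rules)
        then obtain n where "y = num n" using x y by blast
        then have "x = num (Suc n)" using \<open>_ = x\<close> by simp
        then show False using x by blast
      qed
    qed
    then have "x \<in> el v" using x w by blast
    then show False using v by simp
  qed
  then show ?thesis by (metis isset_el)
qed

definition Om :: 'a where "Om = mk (range num)"

lemma el_Om [simp]: "el Om = range num" by (simp add: Om_def isset_range_num)

lemma inductive_Om: "is_inductive E Om" unfolding inductive_iff
proof (intro conjI ballI)
  show "num 0 \<in> el Om" unfolding el_Om by (rule rangeI)
  fix x assume "x \<in> el Om"
  then obtain n where "x = num n" by auto
  then have "mk (insert x (el x)) = num (Suc n)" by simp
  then show "mk (insert x (el x)) \<in> el Om" unfolding el_Om by (metis rangeI)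
qed

lemma is_omega_iff: "is_omega E w \<longleftrightarrow> w = Om"
proof
  assume "is_omega E w"
  moreover have "is_inductive E Om" by (rule inductive_Om)
  ultimately have "el w = range num" unfolding is_omega_def using num_in_inductive by force
  then show "w = Om" by (simp add: Om_def mk_eq)
next
  assume "w = Om"
  then show "is_omega E w" unfolding is_omega_def
    using inductive_Om num_in_inductive by auto
qed

definition nof :: "'a \<Rightarrow> nat" where "nof x = (if x \<in> range num then inv_into UNIV num x else 0)"
definition sof :: "'a \<Rightarrow> nat set" where "sof x = {n. num n \<in> el x}"

lemma inj_num: "inj num" by (simp add: inj_def)

lemma nof_num [simp]: "nof (num n) = n"
  unfolding nof_def by (simp only: inv_into_f_f[OF inj_num UNIV_I] rangeI if_True)

text \<open>\<open>nof\<close> and \<open>sof\<close> read an element of the model as a number and as a set of numbers; \<open>ntm\<close> and \<open>stm\<close> are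
  the definable terms of these two kinds, and \<open>AA\<close> is the family of those sets of numbers that belong to
  the model.\<close>

definition ntm :: "((nat \<Rightarrow> 'a) \<Rightarrow> nat) \<Rightarrow> bool" where "ntm t \<longleftrightarrow> dt E (\<lambda>e. num (t e))"

definition AA :: "nat set set" where "AA = {A. isset (num ` A)}"

definition stm :: "((nat \<Rightarrow> 'a) \<Rightarrow> nat set) \<Rightarrow> bool" where
  "stm S \<longleftrightarrow> dfn E (\<lambda>e. nof (e 0) \<in> S (\<lambda>n. e (Suc n)))"

definition re :: "nat set \<Rightarrow> 'a" where "re A = mk (num ` A)"

lemma dt_num [dfi]: "ntm t \<Longrightarrow> dt E (\<lambda>e. num (t e))" by (simp add: ntm_def)

lemma ntm_nof [dfi]: assumes "dt E s" shows "ntm (\<lambda>e. nof (s e))"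
  unfolding ntm_def
proof (rule dt_sub[of E "\<lambda>x. num (nof x)", OF dtI assms])
  have "e 0 = num (nof (e (Suc 0))) \<longleftrightarrow> (if e (Suc 0) \<in> el Om then e 0 = e (Suc 0) else e 0 = num 0)" for e
    by (cases "e (Suc 0) \<in> range num") (auto simp: nof_def inv_into_f_f[OF inj_num UNIV_I])
  moreover have "dfn E (\<lambda>e. if e (Suc 0) \<in> el Om then e 0 = e (Suc 0) else e 0 = num 0)" by (intro dfi)
  ultimately show "dfn E (\<lambda>e. e 0 = num (nof (e (Suc 0))))" by simp
qed

lemma ntm_const [dfi]: "ntm (\<lambda>e. n)" unfolding ntm_def by (rule dt_const)

lemma dfn_neq [dfi]: "ntm s \<Longrightarrow> ntm t \<Longrightarrow> dfn E (\<lambda>e. s e = t e)"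
  using dfn_eq[of E "\<lambda>e. num (s e)" "\<lambda>e. num (t e)"] by (simp add: ntm_def)

lemma dfn_less [dfi]: "ntm s \<Longrightarrow> ntm t \<Longrightarrow> dfn E (\<lambda>e. s e < t e)"
proof -
  assume *: "ntm s" "ntm t"
  have "dfn E (\<lambda>e. num (s e) \<in> el (num (t e)))" by (intro dfi *)
  then show ?thesis by (simp add: el_num image_iff)
qed

lemma dfn_le [dfi]: "ntm s \<Longrightarrow> ntm t \<Longrightarrow> dfn E (\<lambda>e. s e \<le> t e)"
  using dfn_not[OF dfn_less[of t s]] by (simp add: not_less)

lemma dfn_nall [dfi]: "dfn E (\<lambda>e. Q (nof (e 0)) (\<lambda>n. e (Suc n))) \<Longrightarrow> dfn E (\<lambda>e. \<forall>n. Q n e)"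
proof -
  assume *: "dfn E (\<lambda>e. Q (nof (e 0)) (\<lambda>n. e (Suc n)))"
  have "dfn E (\<lambda>e. \<forall>x. Q (nof x) e)" by (intro dfi *)
  moreover have "(\<forall>x. Q (nof x) e) = (\<forall>n. Q n e)" for e by (metis nof_num)
  ultimately show ?thesis by simp
qed

lemma dfn_nex [dfi]: "dfn E (\<lambda>e. Q (nof (e 0)) (\<lambda>n. e (Suc n))) \<Longrightarrow> dfn E (\<lambda>e. \<exists>n. Q n e)"
  using dfn_not[OF dfn_nall[of "\<lambda>n e. \<not> Q n e"]] dfn_not by fastforce

lemma ntmI: "dfn E (\<lambda>e. nof (e 0) = t (\<lambda>n. e (Suc n))) \<Longrightarrow> ntm t"
  unfolding ntm_def
proof (rule dtI)
  assume *: "dfn E (\<lambda>e. nof (e 0) = t (\<lambda>n. e (Suc n)))"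
  have "dfn E (\<lambda>e. e 0 \<in> el Om \<and> nof (e 0) = t (\<lambda>n. e (Suc n)))" by (intro dfi *)
  moreover have "e 0 \<in> el Om \<and> nof (e 0) = t (\<lambda>n. e (Suc n)) \<longleftrightarrow> e 0 = num (t (\<lambda>n. e (Suc n)))" for e
    by auto
  ultimately show "dfn E (\<lambda>e. e 0 = num (t (\<lambda>n. e (Suc n))))" by simp
qed

lemma ntm_rename: "ntm t \<Longrightarrow> ntm (\<lambda>e. t (\<lambda>n. e (f n)))"
  unfolding ntm_def by (rule dt_rename[of "\<lambda>e. num (t e)"])

lemma stm_rename: "stm t \<Longrightarrow> stm (\<lambda>e. t (\<lambda>n. e (f n)))"
proof -
  assume "stm t"
  from dfn_rename[OF this[unfolded stm_def], of "case_nat 0 (\<lambda>n. Suc (f n))"]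
  show ?thesis by (simp add: stm_def)
qed

lemma dfn_nsub: assumes "dfn E (\<lambda>e. Q (nof (e 0)) (\<lambda>n. e (Suc n)))" "ntm t" shows "dfn E (\<lambda>e. Q (t e) e)"
  using dfn_sub[of E "\<lambda>x e. Q (nof x) e" "\<lambda>e. num (t e)"] assms by (simp add: ntm_def)

lemma dfn_nmem [dfi]: "ntm t \<Longrightarrow> stm S \<Longrightarrow> dfn E (\<lambda>e. t e \<in> S e)"
  by (rule dfn_nsub) (simp_all add: stm_def)

lemma dfn_nball [dfi]: assumes "stm S" "dfn E (\<lambda>e. Q (nof (e 0)) (\<lambda>n. e (Suc n)))" shows "dfn E (\<lambda>e. \<forall>n\<in>S e. Q n e)"
  unfolding Ball_def by (intro dfi stm_rename[OF assms(1)] assms(2))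

lemma dfn_nbex [dfi]: assumes "stm S" "dfn E (\<lambda>e. Q (nof (e 0)) (\<lambda>n. e (Suc n)))" shows "dfn E (\<lambda>e. \<exists>n\<in>S e. Q n e)"
  unfolding Bex_def by (intro dfi stm_rename[OF assms(1)] assms(2))

lemma stm_sof [dfi]: assumes "dt E s" shows "stm (\<lambda>e. sof (s e))"
  unfolding stm_def sof_def mem_Collect_eq by (intro dfi dt_rename[OF assms])

lemma stm_Collect [dfi]: "dfn E (\<lambda>e. Q (nof (e 0)) (\<lambda>n. e (Suc n))) \<Longrightarrow> stm (\<lambda>e. {n. Q n e})"
  unfolding stm_def by simp

lemma re_AA: "A \<in> AA \<Longrightarrow> el (re A) = num ` A" by (simp add: re_def AA_def)

lemma sof_re [simp]: "A \<in> AA \<Longrightarrow> sof (re A) = A" by (auto simp: sof_def re_AA)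

lemma re_sof: "el x \<subseteq> el Om \<Longrightarrow> re (sof x) = x"
  unfolding re_def sof_def by (intro mk_eq) auto

lemma stm_const [dfi]: "A \<in> AA \<Longrightarrow> stm (\<lambda>e. A)"
  using stm_sof[OF dt_const[of E "re A"]] by simp

lemma AA_I: assumes "dfn E (\<lambda>e. Q (nof (e 0)))" shows "{n. Q n} \<in> AA"
proof -
  have "isset {x \<in> el Om. Q (nof x)}" by (rule isset_sep[OF isset_el assms])
  moreover have "{x \<in> el Om. Q (nof x)} = num ` {n. Q n}" by auto
  ultimately show ?thesis by (simp add: AA_def)
qed

lemma AA_stm: assumes "stm (\<lambda>e. A)" shows "A \<in> AA"
  using AA_I[of "\<lambda>n. n \<in> A"] assms by (simp add: stm_def)

lemma sof_AA [simp]: "sof x \<in> AA" by (intro AA_stm dfi)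

lemma stm_AA: assumes "stm S" shows "S e \<in> AA"
proof (rule AA_stm)
  have "dfn E (\<lambda>e'. nof (case_nat (e' 0) e 0) \<in> S (\<lambda>n. case_nat (e' 0) e (Suc n)))"
    using assms unfolding stm_def
  proof (rule dfn_subst[where T="\<lambda>n e'. case_nat (e' 0) e n"])
    fix n show "\<exists>u. \<forall>e'. case_nat (e' 0) e n = atm u e'"
      by (cases n) (auto intro: exI[of _ "Inl 0"] exI[of _ "Inr (e k)" for k])
  qed
  then show "stm (\<lambda>e'. S e)" unfolding stm_def by simp
qed

lemma dt_re [dfi]: assumes "stm S" shows "dt E (\<lambda>e. re (S e))"
proof (rule dtI)
  have "dfn E (\<lambda>e. el (e 0) = {y. y \<in> el Om \<and> nof y \<in> S (\<lambda>n. e (Suc n))})"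
    by (intro dfi stm_rename[OF assms])
  moreover have "el (e 0) = {y. y \<in> el Om \<and> nof y \<in> S (\<lambda>n. e (Suc n))} \<longleftrightarrow> e 0 = re (S (\<lambda>n. e (Suc n)))" for e
  proof -
    have "{y. y \<in> el Om \<and> nof y \<in> S (\<lambda>n. e (Suc n))} = num ` S (\<lambda>n. e (Suc n))" by auto
    then show ?thesis using re_AA[OF stm_AA[OF assms]] ext by metis
  qed
  ultimately show "dfn E (\<lambda>e. e 0 = re (S (\<lambda>n. e (Suc n))))" by simp
qed

lemma dfn_AAall [dfi]: "dfn E (\<lambda>e. Q (sof (e 0)) (\<lambda>n. e (Suc n))) \<Longrightarrow> dfn E (\<lambda>e. \<forall>A\<in>AA. Q A e)"
proof -
  assume *: "dfn E (\<lambda>e. Q (sof (e 0)) (\<lambda>n. e (Suc n)))"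
  have "dfn E (\<lambda>e. \<forall>x. Q (sof x) e)" by (intro dfi *)
  moreover have "(\<forall>x. Q (sof x) e) = (\<forall>A\<in>AA. Q A e)" for e by (metis sof_AA sof_re)
  ultimately show ?thesis by simp
qed

lemma dfn_AAex [dfi]: "dfn E (\<lambda>e. Q (sof (e 0)) (\<lambda>n. e (Suc n))) \<Longrightarrow> dfn E (\<lambda>e. \<exists>A\<in>AA. Q A e)"
  using dfn_not[OF dfn_AAall[of "\<lambda>n e. \<not> Q n e"]] dfn_not by fastforce

lemma stm_ops [dfi]:
  "stm A \<Longrightarrow> stm B \<Longrightarrow> stm (\<lambda>e. A e \<union> B e)"
  "stm A \<Longrightarrow> stm B \<Longrightarrow> stm (\<lambda>e. A e \<inter> B e)"
  "stm A \<Longrightarrow> stm B \<Longrightarrow> stm (\<lambda>e. A e - B e)"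
  "stm (\<lambda>e. UNIV)" "stm (\<lambda>e. {})"
  using dfn_const[of E True] dfn_const[of E False] unfolding stm_def
  by (auto intro: dfn_disj dfn_conj dfn_not)

lemma stm_lessThan [dfi]: assumes "ntm t" shows "stm (\<lambda>e. {..<t e})"
  unfolding stm_def lessThan_iff by (intro dfi ntm_rename[OF assms])

lemma stm_interval [dfi]: assumes "ntm s" "ntm t" shows "stm (\<lambda>e. {s e..<t e})"
  unfolding stm_def atLeastLessThan_iff by (intro dfi ntm_rename[OF assms(1)] ntm_rename[OF assms(2)])

lemma dfn_seteq [dfi]: assumes "stm A" "stm B" shows "dfn E (\<lambda>e. A e = B e)"
  unfolding set_eq_iff by (intro dfi stm_rename[OF assms(1)] stm_rename[OF assms(2)])

lemma dfn_setle [dfi]: assumes "stm A" "stm B" shows "dfn E (\<lambda>e. A e \<subseteq> B e)"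
  unfolding subset_eq by (intro dfi stm_rename[OF assms(1)] stm_rename[OF assms(2)])

lemma dfn_finite [dfi]: assumes "stm A" shows "dfn E (\<lambda>e. finite (A e))"
  unfolding finite_nat_set_iff_bounded by (intro dfi stm_rename[OF assms])

lemma ntm_Suc [dfi]: assumes "ntm t" shows "ntm (\<lambda>e. Suc (t e))"
proof -
  have "nof (e 0) = Suc (t (\<lambda>n. e (Suc n))) \<longleftrightarrow>
    (\<forall>k. k < nof (e 0) \<longleftrightarrow> k < t (\<lambda>n. e (Suc n)) \<or> k = t (\<lambda>n. e (Suc n)))" for e
    by (metis less_Suc_eq linorder_neqE_nat less_irrefl)
  moreover have "dfn E (\<lambda>e. \<forall>k. k < nof (e 0) \<longleftrightarrow> k < t (\<lambda>n. e (Suc n)) \<or> k = t (\<lambda>n. e (Suc n)))"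
    by (intro dfi ntm_rename[OF assms])
  ultimately show ?thesis by (intro ntmI) simp
qed

end

text \<open>Least witness, with the default value 0 if there is none: minimisation is then total and
  preserves definability unconditionally.\<close>

definition mu :: "(nat \<Rightarrow> bool) \<Rightarrow> nat" where "mu Q = (if \<exists>n. Q n then LEAST n. Q n else 0)"

lemma muI: "Q n \<Longrightarrow> Q (mu Q)" unfolding mu_def by (auto intro: LeastI)
lemma mu_le: "Q n \<Longrightarrow> mu Q \<le> n" unfolding mu_def by (auto intro: Least_le)

lemma mu_iff: "v = mu Q \<longleftrightarrow> (Q v \<and> (\<forall>m<v. \<not> Q m)) \<or> ((\<forall>n. \<not> Q n) \<and> v = 0)"
proof (cases "\<exists>n. Q n")
  case True
  then show ?thesis using muI[of Q] mu_le[of Q] by (metis leD linorder_neqE_nat order.antisym not_less)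
qed (auto simp: mu_def)

definition col :: "nat \<Rightarrow> nat set \<Rightarrow> nat set" where "col n c = {m. prod_encode (n, m) \<in> c}"

lemma mem_col [simp]: "m \<in> col n c \<longleftrightarrow> prod_encode (n, m) \<in> c" by (simp add: col_def)

text \<open>The binary digit in arithmetical terms, which brings \<open>set_decode\<close> under the
  closure rules.\<close>

lemma set_decode_iff: "n \<in> set_decode c \<longleftrightarrow> (\<exists>q r. c = (2*q+1)*2^n + r \<and> r < 2^n)"
proof
  assume "n \<in> set_decode c"
  then obtain q where "c div 2^n = 2*q+1" by (auto simp: set_decode_def elim: oddE)
  then have "c = (2*q+1)*2^n + c mod 2^n" by (metis div_mult_mod_eq)
  then show "\<exists>q r. c = (2*q+1)*2^n + r \<and> r < 2^n" by (metis mod_less_divisor zero_less_numeral zero_less_power)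
next
  assume "\<exists>q r. c = (2*q+1)*2^n + r \<and> r < 2^n"
  then obtain q r where "c = (2*q+1)*2^n + r" "r < 2^n" by blast
  then have "c div 2^n = 2*q+1"
    by (intro div_nat_eqI) (auto simp: algebra_simps)
  then show "n \<in> set_decode c" by (simp add: set_decode_def)
qed

section \<open>Arithmetic, coding and recursion on numbers as definable terms\<close>

context zm
begin

text \<open>A value of a recursion is certified by a finite set of pairs in which every entry is the
  initial one or stems from the entry before it. That the entries are unique and right follows by
  induction on \<open>k\<close>.\<close>

lemma rec_graph: "(\<exists>Z. pr (num t) (num v) \<in> el Z \<and> (\<forall>k y. pr (num k) (num y) \<in> el Z \<longrightarrow>
    (k = 0 \<and> y = a) \<or> (\<exists>k' y'. k = Suc k' \<and> pr (num k') (num y') \<in> el Z \<and> y = g k' y'))) \<longleftrightarrow> v = rec_nat a g t"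
    (is "(\<exists>Z. ?Q Z) = _")
proof
  assume "\<exists>Z. ?Q Z"
  then obtain Z where Z: "?Q Z" by blast
  have "pr (num k) (num y) \<in> el Z \<Longrightarrow> y = rec_nat a g k" for k y
    by (induction k arbitrary: y) (use Z in fastforce)+
  then show "v = rec_nat a g t" using Z by blast
next
  assume v: "v = rec_nat a g t"
  define Z where "Z = (\<lambda>k. pr (num k) (num (rec_nat a g k))) ` {..t}"
  have "isset Z" by (intro isset_finite) (simp add: Z_def)
  moreover have "(k = 0 \<and> y = a) \<or> (\<exists>k' y'. k = Suc k' \<and> pr (num k') (num y') \<in> Z \<and> y = g k' y')"
    if "pr (num k) (num y) \<in> Z" for k y
  proof (cases k)
    case 0 then show ?thesis using that by (auto simp: Z_def simp del: num.simps)
  next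
    case (Suc k')
    then have "pr (num k') (num (rec_nat a g k')) \<in> Z" "y = g k' (rec_nat a g k')"
      using that by (auto simp: Z_def simp del: num.simps)
    then show ?thesis using Suc by blast
  qed
  ultimately have "?Q (mk Z)" using v by (auto simp: Z_def simp del: num.simps)
  then show "\<exists>Z. ?Q Z" by (rule exI[of _ "mk Z"])
qed

lemma ntm_rec [dfi]:
  assumes "ntm a" "ntm (\<lambda>e. g (\<lambda>n. e (Suc (Suc n))) (nof (e 0)) (nof (e 1)))" "ntm t"
  shows "ntm (\<lambda>e. rec_nat (a e) (\<lambda>k y. g e k y) (t e))"
proof (rule ntmI)
  have g: "ntm (\<lambda>e. g (\<lambda>n. e (Suc (Suc (Suc (Suc (Suc (Suc n))))))) (nof (e (Suc 0))) (nof (e 0)))"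
    using ntm_rename[OF assms(2), of "case_nat 1 (case_nat 0 (\<lambda>n. Suc (Suc (Suc (Suc (Suc (Suc n)))))))"] by simp
  let ?s = "\<lambda>e n. e (Suc n)"
  have "dfn E (\<lambda>e. \<exists>Z. pr (num (t (?s e))) (num (nof (e 0))) \<in> el Z \<and> (\<forall>k y. pr (num k) (num y) \<in> el Z \<longrightarrow>
    (k = 0 \<and> y = a (?s e)) \<or> (\<exists>k' y'. k = Suc k' \<and> pr (num k') (num y') \<in> el Z \<and> y = g (?s e) k' y')))"
    by (intro dfi ntm_rename[OF assms(1)] ntm_rename[OF assms(3)] g)
  then show "dfn E (\<lambda>e. nof (e 0) = rec_nat (a (?s e)) (\<lambda>k y. g (?s e) k y) (t (?s e)))"
    unfolding rec_graph by simp
qed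

lemma ntm_mu [dfi]:
  assumes "dfn E (\<lambda>e. Q (nof (e 0)) (\<lambda>n. e (Suc n)))" shows "ntm (\<lambda>e. mu (\<lambda>n. Q n e))"
proof (rule ntmI)
  have Q: "dfn E (\<lambda>e. Q (nof (e i)) (\<lambda>n. e (f n)))" for f i
    using dfn_rename[OF assms, of "case_nat i f"] by simp
  show "dfn E (\<lambda>e. nof (e 0) = mu (\<lambda>n. Q n (\<lambda>n. e (Suc n))))"
    unfolding mu_iff by (intro dfi Q)
qed

lemma ntm_if [dfi]: assumes "dfn E Q" "ntm s" "ntm t" shows "ntm (\<lambda>e. if Q e then s e else t e)"
proof (rule ntmI)
  have "dfn E (\<lambda>e. if Q (\<lambda>n. e (Suc n)) then nof (e 0) = s (\<lambda>n. e (Suc n)) else nof (e 0) = t (\<lambda>n. e (Suc n)))"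
    by (intro dfi dfn_rename[OF assms(1)] ntm_rename[OF assms(2)] ntm_rename[OF assms(3)])
  then show "dfn E (\<lambda>e. nof (e 0) = (if Q (\<lambda>n. e (Suc n)) then s (\<lambda>n. e (Suc n)) else t (\<lambda>n. e (Suc n))))"
    by (simp add: if_distrib cong: if_cong)
qed

lemma ntm_plus [dfi]: assumes "ntm s" "ntm t" shows "ntm (\<lambda>e. s e + t e)"
proof -
  have "ntm (\<lambda>e. rec_nat (s e) (\<lambda>k y. Suc y) (t e))" by (intro dfi assms)
  moreover have "rec_nat m (\<lambda>k y. Suc y) n = m + n" for m n by (induction n) auto
  ultimately show ?thesis by simp
qed

lemma ntm_times [dfi]: assumes "ntm s" "ntm t" shows "ntm (\<lambda>e. s e * t e)"
proof -
  have "ntm (\<lambda>e. rec_nat 0 (\<lambda>k y. y + s e) (t e))" by (intro dfi assms ntm_rename[OF assms(1)])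
  moreover have "rec_nat 0 (\<lambda>k y. y + m) n = m * n" for m n by (induction n) auto
  ultimately show ?thesis by simp
qed

lemma ntm_power [dfi]: assumes "ntm s" "ntm t" shows "ntm (\<lambda>e. s e ^ t e)"
proof -
  have "ntm (\<lambda>e. rec_nat 1 (\<lambda>k y. y * s e) (t e))" by (intro dfi assms ntm_rename[OF assms(1)])
  moreover have "rec_nat 1 (\<lambda>k y. y * m) n = m ^ n" for m n :: nat by (induction n) (auto simp: mult.commute)
  ultimately show ?thesis by simp
qed

lemma ntm_minus [dfi]: assumes "ntm s" "ntm t" shows "ntm (\<lambda>e. s e - t e)"
proof -
  have "ntm (\<lambda>e. mu (\<lambda>n. s e = t e + n))" by (intro dfi ntm_rename[OF assms(1)] ntm_rename[OF assms(2)])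
  moreover have "m - n = mu (\<lambda>k. m = n + k)" for m n by (subst mu_iff) auto
  ultimately show ?thesis by simp
qed

lemma ntm_pair [dfi]: assumes "ntm s" "ntm t" shows "ntm (\<lambda>e. prod_encode (s e, t e))"
proof -
  have "ntm (\<lambda>e. rec_nat 0 (\<lambda>k y. y + Suc k) (s e + t e) + s e)" by (intro dfi assms)
  moreover have "rec_nat 0 (\<lambda>k y. y + Suc k) n = triangle n" for n by (induction n) auto
  ultimately show ?thesis by (simp add: prod_encode_def)
qed

lemma ntm_fst [dfi]: assumes "ntm t" shows "ntm (\<lambda>e. fst (prod_decode (t e)))"
proof -
  have "ntm (\<lambda>e. mu (\<lambda>m. \<exists>n. t e = prod_encode (m, n)))" by (intro dfi ntm_rename[OF assms])
  moreover have "fst (prod_decode x) = mu (\<lambda>m. \<exists>n. x = prod_encode (m, n))" for x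
    by (subst mu_iff) (metis fst_conv prod.collapse prod_decode_inverse prod_encode_inverse less_irrefl)
  ultimately show ?thesis by simp
qed

lemma ntm_snd [dfi]: assumes "ntm t" shows "ntm (\<lambda>e. snd (prod_decode (t e)))"
proof -
  have "ntm (\<lambda>e. mu (\<lambda>n. \<exists>m. t e = prod_encode (m, n)))" by (intro dfi ntm_rename[OF assms])
  moreover have "snd (prod_decode x) = mu (\<lambda>n. \<exists>m. x = prod_encode (m, n))" for x
    by (subst mu_iff) (metis snd_conv prod.collapse prod_decode_inverse prod_encode_inverse less_irrefl)
  ultimately show ?thesis by simp
qed

lemma stm_decode [dfi]: assumes "ntm t" shows "stm (\<lambda>e. set_decode (t e))"
  unfolding stm_def set_decode_iff by (intro dfi ntm_rename[OF assms])

lemma stm_col [dfi]: assumes "ntm t" "stm S" shows "stm (\<lambda>e. col (t e) (S e))"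
  unfolding stm_def mem_col by (intro dfi ntm_rename[OF assms(1)] stm_rename[OF assms(2)])

lemma ntm_encode [dfi]: assumes "stm S" shows "ntm (\<lambda>e. set_encode (S e))"
proof -
  have "ntm (\<lambda>e. mu (\<lambda>n. finite (S e) \<and> set_decode n = S e))" by (intro dfi stm_rename[OF assms])
  moreover have "set_encode A = mu (\<lambda>n. finite A \<and> set_decode n = A)" for A
    by (subst mu_iff) (metis finite_set_decode less_irrefl set_decode_inverse set_encode_inf set_encode_inverse)
  ultimately show ?thesis by simp
qed

lemma stm_if [dfi]: assumes "dfn E Q" "stm A" "stm B" shows "stm (\<lambda>e. if Q e then A e else B e)"
proof -
  have "dfn E (\<lambda>e. if Q (\<lambda>n. e (Suc n)) then nof (e 0) \<in> A (\<lambda>n. e (Suc n)) else nof (e 0) \<in> B (\<lambda>n. e (Suc n)))"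
    by (intro dfi dfn_rename[OF assms(1)] stm_rename[OF assms(2)] stm_rename[OF assms(3)])
  then show ?thesis by (simp add: stm_def if_distrib cong: if_cong)
qed

text \<open>Internal sequences of numbers, of sets of numbers and of elements: those definable with
  parameters. For numbers, \<open>nfun_AA\<close> identifies them with the sequences whose coded
  graph lies in \<open>AA\<close>.\<close>

definition nfun :: "(nat \<Rightarrow> nat) \<Rightarrow> bool" where "nfun f \<longleftrightarrow> ntm (\<lambda>e. f (nof (e 0)))"
definition sfun :: "(nat \<Rightarrow> nat set) \<Rightarrow> bool" where "sfun f \<longleftrightarrow> stm (\<lambda>e. f (nof (e 0)))"
definition efun :: "(nat \<Rightarrow> 'a) \<Rightarrow> bool" where "efun f \<longleftrightarrow> dt E (\<lambda>e. f (nof (e 0)))"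

lemma dt_efun: assumes "efun f" "ntm t" shows "dt E (\<lambda>e. f (t e))"
  using dt_sub[of E "\<lambda>x. f (nof x)" "\<lambda>e. num (t e)"] assms by (simp add: efun_def ntm_def)

lemma ntm_nfun: assumes "nfun f" "ntm t" shows "ntm (\<lambda>e. f (t e))"
  using dt_efun[of "\<lambda>n. num (f n)" t] assms by (simp add: efun_def nfun_def ntm_def)

lemma stm_sfun: assumes "sfun f" "ntm t" shows "stm (\<lambda>e. f (t e))"
proof -
  have "dfn E (\<lambda>e. nof (e 1) \<in> f (nof (e 0)))"
    using dfn_rename[OF assms(1)[unfolded sfun_def stm_def], of "case_nat 1 (\<lambda>_. 0)"] by simp
  then have "dfn E (\<lambda>e. nof (e 0) \<in> f (t (\<lambda>n. e (Suc n))))"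
    using dfn_nsub[of "\<lambda>n e. nof (e 0) \<in> f n" "\<lambda>e. t (\<lambda>n. e (Suc n))"] ntm_rename[OF assms(2), of Suc] by simp
  then show ?thesis by (simp add: stm_def)
qed

lemma nfunI: "ntm (\<lambda>e. f (nof (e 0))) \<Longrightarrow> nfun f" by (simp add: nfun_def)
lemma sfunI: "stm (\<lambda>e. f (nof (e 0))) \<Longrightarrow> sfun f" by (simp add: sfun_def)

lemma nfun_AA: "nfun f \<longleftrightarrow> {p. snd (prod_decode p) = f (fst (prod_decode p))} \<in> AA" (is "_ \<longleftrightarrow> ?G \<in> AA")
proof
  assume f: "nfun f" show "?G \<in> AA" by (rule AA_I) (intro dfi ntm_nfun[OF f])
next
  assume G: "?G \<in> AA"
  have "ntm (\<lambda>e. mu (\<lambda>y. prod_encode (nof (e 0), y) \<in> ?G))" by (intro dfi G)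
  moreover have "mu (\<lambda>y. prod_encode (x, y) \<in> ?G) = f x" for x by (rule sym, subst mu_iff) auto
  ultimately show "nfun f" by (simp add: nfun_def)
qed

lemma sfun_AA: "sfun f \<Longrightarrow> {p. snd (prod_decode p) \<in> f (fst (prod_decode p))} \<in> AA"
  by (rule AA_I) (intro dfi stm_sfun)

text \<open>Dependent choices on the natural numbers: the least-witness sequence is internal.\<close>

lemma nat_dc:
  assumes P: "dfn E (\<lambda>e. P (nof (e 0)) (nof (e 1)) (nof (e 2)))"
    and "inv' 0 x0" "\<And>n x. inv' n x \<Longrightarrow> \<exists>y. P n x y"
    "\<And>n x y. inv' n x \<Longrightarrow> P n x y \<Longrightarrow> inv' (Suc n) y"
  obtains f where "nfun f" "f 0 = x0" "\<And>n. P n (f n) (f (Suc n))" "\<And>n. inv' n (f n)"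
proof -
  define f where "f = (\<lambda>n. rec_nat x0 (\<lambda>n x. mu (\<lambda>y. P n x y)) n)"
  have *: "dfn E (\<lambda>e. P (nof (e (Suc 0))) (nof (e (Suc (Suc 0)))) (nof (e 0)))"
    using dfn_rename[OF P, of "\<lambda>n. if n = 0 then Suc 0 else if n = 1 then Suc (Suc 0) else 0"] by simp
  have "nfun f" unfolding f_def by (intro nfunI dfi) (use * in simp)
  moreover have i: "inv' n (f n)" for n
  proof (induction n)
    case (Suc n)
    from assms(3)[OF Suc] have "P n (f n) (f (Suc n))" by (auto simp: f_def intro: muI)
    then show ?case using assms(4) Suc by blast
  qed (simp add: f_def assms)
  moreover have "P n (f n) (f (Suc n))" for n using assms(3)[OF i[of n]] by (auto simp: f_def intro: muI)
  ultimately show ?thesis using that[of f] by (simp add: f_def)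
qed


subsection \<open>Functions and cardinality\<close>

lemma graph_iff: "(a, b) \<in> graph E f \<longleftrightarrow> pr a b \<in> el f"
  by (auto simp: graph_def is_pair_iff)

lemma fun_on_iff: "fun_on E f A \<longleftrightarrow> (\<forall>p\<in>el f. \<exists>a b. p = pr a b) \<and> (\<forall>a. (\<exists>b. pr a b \<in> el f) \<longleftrightarrow> a \<in> el A)
    \<and> (\<forall>a b b'. pr a b \<in> el f \<longrightarrow> pr a b' \<in> el f \<longrightarrow> b = b')"
  unfolding fun_on_def single_valued_def set_eq_iff Domain_iff graph_iff is_pair_iff by blast

lemma fun_onE: assumes "fun_on E f A"
  obtains h where "el f = {pr a (h a) | a. a \<in> el A}" "graph E f = {(a, h a) | a. a \<in> el A}"
proof -
  have "\<forall>a\<in>el A. \<exists>b. pr a b \<in> el f" using assms by (auto simp: fun_on_iff)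
  then obtain h where h: "\<forall>a\<in>el A. pr a (h a) \<in> el f" by metis
  have "el f = {pr a (h a) | a. a \<in> el A}"
    using h assms by (auto simp: fun_on_iff) (metis pr_inj)
  then show ?thesis using that[of h] by (auto simp: graph_def is_pair_iff)
qed

lemma fun_onI: assumes "isset {pr a (h a) | a. a \<in> el A}"
  shows "fun_on E (mk {pr a (h a) | a. a \<in> el A}) A"
    "graph E (mk {pr a (h a) | a. a \<in> el A}) = {(a, h a) | a. a \<in> el A}"
  using assms by (auto simp: fun_on_iff graph_iff)

lemma is_seqE: assumes "is_seq E s"
  obtains h where "graph E s = {(num n, h n) | n. True}" "efun h"
proof -
  from assms obtain h where h: "el s = {pr a (h a) | a. a \<in> el Om}" "graph E s = {(a, h a) | a. a \<in> el Om}"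
    unfolding is_seq_def is_omega_iff by (auto elim: fun_onE)
  have "dfn E (\<lambda>e. pr (num (nof (e 1))) (e 0) \<in> el s)" by (intro dfi)
  moreover have "pr (num n) x \<in> el s \<longleftrightarrow> x = h (num n)" for n x by (auto simp: h(1))
  ultimately have "efun (\<lambda>n. h (num n))" by (simp add: efun_def dt_def)
  then show ?thesis using that[of "\<lambda>n. h (num n)"] h(2) by auto
qed

lemma isset_efun: assumes "efun h" "\<And>n. h n \<in> el A"
  shows "isset {pr (num n) (h n) | n. True}" "isset (range h)"
proof -
  have 1: "dfn E (\<lambda>e. e 1 = h (nof (e 0)))" by (intro dfi dt_efun[OF assms(1)])
  have "isset {pr a b | a b. a \<in> el Om \<and> b \<in> el A \<and> b = h (nof a)}" by (intro isset_rel isset_rules 1)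
  moreover have "{pr a b | a b. a \<in> el Om \<and> b \<in> el A \<and> b = h (nof a)} = {pr (num n) (h n) | n. True}"
    using assms(2) by auto
  ultimately show *: "isset {pr (num n) (h n) | n. True}" by simp
  from isset_Range(1)[OF *] show "isset (range h)" by (rule back_subst[of isset]) auto
qed

lemma is_seqI: assumes "efun h" "\<And>n. h n \<in> el A"
  obtains s where "is_seq E s" "graph E s = {(num n, h n) | n. True}"
proof -
  have eq: "{pr (num n) (h n) | n. True} = {pr a (h (nof a)) | a. a \<in> el Om}" by auto
  note * = isset_efun(1)[OF assms, unfolded eq]
  have "{(a, h (nof a)) | a. a \<in> el Om} = {(num n, h n) | n. True}" by force
  then show ?thesis using that[of "mk {pr a (h (nof a)) | a. a \<in> el Om}"] fun_onI[OF *]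
    unfolding is_seq_def is_omega_iff by auto
qed

text \<open>Internal and true finiteness agree because the numbers of the model are standard and
  every finite set of elements belongs to the model.\<close>

lemma is_finite_iff: "is_finite E x \<longleftrightarrow> finite (el x)"
proof
  assume "is_finite E x"
  then obtain n f where f: "is_bijection E f x (num n)" unfolding is_finite_def is_omega_iff by auto
  then have "fun_on E f x" by (auto simp: is_bijection_def is_injection_def is_map_def)
  then obtain h where h: "graph E f = {(a, h a) | a. a \<in> el x}" by (rule fun_onE)
  have "inj_on h (el x)" "h ` el x \<subseteq> el (num n)"
    using f unfolding is_bijection_def is_injection_def is_map_def h
    by (auto simp: single_valued_def inj_on_def Range_iff)
  then show "finite (el x)" using inj_on_finite[of h "el x" "el (num n)"] by (simp add: el_num)
next
  assume fin: "finite (el x)"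
  then obtain h where h: "bij_betw h (el x) {0..<card (el x)}" using ex_bij_betw_finite_nat by blast
  have "isset {pr a (num (h a)) | a. a \<in> el x}" using fin by (intro isset_finite) simp
  note * = fun_onI[OF this]
  have "is_bijection E (mk {pr a (num (h a)) | a. a \<in> el x}) x (num (card (el x)))"
    unfolding is_bijection_def is_injection_def is_map_def *(2) el_num
  proof (intro conjI)
    have "Range {(a, num (h a)) | a. a \<in> el x} = num ` h ` el x" by (auto simp: Range_iff)
    then show "Range {(a, num (h a)) | a. a \<in> el x} = num ` {..<card (el x)}"
      using h unfolding bij_betw_def lessThan_atLeast0 by simp
    then show "Range {(a, num (h a)) | a. a \<in> el x} \<subseteq> num ` {..<card (el x)}" by simp
    show "single_valued ({(a, num (h a)) | a. a \<in> el x}\<inverse>)"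
      using h by (auto simp: single_valued_def bij_betw_def inj_on_def)
  qed (rule *)
  then show "is_finite E x" unfolding is_finite_def is_omega_iff by auto
qed

lemma is_injectionE: assumes "is_injection E f A B"
  obtains h where "inj_on h (el A)" "h ` el A \<subseteq> el B" "el f = {pr a (h a) | a. a \<in> el A}"
proof -
  have "fun_on E f A" using assms by (auto simp: is_injection_def is_map_def)
  then obtain h where h: "el f = {pr a (h a) | a. a \<in> el A}" "graph E f = {(a, h a) | a. a \<in> el A}" by (rule fun_onE)
  have "inj_on h (el A)" "h ` el A \<subseteq> el B"
    using assms unfolding is_injection_def is_map_def h
    by (auto simp: single_valued_def inj_on_def Range_iff)
  then show ?thesis using that h by blast
qed

lemma is_injectionI: assumes "isset {pr a (h a) | a. a \<in> el A}" "inj_on h (el A)" "h ` el A \<subseteq> el B"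
  shows "is_injection E (mk {pr a (h a) | a. a \<in> el A}) A B"
  using fun_onI[OF assms(1)] assms(2,3) unfolding is_injection_def is_map_def
  by (auto simp: single_valued_def inj_on_def)

lemma countableI: assumes "efun j" "el x \<subseteq> range j" shows "is_countable E x"
proof -
  define h where "h = (\<lambda>a. mu (\<lambda>n. j n = a))"
  have h: "j (h a) = a" if "a \<in> el x" for a using that assms(2) muI[of "\<lambda>n. j n = a"] by (auto simp: h_def)
  have "dfn E (\<lambda>e. e 1 = num (mu (\<lambda>n. j n = e 0)))" by (intro dfi dt_efun[OF assms(1)])
  then have "isset {pr a b | a b. a \<in> el x \<and> b \<in> el Om \<and> b = num (h a)}"
    unfolding h_def by (intro isset_rel isset_rules)
  moreover have "{pr a b | a b. a \<in> el x \<and> b \<in> el Om \<and> b = num (h a)} = {pr a (num (h a)) | a. a \<in> el x}" by auto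
  ultimately have *: "isset {pr a (num (h a)) | a. a \<in> el x}" by simp
  have "inj_on (\<lambda>a. num (h a)) (el x)" by (rule inj_onI) (metis h num_inj)
  from is_injectionI[OF * this, of Om] show ?thesis unfolding is_countable_def is_omega_iff by auto
qed

lemma countableD: assumes "is_countable E x" "el x \<noteq> {}" obtains j where "efun j" "range j = el x"
proof -
  obtain f where "is_injection E f x Om" using assms(1) unfolding is_countable_def is_omega_iff by blast
  then obtain h where h: "inj_on h (el x)" "h ` el x \<subseteq> el Om" "el f = {pr a (h a) | a. a \<in> el x}"
    by (rule is_injectionE)
  obtain a0 where a0: "a0 \<in> el x" using assms(2) by blast
  define j where "j = (\<lambda>n. if \<exists>a. pr a (num n) \<in> el f then THE a. pr a (num n) \<in> el f else a0)"
  have jj: "j n = a" if "pr a (num n) \<in> el f" for n a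
  proof -
    have "(THE a. pr a (num n) \<in> el f) = a"
      using that h by (intro the_equality) (auto simp: inj_on_def)
    then show ?thesis using that by (auto simp: j_def)
  qed
  have j0: "j n = a0" if "\<not> (\<exists>a. pr a (num n) \<in> el f)" for n using that by (simp add: j_def)
  have "x = j n \<longleftrightarrow> pr x (num n) \<in> el f \<or> ((\<forall>a. pr a (num n) \<notin> el f) \<and> x = a0)" for x n
    using jj j0 by metis
  moreover have "dfn E (\<lambda>e. pr (e 0) (num (nof (e (Suc 0)))) \<in> el f \<or> ((\<forall>a. pr a (num (nof (e (Suc 0)))) \<notin> el f) \<and> e 0 = a0))"
    by (intro dfi)
  ultimately have "efun j" by (simp add: efun_def dt_def)
  moreover have "range j = el x"
  proof (intro equalityI subsetI)
    fix y assume "y \<in> range j"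
    then show "y \<in> el x" using jj j0 a0 h(3) by (auto) (metis (mono_tags, lifting) mem_Collect_eq pr_inj)
  next
    fix y assume y: "y \<in> el x"
    then obtain n where "h y = num n" using h(2) by auto
    then have "j n = y" using y h(3) by (intro jj) auto
    then show "y \<in> range j" by auto
  qed
  ultimately show ?thesis using that by blast
qed

end

section \<open>Recursion and well-orders inside a model of ZFC\<close>

locale zfm = zm E for E :: "'a \<Rightarrow> 'a \<Rightarrow> bool" +
  assumes repl: "replacement E" and choi: "choice E"
begin

lemma isset_repl: assumes "dfn E (\<lambda>e. Q (e 0) (e 1))" "isset A" "\<And>x. x \<in> A \<Longrightarrow> \<exists>!y. Q x y"
  shows "isset {y. \<exists>x\<in>A. Q x y}"
proof -
  obtain a where a: "A = el a" using assms(2) isset_def by auto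
  obtain b where b: "\<forall>x \<in> el a. \<exists>y \<in> el b. Q x y"
    using replacementD[OF repl assms(1), of a] assms(3) a by blast
  have "dfn E (\<lambda>e. Q (e 0) (e (Suc 0)))" using assms(1) by simp
  then have Q: "dfn E (\<lambda>e. Q (e i) (e j))" for i j
    using dfn_rename[of E "\<lambda>e. Q (e 0) (e (Suc 0))" "case_nat i (\<lambda>_. j)"] by simp
  have "dfn E (\<lambda>e. \<exists>x\<in>el a. Q x (e 0))" by (intro dfi Q)
  then show ?thesis unfolding a
    by (rule isset_sub[OF _ isset_el[of b]]) (use b assms(3) a in metis)
qed

lemma isset_image: assumes "dt E (\<lambda>e. f (e 0))" "isset A" shows "isset (f ` A)"
proof -
  have "dfn E (\<lambda>e. e 1 = f (e 0))" by (intro dfi assms dt_rename[OF assms(1)])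
  from isset_repl[OF this assms(2)] show ?thesis by (simp add: image_def)
qed

section \<open>Transitive closures and ordinals\<close>

definition trans_el :: "'a \<Rightarrow> bool" where "trans_el t \<longleftrightarrow> (\<forall>y\<in>el t. el y \<subseteq> el t)"

lemma dfn_trans_el [dfi]: assumes "dt E t" shows "dfn E (\<lambda>e. trans_el (t e))"
  unfolding trans_el_def by (intro dfi assms dt_rename[OF assms])

text \<open>Membership induction, with closures of the members collected by replacement. Replacement
  wants unique values, so the least transitive set around each member is taken, which separation
  cuts out of any one.\<close>

lemma trcl: "\<exists>t. trans_el t \<and> x \<in> el t"
proof (induction x rule: wf_induct)
  case (less x)
  define Q where "Q = (\<lambda>y t. trans_el t \<and> y \<in> el t \<and> (\<forall>s. trans_el s \<and> y \<in> el s \<longrightarrow> el t \<subseteq> el s))"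
  have Qd: "dfn E (\<lambda>e. Q (e 0) (e 1))" unfolding Q_def by (intro dfi)
  have ex: "\<exists>!t. Q y t" if y: "y \<in> el x" for y
  proof -
    obtain s where s: "trans_el s" "y \<in> el s" using less[OF y] by blast
    have "isset {z \<in> el s. \<forall>u. trans_el u \<and> y \<in> el u \<longrightarrow> z \<in> el u}" by (intro isset_sep isset_el dfi)
    then obtain t where t: "el t = {z \<in> el s. \<forall>u. trans_el u \<and> y \<in> el u \<longrightarrow> z \<in> el u}" by (auto simp: isset_def)
    have "Q y t" unfolding Q_def
    proof (intro conjI allI impI)
      show "trans_el t" unfolding trans_el_def t using s(1) unfolding trans_el_def by blast
    qed (use s t in auto)
    moreover have "t' = t''" if "Q y t'" "Q y t''" for t' t'' using that unfolding Q_def by (intro ext) blast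
    ultimately show ?thesis by blast
  qed
  have "isset {t. \<exists>y\<in>el x. Q y t}" by (rule isset_repl[OF Qd isset_el ex])
  then have "isset (insert x (el x \<union> (\<Union>t\<in>{t. \<exists>y\<in>el x. Q y t}. el t)))"
    by (intro isset_insert isset_Un isset_Union isset_el)
  then obtain T where T: "el T = insert x (el x \<union> (\<Union>t\<in>{t. \<exists>y\<in>el x. Q y t}. el t))" by (auto simp: isset_def)
  have "trans_el T" unfolding trans_el_def
  proof
    fix z assume z: "z \<in> el T"
    have sub: "el y \<subseteq> el T" if "y \<in> el x" for y
    proof -
      obtain t where "Q y t" using ex[OF \<open>y \<in> el x\<close>] by blast
      then have "el y \<subseteq> el t" "el t \<subseteq> el T" using that T by (auto simp: Q_def trans_el_def)
      then show ?thesis by blast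
    qed
    consider "z = x" | "z \<in> el x" | t y where "Q y t" "y \<in> el x" "z \<in> el t" using z T by blast
    then show "el z \<subseteq> el T"
    proof cases
      case 3
      then have "el z \<subseteq> el t" by (auto simp: Q_def trans_el_def)
      then show ?thesis using 3 T by blast
    qed (use T sub in auto)
  qed
  then show ?case using T by blast
qed

definition Ord :: "'a \<Rightarrow> bool" where "Ord x \<longleftrightarrow> trans_el x \<and> (\<forall>y\<in>el x. trans_el y)"

lemma dfn_Ord [dfi]: assumes "dt E t" shows "dfn E (\<lambda>e. Ord (t e))"
  unfolding Ord_def by (intro dfi assms dt_rename[OF assms])

lemma Ord_el: "Ord x \<Longrightarrow> y \<in> el x \<Longrightarrow> Ord y"
  unfolding Ord_def trans_el_def by blast

lemma Ord_trans: "Ord x \<Longrightarrow> y \<in> el x \<Longrightarrow> z \<in> el y \<Longrightarrow> z \<in> el x"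
  by (auto simp: Ord_def trans_el_def)

lemma Ord_linear: "Ord x \<Longrightarrow> Ord y \<Longrightarrow> x \<in> el y \<or> x = y \<or> y \<in> el x"
proof (induction x arbitrary: y rule: wf_induct)
  case (less x)
  note IHx = less
  show ?case using less.prems(2)
  proof (induction y rule: wf_induct)
    case (less y)
    show ?case
    proof (rule ccontr)
      assume *: "\<not> ?case"
      have "z \<in> el y" if "z \<in> el x" for z
        using IHx(1)[OF that _ less.prems] Ord_el[OF IHx(2) that] * that Ord_trans[OF IHx(2) that] by blast
      moreover have "z \<in> el x" if "z \<in> el y" for z
        using less.IH[OF that] Ord_el[OF less.prems that] * that Ord_trans[OF less.prems that] by blast
      ultimately have "x = y" by (intro ext) blast
      then show False using * by blast
    qed
  qed
qed

end

text \<open>Recursion along a downward closed class \<open>K\<close> of ordinals.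
  \<open>Step g b y\<close> sees the set \<open>g\<close> of the earlier values but not how they are
  indexed, and it may have no value, in which case \<open>Val\<close> stops there.\<close>

locale recur = zfm E for E :: "'a \<Rightarrow> 'a \<Rightarrow> bool" +
  fixes K :: "'a \<Rightarrow> bool" and Step :: "'a \<Rightarrow> 'a \<Rightarrow> 'a \<Rightarrow> bool"
  assumes K: "dfn E (\<lambda>e. K (e 0))" and K_Ord: "K b \<Longrightarrow> Ord b" and K_el: "K b \<Longrightarrow> c \<in> el b \<Longrightarrow> K c"
    and Step: "dfn E (\<lambda>e. Step (e 0) (e 1) (e 2))"
    and Step_fun: "Step g b y \<Longrightarrow> Step g b y' \<Longrightarrow> y = y'"
begin

definition Good :: "'a \<Rightarrow> bool" where
  "Good h \<longleftrightarrow> (\<forall>b y. pr b y \<in> el h \<longrightarrow> K b \<and> (\<forall>c\<in>el b. \<exists>z. pr c z \<in> el h)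
     \<and> (\<exists>g. el g = {z. \<exists>c\<in>el b. pr c z \<in> el h} \<and> Step g b y))"

definition Val :: "'a \<Rightarrow> 'a \<Rightarrow> bool" where "Val b y \<longleftrightarrow> (\<exists>h. Good h \<and> pr b y \<in> el h)"

lemma dfn_Val: "dt E s \<Longrightarrow> dt E t \<Longrightarrow> dfn E (\<lambda>e. Val (s e) (t e))"
proof (rule dfn_sub2[where Q=Val])
  have K': "dfn E (\<lambda>e. K (e i))" for i using dfn_rename[OF K, of "\<lambda>_. i"] by simp
  have S': "dfn E (\<lambda>e. Step (e i) (e j) (e k))" for i j k
    using dfn_rename[OF Step, of "case_nat i (case_nat j (\<lambda>_. k))"] by (simp add: numeral_2_eq_2)
  show "dfn E (\<lambda>e. Val (e 0) (e 1))" unfolding Val_def Good_def by (intro dfi K' S')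
qed

lemma GoodE: assumes "Good h" "pr b y \<in> el h"
  obtains g where "K b" "\<forall>c\<in>el b. \<exists>z. pr c z \<in> el h" "el g = {z. \<exists>c\<in>el b. pr c z \<in> el h}" "Step g b y"
  using assms(1)[unfolded Good_def, rule_format, OF assms(2)] by auto

lemma Good_unique: "Good h \<Longrightarrow> Good h' \<Longrightarrow> pr b y \<in> el h \<Longrightarrow> pr b y' \<in> el h' \<Longrightarrow> y = y'"
proof (induction b arbitrary: y y' rule: wf_induct)
  case (less b)
  obtain g where g: "el g = {z. \<exists>c\<in>el b. pr c z \<in> el h}" "Step g b y" "\<forall>c\<in>el b. \<exists>z. pr c z \<in> el h"
    by (rule GoodE[OF less.prems(1,3)]) (rule that; assumption)
  obtain g' where g': "el g' = {z. \<exists>c\<in>el b. pr c z \<in> el h'}" "Step g' b y'" "\<forall>c\<in>el b. \<exists>z. pr c z \<in> el h'"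
    by (rule GoodE[OF less.prems(2,4)]) (rule that; assumption)
  have "pr c z \<in> el h \<longleftrightarrow> pr c z \<in> el h'" if "c \<in> el b" for c z
  proof -
    obtain u v where uv: "pr c u \<in> el h" "pr c v \<in> el h'" using g(3) g'(3) \<open>c \<in> el b\<close> by blast
    have "pr c z \<in> el h \<Longrightarrow> z = v" "pr c z \<in> el h' \<Longrightarrow> u = z"
      using less.IH[OF that less.prems(1,2)] uv by blast+
    moreover have "u = v" using less.IH[OF that less.prems(1,2)] uv by blast
    ultimately show ?thesis using uv by blast
  qed
  then have "g = g'" by (intro ext) (auto simp: g g')
  then show ?case using Step_fun g(2) g'(2) by blast
qed

lemma Val_unique: "Val b y \<Longrightarrow> Val b y' \<Longrightarrow> y = y'"
  unfolding Val_def using Good_unique by blast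

lemma Good_Val: "Good h \<Longrightarrow> pr b y \<in> el h \<Longrightarrow> Val b y" unfolding Val_def by blast

lemma Val_step: assumes "Val b y"
  shows "K b" "\<forall>c\<in>el b. \<exists>z. Val c z" "\<exists>g. el g = {z. \<exists>c\<in>el b. Val c z} \<and> Step g b y"
proof -
  obtain h where h: "Good h" "pr b y \<in> el h" using assms Val_def by auto
  obtain g where g: "K b" "el g = {z. \<exists>c\<in>el b. pr c z \<in> el h}" "Step g b y" "\<forall>c\<in>el b. \<exists>z. pr c z \<in> el h"
    by (rule GoodE[OF h]) (rule that; assumption)
  show "K b" "\<forall>c\<in>el b. \<exists>z. Val c z" using g h Good_Val by blast+
  have "Val c z \<longleftrightarrow> pr c z \<in> el h" if "c \<in> el b" for c z
    using g(4) that Good_Val[OF h(1)] Val_unique by metis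
  then have "el g = {z. \<exists>c\<in>el b. Val c z}" using g(2) by auto
  then show "\<exists>g. el g = {z. \<exists>c\<in>el b. Val c z} \<and> Step g b y" using g(3) by blast
qed

lemma Val_set: assumes "\<forall>c\<in>el b. \<exists>z. Val c z" shows "isset {z. \<exists>c\<in>el b. Val c z}"
proof (rule isset_repl[OF _ isset_el])
  show "dfn E (\<lambda>e. Val (e 0) (e 1))" by (intro dfn_Val dfi)
  show "\<exists>!z. Val c z" if "c \<in> el b" for c using assms that Val_unique by blast
qed

text \<open>The earlier values form a set by replacement; their graph together with the new pair is
  an approximation that witnesses \<open>Val\<close>.\<close>

lemma Val_intro: assumes "K b" "\<forall>c\<in>el b. \<exists>z. Val c z" "Step (mk {z. \<exists>c\<in>el b. Val c z}) b y"
  shows "Val b y"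
proof -
  note iss = Val_set[OF assms(2)]
  have "isset {pr c z | c z. c \<in> el b \<and> z \<in> {z. \<exists>c\<in>el b. Val c z} \<and> Val c z}"
    by (intro isset_rel iss isset_el dfn_Val dfi)
  moreover have "{pr c z | c z. c \<in> el b \<and> z \<in> {z. \<exists>c\<in>el b. Val c z} \<and> Val c z} = {pr c z | c z. c \<in> el b \<and> Val c z}"
    by auto
  ultimately have "isset (insert (pr b y) {pr c z | c z. c \<in> el b \<and> Val c z})" by (simp add: isset_insert)
  then obtain h where h: "el h = insert (pr b y) {pr c z | c z. c \<in> el b \<and> Val c z}" by (auto simp: isset_def)
  have "K c \<and> (\<forall>d\<in>el c. \<exists>z. pr d z \<in> el h) \<and> (\<exists>g. el g = {z. \<exists>d\<in>el c. pr d z \<in> el h} \<and> Step g c z)"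
    if cz: "pr c z \<in> el h" for c z
  proof -
    have below: "pr d x \<in> el h \<longleftrightarrow> Val d x" if "d \<in> el b" for d x
      using that h el_irrefl by auto
    show ?thesis
    proof (cases "c = b")
      case True
      then have z: "z = y" using cz h el_irrefl by auto
      have eq: "{z. \<exists>d\<in>el c. pr d z \<in> el h} = {z. \<exists>c\<in>el b. Val c z}" using below True by auto
      have "\<forall>d\<in>el c. \<exists>z. pr d z \<in> el h" using below True assms(2) by auto
      moreover have "\<exists>g. el g = {z. \<exists>c\<in>el b. Val c z} \<and> Step g c z"
        using assms(3) True z iss by (intro exI[of _ "mk {z. \<exists>c\<in>el b. Val c z}"]) simp
      ultimately show ?thesis using assms(1) True eq by simp
    next
      case False
      then have c: "c \<in> el b" "Val c z" using cz h by auto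
      have "d \<in> el b" if "d \<in> el c" for d using Ord_trans[OF K_Ord[OF assms(1)] c(1) that] .
      then have "{z. \<exists>d\<in>el c. pr d z \<in> el h} = {z. \<exists>d\<in>el c. Val d z}" "\<forall>d\<in>el c. \<forall>z. pr d z \<in> el h \<longleftrightarrow> Val d z"
        using below by auto
      then show ?thesis using Val_step[OF c(2)] by auto
    qed
  qed
  then have "Good h" unfolding Good_def by blast
  then show ?thesis using h by (auto simp: Val_def)
qed

end

section \<open>The well-ordering theorem\<close>

context zfm
begin

text \<open>The axiom of choice speaks of disjoint families, so each nonempty \<open>x\<close> is
  replaced by the set of pairs of \<open>x\<close> with its elements.\<close>

lemma choice_fun: "\<exists>s. \<forall>x. el x \<subseteq> el a \<and> el x \<noteq> {} \<longrightarrow> (\<exists>!y. y \<in> el x \<and> pr x y \<in> el s)"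
proof -
  define Q where "Q = (\<lambda>y. \<exists>x. el x \<subseteq> el a \<and> (\<exists>z. z \<in> el x) \<and> el y = {p. \<exists>b\<in>el x. p = pr x b})"
  have Qd: "dfn E (\<lambda>e. Q (e 0))" unfolding Q_def by (intro dfi)
  have "isset {y. el y \<subseteq> {pr x b | x b. x \<in> {x. el x \<subseteq> el a} \<and> b \<in> el a}}"
    by (intro isset_Pow isset_prod isset_el)
  then have "isset {y. Q y}" by (rule isset_sub[OF Qd]) (unfold Q_def, blast)
  then obtain F where F: "el F = {y. Q y}" by (auto simp: isset_def)
  have iss: "isset {p. \<exists>b\<in>el x. p = pr x b}" for x
  proof -
    have "{pr a b | a b. a \<in> {x} \<and> b \<in> el x} = {p. \<exists>b\<in>el x. p = pr x b}" by auto
    then show ?thesis using isset_prod[OF isset_sing[of x] isset_el[of x]] by simp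
  qed
  have *: "(\<forall>x\<in>el F. el x \<noteq> {}) \<and> (\<forall>x\<in>el F. \<forall>y\<in>el F. x \<noteq> y \<longrightarrow> el x \<inter> el y = {})"
  proof (intro conjI ballI impI)
    fix x y assume "x \<in> el F" "y \<in> el F" "x \<noteq> y"
    then obtain u v where "el x = {p. \<exists>b\<in>el u. p = pr u b}" "el y = {p. \<exists>b\<in>el v. p = pr v b}"
      unfolding F Q_def by blast
    moreover from this have "u \<noteq> v" using \<open>x \<noteq> y\<close> ext by metis
    ultimately show "el x \<inter> el y = {}" by auto
  qed (auto simp: F Q_def)
  obtain s where s: "\<forall>x\<in>el F. \<exists>!y. y \<in> el x \<inter> el s"
    using choi[unfolded choice_def, THEN spec, THEN mp, OF *] by (elim exE)
  have "\<exists>!y. y \<in> el x \<and> pr x y \<in> el s" if "el x \<subseteq> el a \<and> el x \<noteq> {}" for x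
  proof -
    have "Q (mk {p. \<exists>b\<in>el x. p = pr x b})" unfolding Q_def using that iss[of x] by (intro exI[of _ x]) auto
    then have "mk {p. \<exists>b\<in>el x. p = pr x b} \<in> el F" by (simp add: F)
    from s[rule_format, OF this] have *: "\<exists>!p. p \<in> {p. \<exists>b\<in>el x. p = pr x b} \<inter> el s"
      unfolding el_mk[OF iss] .
    define S where "S = {p. \<exists>b\<in>el x. p = pr x b} \<inter> el s"
    have "\<exists>!p. p \<in> S" using * unfolding S_def .
    then obtain p where p: "p \<in> S" "\<And>q. q \<in> S \<Longrightarrow> q = p" by blast
    note p = p[unfolded S_def]
    then obtain y where y: "y \<in> el x" "p = pr x y" by blast
    show ?thesis
    proof (rule ex1I[of _ y])
      show "z = y" if "z \<in> el x \<and> pr x z \<in> el s" for z using p(2)[of "pr x z"] that y by auto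
    qed (use p y in auto)
  qed
  then show ?thesis by blast
qed

lemma zermelo: obtains th f where "Ord th" "dt E (\<lambda>e. f (e 0))" "inj_on f (el th)" "f ` el th = el a"
proof -
  obtain s where s: "\<And>x. el x \<subseteq> el a \<and> el x \<noteq> {} \<Longrightarrow> (\<exists>!y. y \<in> el x \<and> pr x y \<in> el s)"
    using choice_fun[of a] by blast
  define Step where "Step = (\<lambda>g (b::'a) y. \<exists>x. el x = {z. z \<in> el a \<and> z \<notin> el g} \<and> y \<in> el x \<and> pr x y \<in> el s)"
  interpret R: recur E Ord Step
  proof
    show "dfn E (\<lambda>e. Step (e 0) (e 1) (e 2))" unfolding Step_def by (intro dfi)
    show "y = y'" if "Step g b y" "Step g b y'" for g b y y'
    proof -
      from that(1) obtain x where x: "el x = {z. z \<in> el a \<and> z \<notin> el g}" "y \<in> el x \<and> pr x y \<in> el s"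
        unfolding Step_def by (elim exE conjE) simp
      from that(2) obtain x' where x': "el x' = {z. z \<in> el a \<and> z \<notin> el g}" "y' \<in> el x' \<and> pr x' y' \<in> el s"
        unfolding Step_def by (elim exE conjE) simp
      have "x' = x" by (rule ext) (simp add: x x')
      moreover have "\<exists>!y. y \<in> el x \<and> pr x y \<in> el s" using x by (intro s) auto
      ultimately show ?thesis using x(2) x'(2) by blast
    qed
    show "dfn E (\<lambda>e. Ord (e 0))" by (intro dfi)
  qed (auto intro: Ord_el)
  have Va: "y \<in> el a" "y \<notin> {z. \<exists>c\<in>el b. R.Val c z}" if "R.Val b y" for b y
    using R.Val_step(3)[OF that] unfolding Step_def by auto
  have Vinj: "b = b'" if "R.Val b y" "R.Val b' y" for b b' y
    using Ord_linear[OF R.Val_step(1)[OF that(1)] R.Val_step(1)[OF that(2)]] Va(2)[OF that(1)] Va(2)[OF that(2)] that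
    by blast
  \<comment> \<open>Burali-Forti: if the recursion never stopped, its inverse would map a subset of
    \<open>a\<close> onto all ordinals, and replacement would make these a set.\<close>
  have "\<exists>b. Ord b \<and> (\<nexists>y. R.Val b y)"
  proof (rule ccontr)
    assume *: "\<not> ?thesis"
    have 1: "isset {y \<in> el a. \<exists>b. R.Val b y}" by (intro isset_sep isset_el dfi R.dfn_Val)
    have "isset {b. \<exists>y\<in>{y \<in> el a. \<exists>b. R.Val b y}. R.Val b y}"
    proof (rule isset_repl[OF _ 1])
      show "dfn E (\<lambda>e. R.Val (e 1) (e 0))" by (intro R.dfn_Val dfi)
      show "\<exists>!b. R.Val b y" if "y \<in> {y \<in> el a. \<exists>b. R.Val b y}" for y using that Vinj by blast
    qed
    moreover have "{b. \<exists>y\<in>{y \<in> el a. \<exists>b. R.Val b y}. R.Val b y} = {b. Ord b}"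
      using * Va R.Val_step(1) by blast
    ultimately obtain O' where O: "el O' = {b. Ord b}" by (auto simp: isset_def)
    have "Ord O'" unfolding Ord_def trans_el_def O using Ord_el Ord_trans by blast
    then have "O' \<in> el O'" using O by blast
    then show False using el_irrefl by blast
  qed
  then obtain b0 where b0: "Ord b0 \<and> (\<nexists>y. R.Val b0 y)" by blast
  obtain th where th: "Ord th \<and> (\<nexists>y. R.Val th y)" "\<And>y. y \<in> el th \<Longrightarrow> \<not> (Ord y \<and> (\<nexists>z. R.Val y z))"
    by (rule minimal[of "\<lambda>b. Ord b \<and> (\<nexists>y. R.Val b y)", OF b0]) blast
  have ex: "\<forall>c\<in>el th. \<exists>z. R.Val c z" using th Ord_el by blast
  define g where "g = {z. \<exists>c\<in>el th. R.Val c z}"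
  have iss: "isset g" unfolding g_def by (rule R.Val_set[OF ex])
  have ga: "g = el a"
  proof (rule ccontr)
    assume "g \<noteq> el a"
    then have ne: "{z. z \<in> el a \<and> z \<notin> g} \<noteq> {}" using Va unfolding g_def by blast
    have "isset {z \<in> el a. z \<notin> el (mk g)}" by (intro isset_sep isset_el dfi)
    then obtain x where x: "el x = {z. z \<in> el a \<and> z \<notin> g}" using iss by (auto simp: isset_def)
    then obtain y where "y \<in> el x \<and> pr x y \<in> el s" using s[of x] ne by blast
    then have "Step (mk g) th y" unfolding Step_def using x iss by auto
    then show False using R.Val_intro[of th y] th ex unfolding g_def by blast
  qed
  define f where "f = (\<lambda>b. if b \<in> el th then THE y. R.Val b y else b)"
  have f: "R.Val b (f b)" if "b \<in> el th" for b
  proof -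
    obtain y where y: "R.Val b y" using ex \<open>b \<in> el th\<close> by blast
    then have "(THE y. R.Val b y) = y" by (rule the_equality) (rule R.Val_unique[OF _ y])
    then show ?thesis using y that by (simp add: f_def)
  qed
  have "y = f b \<longleftrightarrow> (if b \<in> el th then R.Val b y else y = b)" for y b
    using f R.Val_unique by (auto simp: f_def)
  moreover have "dfn E (\<lambda>e. if e (Suc 0) \<in> el th then R.Val (e (Suc 0)) (e 0) else e 0 = e (Suc 0))" by (intro dfi R.dfn_Val)
  ultimately have "dt E (\<lambda>e. f (e 0))" by (simp add: dt_def)
  moreover have "inj_on f (el th)" by (rule inj_onI) (metis f Vinj)
  moreover have "f ` el th = el a" unfolding ga[symmetric] g_def using f R.Val_unique by blast
  ultimately show ?thesis using that th by blast
qed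

end

section \<open>Recursion under the Continuum Hypothesis\<close>

locale chm = zfm E for E :: "'a \<Rightarrow> 'a \<Rightarrow> bool" +
  assumes ch: "CH E"
begin

text \<open>In a well-order of the power set of \<omega> let \<open>ka\<close> be the least ordinal
  with uncountable image. Initial segments are countable by minimality, CH maps the image
  bijectively onto the power set, and there is no last element because one more point leaves a set
  countable.\<close>

lemma CH_enum: obtains ka r where "Ord ka" "stm (\<lambda>e. r (e 0))" "r ` el ka = AA"
  "\<forall>a\<in>el ka. el a \<noteq> {} \<longrightarrow> (\<exists>j. efun j \<and> range j = el a)"
  "\<forall>a\<in>el ka. \<exists>b\<in>el ka. a \<in> el b" "inj_on r (el ka)"
proof -
  obtain pw where pw: "el pw = {y. el y \<subseteq> el Om}" using isset_Pow[OF isset_el[of Om]] by (auto simp: isset_def)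
  have unc: "\<not> is_countable E pw"
  proof
    assume "is_countable E pw"
    moreover have "Om \<in> el pw" by (simp only: pw mem_Collect_eq subset_refl)
    ultimately obtain j where j: "efun j" "range j = el pw" using countableD by blast
    have D: "{n. n \<notin> sof (j n)} \<in> AA" by (rule AA_I) (intro dfi dt_efun[OF j(1)])
    then have "re {n. n \<notin> sof (j n)} \<in> el pw" by (auto simp: pw re_AA)
    then obtain n where "j n = re {n. n \<notin> sof (j n)}" using j(2) by (metis imageE)
    then show False using sof_re[OF D] by (metis (mono_tags, lifting) mem_Collect_eq)
  qed
  obtain th f where f: "Ord th" "dt E (\<lambda>e. f (e 0))" "inj_on f (el th)" "f ` el th = el pw" by (rule zermelo)
  define fi where "fi = (\<lambda>b. mk (f ` el b))"
  have fi: "el (fi b) = f ` el b" for b unfolding fi_def by (intro el_mk isset_image f isset_el)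
  have Qth: "(th = th \<or> th \<in> el th) \<and> \<not> is_countable E (fi th)" using unc fi f(4) by (metis ext)
  obtain ka where ka: "(ka = th \<or> ka \<in> el th) \<and> \<not> is_countable E (fi ka)"
    "\<And>y. y \<in> el ka \<Longrightarrow> \<not> ((y = th \<or> y \<in> el th) \<and> \<not> is_countable E (fi y))"
    by (rule minimal[of "\<lambda>b. (b = th \<or> b \<in> el th) \<and> \<not> is_countable E (fi b)", OF Qth]) blast
  have ord: "Ord ka" using ka f(1) Ord_el by blast
  have sub: "el ka \<subseteq> el th" using ka f(1) Ord_trans by blast
  have cnt: "is_countable E (fi b)" if "b \<in> el ka" for b using ka(2)[OF that] sub that by blast
  have "el (fi ka) \<subseteq> el pw" unfolding fi f(4)[symmetric] using sub by (rule image_mono)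
  then obtain h where "is_bijection E h (fi ka) pw"
    using ch ka(1) pw unfolding CH_def is_omega_iff is_Pow_def by blast
  then have h': "is_injection E h (fi ka) pw" "Range (graph E h) = el pw" by (auto simp: is_bijection_def)
  obtain b where b: "inj_on b (el (fi ka))" "el h = {pr x (b x) | x. x \<in> el (fi ka)}"
    using h'(1) by (rule is_injectionE)
  have "Range (graph E h) = b ` el (fi ka)" by (auto simp: graph_iff b(2) Range_iff)
  then have rng: "b ` el (fi ka) = el pw" using h'(2) by simp
  define r where "r = (\<lambda>x. {n. \<exists>y. pr (f x) y \<in> el h \<and> n \<in> sof y})"
  have rb: "r x = sof (b (f x))" if "x \<in> el ka" for x
    using that by (auto simp: r_def b(2) fi)
  have r_stm: "stm (\<lambda>e. r (e 0))" unfolding r_def by (intro dfi dt_sub[OF f(2)])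
  have sofinj: "inj_on sof (el pw)" by (rule inj_onI) (metis pw mem_Collect_eq re_sof)
  have sofpw: "sof ` el pw = AA"
  proof (intro equalityI subsetI)
    fix A assume A: "A \<in> AA"
    then have "re A \<in> el pw" by (auto simp: pw re_AA)
    then show "A \<in> sof ` el pw" using sof_re[OF A] by (metis imageI)
  qed auto
  have "r ` el ka = sof ` b ` f ` el ka" using rb by (auto simp: image_image)
  then have rAA: "r ` el ka = AA" using rng fi sofpw by simp
  have "inj_on r (el ka)"
  proof (rule inj_onI)
    fix x y assume xy: "x \<in> el ka" "y \<in> el ka" "r x = r y"
    then have "b (f x) = b (f y)" using rb sofinj rng fi by (metis inj_on_def imageI)
    then have "f x = f y" using b(1) fi xy by (auto simp: inj_on_def)
    then show "x = y" using f(3) xy sub by (auto simp: inj_on_def)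
  qed
  moreover have enum: "\<exists>j. efun j \<and> range j = el a" if a: "a \<in> el ka" "el a \<noteq> {}" for a
  proof -
    have "el (fi a) \<noteq> {}" using fi a by simp
    then obtain j where j: "efun j" "range j = el (fi a)" using countableD[OF cnt[OF a(1)]] by blast
    have asub: "el a \<subseteq> el th" using sub a(1) ord Ord_trans by blast
    define j' where "j' = (\<lambda>n. THE x. x \<in> el a \<and> f x = j n)"
    have j': "j' n \<in> el a \<and> f (j' n) = j n" for n
    proof -
      obtain x where x: "x \<in> el a \<and> f x = j n" using j(2) fi by (metis imageE rangeI)
      moreover from this have "j' n = x" unfolding j'_def using inj_on_subset[OF f(3) asub]
        by (intro the_equality) (auto simp: inj_on_def)
      ultimately show ?thesis by simp
    qed
    then have "x = j' n \<longleftrightarrow> x \<in> el a \<and> f x = j n" for x n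
      using f(3) asub by (metis inj_on_def subsetD)
    moreover have "dfn E (\<lambda>e. e 0 \<in> el a \<and> f (e 0) = j (nof (e (Suc 0))))"
      by (intro dfi f(2) dt_efun[OF j(1)])
    ultimately have "efun j'" by (simp add: efun_def dt_def)
    moreover have "range j' = el a"
    proof (intro equalityI subsetI)
      fix x assume x: "x \<in> el a"
      then obtain n where "f x = j n" using j(2) fi by (metis imageE imageI)
      then have "x = j' n" using j'[of n] x inj_on_subset[OF f(3) asub] by (auto simp: inj_on_def)
      then show "x \<in> range j'" by blast
    qed (use j' in auto)
    ultimately show ?thesis by blast
  qed
  moreover have "\<exists>b\<in>el ka. a \<in> el b" if a: "a \<in> el ka" for a
  proof (rule ccontr)
    assume *: "\<not> ?thesis"
    have ka_eq: "el ka = insert a (el a)"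
      using * Ord_linear[OF Ord_el[OF ord a] Ord_el[OF ord]] Ord_trans[OF ord a] a by blast
    have "\<exists>j. efun j \<and> el a \<subseteq> range j"
    proof (cases "el a = {}")
      case True then show ?thesis by (intro exI[of _ "\<lambda>_. a"]) (auto simp: efun_def intro: dfi)
    qed (use enum[OF a] in auto)
    then obtain j where j: "efun j" "el a \<subseteq> range j" by blast
    define j' where "j' = (\<lambda>n. case n of 0 \<Rightarrow> f a | Suc k \<Rightarrow> f (j k))"
    have "x = j' n \<longleftrightarrow> (n = 0 \<and> x = f a) \<or> (\<exists>k. n = Suc k \<and> x = f (j k))" for x n
      by (auto simp: j'_def split: nat.split)
    moreover have "dfn E (\<lambda>e. (nof (e (Suc 0)) = 0 \<and> e 0 = f a) \<or> (\<exists>k. nof (e (Suc 0)) = Suc k \<and> e 0 = f (j k)))"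
      by (intro dfi dt_sub[OF f(2)] dt_efun[OF j(1)])
    ultimately have "efun j'" by (simp add: efun_def dt_def)
    moreover have "el (fi ka) \<subseteq> range j'"
    proof
      fix x assume "x \<in> el (fi ka)"
      then consider "x = f a" | y where "y \<in> el a" "x = f y" using fi ka_eq by auto
      then show "x \<in> range j'"
      proof cases
        case 1 then have "x = j' 0" by (simp add: j'_def) then show ?thesis by blast
      next
        case 2
        then obtain k where "y = j k" using j(2) by blast
        then have "x = j' (Suc k)" using 2 by (simp add: j'_def)
        then show ?thesis by blast
      qed
    qed
    ultimately show False using countableI ka(1) by blast
  qed
  ultimately show ?thesis using that[OF ord r_stm rAA] by blast
qed

text \<open>Recursion of length the first uncountable ordinal: \<open>Req e r c\<close> says that \<open>c\<close> is an admissible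
  value at the stage with real \<open>r\<close>, when the previous values are the columns \<open>col (Suc j) e\<close> with
  \<open>j \<in> col 0 e\<close>.\<close>

definition cols :: "nat set \<Rightarrow> nat set set" where "cols e = {col (Suc j) e | j. j \<in> col 0 e}"

lemma CH_rec:
  assumes Req: "dfn E (\<lambda>e. Req (sof (e 0)) (sof (e 1)) (sof (e 2)))"
    and ex: "\<And>e r. e \<in> AA \<Longrightarrow> r \<in> AA \<Longrightarrow> (\<And>x. x \<in> cols e \<Longrightarrow> valid x) \<Longrightarrow>
      (\<And>x y. x \<in> cols e \<Longrightarrow> y \<in> cols e \<Longrightarrow> x = y \<or> lt x y \<or> lt y x) \<Longrightarrow> \<exists>c\<in>AA. Req e r c"
    and lt: "\<And>e r c x. Req e r c \<Longrightarrow> x \<in> cols e \<Longrightarrow> lt x c"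
    and valid: "\<And>e r c. Req e r c \<Longrightarrow> valid c"
  obtains ka c r where "stm (\<lambda>e. c (e 0))" "Ord ka" "r ` el ka = AA"
    "\<forall>a\<in>el ka. \<exists>e\<in>AA. cols e = c ` el a \<and> Req e (r a) (c a)"
    "\<forall>a\<in>el ka. \<forall>b\<in>el a. lt (c b) (c a)" "\<forall>a\<in>el ka. \<exists>b\<in>el ka. a \<in> el b"
proof -
  obtain ka r where r: "Ord ka" "stm (\<lambda>e. r (e 0))" "r ` el ka = AA"
  "\<forall>a\<in>el ka. el a \<noteq> {} \<longrightarrow> (\<exists>j. efun j \<and> range j = el a)"
  "\<forall>a\<in>el ka. \<exists>b\<in>el ka. a \<in> el b" "inj_on r (el ka)" by (rule CH_enum)
  \<comment> \<open>\<open>x\<close> is the index of an admissible value at stage \<open>a\<close>.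
    The earlier values are given as a set \<open>g\<close>, and \<open>e\<close> is any listing of
    this set by a real; there is one because the stage has countably many predecessors.\<close>
  define T where "T = (\<lambda>g a x. \<exists>e\<in>AA. (\<forall>z. z \<in> el g \<longleftrightarrow> (\<exists>j\<in>col 0 e. z = re (col (Suc j) e))) \<and> Req e (r a) (r x))"
  have Req': "dfn E (\<lambda>e. Req (sof (s e)) (r (t e)) (r (u e)))" if "dt E s" "dt E t" "dt E u" for s t u
  proof -
    have "dfn E (\<lambda>e. Req (sof (s e)) (sof (re (r (t e)))) (sof (re (r (u e)))))"
      by (rule dfn_sub3[OF Req]) (intro that dfi dt_sub[of E "\<lambda>x. re (r x)"] r(2))+
    moreover have "r x \<in> AA" for x using stm_AA[OF r(2), of "\<lambda>_. x"] .
    ultimately show ?thesis by simp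
  qed
  have T: "dfn E (\<lambda>e. T (e i) (e j) (e k))" for i j k unfolding T_def by (intro dfi Req')
  \<comment> \<open>The enumeration \<open>r\<close> serves twice: it lists the tasks, and taking
    the least index makes the choice among admissible values definable.\<close>
  define Step where "Step = (\<lambda>g a y. \<exists>x\<in>el ka. y = re (r x) \<and> T g a x \<and> (\<forall>z\<in>el x. \<not> T g a z))"
  have minT: "\<exists>y. Step g a y" if x: "x \<in> el ka" "T g a x" for g a x
  proof -
    obtain z where z: "z \<in> el ka \<and> T g a z" "\<And>y. y \<in> el z \<Longrightarrow> \<not> (y \<in> el ka \<and> T g a y)"
      by (rule minimal[of "\<lambda>x. x \<in> el ka \<and> T g a x" x, OF conjI[OF x]]) (rule that; simp)
    then have "\<forall>y\<in>el z. \<not> T g a y" using Ord_trans[OF r(1)] by blast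
    then show ?thesis unfolding Step_def using z by blast
  qed
  interpret R: recur E "\<lambda>b. b \<in> el ka" Step
  proof
    show "dfn E (\<lambda>e. Step (e 0) (e 1) (e 2))" unfolding Step_def
      by (intro dfi dt_sub[of E "\<lambda>x. re (r x)"] r(2) T)
    show "y = y'" if "Step g b y" "Step g b y'" for g b y y'
    proof -
      obtain x where x: "x \<in> el ka" "y = re (r x)" "T g b x" "\<forall>z\<in>el x. \<not> T g b z"
        using \<open>Step g b y\<close> unfolding Step_def by blast
      obtain x' where x': "x' \<in> el ka" "y' = re (r x')" "T g b x'" "\<forall>z\<in>el x'. \<not> T g b z"
        using \<open>Step g b y'\<close> unfolding Step_def by blast
      have "x = x'" using Ord_linear[OF Ord_el[OF r(1) x(1)] Ord_el[OF r(1) x'(1)]] x x' by blast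
      then show ?thesis using x x' by simp
    qed
    show "dfn E (\<lambda>e. e 0 \<in> el ka)" by (intro dfi)
  qed (use r(1) Ord_el Ord_trans in blast)+
  have rx: "r x \<in> AA" for x using stm_AA[OF r(2), of "\<lambda>_. x"] .
  define V where "V = (\<lambda>a. {z. \<exists>b\<in>el a. R.Val b z})"
  have Val_re: "y = re (sof y) \<and> (\<exists>e\<in>AA. cols e = sof ` V a \<and> Req e (r a) (sof y))"
    if v: "R.Val a y" for a y
  proof -
    obtain g where g: "el g = V a" "Step g a y" using R.Val_step(3)[OF v] unfolding V_def by (elim exE conjE)
    then obtain x where x: "x \<in> el ka" "y = re (r x)" "T g a x" unfolding Step_def by blast
    then obtain e where e: "e \<in> AA" "\<forall>z. z \<in> el g \<longleftrightarrow> (\<exists>j\<in>col 0 e. z = re (col (Suc j) e))" "Req e (r a) (r x)"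
      unfolding T_def by blast
    have colAA: "col (Suc j) e \<in> AA" for j by (rule AA_stm) (intro dfi e)
    have ce: "cols e = sof ` el g"
    proof (intro equalityI subsetI)
      fix z assume "z \<in> cols e"
      then obtain j where "j \<in> col 0 e" "z = col (Suc j) e" unfolding cols_def by blast
      then show "z \<in> sof ` el g" using e(2) sof_re[OF colAA] by (metis imageI)
    next
      fix z assume "z \<in> sof ` el g"
      then obtain w where w: "w \<in> el g" "z = sof w" by blast
      obtain j where "j \<in> col 0 e" "w = re (col (Suc j) e)" using e(2)[rule_format, THEN iffD1, OF w(1)] by blast
      then have "z = col (Suc j) e" using w sof_re[OF colAA] by simp
      then show "z \<in> cols e" using \<open>j \<in> col 0 e\<close> unfolding cols_def by blast
    qed
    have sy: "sof y = r x" using x rx by simp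
    then have "y = re (sof y)" using x by simp
    moreover have "cols e = sof ` V a" using ce unfolding g(1) .
    moreover have "Req e (r a) (sof y)" using e(3) sy by simp
    ultimately show ?thesis using e(1) by blast
  qed
  define c where "c = (\<lambda>a. {n. \<exists>y. R.Val a y \<and> n \<in> sof y})"
  have cV: "c a = sof y" if "R.Val a y" for a y using that R.Val_unique unfolding c_def by blast
  have c_stm: "stm (\<lambda>e. c (e 0))" unfolding c_def by (intro dfi R.dfn_Val)
  have main: "(\<exists>y. R.Val a y)" if "a \<in> el ka" for a using that
  proof (induction a rule: wf_induct)
    case (less a)
    have below: "b \<in> el ka" if "b \<in> el a" for b using Ord_trans[OF r(1) less.prems that] .
    have exV: "\<forall>b\<in>el a. \<exists>y. R.Val b y" using less.IH below by blast
    define g where "g = V a"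
    have iss: "isset g" unfolding g_def V_def by (rule R.Val_set[OF exV])
    have lt': "lt (c b) (c a')" if b: "b \<in> el a'" and a': "a' \<in> el a" for b a'
    proof -
      obtain y where y: "R.Val a' y" using exV a' by blast
      obtain z where z: "R.Val b z" using exV Ord_trans[OF Ord_el[OF r(1) less.prems] a' b] by blast
      obtain e where "cols e = sof ` V a'" "Req e (r a') (sof y)" using Val_re[OF y] by blast
      moreover from this(1) have "sof z \<in> cols e" using z \<open>b \<in> el a'\<close> unfolding V_def by blast
      ultimately show ?thesis unfolding cV[OF y] cV[OF z] by (intro lt)
    qed
    have valid': "valid (c b)" if b: "b \<in> el a" for b
    proof -
      obtain y where y: "R.Val b y" using exV b by blast
      obtain e where "Req e (r b) (sof y)" using Val_re[OF y] by blast
      then show ?thesis unfolding cV[OF y] by (rule valid)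
    qed
    have "\<exists>e\<in>AA. (\<forall>z. z \<in> g \<longleftrightarrow> (\<exists>j\<in>col 0 e. z = re (col (Suc j) e))) \<and> cols e = c ` el a"
    proof (cases "el a = {}")
      case True
      have "{} \<in> AA" by (rule AA_stm) (intro dfi)
      then show ?thesis using True by (intro bexI[of _ "{}"]) (auto simp: g_def V_def cols_def)
    next
      case False
      then obtain j where j: "efun j" "range j = el a" using r(4) less.prems by blast
      define e where "e = {p. fst (prod_decode p) = 0 \<or>
          (\<exists>k. fst (prod_decode p) = Suc k \<and> snd (prod_decode p) \<in> c (j k))}"
      have cj: "stm (\<lambda>e. c (j (t e)))" if "ntm t" for t
      proof -
        have "stm (\<lambda>e. sof (re (c (j (t e)))))"
          by (intro dfi dt_sub[of E "\<lambda>x. re (c x)" "\<lambda>e. j (t e)"] c_stm dt_efun[OF j(1)] that)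
        moreover have "c x \<in> AA" for x using stm_AA[OF c_stm, of "\<lambda>_. x"] .
        ultimately show ?thesis by simp
      qed
      have eAA: "e \<in> AA" unfolding e_def by (rule AA_I) (intro dfi cj)
      have e0: "col 0 e = UNIV" and eS: "col (Suc k) e = c (j k)" for k by (auto simp: e_def)
      have "cols e = range (\<lambda>k. c (j k))" unfolding cols_def e0 eS by blast
      then have "cols e = c ` el a" unfolding j(2)[symmetric] by (simp add: image_image)
      moreover have "z \<in> g \<longleftrightarrow> (\<exists>k\<in>col 0 e. z = re (col (Suc k) e))" for z
      proof
        assume "z \<in> g"
        then obtain b where b: "b \<in> el a" "R.Val b z" unfolding g_def V_def by blast
        then obtain k where "b = j k" using j(2) by (metis imageE)
        moreover have "z = re (c b)" unfolding cV[OF b(2)] using Val_re[OF b(2)] by blast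
        ultimately show "\<exists>k\<in>col 0 e. z = re (col (Suc k) e)" unfolding eS e0 by blast
      next
        assume "\<exists>k\<in>col 0 e. z = re (col (Suc k) e)"
        then obtain k where k: "z = re (c (j k))" using eS by auto
        have "j k \<in> el a" using j(2) by blast
        then obtain y where y: "R.Val (j k) y" using exV by blast
        have "y = re (c (j k))" unfolding cV[OF y] using Val_re[OF y] by blast
        then show "z \<in> g" unfolding g_def V_def using \<open>j k \<in> el a\<close> y k by blast
      qed
      ultimately show ?thesis using eAA by blast
    qed
    then obtain e where e: "e \<in> AA" "\<forall>z. z \<in> g \<longleftrightarrow> (\<exists>j\<in>col 0 e. z = re (col (Suc j) e))" "cols e = c ` el a" by blast
    have "\<exists>C\<in>AA. Req e (r a) C"
    proof (rule ex[OF e(1) rx])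
      show "valid x" if "x \<in> cols e" for x using that valid' unfolding e(3) by blast
      show "x = y \<or> lt x y \<or> lt y x" if xy: "x \<in> cols e" "y \<in> cols e" for x y
      proof -
        obtain b where b: "b \<in> el a" "x = c b" using xy(1) unfolding e(3) by blast
        obtain d where d: "d \<in> el a" "y = c d" using xy(2) unfolding e(3) by blast
        note bd = b(1) d(1) b(2) d(2)
        have "Ord b" "Ord d" using bd below Ord_el[OF r(1)] by blast+
        then show ?thesis using Ord_linear lt' bd by metis
      qed
    qed
    then obtain C where C: "C \<in> AA" "Req e (r a) C" by blast
    then obtain x where x: "x \<in> el ka" "r x = C" using r(3) by (metis imageE)
    have "T (mk g) a x" unfolding T_def using e C x iss by auto
    then obtain y where "Step (mk g) a y" using minT x by blast
    then show ?case using R.Val_intro[OF less.prems exV] unfolding g_def V_def by blast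
  qed
  have Vc: "R.Val a (re (c a))" if a: "a \<in> el ka" for a
  proof -
    obtain y where y: "R.Val a y" using main[OF a] by blast
    then have "y = re (c a)" unfolding cV[OF y] using Val_re[OF y] by blast
    then show ?thesis using y by simp
  qed
  have img: "sof ` V a = c ` el a" if "a \<in> el ka" for a
  proof -
    have "\<exists>y. R.Val b y" if "b \<in> el a" for b using main Ord_trans[OF r(1) \<open>a \<in> el ka\<close> that] by blast
    then show ?thesis unfolding image_def V_def using cV by blast
  qed
  have cAA: "c x \<in> AA" for x using stm_AA[OF c_stm, of "\<lambda>_. x"] .
  have A: "\<exists>e\<in>AA. cols e = c ` el a \<and> Req e (r a) (c a)" if "a \<in> el ka" for a
    using Val_re[OF Vc[OF that]] unfolding img[OF that] sof_re[OF cAA] by blast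
  show ?thesis
  proof (rule that[OF c_stm r(1) r(3) _ _ r(5)])
    show "\<forall>a\<in>el ka. \<exists>e\<in>AA. cols e = c ` el a \<and> Req e (r a) (c a)" using A by blast
    show "\<forall>a\<in>el ka. \<forall>b\<in>el a. lt (c b) (c a)"
    proof (intro ballI)
      fix a b assume ab: "a \<in> el ka" "b \<in> el a"
      obtain e where e: "cols e = c ` el a" "Req e (r a) (c a)" using A[OF ab(1)] by blast
      show "lt (c b) (c a)" by (rule lt[OF e(2)]) (use ab e(1) in blast)
    qed
  qed
qed

end

section \<open>Choosing from sets inside a model\<close>

text \<open>The axiom of choice enters in the form that every set \<open>x\<close> has a chain \<open>C\<close> of subsets such that
  each nonempty \<open>A \<subseteq> x\<close> has a unique element picked out by some member of \<open>C\<close>; think of the initial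
  segments of a well-order.\<close>

locale zmc = zm E for E :: "'a \<Rightarrow> 'a \<Rightarrow> bool" +
  assumes chain: "\<exists>C. (\<forall>i\<in>elts E C. \<forall>i'\<in>elts E C. elts E i \<subseteq> elts E i' \<or> elts E i' \<subseteq> elts E i) \<and>
    (\<forall>A. A \<noteq> {} \<and> A \<subseteq> elts E x \<longrightarrow> (\<exists>i\<in>elts E C. \<exists>a. elts E i \<inter> A = {a}))"
begin

text \<open>The value at \<open>n\<close> is the witness that some member of the chain isolates
  among all witnesses. Two comparable members can isolate only the same one, so the choice is
  definable from the chain. The empty set is the default.\<close>

lemma uniformize:
  assumes Q: "dfn E (\<lambda>e. Q (e 0) (e 1))"
  obtains t where "dt E (\<lambda>e. t (e 0))" "\<And>n. \<exists>y\<in>el x. Q n y \<Longrightarrow> t n \<in> el x \<and> Q n (t n)"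
    "\<And>n. \<not> (\<exists>y\<in>el x. Q n y) \<Longrightarrow> t n = mk {}"
proof -
  obtain C where C1: "\<forall>i\<in>el C. \<forall>i'\<in>el C. el i \<subseteq> el i' \<or> el i' \<subseteq> el i"
    and C2: "\<forall>A. A \<noteq> {} \<and> A \<subseteq> el x \<longrightarrow> (\<exists>i\<in>el C. \<exists>a. el i \<inter> A = {a})"
    using chain[of x] by (elim exE conjE)
  define T where "T = (\<lambda>n a. a \<in> el x \<and> Q n a \<and> (\<exists>i\<in>el C. a \<in> el i \<and> (\<forall>b\<in>el i. b \<in> el x \<and> Q n b \<longrightarrow> b = a)))"
  define t where "t = (\<lambda>n. if \<exists>a. T n a then THE a. T n a else mk {})"
  have uniq: "a = b" if "T n a" "T n b" for n a b
  proof -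
    from \<open>T n a\<close> obtain i where i: "i \<in> el C" "a \<in> el i" "\<forall>b\<in>el i. b \<in> el x \<and> Q n b \<longrightarrow> b = a" "a \<in> el x" "Q n a"
      unfolding T_def by blast
    from \<open>T n b\<close> obtain j where j: "j \<in> el C" "b \<in> el j" "\<forall>a\<in>el j. a \<in> el x \<and> Q n a \<longrightarrow> a = b" "b \<in> el x" "Q n b"
      unfolding T_def by blast
    show ?thesis using C1[rule_format, OF i(1) j(1)] i j by blast
  qed
  have tT: "t n = a" if T: "T n a" for n a
  proof -
    have "(THE a. T n a) = a" by (rule the_equality[of "T n", OF T uniq[OF _ T]])
    then show ?thesis using T unfolding t_def by auto
  qed
  have "y = t n \<longleftrightarrow> T n y \<or> ((\<forall>a. \<not> T n a) \<and> y = mk {})" for y n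
  proof (cases "\<exists>a. T n a")
    case True
    then obtain a where "T n a" by blast
    then show ?thesis using tT uniq by blast
  qed (auto simp: t_def)
  moreover have "dfn E (\<lambda>e. T (e (Suc 0)) (e 0) \<or> ((\<forall>a. \<not> T (e (Suc 0)) a) \<and> e 0 = mk {}))"
  proof -
    have Q': "dfn E (\<lambda>e. Q (e i) (e j))" for i j
      by (rule dfn_sub2[OF Q]) (intro dfi)+
    show ?thesis unfolding T_def by (intro dfi Q')
  qed
  ultimately have 1: "dt E (\<lambda>e. t (e 0))" by (simp add: dt_def)
  have 2: "t n \<in> el x \<and> Q n (t n)" if ex: "\<exists>y\<in>el x. Q n y" for n
  proof -
    define A where "A = {y. y \<in> el x \<and> Q n y}"
    have "A \<noteq> {} \<and> A \<subseteq> el x" using ex unfolding A_def by blast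
    with C2 have "\<exists>i\<in>el C. \<exists>a. el i \<inter> A = {a}" by (elim allE[of _ A]) (erule mp)
    then obtain i a where ia: "i \<in> el C" "el i \<inter> A = {a}" by (elim bexE exE)
    have "a \<in> el i" "a \<in> A" "\<And>b. b \<in> el i \<Longrightarrow> b \<in> A \<Longrightarrow> b = a" using ia(2) by auto
    then have T: "T n a" unfolding T_def A_def using ia(1) by blast
    show ?thesis unfolding tT[OF T] using T unfolding T_def by (elim conjE) (intro conjI)
  qed
  have 3: "t n = mk {}" if "\<not> (\<exists>y\<in>el x. Q n y)" for n
  proof -
    have "\<not> (\<exists>a. T n a)" using that unfolding T_def by blast
    then show ?thesis unfolding t_def by (rule if_not_P)
  qed
  show ?thesis by (rule that[OF 1 2 3])
qed

end

context zm
begin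

text \<open>The finite certificates of \<open>rec_graph\<close>, now with arbitrary elements of the
  model as values.\<close>

lemma efun_rec:
  assumes F: "dt E (\<lambda>e. F (nof (e 0)) (e 1))" and f: "f 0 = a" "\<And>n. f (Suc n) = F n (f n)"
  shows "efun f"
proof -
  let ?W = "\<lambda>Z. \<forall>k y. pr (num k) y \<in> el Z \<longrightarrow>
    (k = 0 \<and> y = a) \<or> (\<exists>k' y'. k = Suc k' \<and> pr (num k') y' \<in> el Z \<and> y = F k' y')"
  have eq: "x = f n \<longleftrightarrow> (\<exists>Z. pr (num n) x \<in> el Z \<and> ?W Z)" for x n
  proof
    assume x: "x = f n"
    define Z where "Z = (\<lambda>k. pr (num k) (f k)) ` {..n}"
    have "isset Z" by (intro isset_finite) (simp add: Z_def)
    moreover have "(k = 0 \<and> y = a) \<or> (\<exists>k' y'. k = Suc k' \<and> pr (num k') y' \<in> Z \<and> y = F k' y')"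
      if kz: "pr (num k) y \<in> Z" for k y
    proof (cases k)
      case 0 then show ?thesis using kz f by (auto simp: Z_def simp del: num.simps)
    next
      case (Suc k')
      then have "pr (num k') (f k') \<in> Z" "y = F k' (f k')"
        using kz f(2) by (auto simp: Z_def simp del: num.simps)
      then show ?thesis using Suc by blast
    qed
    ultimately have "pr (num n) x \<in> el (mk Z) \<and> ?W (mk Z)" using x by (auto simp: Z_def simp del: num.simps)
    then show "\<exists>Z. pr (num n) x \<in> el Z \<and> ?W Z" by (rule exI[of _ "mk Z"])
  next
    assume "\<exists>Z. pr (num n) x \<in> el Z \<and> ?W Z"
    then obtain Z where Z: "pr (num n) x \<in> el Z" "?W Z" by blast
    have "pr (num k) y \<in> el Z \<Longrightarrow> y = f k" for k y
    proof (induction k arbitrary: y)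
      case 0 then show ?case using Z(2) f(1) by blast
    next
      case (Suc k)
      then obtain y' where "pr (num k) y' \<in> el Z" "y = F k y'" using Z(2) by blast
      then show ?case using Suc.IH f(2) by simp
    qed
    then show "x = f n" using Z by blast
  qed
  have F': "dt E (\<lambda>e. F (nof (e i)) (e j))" for i j
    using dt_rename[OF F, of "case_nat i (\<lambda>_. j)"] by simp
  have "dfn E (\<lambda>e. \<exists>Z. pr (num (nof (e (Suc 0)))) (e 0) \<in> el Z \<and> ?W Z)"
    by (intro dfi F')
  then show ?thesis unfolding efun_def dt_def eq by simp
qed

text \<open>The first component of a pair lies two membership steps below the pair, so the induction
  is carried out for \<open>x\<close>, its members and their members at once.\<close>

lemma pr_induct: "(\<And>x. (\<And>y p. pr y p \<in> el x \<Longrightarrow> Q y) \<Longrightarrow> Q x) \<Longrightarrow> Q x"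
proof -
  assume *: "\<And>x. (\<And>y p. pr y p \<in> el x \<Longrightarrow> Q y) \<Longrightarrow> Q x"
  have "Q x \<and> (\<forall>y\<in>el x. Q y) \<and> (\<forall>y\<in>el x. \<forall>z\<in>el y. Q z)"
  proof (induction x rule: wf_induct)
    case (less x)
    have "Q y" if "pr y p \<in> el x" for y p
    proof -
      have "mk {y} \<in> el (pr y p)" "y \<in> el (mk {y})" by (simp_all add: el_pr isset_rules)
      then show ?thesis using less[OF that] by blast
    qed
    then show ?case using * less by blast
  qed
  then show ?thesis by blast
qed

end

text \<open>The chain consists of the closed initial segments of a well-order of \<open>x\<close>;
  the segment up to the least element of \<open>A\<close> meets \<open>A\<close> in that element
  alone.\<close>

sublocale zfm \<subseteq> zmc
proof
  fix x
  obtain th f where f: "Ord th" "dt E (\<lambda>e. f (e 0))" "inj_on f (el th)" "f ` el th = el x" by (rule zermelo)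
  define I where "I = (\<lambda>b. mk (f ` insert b (el b)))"
  have I: "el (I b) = insert (f b) (f ` el b)" for b
    unfolding I_def by (subst el_mk) (auto intro!: isset_image f isset_insert)
  have "dfn E (\<lambda>e. el (e 0) = {z. z = f (e (Suc 0)) \<or> (\<exists>c\<in>el (e (Suc 0)). z = f c)})"
    by (intro dfi dt_sub[OF f(2)])
  moreover have "el y = {z. z = f b \<or> (\<exists>c\<in>el b. z = f c)} \<longleftrightarrow> y = I b" for y b
  proof -
    have "el (I b) = {z. z = f b \<or> (\<exists>c\<in>el b. z = f c)}" unfolding I by blast
    then show ?thesis using ext by metis
  qed
  ultimately have "dt E (\<lambda>e. I (e 0))" unfolding dt_def by simp
  then have "isset (I ` el th)" by (rule isset_image) simp
  then obtain C where C: "el C = I ` el th" unfolding isset_def by blast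
  have mono: "el (I b) \<subseteq> el (I c)" if "c \<in> el th" "b = c \<or> b \<in> el c" for b c
  proof -
    have "el b \<subseteq> insert c (el c)" using that Ord_trans[OF Ord_el[OF f(1) that(1)]] by blast
    then show ?thesis unfolding I using that by blast
  qed
  show "\<exists>C. (\<forall>i\<in>el C. \<forall>i'\<in>el C. el i \<subseteq> el i' \<or> el i' \<subseteq> el i) \<and>
    (\<forall>A. A \<noteq> {} \<and> A \<subseteq> el x \<longrightarrow> (\<exists>i\<in>el C. \<exists>a. el i \<inter> A = {a}))"
  proof (intro exI[of _ C] conjI ballI allI impI)
    fix i i' assume "i \<in> el C" "i' \<in> el C"
    then obtain b c where bc: "b \<in> el th" "c \<in> el th" "i = I b" "i' = I c" unfolding C by blast
    then consider "b \<in> el c" | "b = c" | "c \<in> el b"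
      using Ord_linear[OF Ord_el[OF f(1) bc(1)] Ord_el[OF f(1) bc(2)]] by blast
    then show "el i \<subseteq> el i' \<or> el i' \<subseteq> el i"
      by cases (use mono[of c b] mono[of b c] bc in auto)
  next
    fix A assume A: "A \<noteq> {} \<and> A \<subseteq> el x"
    then obtain a0 where a0: "a0 \<in> A" "a0 \<in> f ` el th" unfolding f(4) by blast
    then obtain b0 where b0: "b0 \<in> el th \<and> f b0 \<in> A" by blast
    obtain b where b: "b \<in> el th \<and> f b \<in> A" "\<And>y. y \<in> el b \<Longrightarrow> \<not> (y \<in> el th \<and> f y \<in> A)"
      by (rule minimal[of "\<lambda>b. b \<in> el th \<and> f b \<in> A", OF b0]) (rule that; simp)
    have "y \<in> el th" if "y \<in> el b" for y using b(1) Ord_trans[OF f(1) _ that] by blast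
    then have "el (I b) \<inter> A = {f b}" unfolding I using b by blast
    then show "\<exists>i\<in>el C. \<exists>a. el i \<inter> A = {a}" unfolding C using b(1) by blast
  qed
qed


section \<open>Forcing\<close>

text \<open>\<open>leq\<close> is defined for all elements of \<open>M\<close>, and
  \<open>Pm\<close> is the set of conditions. \<open>one\<close> is a fixed member of
  \<open>G\<close> that labels the entries of canonical names.\<close>

locale forcing = zfm M for M :: "'m \<Rightarrow> 'm \<Rightarrow> bool" +
  fixes N :: "'n \<Rightarrow> 'n \<Rightarrow> bool" and Pm one :: 'm and leq :: "'m \<Rightarrow> 'm \<Rightarrow> bool" and G :: "'m set"
    and vl :: "'m \<Rightarrow> 'n"
  assumes leq_refl: "leq p p" and leq_trans: "leq p q \<Longrightarrow> leq q r \<Longrightarrow> leq p r"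
    and leq_dfn: "dfn M (\<lambda>e. leq (e 0) (e 1))"
    and one: "one \<in> G"
    and G_P: "G \<subseteq> elts M Pm" and G_up: "p \<in> G \<Longrightarrow> q \<in> elts M Pm \<Longrightarrow> leq p q \<Longrightarrow> q \<in> G"
    and G_dir: "p \<in> G \<Longrightarrow> q \<in> G \<Longrightarrow> \<exists>r\<in>G. leq r p \<and> leq r q"
    and G_gen: "dense_in M (elts M Pm) leq d \<Longrightarrow> G \<inter> elts M d \<noteq> {}"
    and N_ext: "elts N x = elts N y \<Longrightarrow> x = y"
    and vl_surj: "\<exists>t. name M (elts M Pm) t \<and> vl t = x"
    and vl_el: "name M (elts M Pm) t \<Longrightarrow>
      elts N (vl t) = {vl s | s p e. name M (elts M Pm) s \<and> p \<in> G \<and> is_pair M s p e \<and> e \<in> elts M t}"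
begin

abbreviation P :: "'m set" where "P \<equiv> el Pm"
abbreviation nm :: "'m \<Rightarrow> bool" where "nm \<equiv> name M P"

lemma nmI: "(\<And>e. e \<in> el t \<Longrightarrow> \<exists>s p. nm s \<and> p \<in> P \<and> e = pr s p) \<Longrightarrow> nm t"
  by (rule name.intros) (simp add: is_pair_iff)

lemma nmD: "nm t \<Longrightarrow> e \<in> el t \<Longrightarrow> \<exists>s p. nm s \<and> p \<in> P \<and> e = pr s p"
  by (erule name.cases) (simp add: is_pair_iff)

lemma nm_pr: assumes "nm t" "pr s p \<in> el t" shows "nm s" "p \<in> P"
  using nmD[OF assms] by auto

lemma vl_iff: assumes "nm t" shows "x \<in> elts N (vl t) \<longleftrightarrow> (\<exists>s p. p \<in> G \<and> pr s p \<in> el t \<and> x = vl s)"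
  unfolding vl_el[OF assms] using nm_pr[OF assms] by (auto simp: is_pair_iff)

lemma dfn_leq: "dt M s \<Longrightarrow> dt M t \<Longrightarrow> dfn M (\<lambda>e. leq (s e) (t e))"
  by (rule dfn_sub2[OF leq_dfn])

lemma trans_pr: "trans_el t \<Longrightarrow> x \<in> el t \<Longrightarrow> pr y p \<in> el x \<Longrightarrow> y \<in> el t"
proof -
  assume *: "trans_el t" "x \<in> el t" "pr y p \<in> el x"
  have "mk {y} \<in> el (pr y p)" "y \<in> el (mk {y})" by (simp_all add: el_pr isset_rules)
  then show ?thesis using * unfolding trans_el_def by blast
qed

text \<open>\<open>name\<close> is an inductive predicate of HOL. This is its first-order form:
  \<open>T\<close> is a set closed under passing to the first components of entries, and transitive
  closures supply it.\<close>

definition Nm :: "'m \<Rightarrow> bool" where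
  "Nm t \<longleftrightarrow> (\<exists>T. t \<in> el T \<and> (\<forall>u\<in>el T. \<forall>e\<in>el u. \<exists>s\<in>el T. \<exists>p\<in>el Pm. e = pr s p))"

lemma dfn_Nm: "dfn M (\<lambda>e. Nm (e i))"
  unfolding Nm_def by (intro dfi)

lemma Nm_pr: assumes "Nm t" "e \<in> el t" shows "\<exists>s p. Nm s \<and> p \<in> P \<and> e = pr s p"
  using assms unfolding Nm_def by blast

lemma Nm_iff: "Nm t \<longleftrightarrow> nm t"
proof
  show "Nm t \<Longrightarrow> nm t"
  proof (induction t rule: pr_induct)
    case (1 t)
    show ?case
    proof (rule nmI)
      fix e assume "e \<in> el t"
      then obtain s p where "Nm s" "p \<in> P" "e = pr s p" using Nm_pr[OF 1(2)] by blast
      then show "\<exists>s p. nm s \<and> p \<in> P \<and> e = pr s p" using 1(1) \<open>e \<in> el t\<close> by blast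
    qed
  qed
next
  assume "nm t"
  then show "Nm t"
  proof (induction rule: name.induct)
    case (1 t)
    obtain t0 where t0: "trans_el t0" "t \<in> el t0" using trcl by blast
    have "isset {x \<in> el t0. Nm x}" by (intro isset_sep isset_el dfn_Nm)
    then have "isset (insert t {x \<in> el t0. Nm x})" by (rule isset_insert)
    then obtain T where T: "el T = insert t {x \<in> el t0. Nm x}" by (auto simp: isset_def)
    have "\<exists>s\<in>el T. \<exists>p\<in>P. e = pr s p" if ue: "u \<in> el T" "e \<in> el u" for u e
    proof -
      have u0: "u \<in> el t0" using ue(1) t0(2) unfolding T by auto
      have "\<exists>s p. Nm s \<and> p \<in> P \<and> e = pr s p"
      proof (cases "u = t")
        case True
        then show ?thesis using 1[of e] ue(2) by (auto simp: is_pair_iff)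
      next
        case False
        then show ?thesis using ue T Nm_pr by blast
      qed
      then obtain s p where s: "Nm s" "p \<in> P" "e = pr s p" by blast
      moreover have "s \<in> el t0" using trans_pr[OF t0(1) u0] ue(2) s(3) by blast
      ultimately show ?thesis using T by blast
    qed
    then show "Nm t" unfolding Nm_def using T by blast
  qed
qed

lemma dfn_nm [dfi]: "dfn M (\<lambda>e. nm (e i))"
  using dfn_Nm unfolding Nm_iff .

text \<open>The conditions that lie in \<open>D\<close> or have no extension in \<open>D\<close>
  form a dense set of \<open>M\<close>. Genericity enters all later arguments through this
  dichotomy.\<close>

lemma gen: assumes D: "dfn M (\<lambda>e. D (e 0))"
  shows "(\<exists>p\<in>G. D p) \<or> (\<exists>p\<in>G. \<forall>q\<in>P. leq q p \<longrightarrow> \<not> D q)"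
proof -
  have D': "dfn M (\<lambda>e. D (e i))" for i using dfn_rename[OF D, of "\<lambda>_. i"] by simp
  have "isset {p \<in> P. D p \<or> (\<forall>q\<in>P. leq q p \<longrightarrow> \<not> D q)}" by (intro isset_sep isset_el dfi D' dfn_leq)
  then obtain d where d: "el d = {p \<in> P. D p \<or> (\<forall>q\<in>P. leq q p \<longrightarrow> \<not> D q)}" by (auto simp: isset_def)
  have "dense_in M P leq d" unfolding dense_in_def d using leq_refl leq_trans by blast
  then have "G \<inter> el d \<noteq> {}" by (rule G_gen)
  then show ?thesis unfolding d by blast
qed

lemma gen_below: assumes D: "dfn M (\<lambda>e. D (e 0))" and p: "p \<in> G"
    and dense: "\<And>q. q \<in> P \<Longrightarrow> leq q p \<Longrightarrow> \<exists>r\<in>P. leq r q \<and> D r"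
  shows "\<exists>r\<in>G. leq r p \<and> D r"
proof -
  have "dfn M (\<lambda>e. leq (e 0) p \<and> D (e 0))" by (intro dfi dfn_leq D)
  from gen[OF this] show ?thesis
  proof
    assume "\<exists>q\<in>G. \<forall>r\<in>P. leq r q \<longrightarrow> \<not> (leq r p \<and> D r)"
    then obtain q where q: "q \<in> G" "\<forall>r\<in>P. leq r q \<longrightarrow> \<not> (leq r p \<and> D r)" by blast
    obtain q' where q': "q' \<in> G" "leq q' q" "leq q' p" using G_dir[OF q(1) p] by blast
    then have "q' \<in> P" using G_P by blast
    then obtain r where "r \<in> P" "leq r q'" "D r" using dense[OF _ q'(3)] by blast
    then show ?thesis using q(2) q' leq_trans by blast
  qed blast
qed

subsection \<open>The forcing relation for atomic formulas\<close>

text \<open>With \<open>X\<close> as forced equality this is one half of it: \<open>p\<close> forces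
  the value of \<open>t\<close> to be included in that of \<open>s\<close>.\<close>

definition sim :: "('m \<Rightarrow> 'm \<Rightarrow> 'm \<Rightarrow> bool) \<Rightarrow> 'm \<Rightarrow> 'm \<Rightarrow> 'm \<Rightarrow> bool" where
  "sim X p t s \<longleftrightarrow> (\<forall>r u q. pr r u \<in> el t \<longrightarrow> q \<in> P \<longrightarrow> leq q p \<longrightarrow> leq q u \<longrightarrow>
     (\<exists>q'\<in>P. leq q' q \<and> (\<exists>r' u'. pr r' u' \<in> el s \<and> leq q' u' \<and> X q' r r')))"

lemma sim_mono: assumes "sim X p t s"
  "\<And>q r u r' u'. q \<in> P \<Longrightarrow> pr r u \<in> el t \<Longrightarrow> pr r' u' \<in> el s \<Longrightarrow> X q r r' \<Longrightarrow> Y q r r'"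
  shows "sim Y p t s"
  using assms unfolding sim_def by blast

lemma sim_leq: "sim X p t s \<Longrightarrow> leq q p \<Longrightarrow> sim X q t s"
  unfolding sim_def using leq_trans by blast

definition bis :: "'m \<Rightarrow> bool" where
  "bis H \<longleftrightarrow> (\<forall>p t s. pr p (pr t s) \<in> el H \<longrightarrow>
     sim (\<lambda>q a b. pr q (pr a b) \<in> el H) p t s \<and> sim (\<lambda>q a b. pr q (pr b a) \<in> el H) p s t)"

text \<open>Forcing an equality is the greatest relation satisfying the usual recursion; by
  well-foundedness it is the only one, and this form makes it definable at once.\<close>

definition Feq :: "'m \<Rightarrow> 'm \<Rightarrow> 'm \<Rightarrow> bool" where
  "Feq p t s \<longleftrightarrow> (\<exists>H. bis H \<and> pr p (pr t s) \<in> el H)"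

lemma dfn_Feq: "dt M s \<Longrightarrow> dt M t \<Longrightarrow> dt M u \<Longrightarrow> dfn M (\<lambda>e. Feq (s e) (t e) (u e))"
proof (rule dfn_sub3[where Q=Feq])
  show "dfn M (\<lambda>e. Feq (e 0) (e 1) (e 2))" unfolding Feq_def bis_def sim_def by (intro dfi dfn_leq)
qed

lemma Feq_sim: assumes "Feq p t s" shows "sim Feq p t s \<and> sim (\<lambda>q a b. Feq q b a) p s t"
proof -
  obtain H where H: "bis H" "pr p (pr t s) \<in> el H" using assms Feq_def by blast
  then have 1: "sim (\<lambda>q a b. pr q (pr a b) \<in> el H) p t s" "sim (\<lambda>q a b. pr q (pr b a) \<in> el H) p s t"
    unfolding bis_def by blast+
  have "pr q (pr a b) \<in> el H \<Longrightarrow> Feq q a b" for q a b using H(1) Feq_def by blast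
  then show ?thesis using sim_mono[OF 1(1), of Feq] sim_mono[OF 1(2), of "\<lambda>q a b. Feq q b a"] by blast
qed

text \<open>For the converse, the forced equalities between elements of the transitive closures of
  \<open>t\<close> and \<open>s\<close> are gathered in a set; with the triple of \<open>p\<close>,
  \<open>t\<close> and \<open>s\<close> added it still satisfies \<open>bis\<close>.\<close>

lemma Feq_iff: assumes "p \<in> P" shows "Feq p t s \<longleftrightarrow> sim Feq p t s \<and> sim (\<lambda>q a b. Feq q b a) p s t"
proof
  assume *: "sim Feq p t s \<and> sim (\<lambda>q a b. Feq q b a) p s t"
  obtain T0 where T0: "trans_el T0" "t \<in> el T0" using trcl by blast
  obtain T1 where T1: "trans_el T1" "s \<in> el T1" using trcl by blast
  define T where "T = el T0 \<union> el T1"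
  have T: "isset T" "\<And>x y p. x \<in> T \<Longrightarrow> pr y p \<in> el x \<Longrightarrow> y \<in> T" "t \<in> T" "s \<in> T"
    unfolding T_def using trans_pr T0 T1 by (auto intro: isset_Un)
  define H where "H = {pr q z | q z. q \<in> P \<and> z \<in> {pr a b | a b. a \<in> T \<and> b \<in> T} \<and> (\<exists>a b. z = pr a b \<and> Feq q a b)}"
  have "dfn M (\<lambda>e. \<exists>a b. e 1 = pr a b \<and> Feq (e 0) a b)" by (intro dfi dfn_Feq)
  then have "isset H" unfolding H_def by (intro isset_rel isset_prod T isset_el)
  then obtain h where h: "el h = insert (pr p (pr t s)) H" using isset_insert isset_def by metis
  have inH: "pr q (pr a b) \<in> H \<longleftrightarrow> q \<in> P \<and> a \<in> T \<and> b \<in> T \<and> Feq q a b" for q a b by (auto simp: H_def)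
  have "bis h" unfolding bis_def
  proof (intro allI impI)
    fix q a b assume q: "pr q (pr a b) \<in> el h"
    have "sim Feq q a b \<and> sim (\<lambda>q a b. Feq q b a) q b a \<and> a \<in> T \<and> b \<in> T"
      using q * Feq_sim T(3,4) unfolding h insert_iff inH by auto
    then have 1: "sim Feq q a b" "sim (\<lambda>q a b. Feq q b a) q b a" "a \<in> T" "b \<in> T" by blast+
    show "sim (\<lambda>q a b. pr q (pr a b) \<in> el h) q a b \<and> sim (\<lambda>q a b. pr q (pr b a) \<in> el h) q b a"
      by (intro conjI sim_mono[OF 1(1)] sim_mono[OF 1(2)]; unfold h insert_iff inH; use T(2) 1(3,4) in blast)
  qed
  then show "Feq p t s" unfolding Feq_def using h by blast
qed (rule Feq_sim)

lemma Feq_leq: "Feq p t s \<Longrightarrow> q \<in> P \<Longrightarrow> leq q p \<Longrightarrow> Feq q t s"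
  using Feq_sim[of p t s] Feq_iff[of q t s] sim_leq by blast

definition blk :: "('m \<Rightarrow> 'm \<Rightarrow> 'm \<Rightarrow> bool) \<Rightarrow> 'm \<Rightarrow> 'm \<Rightarrow> 'm \<Rightarrow> bool" where
  "blk X q t s \<longleftrightarrow> (\<exists>r u. pr r u \<in> el t \<and> leq q u \<and> (\<forall>q'\<in>P. leq q' q \<longrightarrow>
     (\<forall>r' u'. pr r' u' \<in> el s \<longrightarrow> leq q' u' \<longrightarrow> \<not> X q' r r')))"

lemma not_sim: "\<not> sim X p t s \<Longrightarrow> \<exists>q\<in>P. leq q p \<and> blk X q t s"
  unfolding sim_def blk_def by blast

lemma sim_sub:
  assumes p: "p \<in> G" and t: "nm t" and s: "nm s" and sim: "sim X p t s" and X: "dfn M (\<lambda>e. X (e 0) (e 1) (e 2))"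
    and tr: "\<And>r u r' u' q. pr r u \<in> el t \<Longrightarrow> pr r' u' \<in> el s \<Longrightarrow> q \<in> G \<Longrightarrow> X q r r' \<Longrightarrow> vl r = vl r'"
  shows "elts N (vl t) \<subseteq> elts N (vl s)"
proof
  fix x assume "x \<in> elts N (vl t)"
  then obtain r u where r: "u \<in> G" "pr r u \<in> el t" "x = vl r" using vl_iff[OF t] by blast
  obtain q0 where q0: "q0 \<in> G" "leq q0 p" "leq q0 u" using G_dir[OF p r(1)] by blast
  have X': "dfn M (\<lambda>e. X (e i) r (e j))" for i j by (rule dfn_sub3[OF X]) (intro dfi)+
  have "\<exists>q\<in>G. leq q q0 \<and> (\<exists>r' u'. pr r' u' \<in> el s \<and> leq q u' \<and> X q r r')"
  proof (rule gen_below[OF _ q0(1)])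
    show "dfn M (\<lambda>e. \<exists>r' u'. pr r' u' \<in> el s \<and> leq (e 0) u' \<and> X (e 0) r r')"
      by (intro dfi dfn_leq X')
    fix q assume "q \<in> P" "leq q q0"
    then show "\<exists>q'\<in>P. leq q' q \<and> (\<exists>r' u'. pr r' u' \<in> el s \<and> leq q' u' \<and> X q' r r')"
      using sim r(2) q0 leq_trans unfolding sim_def by blast
  qed
  then obtain q r' u' where q: "q \<in> G" "pr r' u' \<in> el s" "leq q u'" "X q r r'" by blast
  then have "u' \<in> G" using G_up nm_pr(2)[OF s] by blast
  moreover have "x = vl r'" using tr[OF r(2) q(2,1,4)] r(3) by simp
  ultimately show "x \<in> elts N (vl s)" using vl_iff[OF s] q(2) by blast
qed

lemma blk_false:
  assumes q: "q \<in> G" and t: "nm t" and s: "nm s" and blk: "blk X q t s" and eq: "elts N (vl t) \<subseteq> elts N (vl s)"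
    and tr: "\<And>r u r' u'. pr r u \<in> el t \<Longrightarrow> pr r' u' \<in> el s \<Longrightarrow> vl r = vl r' \<Longrightarrow> \<exists>q\<in>G. X q r r'"
    and mono: "\<And>q p r r'. X p r r' \<Longrightarrow> q \<in> P \<Longrightarrow> leq q p \<Longrightarrow> X q r r'"
  shows False
proof -
  obtain r u where r: "pr r u \<in> el t" "leq q u" and
    no: "\<forall>q'\<in>P. leq q' q \<longrightarrow> (\<forall>r' u'. pr r' u' \<in> el s \<longrightarrow> leq q' u' \<longrightarrow> \<not> X q' r r')"
    using blk unfolding blk_def by blast
  have "u \<in> G" using G_up[OF q] nm_pr(2)[OF t] r by blast
  then have "vl r \<in> elts N (vl s)" using vl_iff[OF t] r eq by blast
  then obtain r' u' where r': "u' \<in> G" "pr r' u' \<in> el s" "vl r = vl r'" using vl_iff[OF s] by blast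
  obtain q1 where q1: "q1 \<in> G" "X q1 r r'" using tr[OF r(1) r'(2,3)] by blast
  obtain q2 where q2: "q2 \<in> G" "leq q2 q1" "leq q2 q" using G_dir[OF q1(1) q] by blast
  obtain q3 where q3: "q3 \<in> G" "leq q3 q2" "leq q3 u'" using G_dir[OF q2(1) r'(1)] by blast
  have "q3 \<in> P" using q3 G_P by blast
  moreover have "X q3 r r'" using mono[OF q1(2) \<open>q3 \<in> P\<close>] leq_trans[OF q3(2) q2(2)] by blast
  ultimately show False using no leq_trans[OF q3(2) q2(3)] r'(2) q3(3) by blast
qed

text \<open>A condition in \<open>G\<close> that forces equality carries members over in both
  directions by \<open>sim\<close>. Conversely, if no extension of some \<open>p \<in> G\<close>
  forces equality, the conditions with a \<open>blk\<close> are dense below \<open>p\<close>, and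
  one of them in \<open>G\<close> contradicts equality of the values.\<close>

lemma Feq_truth: "nm t \<Longrightarrow> nm s \<Longrightarrow> vl t = vl s \<longleftrightarrow> (\<exists>p\<in>G. Feq p t s)"
proof (induction t arbitrary: s rule: pr_induct)
  case (1 t)
  note t = 1(2) and s = 1(3)
  have IH: "vl r = vl r' \<longleftrightarrow> (\<exists>p\<in>G. Feq p r r')" if "pr r u \<in> el t" "pr r' u' \<in> el s" for r u r' u'
    using 1(1)[OF that(1)] nm_pr(1)[OF t that(1)] nm_pr(1)[OF s that(2)] by blast
  have d1: "dfn M (\<lambda>e. Feq (e 0) (e 1) (e 2))" and d2: "dfn M (\<lambda>e. Feq (e 0) (e 2) (e 1))"
    by (intro dfn_Feq dfi)+
  show ?case
  proof
    assume "\<exists>p\<in>G. Feq p t s"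
    then obtain p where p: "p \<in> G" "Feq p t s" by blast
    have "elts N (vl t) \<subseteq> elts N (vl s)"
      by (rule sim_sub[OF p(1) t s conjunct1[OF Feq_sim[OF p(2)]] d1]) (use IH in blast)
    moreover have "elts N (vl s) \<subseteq> elts N (vl t)"
      by (rule sim_sub[OF p(1) s t conjunct2[OF Feq_sim[OF p(2)]] d2]) (use IH in metis)
    ultimately show "vl t = vl s" by (intro N_ext) blast
  next
    assume eq: "vl t = vl s"
    have "dfn M (\<lambda>e. Feq (e 0) t s)" by (intro dfn_Feq dfi)
    from gen[OF this] show "\<exists>p\<in>G. Feq p t s"
    proof
      assume "\<exists>p\<in>G. \<forall>q\<in>P. leq q p \<longrightarrow> \<not> Feq q t s"
      then obtain p where p: "p \<in> G" "\<forall>q\<in>P. leq q p \<longrightarrow> \<not> Feq q t s" by blast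
      have "\<exists>q\<in>G. leq q p \<and> (blk Feq q t s \<or> blk (\<lambda>q a b. Feq q b a) q s t)"
      proof (rule gen_below[OF _ p(1)])
        show "dfn M (\<lambda>e. blk Feq (e 0) t s \<or> blk (\<lambda>q a b. Feq q b a) (e 0) s t)"
          unfolding blk_def by (intro dfi dfn_Feq dfn_leq)
        fix q assume q: "q \<in> P" "leq q p"
        then have "\<not> sim Feq q t s \<or> \<not> sim (\<lambda>q a b. Feq q b a) q s t" using p(2) Feq_iff by blast
        then show "\<exists>r\<in>P. leq r q \<and> (blk Feq r t s \<or> blk (\<lambda>q a b. Feq q b a) r s t)" using not_sim by metis
      qed
      then obtain q where q: "q \<in> G" "blk Feq q t s \<or> blk (\<lambda>q a b. Feq q b a) q s t" by blast
      from q(2) have False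
      proof
        assume "blk Feq q t s"
        then show False by (rule blk_false[OF q(1) t s]) (use eq IH Feq_leq in auto)
      next
        assume "blk (\<lambda>q a b. Feq q b a) q s t"
        then show False
        proof (rule blk_false[OF q(1) s t])
          show "\<exists>q\<in>G. Feq q r' r" if "pr r u \<in> el s" "pr r' u' \<in> el t" "vl r = vl r'" for r u r' u'
            using IH[OF that(2,1)] that(3) by simp
        qed (use eq Feq_leq in auto)
      qed
      then show ?thesis ..
    qed
  qed
qed

definition Fmem :: "'m \<Rightarrow> 'm \<Rightarrow> 'm \<Rightarrow> bool" where
  "Fmem p t s \<longleftrightarrow> (\<forall>q\<in>P. leq q p \<longrightarrow> (\<exists>r\<in>P. leq r q \<and> (\<exists>a u. pr a u \<in> el s \<and> leq r u \<and> Feq r t a)))"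

lemma dfn_Fmem: "dt M s \<Longrightarrow> dt M t \<Longrightarrow> dt M u \<Longrightarrow> dfn M (\<lambda>e. Fmem (s e) (t e) (u e))"
proof (rule dfn_sub3[where Q=Fmem])
  show "dfn M (\<lambda>e. Fmem (e 0) (e 1) (e 2))" unfolding Fmem_def by (intro dfi dfn_leq dfn_Feq)
qed

lemma Fmem_leq: "Fmem p t s \<Longrightarrow> leq q p \<Longrightarrow> Fmem q t s"
  unfolding Fmem_def using leq_trans by blast

lemma Fmem_truth: assumes t: "nm t" and s: "nm s"
  shows "vl t \<in> elts N (vl s) \<longleftrightarrow> (\<exists>p\<in>G. Fmem p t s)"
proof
  assume "\<exists>p\<in>G. Fmem p t s"
  then obtain p where p: "p \<in> G" "Fmem p t s" by blast
  have "\<exists>r\<in>G. leq r p \<and> (\<exists>a u. pr a u \<in> el s \<and> leq r u \<and> Feq r t a)"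
  proof (rule gen_below[OF _ p(1)])
    show "dfn M (\<lambda>e. \<exists>a u. pr a u \<in> el s \<and> leq (e 0) u \<and> Feq (e 0) t a)" by (intro dfi dfn_leq dfn_Feq)
  qed (use p(2) Fmem_def in blast)
  then obtain r a u where r: "r \<in> G" "pr a u \<in> el s" "leq r u" "Feq r t a" by blast
  then have "u \<in> G" "nm a" using G_up nm_pr[OF s] by blast+
  moreover from this have "vl t = vl a" using Feq_truth[OF t] r by blast
  ultimately show "vl t \<in> elts N (vl s)" using vl_iff[OF s] r(2) by blast
next
  assume "vl t \<in> elts N (vl s)"
  then obtain a u where a: "u \<in> G" "pr a u \<in> el s" "vl t = vl a" using vl_iff[OF s] by blast
  then obtain p where p: "p \<in> G" "Feq p t a" using Feq_truth[OF t nm_pr(1)[OF s]] by blast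
  obtain q where q: "q \<in> G" "leq q p" "leq q u" using G_dir[OF p(1) a(1)] by blast
  have "Fmem q t s" unfolding Fmem_def
  proof (intro ballI impI)
    fix q' assume q': "q' \<in> P" "leq q' q"
    then have "leq q' u" "Feq q' t a" using leq_trans q Feq_leq[OF p(2)] by blast+
    then show "\<exists>r\<in>P. leq r q' \<and> (\<exists>a u. pr a u \<in> el s \<and> leq r u \<and> Feq r t a)"
      using q'(1) a(2) leq_refl by blast
  qed
  then show "\<exists>p\<in>G. Fmem p t s" using q by blast
qed

subsection \<open>The forcing theorem\<close>

text \<open>In the clause for \<open>Forall\<close> each instance is forced only densely below
  \<open>p\<close>. With this weak clause a condition none of whose extensions refutes an instance
  forces the quantified formula by definition.\<close>

primrec forces :: "fm \<Rightarrow> 'm \<Rightarrow> (nat \<Rightarrow> 'm) \<Rightarrow> bool" where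
  "forces (Mem i j) p s \<longleftrightarrow> Fmem p (s i) (s j)"
| "forces (Eq i j) p s \<longleftrightarrow> Feq p (s i) (s j)"
| "forces (Neg \<phi>) p s \<longleftrightarrow> (\<forall>q\<in>P. leq q p \<longrightarrow> \<not> forces \<phi> q s)"
| "forces (Conj \<phi> \<psi>) p s \<longleftrightarrow> forces \<phi> p s \<and> forces \<psi> p s"
| "forces (Forall i \<phi>) p s \<longleftrightarrow> (\<forall>x. nm x \<longrightarrow> (\<forall>q\<in>P. leq q p \<longrightarrow> (\<exists>r\<in>P. leq r q \<and> forces \<phi> r (s(i := x)))))"

lemma dfn_forces: "dfn M (\<lambda>e. forces \<phi> (e 0) (\<lambda>n. e (Suc n)))"
proof (induction \<phi>)
  case (Neg \<phi>)
  have "dfn M (\<lambda>e. forces \<phi> (e 0) (\<lambda>n. e (Suc (Suc n))))"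
    using dfn_rename[OF Neg, of "case_nat 0 (\<lambda>n. Suc (Suc n))"] by simp
  then show ?case unfolding forces.simps by (intro dfi dfn_leq)
next
  case (Conj \<phi> \<psi>) then show ?case unfolding forces.simps by (intro dfi)
next
  case (Forall i \<phi>)
  define f where "f = case_nat (0::nat) ((\<lambda>n. Suc (Suc (Suc (Suc n))))(i := Suc (Suc 0)))"
  have "dfn M (\<lambda>e. forces \<phi> (e 0) ((\<lambda>n. e (Suc (Suc (Suc (Suc n)))))(i := e (Suc (Suc 0)))))"
    using dfn_rename[OF Forall, of f] by (simp add: f_def fun_upd_def if_distrib)
  then show ?case unfolding forces.simps by (intro dfi dfn_leq)
qed (unfold forces.simps, (intro dfn_Fmem dfn_Feq dfi)+)

lemma forces_leq: "forces \<phi> p s \<Longrightarrow> q \<in> P \<Longrightarrow> leq q p \<Longrightarrow> forces \<phi> q s"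
proof (induction \<phi> arbitrary: s)
  case (Neg \<phi>) then show ?case using leq_trans by auto
next
  case (Forall i \<phi>)
  show ?case unfolding forces.simps
  proof (intro allI impI ballI)
    fix x q' assume "nm x" "q' \<in> P" "leq q' q"
    then show "\<exists>r\<in>P. leq r q' \<and> forces \<phi> r (s(i := x))"
      using Forall.prems(1)[unfolded forces.simps] leq_trans[OF _ Forall.prems(3)] by blast
  qed
qed (auto intro: Fmem_leq Feq_leq)

lemma dfn_forces': assumes "\<And>n. \<exists>u. \<forall>e. T n e = atm u e"
  shows "dfn M (\<lambda>e. forces \<phi> (e k) (\<lambda>n. T n e))"
proof -
  have "dfn M (\<lambda>e. (\<lambda>e. forces \<phi> (e 0) (\<lambda>n. e (Suc n))) (\<lambda>n. (case n of 0 \<Rightarrow> (\<lambda>e. e k) | Suc n \<Rightarrow> T n) e))"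
    using dfn_forces
  proof (rule dfn_subst)
    fix n show "\<exists>u. \<forall>e. (case n of 0 \<Rightarrow> (\<lambda>e. e k) | Suc n \<Rightarrow> T n) e = atm u e"
      using assms by (cases n) (auto intro: exI[of _ "Inl k"])
  qed
  then show ?thesis by simp
qed

lemma dfn_forces_const: "dfn M (\<lambda>e. forces \<phi> (e k) s)"
  by (rule dfn_forces') (auto intro: exI[of _ "Inr (s n)" for n])

lemma dfn_forces_upd: "dfn M (\<lambda>e. forces \<phi> (e k) (s(i := e j)))"
proof (rule dfn_forces')
  fix n show "\<exists>u. \<forall>e. (s(i := e j)) n = atm u e"
    by (cases "n = i") (auto intro: exI[of _ "Inl j"] exI[of _ "Inr (s n)"])
qed

theorem truth: "(\<And>n. nm (s n)) \<Longrightarrow> sat N (\<lambda>n. vl (s n)) \<phi> \<longleftrightarrow> (\<exists>p\<in>G. forces \<phi> p s)"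
proof (induction \<phi> arbitrary: s)
  case (Mem i j) then show ?case using Fmem_truth by (simp add: elts_def)
next
  case (Eq i j) then show ?case using Feq_truth by simp
next
  case (Neg \<phi>)
  have IH: "sat N (\<lambda>n. vl (s n)) \<phi> \<longleftrightarrow> (\<exists>p\<in>G. forces \<phi> p s)" by (rule Neg.IH) (rule Neg.prems)
  show ?case
  proof
    assume "sat N (\<lambda>n. vl (s n)) (Neg \<phi>)"
    then have no: "\<not> (\<exists>p\<in>G. forces \<phi> p s)" using IH by simp
    show "\<exists>p\<in>G. forces (Neg \<phi>) p s"
      using gen[OF dfn_forces_const[of \<phi> 0 s]] no by simp
  next
    assume "\<exists>p\<in>G. forces (Neg \<phi>) p s"
    then obtain p where p: "p \<in> G" "\<forall>q\<in>P. leq q p \<longrightarrow> \<not> forces \<phi> q s" by auto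
    have "\<not> (\<exists>p\<in>G. forces \<phi> p s)"
    proof
      assume "\<exists>p\<in>G. forces \<phi> p s"
      then obtain r where r: "r \<in> G" "forces \<phi> r s" by blast
      obtain q where "q \<in> G" "leq q p" "leq q r" using G_dir[OF p(1) r(1)] by blast
      then show False using p(2) forces_leq[OF r(2)] G_P by blast
    qed
    then show "sat N (\<lambda>n. vl (s n)) (Neg \<phi>)" using IH by simp
  qed
next
  case (Conj \<phi> \<psi>)
  have IH: "sat N (\<lambda>n. vl (s n)) \<phi> \<longleftrightarrow> (\<exists>p\<in>G. forces \<phi> p s)" "sat N (\<lambda>n. vl (s n)) \<psi> \<longleftrightarrow> (\<exists>p\<in>G. forces \<psi> p s)"
    by (rule Conj.IH, rule Conj.prems)+
  have "\<exists>r\<in>G. forces \<phi> r s \<and> forces \<psi> r s" if "p \<in> G" "forces \<phi> p s" "q \<in> G" "forces \<psi> q s" for p q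
    using G_dir[OF that(1,3)] forces_leq[OF that(2)] forces_leq[OF that(4)] G_P by blast
  then show ?case unfolding sat.simps forces.simps IH by blast
next
  case (Forall i \<phi>)
  have upd: "(\<lambda>n. vl (s n))(i := vl x) = (\<lambda>n. vl ((s(i := x)) n))" for x by auto
  have IH: "sat N ((\<lambda>n. vl (s n))(i := vl x)) \<phi> \<longleftrightarrow> (\<exists>p\<in>G. forces \<phi> p (s(i := x)))" if "nm x" for x
    unfolding upd by (rule Forall.IH) (use that Forall.prems in auto)
  have all: "sat N (\<lambda>n. vl (s n)) (Forall i \<phi>) \<longleftrightarrow> (\<forall>x. nm x \<longrightarrow> sat N ((\<lambda>n. vl (s n))(i := vl x)) \<phi>)"
    using vl_surj by (auto) metis
  show ?case
  proof
    assume sat: "sat N (\<lambda>n. vl (s n)) (Forall i \<phi>)"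
    define D where "D = (\<lambda>p. \<exists>x. nm x \<and> (\<forall>q\<in>P. leq q p \<longrightarrow> \<not> forces \<phi> q (s(i := x))))"
    have D: "dfn M (\<lambda>e. D (e 0))" unfolding D_def by (intro dfi dfn_leq dfn_forces_upd)
    from gen[OF D] show "\<exists>p\<in>G. forces (Forall i \<phi>) p s"
    proof
      assume "\<exists>p\<in>G. D p"
      then obtain p x where p: "p \<in> G" "nm x" "\<forall>q\<in>P. leq q p \<longrightarrow> \<not> forces \<phi> q (s(i := x))" unfolding D_def by blast
      obtain r where r: "r \<in> G" "forces \<phi> r (s(i := x))" using sat all IH[OF p(2)] p(2) by blast
      obtain q where "q \<in> G" "leq q p" "leq q r" using G_dir[OF p(1) r(1)] by blast
      then show ?thesis using p(3) forces_leq[OF r(2)] G_P by blast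
    next
      assume "\<exists>p\<in>G. \<forall>q\<in>P. leq q p \<longrightarrow> \<not> D q"
      then obtain p where p: "p \<in> G" "\<forall>q\<in>P. leq q p \<longrightarrow> \<not> D q" by blast
      then have "forces (Forall i \<phi>) p s" unfolding forces.simps D_def by blast
      then show ?thesis using p(1) by blast
    qed
  next
    assume "\<exists>p\<in>G. forces (Forall i \<phi>) p s"
    then obtain p where p: "p \<in> G" "forces (Forall i \<phi>) p s" by blast
    show "sat N (\<lambda>n. vl (s n)) (Forall i \<phi>)" unfolding all
    proof (intro allI impI)
      fix x assume x: "nm x"
      have "\<exists>r\<in>G. leq r p \<and> forces \<phi> r (s(i := x))"
        by (rule gen_below[OF dfn_forces_const p(1)]) (use p(2)[unfolded forces.simps] x in blast)
      then show "sat N ((\<lambda>n. vl (s n))(i := vl x)) \<phi>" using IH[OF x] by blast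
    qed
  qed
qed

end

context zm
begin

lemma el_inj: "el x = el y \<longleftrightarrow> x = y" using ext by blast

end

section \<open>The axioms of \<open>zmc\<close> in the extension\<close>

context forcing
begin

lemma wf_N: "wfp N"
proof -
  have "Wellfounded.accp N (vl t)" if "nm t" for t
    using that
  proof (induction t rule: name.induct)
    case (1 t)
    have t: "nm t" by (rule name.intros) (use 1 in blast)
    show ?case
    proof (rule accp.accI)
      fix y assume "N y (vl t)"
      then have "y \<in> elts N (vl t)" by (simp add: elts_def)
      then obtain s p where s: "p \<in> G" "pr s p \<in> el t" "y = vl s" using vl_iff[OF t] by blast
      obtain s' p' where "Wellfounded.accp N (vl s')" "is_pair M s' p' (pr s p)" using 1[OF s(2)] by blast
      then show "Wellfounded.accp N y" using s(3) by (simp add: is_pair_iff)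
    qed
  qed
  then show ?thesis using vl_surj accp_wfpI by metis
qed

lemma name_of: obtains t where "nm t" "vl t = x"
  using vl_surj by metis

text \<open>The subset is named by the pairs of an \<open>x\<close> and a condition \<open>p\<close>
  that lies below a label of \<open>x\<close> in the name of \<open>a\<close> and forces the formula
  at \<open>x\<close>.\<close>

lemma sep_N: "separation N"
  unfolding separation_def
proof (intro allI)
  fix \<phi> and s :: "nat \<Rightarrow> 'n" and a
  define s' where "s' = (\<lambda>n. SOME t. nm t \<and> vl t = s n)"
  have "nm (s' n) \<and> vl (s' n) = s n" for n unfolding s'_def by (rule someI_ex) (rule vl_surj)
  then have s': "\<And>n. nm (s' n)" "\<And>n. vl (s' n) = s n" by blast+
  obtain al where al: "nm al" "vl al = a" by (rule name_of)
  define Q where "Q = (\<lambda>x p. (\<exists>u. pr x u \<in> el al \<and> leq p u) \<and> forces \<phi> p (s'(0 := x)))"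
  define A where "A = {x. \<exists>u. pr x u \<in> el al}"
  have "dfn M (\<lambda>e. Q (e 0) (e 1))" unfolding Q_def by (intro dfi dfn_leq dfn_forces_upd)
  moreover have "isset A" unfolding A_def by (rule isset_Range(2)) simp
  ultimately have "isset {pr x p | x p. x \<in> A \<and> p \<in> P \<and> Q x p}" by (intro isset_rel isset_el)
  then obtain b where b: "el b = {pr x p | x p. x \<in> A \<and> p \<in> P \<and> Q x p}" by (auto simp: isset_def)
  have nmb: "nm b"
  proof (rule nmI)
    fix e assume "e \<in> el b"
    then obtain x p where x: "x \<in> A" "p \<in> P" "e = pr x p" unfolding b by blast
    then show "\<exists>s p. nm s \<and> p \<in> P \<and> e = pr s p" using nm_pr(1)[OF al(1)] unfolding A_def by blast
  qed
  have sat: "sat N (s(0 := vl x)) \<phi> \<longleftrightarrow> (\<exists>p\<in>G. forces \<phi> p (s'(0 := x)))" if "nm x" for x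
  proof -
    have "(\<lambda>n. vl ((s'(0 := x)) n)) = s(0 := vl x)" by (auto simp: s')
    moreover have "nm ((s'(0 := x)) n)" for n using that s' by simp
    ultimately show ?thesis using truth[of "s'(0 := x)" \<phi>] by simp
  qed
  have "y \<in> elts N (vl b) \<longleftrightarrow> y \<in> elts N a \<and> sat N (s(0 := y)) \<phi>" for y
  proof
    assume "y \<in> elts N (vl b)"
    then obtain x p where x: "p \<in> G" "pr x p \<in> el b" "y = vl x" using vl_iff[OF nmb] by blast
    then have Q: "Q x p" using b by auto
    then obtain u where u: "pr x u \<in> el al" "leq p u" unfolding Q_def by blast
    have "u \<in> G" using G_up[OF x(1) nm_pr(2)[OF al(1) u(1)] u(2)] .
    then have "y \<in> elts N a" using vl_iff[OF al(1)] u(1) x(3) al(2) by blast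
    moreover have "sat N (s(0 := y)) \<phi>" using sat[OF nm_pr(1)[OF al(1) u(1)]] x Q unfolding Q_def by blast
    ultimately show "y \<in> elts N a \<and> sat N (s(0 := y)) \<phi>" by blast
  next
    assume y: "y \<in> elts N a \<and> sat N (s(0 := y)) \<phi>"
    then obtain x u where x: "u \<in> G" "pr x u \<in> el al" "y = vl x" using vl_iff[OF al(1)] al(2) by blast
    obtain p where p: "p \<in> G" "forces \<phi> p (s'(0 := x))" using y sat[OF nm_pr(1)[OF al(1) x(2)]] x(3) by blast
    obtain r where r: "r \<in> G" "leq r p" "leq r u" using G_dir[OF p(1) x(1)] by blast
    have rP: "r \<in> P" using r G_P by blast
    have "Q x r" unfolding Q_def using x(2) r forces_leq[OF p(2) rP] by blast
    then have "pr x r \<in> el b" unfolding b using rP x(2) unfolding A_def by blast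
    then show "y \<in> elts N (vl b)" using vl_iff[OF nmb] r(1) x(3) by blast
  qed
  then have "elts N (vl b) = {x \<in> elts N a. sat N (s(0 := x)) \<phi>}" by blast
  then show "\<exists>b. elts N b = {x \<in> elts N a. sat N (s(0 := x)) \<phi>}" by blast
qed

lemma one_P: "one \<in> P" using one G_P by blast

lemma up_name: assumes "isset A" "\<And>a. a \<in> A \<Longrightarrow> nm a"
  obtains c where "nm c" "elts N (vl c) = vl ` A" "el c = (\<lambda>a. pr a one) ` A"
proof -
  have "isset ((\<lambda>a. pr a one) ` A)" by (intro isset_image assms dfi)
  then obtain c where c: "el c = (\<lambda>a. pr a one) ` A" by (auto simp: isset_def)
  have nmc: "nm c" by (rule nmI) (use c assms(2) one_P in blast)
  have "elts N (vl c) = vl ` A" using vl_iff[OF nmc] one unfolding c by (auto simp: set_eq_iff)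
  then show ?thesis using that nmc c by blast
qed

lemma pair_N: "\<exists>c. a \<in> elts N c \<and> b \<in> elts N c"
proof -
  obtain s where s: "nm s" "vl s = a" by (rule name_of)
  obtain t where t: "nm t" "vl t = b" by (rule name_of)
  obtain c where "elts N (vl c) = vl ` {s, t}" by (rule up_name[OF isset_upair[of s t]]) (use s t in auto)
  then show ?thesis using s t by auto
qed

lemma union_N: "\<exists>u. \<forall>y\<in>elts N x. elts N y \<subseteq> elts N u"
proof -
  obtain t where t: "nm t" "vl t = x" by (rule name_of)
  define A where "A = {s. \<exists>p. pr s p \<in> el t}"
  have A: "isset A" unfolding A_def by (intro isset_Range isset_el)
  have iss: "isset {s. \<exists>p. pr s p \<in> (\<Union>y\<in>A. el y)}" by (intro isset_Range isset_Union A)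
  have nms: "nm a" if "a \<in> {s. \<exists>p. pr s p \<in> (\<Union>y\<in>A. el y)}" for a
  proof -
    have "\<exists>p y q. pr a p \<in> el y \<and> pr y q \<in> el t" using that unfolding A_def by blast
    then show ?thesis using nm_pr t(1) by blast
  qed
  obtain c where c: "elts N (vl c) = vl ` {s. \<exists>p. pr s p \<in> (\<Union>y\<in>A. el y)}" by (rule up_name[OF iss nms])
  have "z \<in> elts N (vl c)" if yz: "y \<in> elts N x" "z \<in> elts N y" for y z
  proof -
    obtain s p where s: "pr s p \<in> el t" "y = vl s" using yz(1) vl_iff[OF t(1)] t(2) by blast
    obtain r q where r: "pr r q \<in> el s" "z = vl r" using yz(2) vl_iff[OF nm_pr(1)[OF t(1) s(1)]] s(2) by blast
    then show ?thesis unfolding c A_def using s(1) by blast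
  qed
  then show ?thesis by blast
qed

text \<open>Every subset of \<open>x\<close> has a name among the subsets of \<open>A\<close> times
  \<open>P\<close>, namely the set of pairs of an \<open>s\<close> and a \<open>p\<close> that
  forces \<open>s\<close> into the subset. These names form the set \<open>W\<close> of
  \<open>M\<close>.\<close>

lemma pow_N: "\<exists>p. \<forall>y. elts N y \<subseteq> elts N x \<longrightarrow> y \<in> elts N p"
proof -
  obtain t where t: "nm t" "vl t = x" by (rule name_of)
  define A where "A = {s. \<exists>p. pr s p \<in> el t}"
  have A: "isset A" unfolding A_def by (intro isset_Range isset_el)
  define W where "W = {v. el v \<subseteq> {pr s p | s p. s \<in> A \<and> p \<in> P}}"
  have W: "isset W" unfolding W_def by (intro isset_Pow isset_prod A isset_el)
  have nmA: "nm s" if "s \<in> A" for s using that nm_pr(1)[OF t(1)] unfolding A_def by blast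
  have nmW: "nm v" if "v \<in> W" for v
    by (rule nmI) (use that nmA in \<open>unfold W_def, blast\<close>)
  obtain c where c: "elts N (vl c) = vl ` W" by (rule up_name[OF W nmW])
  have "y \<in> elts N (vl c)" if y: "elts N y \<subseteq> elts N x" for y
  proof -
    obtain b where b: "nm b" "vl b = y" by (rule name_of)
    have "dfn M (\<lambda>e. Fmem (e 1) (e 0) b)" by (intro dfn_Fmem dfi)
    then have "isset {pr s p | s p. s \<in> A \<and> p \<in> P \<and> Fmem p s b}" by (intro isset_rel A isset_el)
    then obtain v where v: "el v = {pr s p | s p. s \<in> A \<and> p \<in> P \<and> Fmem p s b}" by (auto simp: isset_def)
    then have vW: "v \<in> W" unfolding W_def by blast
    have "elts N (vl v) = elts N y"
    proof (intro equalityI subsetI)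
      fix z assume "z \<in> elts N (vl v)"
      then obtain s p where s: "p \<in> G" "pr s p \<in> el v" "z = vl s" using vl_iff[OF nmW[OF vW]] by blast
      then have "s \<in> A" "Fmem p s b" unfolding v by auto
      then show "z \<in> elts N y" using Fmem_truth[OF nmA b(1)] s b(2) by blast
    next
      fix z assume z: "z \<in> elts N y"
      then have "z \<in> elts N (vl t)" using y t(2) by blast
      then obtain s p where s: "pr s p \<in> el t" "z = vl s" using vl_iff[OF t(1)] by blast
      then have sA: "s \<in> A" unfolding A_def by blast
      then obtain q where q: "q \<in> G" "Fmem q s b" using Fmem_truth[OF nmA b(1)] z s b(2) by blast
      then have "pr s q \<in> el v" unfolding v using sA G_P by blast
      then show "z \<in> elts N (vl v)" using vl_iff[OF nmW[OF vW]] q s(2) by blast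
    qed
    then have "vl v = y" by (rule N_ext)
    then show ?thesis unfolding c using vW by blast
  qed
  then show ?thesis by blast
qed

text \<open>Canonical names of the natural numbers.\<close>

primrec nn :: "nat \<Rightarrow> 'm" where
  "nn 0 = mk {}"
| "nn (Suc n) = mk (insert (pr (nn n) one) (el (nn n)))"

lemma efun_nn: "efun nn"
proof (rule efun_rec[where F="\<lambda>_ x. mk (insert (pr x one) (el x))"])
  have "y = mk (insert (pr x one) (el x)) \<longleftrightarrow> el y = {z. z = pr x one \<or> z \<in> el x}" for x y
  proof -
    have "el (mk (insert (pr x one) (el x))) = {z. z = pr x one \<or> z \<in> el x}" by (subst el_mk) (auto intro: isset_insert)
    then show ?thesis using el_inj[of y "mk (insert (pr x one) (el x))"] by simp
  qed
  moreover have "dfn M (\<lambda>e. el (e 0) = {z. z = pr (e (Suc (Suc 0))) one \<or> z \<in> el (e (Suc (Suc 0)))})" by (intro dfi)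
  ultimately show "dt M (\<lambda>e. mk (insert (pr (e 1) one) (el (e 1))))" by (simp add: dt_def)
qed simp_all

lemma el_nn_Suc: "el (nn (Suc n)) = insert (pr (nn n) one) (el (nn n))" by (simp add: isset_insert)

lemma nm_nn: "nm (nn n)"
proof (induction n)
  case 0 show ?case by (rule nmI) (simp add: isset_empty)
next
  case (Suc n) show ?case
  proof (rule nmI)
    fix e assume "e \<in> el (nn (Suc n))"
    then show "\<exists>s p. nm s \<and> p \<in> P \<and> e = pr s p" unfolding el_nn_Suc using Suc nmD one_P by blast
  qed
qed

lemma vl_nn: "elts N (vl (nn 0)) = {}" "elts N (vl (nn (Suc n))) = insert (vl (nn n)) (elts N (vl (nn n)))"
proof -
  show "elts N (vl (nn 0)) = {}" using vl_iff[OF nm_nn[of 0]] by (auto simp: isset_empty)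
  have "x \<in> elts N (vl (nn (Suc n))) \<longleftrightarrow> x = vl (nn n) \<or> x \<in> elts N (vl (nn n))" for x
    unfolding vl_iff[OF nm_nn] el_nn_Suc using one by auto
  then show "elts N (vl (nn (Suc n))) = insert (vl (nn n)) (elts N (vl (nn n)))" by blast
qed

lemma isset_range: "efun f \<Longrightarrow> isset (range f)"
proof -
  assume f: "efun f"
  have "isset ((\<lambda>x. f (nof x)) ` el Om)" using f by (intro isset_image isset_el) (simp add: efun_def)
  moreover have "(\<lambda>x. f (nof x)) ` el Om = range f" by (auto simp: image_image)
  ultimately show ?thesis by simp
qed

lemma inf_N: "\<exists>w. is_inductive N w"
proof -
  obtain c where c: "elts N (vl c) = vl ` range nn" by (rule up_name[OF isset_range[OF efun_nn]]) (use nm_nn in blast)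
  have "is_inductive N (vl c)" unfolding is_inductive_def c
  proof (intro conjI ballI)
    show "\<exists>z\<in>vl ` range nn. elts N z = {}" using vl_nn(1) by blast
    fix x assume "x \<in> vl ` range nn"
    then obtain n where "x = vl (nn n)" by blast
    then show "\<exists>y\<in>vl ` range nn. elts N y = insert x (elts N x)" using vl_nn(2)[of n] by blast
  qed
  then show ?thesis by blast
qed

text \<open>The work is done by a well-order in \<open>M\<close> of the first components of a name
  of \<open>x\<close>: \<open>I b\<close> keeps the entries of index up to \<open>b\<close>. Several
  indices may have the same value in \<open>N\<close>, but the least index that \<open>G\<close>
  admits with a value in \<open>A\<close> already isolates one element.\<close>

lemma chain_N: "\<exists>C. (\<forall>i\<in>elts N C. \<forall>i'\<in>elts N C. elts N i \<subseteq> elts N i' \<or> elts N i' \<subseteq> elts N i) \<and>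
    (\<forall>A. A \<noteq> {} \<and> A \<subseteq> elts N x \<longrightarrow> (\<exists>i\<in>elts N C. \<exists>a. elts N i \<inter> A = {a}))"
proof -
  obtain t where t: "nm t" "vl t = x" by (rule name_of)
  define D where "D = {s. \<exists>p. pr s p \<in> el t}"
  have "isset D" unfolding D_def by (intro isset_Range isset_el)
  then obtain d where d: "el d = D" by (auto simp: isset_def)
  obtain th f where f: "Ord th" "dt M (\<lambda>e. f (e 0))" "inj_on f (el th)" "f ` el th = el d" by (rule zermelo)
  define I where "I = (\<lambda>b. mk {z. z \<in> el t \<and> (\<exists>c p. (c = b \<or> c \<in> el b) \<and> z = pr (f c) p)})"
  have I: "el (I b) = {z. z \<in> el t \<and> (\<exists>c p. (c = b \<or> c \<in> el b) \<and> z = pr (f c) p)}" for b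
  proof -
    have "isset {z \<in> el t. \<exists>c p. (c = b \<or> c \<in> el b) \<and> z = pr (f c) p}"
      by (intro isset_sep isset_el dfi dt_sub[OF f(2)])
    then show ?thesis unfolding I_def by (intro el_mk) simp
  qed
  have "dfn M (\<lambda>e. el (e 0) = {z. z \<in> el t \<and> (\<exists>c p. (c = e (Suc 0) \<or> c \<in> el (e (Suc 0))) \<and> z = pr (f c) p)})"
    by (intro dfi dt_sub[OF f(2)])
  moreover have "el y = {z. z \<in> el t \<and> (\<exists>c p. (c = b \<or> c \<in> el b) \<and> z = pr (f c) p)} \<longleftrightarrow> y = I b" for y b
    using el_inj[of y "I b"] unfolding I .
  ultimately have "dt M (\<lambda>e. I (e 0))" unfolding dt_def by simp
  then have iss: "isset (I ` el th)" by (rule isset_image) simp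
  have nmI': "nm (I b)" for b by (rule nmI) (use nmD[OF t(1)] in \<open>unfold I, blast\<close>)
  have vI: "y \<in> elts N (vl (I b)) \<longleftrightarrow> (\<exists>c p. p \<in> G \<and> (c = b \<or> c \<in> el b) \<and> pr (f c) p \<in> el t \<and> y = vl (f c))" for y b
    unfolding vl_iff[OF nmI'] I mem_Collect_eq
  proof (intro iffI; elim exE conjE)
    fix s p c q assume "p \<in> G" "y = vl s" "pr s p \<in> el t" "c = b \<or> c \<in> el b" "pr s p = pr (f c) q"
    then have "p \<in> G \<and> (c = b \<or> c \<in> el b) \<and> pr (f c) p \<in> el t \<and> y = vl (f c)" by simp
    then show "\<exists>c p. p \<in> G \<and> (c = b \<or> c \<in> el b) \<and> pr (f c) p \<in> el t \<and> y = vl (f c)" by (intro exI)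
  next
    fix c p assume "p \<in> G" "c = b \<or> c \<in> el b" "pr (f c) p \<in> el t" "y = vl (f c)"
    then show "\<exists>s p. p \<in> G \<and> (pr s p \<in> el t \<and> (\<exists>c q. (c = b \<or> c \<in> el b) \<and> pr s p = pr (f c) q)) \<and> y = vl s"
      by (intro exI[of _ "f c"] exI[of _ p] exI[of _ c] conjI) auto
  qed
  obtain C where C: "elts N (vl C) = vl ` (I ` el th)" by (rule up_name[OF iss]) (use nmI' in blast)
  have mono: "elts N (vl (I b)) \<subseteq> elts N (vl (I c))" if c: "c \<in> el th" and bc: "b = c \<or> b \<in> el c" for b c
  proof
    fix y assume "y \<in> elts N (vl (I b))"
    then obtain d p where d: "p \<in> G" "d = b \<or> d \<in> el b" "pr (f d) p \<in> el t" "y = vl (f d)"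
      unfolding vI by (elim exE conjE)
    have "d = c \<or> d \<in> el c" using Ord_trans[OF Ord_el[OF f(1) c], of b d] d(2) bc by blast
    then show "y \<in> elts N (vl (I c))" unfolding vI using d(1,3,4) by (intro exI conjI)
  qed
  show ?thesis
  proof (intro exI[of _ "vl C"] conjI ballI allI impI)
    fix i i' assume "i \<in> elts N (vl C)" "i' \<in> elts N (vl C)"
    then obtain b c where bc: "b \<in> el th" "c \<in> el th" "i = vl (I b)" "i' = vl (I c)" unfolding C by blast
    then consider "b \<in> el c" | "b = c" | "c \<in> el b"
      using Ord_linear[OF Ord_el[OF f(1) bc(1)] Ord_el[OF f(1) bc(2)]] by blast
    then show "elts N i \<subseteq> elts N i' \<or> elts N i' \<subseteq> elts N i"
      by cases (use mono[of c b] mono[of b c] bc in auto)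
  next
    fix A assume A: "A \<noteq> {} \<and> A \<subseteq> elts N x"
    define W where "W = (\<lambda>b. b \<in> el th \<and> (\<exists>p\<in>G. pr (f b) p \<in> el t) \<and> vl (f b) \<in> A)"
    obtain a where a: "a \<in> A" "a \<in> elts N (vl t)" using A t(2) by blast
    then obtain s p where s: "p \<in> G" "pr s p \<in> el t" "a = vl s" using vl_iff[OF t(1)] by blast
    then have "s \<in> f ` el th" unfolding f(4) d D_def by blast
    then obtain b0 where b0: "W b0" unfolding W_def using s a by blast
    obtain b where b: "W b" "\<And>y. y \<in> el b \<Longrightarrow> \<not> W y" by (rule minimal[of W, OF b0]) (erule that, simp)
    have bth: "y \<in> el th" if "y \<in> el b" for y using b(1) Ord_trans[OF f(1) _ that] unfolding W_def by blast
    have "elts N (vl (I b)) \<inter> A = {vl (f b)}"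
    proof (intro equalityI subsetI)
      fix y assume y: "y \<in> elts N (vl (I b)) \<inter> A"
      then obtain c p where c: "p \<in> G" "c = b \<or> c \<in> el b" "pr (f c) p \<in> el t" "y = vl (f c)"
        unfolding Int_iff vI by (elim exE conjE)
      have "c = b" using c(1,2,3) b(2)[of c] bth[of c] y unfolding W_def c(4) by (elim disjE IntE) auto
      then show "y \<in> {vl (f b)}" using c(4) by simp
    next
      fix y assume "y \<in> {vl (f b)}"
      moreover obtain p where "p \<in> G" "pr (f b) p \<in> el t" "vl (f b) \<in> A" using b(1) unfolding W_def by blast
      ultimately show "y \<in> elts N (vl (I b)) \<inter> A" unfolding Int_iff vI by blast
    qed
    then show "\<exists>i\<in>elts N (vl C). \<exists>a. elts N i \<inter> A = {a}" unfolding C using b(1) unfolding W_def by blast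
  qed
qed

end

sublocale forcing \<subseteq> N: zmc N
  by unfold_locales (use wf_N N_ext sep_N pair_N union_N pow_N inf_N chain_N in auto)

section \<open>Names of reals\<close>

context forcing
begin

lemma N_num: "N.num n = vl (nn n)"
proof (induction n)
  case 0 show ?case using vl_nn(1) by (simp add: N.mk_eq del: nn.simps)
next
  case (Suc n) then show ?case using vl_nn(2)[of n] by (simp add: N.mk_eq del: nn.simps)
qed

text \<open>The name has the entries \<open>nn n\<close> labelled by \<open>f n\<close>. In this way
  filters and Cohen reals that are read off \<open>G\<close> become reals of
  \<open>N\<close>.\<close>

lemma real_name: assumes f: "efun f" and A: "A \<in> AA" and fP: "\<And>n. n \<in> A \<Longrightarrow> f n \<in> P"
  shows "{n \<in> A. f n \<in> G} \<in> N.AA"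
proof -
  define g where "g = (\<lambda>x. pr (nn (nof x)) (f (nof x)))"
  have "isset (g ` el (re A))" unfolding g_def
    by (intro isset_image isset_el dfi dt_efun[OF efun_nn] dt_efun[OF f])
  then obtain c where c: "el c = g ` el (re A)" by (auto simp: isset_def)
  then have cel: "el c = {pr (nn n) (f n) | n. n \<in> A}" unfolding re_AA[OF A] g_def by force
  have nmc: "nm c" by (rule nmI) (use nm_nn fP in \<open>unfold cel, blast\<close>)
  have "elts N (vl c) = N.num ` {n \<in> A. f n \<in> G}"
    using vl_iff[OF nmc] unfolding cel N_num by auto
  then show ?thesis unfolding N.AA_def using N.isset_el[of "vl c"] by simp
qed

lemma AA_sub: "A \<in> AA \<Longrightarrow> A \<in> N.AA"
  using real_name[of "\<lambda>_. one" A] one one_P by (simp add: efun_def dfi)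

text \<open>It makes sets of reals built in \<open>M\<close> available as elements of
  \<open>N\<close>.\<close>

lemma reals_name: assumes X: "isset (re ` X)" "X \<subseteq> AA" shows "N.isset (N.re ` X)"
proof -
  define g where "g = (\<lambda>x. mk {z. \<exists>n. n \<in> sof x \<and> z = pr (nn n) one})"
  have g: "el (g x) = {z. \<exists>n. n \<in> sof x \<and> z = pr (nn n) one}" for x
  proof -
    have "isset ((\<lambda>y. pr (nn (nof y)) one) ` {y \<in> el Om. nof y \<in> sof x})"
      by (intro isset_image isset_sep isset_el dfi dt_efun[OF efun_nn])
    moreover have "(\<lambda>y. pr (nn (nof y)) one) ` {y \<in> el Om. nof y \<in> sof x} = {z. \<exists>n. n \<in> sof x \<and> z = pr (nn n) one}"
      by force
    ultimately show ?thesis unfolding g_def by (intro el_mk) simp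
  qed
  have "dfn M (\<lambda>e. el (e 0) = {z. \<exists>n. n \<in> sof (e (Suc 0)) \<and> z = pr (nn n) one})"
    by (intro dfi dt_efun[OF efun_nn])
  moreover have "el y = {z. \<exists>n. n \<in> sof x \<and> z = pr (nn n) one} \<longleftrightarrow> y = g x" for x y
    using el_inj[of y "g x"] unfolding g .
  ultimately have "dt M (\<lambda>e. g (e 0))" unfolding dt_def by simp
  then have iss: "isset (g ` re ` X)" using X(1) by (rule isset_image)
  have nmg: "nm (g x)" for x by (rule nmI) (use nm_nn one_P in \<open>unfold g, blast\<close>)
  obtain c where c: "elts N (vl c) = vl ` (g ` re ` X)" by (rule up_name[OF iss]) (use nmg in blast)
  have "vl (g (re A)) = N.re A" if "A \<in> X" for A
  proof (rule N_ext)
    have AA: "A \<in> AA" "A \<in> N.AA" using that X(2) AA_sub by blast+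
    have "y \<in> elts N (vl (g (re A))) \<longleftrightarrow> (\<exists>n\<in>A. y = vl (nn n))" for y
    proof -
      have "y \<in> elts N (vl (g (re A))) \<longleftrightarrow> (\<exists>s p. p \<in> G \<and> (\<exists>n. n \<in> A \<and> pr s p = pr (nn n) one) \<and> y = vl s)"
        unfolding vl_iff[OF nmg] g sof_re[OF AA(1)] mem_Collect_eq ..
      also have "\<dots> \<longleftrightarrow> (\<exists>n\<in>A. y = vl (nn n))" using one unfolding pr_inj by blast
      finally show ?thesis .
    qed
    then show "elts N (vl (g (re A))) = elts N (N.re A)"
      unfolding N.re_AA[OF AA(2)] N_num by blast
  qed
  then have "vl ` (g ` re ` X) = N.re ` X" by (auto simp: image_image)
  then show ?thesis using c N.isset_el[of "vl c"] by simp
qed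

end


section \<open>Cohen reals\<close>

text \<open>Code of the sequence of the first \<open>k\<close> digits of \<open>x\<close>; the extra
  element \<open>k\<close>, the largest of the set, records the length.\<close>

definition cyl :: "nat set \<Rightarrow> nat \<Rightarrow> nat" where "cyl x k = set_encode (insert k (x \<inter> {..<k}))"

lemma cyl_decode: "set_decode (cyl x k) = insert k (x \<inter> {..<k})" unfolding cyl_def by (rule set_encode_inverse) simp

lemma cyl_eq: "cyl x k = cyl y l \<longleftrightarrow> k = l \<and> x \<inter> {..<k} = y \<inter> {..<k}"
proof
  assume "cyl x k = cyl y l"
  then have eq: "insert k (x \<inter> {..<k}) = insert l (y \<inter> {..<l})" by (metis cyl_decode)
  have "Max (insert k (x \<inter> {..<k})) = k" "Max (insert l (y \<inter> {..<l})) = l" by (auto intro!: Max_eqI)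
  then have "k = l" using eq by simp
  moreover have "x \<inter> {..<k} = insert k (x \<inter> {..<k}) \<inter> {..<k}" "y \<inter> {..<l} = insert l (y \<inter> {..<l}) \<inter> {..<l}" by auto
  ultimately show "k = l \<and> x \<inter> {..<k} = y \<inter> {..<k}" using eq by metis
next
  assume "k = l \<and> x \<inter> {..<k} = y \<inter> {..<k}"
  then show "cyl x k = cyl y l" unfolding cyl_def by metis
qed

text \<open>\<open>T\<close> codes a preorder on \<open>Q\<close>, \<open>H\<close> is a filter on it and \<open>c\<close> a Cohen real such that the pair \<open>(H, c)\<close> is
  generic for the family \<open>A\<close>: a set \<open>D \<in> A\<close> of pairs of conditions and finite binary sequences is
  met by \<open>(H, c)\<close>, or avoided from some point on.\<close>

locale generic_real =
  fixes A A' :: "nat set set" and Q T H c :: "nat set"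
  assumes AQ: "Q \<in> A" "T \<in> A" and AH: "H \<in> A'" "c \<in> A'" and HQ: "H \<subseteq> Q" and H0: "H \<noteq> {}"
    and T_refl: "q \<in> Q \<Longrightarrow> prod_encode (q, q) \<in> T"
    and T_trans: "prod_encode (p, q) \<in> T \<Longrightarrow> prod_encode (q, r) \<in> T \<Longrightarrow> prod_encode (p, r) \<in> T"
    and H_up: "q \<in> H \<Longrightarrow> r \<in> Q \<Longrightarrow> prod_encode (q, r) \<in> T \<Longrightarrow> r \<in> H"
    and H_dir: "q \<in> H \<Longrightarrow> r \<in> H \<Longrightarrow> \<exists>p\<in>H. prod_encode (p, q) \<in> T \<and> prod_encode (p, r) \<in> T"
    and H_gen: "D \<in> A \<Longrightarrow> (\<exists>q\<in>H. \<exists>k. prod_encode (q, cyl c k) \<in> D) \<or>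
      (\<exists>q\<in>H. \<exists>k. \<forall>q'\<in>Q. prod_encode (q', q) \<in> T \<longrightarrow>
        (\<forall>x k'. k \<le> k' \<longrightarrow> x \<inter> {..<k} = c \<inter> {..<k} \<longrightarrow> prod_encode (q', cyl x k') \<notin> D))"

section \<open>Coding Cohen conditions by numbers\<close>

context zm
begin

lemma dfn_fin [dfi]: assumes "dt E t" shows "dfn E (\<lambda>e. finite (el (t e)))"
proof -
  have "finite (el x) \<longleftrightarrow> (\<exists>f n. \<forall>a\<in>el x. \<exists>k. k < n \<and> pr (num k) a \<in> el f \<and> (\<forall>b. pr (num k) b \<in> el f \<longrightarrow> b = a))" for x
  proof
    assume "finite (el x)"
    then obtain h where h: "bij_betw h (el x) {0..<card (el x)}" using ex_bij_betw_finite_nat by blast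
    have "isset ((\<lambda>a. pr (num (h a)) a) ` el x)" using \<open>finite (el x)\<close> by (intro isset_finite) simp
    then obtain f where f: "el f = (\<lambda>a. pr (num (h a)) a) ` el x" by (auto simp: isset_def)
    have "\<exists>k. k < card (el x) \<and> pr (num k) a \<in> el f \<and> (\<forall>b. pr (num k) b \<in> el f \<longrightarrow> b = a)" if "a \<in> el x" for a
      using that h unfolding f bij_betw_def inj_on_def by (intro exI[of _ "h a"]) auto
    then show "\<exists>f n. \<forall>a\<in>el x. \<exists>k. k < n \<and> pr (num k) a \<in> el f \<and> (\<forall>b. pr (num k) b \<in> el f \<longrightarrow> b = a)" by blast
  next
    assume "\<exists>f n. \<forall>a\<in>el x. \<exists>k. k < n \<and> pr (num k) a \<in> el f \<and> (\<forall>b. pr (num k) b \<in> el f \<longrightarrow> b = a)"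
    then obtain f n where f: "\<forall>a\<in>el x. \<exists>k. k < n \<and> pr (num k) a \<in> el f \<and> (\<forall>b. pr (num k) b \<in> el f \<longrightarrow> b = a)" by blast
    then have "el x \<subseteq> (\<lambda>k. THE a. pr (num k) a \<in> el f) ` {..<n}"
    proof (intro subsetI)
      fix a assume "a \<in> el x"
      then obtain k where k: "k < n" "pr (num k) a \<in> el f" "\<forall>b. pr (num k) b \<in> el f \<longrightarrow> b = a" using f by blast
      have "(THE a. pr (num k) a \<in> el f) = a"
      proof (rule the_equality)
        show "pr (num k) a \<in> el f" by (rule k(2))
        show "b = a" if "pr (num k) b \<in> el f" for b using k(3)[rule_format, OF that] .
      qed
      then show "a \<in> (\<lambda>k. THE a. pr (num k) a \<in> el f) ` {..<n}" using k(1) by blast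
    qed
    then show "finite (el x)" by (rule finite_surj[OF finite_lessThan])
  qed
  moreover have "dfn E (\<lambda>e. \<exists>f n. \<forall>a\<in>el (t e). \<exists>k. k < n \<and> pr (num k) a \<in> el f \<and> (\<forall>b. pr (num k) b \<in> el f \<longrightarrow> b = a))"
    by (intro dfi dt_rename[OF assms])
  ultimately show ?thesis by (simp only:)
qed

text \<open>Application of an internal (possibly partial) sequence, with default value \<open>a0\<close>.\<close>

definition ap :: "'a \<Rightarrow> 'a \<Rightarrow> nat \<Rightarrow> 'a" where
  "ap a0 x n = (if \<exists>!y. pr (num n) y \<in> el x then THE y. pr (num n) y \<in> el x else a0)"

lemma ap_eq: assumes y: "pr (num n) y \<in> el x" and u: "\<And>z. pr (num n) z \<in> el x \<Longrightarrow> z = y" shows "ap a0 x n = y"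
proof -
  have "\<exists>!y. pr (num n) y \<in> el x" by (rule ex1I[of _ y]) (fact y, rule u)
  then have "ap a0 x n = (THE y. pr (num n) y \<in> el x)" unfolding ap_def by (rule if_P)
  also have "\<dots> = y" by (rule the_equality) (fact y, rule u)
  finally show ?thesis .
qed

lemma ap_empty: "el x = {} \<Longrightarrow> ap a0 x n = a0" unfolding ap_def Ex1_def by auto

lemma dt_ap: assumes "dt E s" "ntm t" shows "dt E (\<lambda>e. ap a0 (s e) (t e))"
proof (rule dtI)
  have "y = ap a0 x n \<longleftrightarrow> (pr (num n) y \<in> el x \<and> (\<forall>z. pr (num n) z \<in> el x \<longrightarrow> z = y)) \<or>
      (\<not> (\<exists>y. pr (num n) y \<in> el x \<and> (\<forall>z. pr (num n) z \<in> el x \<longrightarrow> z = y)) \<and> y = a0)" for y x n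
  proof (cases "\<exists>!y. pr (num n) y \<in> el x")
    case True
    then have "\<exists>w. pr (num n) w \<in> el x \<and> (\<forall>z. pr (num n) z \<in> el x \<longrightarrow> z = w)" unfolding Ex1_def .
    then obtain w where w: "pr (num n) w \<in> el x" "\<forall>z. pr (num n) z \<in> el x \<longrightarrow> z = w" by (elim exE conjE)
    have "ap a0 x n = w" by (rule ap_eq[OF w(1)]) (erule w(2)[rule_format])
    moreover have "\<exists>y. pr (num n) y \<in> el x \<and> (\<forall>z. pr (num n) z \<in> el x \<longrightarrow> z = y)" using w by (intro exI conjI)
    moreover have "pr (num n) y \<in> el x \<and> (\<forall>z. pr (num n) z \<in> el x \<longrightarrow> z = y) \<longleftrightarrow> y = w"
    proof
      assume "pr (num n) y \<in> el x \<and> (\<forall>z. pr (num n) z \<in> el x \<longrightarrow> z = y)"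
      then show "y = w" using w(2)[THEN spec, of y] by (elim conjE) (erule mp)
    qed (use w in \<open>elim ssubst, intro conjI\<close>)
    ultimately show ?thesis by (simp only: simp_thms)
  next
    case False
    then have "\<not> (\<exists>y. pr (num n) y \<in> el x \<and> (\<forall>z. pr (num n) z \<in> el x \<longrightarrow> z = y))" unfolding Ex1_def .
    moreover have "ap a0 x n = a0" using False unfolding ap_def by (rule if_not_P)
    moreover from calculation(1) have "\<not> (pr (num n) y \<in> el x \<and> (\<forall>z. pr (num n) z \<in> el x \<longrightarrow> z = y))" by (rule contrapos_nn) (rule exI)
    ultimately show ?thesis by (simp only: simp_thms)
  qed
  note eq = this
  show "dfn E (\<lambda>e. e 0 = ap a0 (s (\<lambda>n. e (Suc n))) (t (\<lambda>n. e (Suc n))))"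
    unfolding eq by (intro dfi dt_rename[OF assms(1)] ntm_rename[OF assms(2)])
qed

text \<open>An entry of a Cohen condition: the real with index \<open>i\<close> has the digit
  \<open>b\<close> at \<open>n\<close>.\<close>

definition cell :: "'a \<Rightarrow> nat \<Rightarrow> nat \<Rightarrow> 'a" where "cell i n b = pr (pr i (num n)) (num b)"

lemma cell_inj [simp]: "cell i n b = cell i' n' b' \<longleftrightarrow> i = i' \<and> n = n' \<and> b = b'" by (simp add: cell_def)

lemma dt_cell [dfi]: "dt E s \<Longrightarrow> ntm t \<Longrightarrow> ntm u \<Longrightarrow> dt E (\<lambda>e. cell (s e) (t e) (u e))"
  unfolding cell_def by (intro dfi)

text \<open>The finite set of cells coded by \<open>c\<close>, with coordinates taken from the sequence \<open>j\<close>.\<close>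

definition cnd :: "(nat \<Rightarrow> 'a) \<Rightarrow> nat \<Rightarrow> 'a" where
  "cnd j c = mk {z. \<exists>a m b. prod_encode (a, prod_encode (m, b)) \<in> set_decode c \<and> z = cell (j a) m b}"

lemma el_cnd: "el (cnd j c) = {z. \<exists>a m b. prod_encode (a, prod_encode (m, b)) \<in> set_decode c \<and> z = cell (j a) m b}"
proof -
  have "{z. \<exists>a m b. prod_encode (a, prod_encode (m, b)) \<in> set_decode c \<and> z = cell (j a) m b}
    \<subseteq> (\<lambda>p. cell (j (fst (prod_decode p))) (fst (prod_decode (snd (prod_decode p)))) (snd (prod_decode (snd (prod_decode p))))) ` set_decode c"
    by force
  then have "finite {z. \<exists>a m b. prod_encode (a, prod_encode (m, b)) \<in> set_decode c \<and> z = cell (j a) m b}"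
    by (rule finite_surj[OF finite_set_decode])
  then show ?thesis unfolding cnd_def by (intro el_mk isset_finite)
qed

lemma finite_cnd: "finite (el (cnd j c))"
proof -
  have "el (cnd j c)
    \<subseteq> (\<lambda>p. cell (j (fst (prod_decode p))) (fst (prod_decode (snd (prod_decode p)))) (snd (prod_decode (snd (prod_decode p))))) ` set_decode c"
    unfolding el_cnd by force
  then show ?thesis by (rule finite_surj[OF finite_set_decode])
qed

lemma dt_cnd: assumes "\<And>f g. dt E (\<lambda>e. j (\<lambda>n. e (f n)) (nof (e g)))" "ntm t"
  shows "dt E (\<lambda>e. cnd (j e) (t e))"
proof (rule dtI)
  have "dfn E (\<lambda>e. el (e 0) = {z. \<exists>a m b. prod_encode (a, prod_encode (m, b)) \<in> set_decode (t (\<lambda>n. e (Suc n)))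
      \<and> z = cell (j (\<lambda>n. e (Suc n)) a) m b})"
    by (intro dfi ntm_rename[OF assms(2)] assms(1))
  then show "dfn E (\<lambda>e. e 0 = cnd (j (\<lambda>n. e (Suc n))) (t (\<lambda>n. e (Suc n))))"
    unfolding el_cnd[symmetric] el_inj .
qed

lemma cnd_ex: assumes "finite F" "\<And>e. e \<in> F \<Longrightarrow> \<exists>a m b. e = cell (j a) m b"
  shows "\<exists>c. el (cnd j c) = F"
proof -
  define K where "K = (\<lambda>p. cell (j (fst (prod_decode p))) (fst (prod_decode (snd (prod_decode p)))) (snd (prod_decode (snd (prod_decode p)))))"
  have "\<exists>p. e = K p" if "e \<in> F" for e
  proof -
    obtain a m b where "e = cell (j a) m b" using assms(2)[OF \<open>e \<in> F\<close>] by blast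
    then show ?thesis unfolding K_def by (intro exI[of _ "prod_encode (a, prod_encode (m, b))"]) simp
  qed
  then have "\<exists>h. \<forall>e\<in>F. e = K (h e)" by metis
  then obtain h where h: "\<forall>e\<in>F. e = K (h e)" by blast
  have "el (cnd j (set_encode (h ` F))) = F"
  proof -
    have "set_decode (set_encode (h ` F)) = h ` F" using assms(1) by simp
    moreover have "(\<exists>a m b. prod_encode (a, prod_encode (m, b)) \<in> A \<and> z = cell (j a) m b) \<longleftrightarrow> (\<exists>p\<in>A. z = K p)" for z A
    proof
      assume "\<exists>p\<in>A. z = K p"
      then obtain p where p: "p \<in> A" "z = K p" by blast
      have "p = prod_encode (fst (prod_decode p), prod_encode (fst (prod_decode (snd (prod_decode p))), snd (prod_decode (snd (prod_decode p)))))"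
        by simp
      then show "\<exists>a m b. prod_encode (a, prod_encode (m, b)) \<in> A \<and> z = cell (j a) m b"
        using p unfolding K_def by (intro exI conjI) auto
    next
      assume "\<exists>a m b. prod_encode (a, prod_encode (m, b)) \<in> A \<and> z = cell (j a) m b"
      then obtain a m b where "prod_encode (a, prod_encode (m, b)) \<in> A" "z = cell (j a) m b" by blast
      then show "\<exists>p\<in>A. z = K p" unfolding K_def by (intro bexI[of _ "prod_encode (a, prod_encode (m, b))"]) simp_all
    qed
    ultimately have "z \<in> el (cnd j (set_encode (h ` F))) \<longleftrightarrow> (\<exists>p\<in>h ` F. z = K p)" for z
      unfolding el_cnd by simp
    then show ?thesis using h by auto
  qed
  then show ?thesis by blast
qed

end

section \<open>Reals of a Cohen extension\<close>

locale cohen = chm M for M :: "'m \<Rightarrow> 'm \<Rightarrow> bool" +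
  fixes N :: "'n \<Rightarrow> 'n \<Rightarrow> bool" and I :: 'm and G :: "'m set" and vl :: "'m \<Rightarrow> 'n"
  assumes uncountable: "\<not> is_countable M I"
    and filter: "generic_filter M (Cohen_conditions M I) (Cohen_le M) G"
    and N_ext': "elts N x = elts N y \<Longrightarrow> x = y"
    and vl_surj': "\<exists>t. name M (Cohen_conditions M I) t \<and> vl t = x"
    and vl_el': "name M (Cohen_conditions M I) t \<Longrightarrow> elts N (vl t) =
      {vl s | s p e. name M (Cohen_conditions M I) s \<and> p \<in> G \<and> is_pair M s p e \<and> e \<in> elts M t}"
begin

lemma num01: "el b = {} \<longleftrightarrow> b = num 0" "el c = {num 0} \<longleftrightarrow> c = num (Suc 0)"
proof -
  show "el b = {} \<longleftrightarrow> b = num 0" using el_inj[of b "num 0"] el_num[of 0] by simp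
  show "el c = {num 0} \<longleftrightarrow> c = num (Suc 0)" using el_inj[of c "num (Suc 0)"] el_num[of "Suc 0"] by (simp add: lessThan_Suc)
qed

lemma conditions_iff: "p \<in> Cohen_conditions M I \<longleftrightarrow> finite (el p) \<and>
    (\<forall>e\<in>el p. \<exists>i\<in>el I. \<exists>n b. b < 2 \<and> e = cell i n b) \<and>
    (\<forall>z b b'. pr z b \<in> el p \<longrightarrow> pr z b' \<in> el p \<longrightarrow> b = b')"
proof -
  have "(\<exists>w i n z b. is_omega M w \<and> i \<in> el I \<and> n \<in> el w \<and> is_pair M i n z \<and> is_pair M z b e \<and>
        (el b = {} \<or> (\<exists>o'. el o' = {} \<and> el b = {o'}))) \<longleftrightarrow> (\<exists>i\<in>el I. \<exists>n b. b < 2 \<and> e = cell i n b)" (is "?L = ?R") for e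
  proof
    assume ?L
    then obtain i n b where i: "i \<in> el I" "n \<in> el Om" "e = pr (pr i n) b" "el b = {} \<or> (\<exists>o'. el o' = {} \<and> el b = {o'})"
      unfolding is_omega_iff is_pair_iff by blast
    from i(4) have "b = num 0 \<or> b = num (Suc 0)" using num01 by metis
    then obtain b' :: nat where "b' < 2" "b = num b'" by (elim disjE) (auto intro: that[of 0] that[of "Suc 0"] simp del: num.simps)
    moreover obtain m where "n = num m" using i(2) by auto
    ultimately show ?R using i(1,3) unfolding cell_def by blast
  next
    assume ?R
    then obtain i n b where i: "i \<in> el I" "b < 2" "e = cell i n b" by blast
    have "b = 0 \<or> b = Suc 0" using i(2) by linarith
    then have "el (num b) = {} \<or> (\<exists>o'. el o' = {} \<and> el (num b) = {o'})" using num01 by metis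
    moreover have "num n \<in> el Om" by simp
    ultimately show ?L using i unfolding is_omega_iff is_pair_iff cell_def by blast
  qed
  then show ?thesis unfolding Cohen_conditions_def mem_Collect_eq is_finite_iff single_valued_def graph_iff by simp
qed

lemma isset_conditions: "isset (Cohen_conditions M I)"
proof -
  have "isset {y. el y \<subseteq> {pr z b | z b. z \<in> {pr i n | i n. i \<in> el I \<and> n \<in> el Om} \<and> b \<in> el Om}}"
    by (intro isset_Pow isset_prod isset_el)
  moreover have "dfn M (\<lambda>e. finite (el (e 0)) \<and>
    (\<forall>z\<in>el (e 0). \<exists>i\<in>el I. \<exists>n b. b < 2 \<and> z = cell i n b) \<and>
    (\<forall>z b b'. pr z b \<in> el (e 0) \<longrightarrow> pr z b' \<in> el (e 0) \<longrightarrow> b = b'))" by (intro dfi)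
  ultimately have "isset {p. finite (el p) \<and>
    (\<forall>z\<in>el p. \<exists>i\<in>el I. \<exists>n b. b < 2 \<and> z = cell i n b) \<and>
    (\<forall>z b b'. pr z b \<in> el p \<longrightarrow> pr z b' \<in> el p \<longrightarrow> b = b')}"
    by (intro isset_sub[where Q="\<lambda>p. finite (el p) \<and>
    (\<forall>z\<in>el p. \<exists>i\<in>el I. \<exists>n b. b < 2 \<and> z = cell i n b) \<and>
    (\<forall>z b b'. pr z b \<in> el p \<longrightarrow> pr z b' \<in> el p \<longrightarrow> b = b')"]) (auto simp: cell_def)
  moreover have "Cohen_conditions M I = {p. finite (el p) \<and>
    (\<forall>z\<in>el p. \<exists>i\<in>el I. \<exists>n b. b < 2 \<and> z = cell i n b) \<and>
    (\<forall>z b b'. pr z b \<in> el p \<longrightarrow> pr z b' \<in> el p \<longrightarrow> b = b')}" using conditions_iff by blast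
  ultimately show ?thesis by simp
qed

abbreviation "Pm \<equiv> mk (Cohen_conditions M I)"

lemma el_Pm: "el Pm = Cohen_conditions M I" using isset_conditions by simp

end

sublocale cohen \<subseteq> forcing M N Pm "mk {}" "Cohen_le M" G vl
proof
  note f = filter[unfolded generic_filter_def]
  note G = conjunct1[OF f] conjunct1[OF conjunct2[OF f]] conjunct1[OF conjunct2[OF conjunct2[OF f]]]
    conjunct1[OF conjunct2[OF conjunct2[OF conjunct2[OF f]]]] conjunct2[OF conjunct2[OF conjunct2[OF conjunct2[OF f]]]]
  show "dfn M (\<lambda>e. Cohen_le M (e 0) (e 1))" unfolding Cohen_le_def by (intro dfi)
  have "mk {} \<in> Cohen_conditions M I" unfolding conditions_iff by (simp add: isset_empty)
  then show "mk {} \<in> G" using G(2,3) unfolding Cohen_le_def by (auto simp: isset_empty)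
  show "G \<subseteq> el Pm" unfolding el_Pm by (rule G(1))
  show "\<And>p q. p \<in> G \<Longrightarrow> q \<in> el Pm \<Longrightarrow> Cohen_le M p q \<Longrightarrow> q \<in> G" unfolding el_Pm using G(3) by blast
  show "\<And>p q. p \<in> G \<Longrightarrow> q \<in> G \<Longrightarrow> \<exists>r\<in>G. Cohen_le M r p \<and> Cohen_le M r q" using G(4) by blast
  show "\<And>d. dense_in M (el Pm) (Cohen_le M) d \<Longrightarrow> G \<inter> el d \<noteq> {}" unfolding el_Pm using G(5) by blast
  show "\<And>x. \<exists>t. name M (el Pm) t \<and> vl t = x" unfolding el_Pm by (rule vl_surj')
  show "\<And>t. name M (el Pm) t \<Longrightarrow> elts N (vl t) =
      {vl s | s p e. name M (el Pm) s \<and> p \<in> G \<and> is_pair M s p e \<and> e \<in> el t}" unfolding el_Pm by (rule vl_el')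
qed (auto simp: Cohen_le_def intro: N_ext')

context cohen
begin

lemma P_iff: "p \<in> P \<longleftrightarrow> finite (el p) \<and> (\<forall>e\<in>el p. \<exists>i\<in>el I. \<exists>n b. b < 2 \<and> e = cell i n b) \<and>
    (\<forall>z b b'. pr z b \<in> el p \<longrightarrow> pr z b' \<in> el p \<longrightarrow> b = b')"
  unfolding el_Pm by (rule conditions_iff)

lemma P_cell: "p \<in> P \<Longrightarrow> e \<in> el p \<Longrightarrow> \<exists>i\<in>el I. \<exists>n b. b < 2 \<and> e = cell i n b"
  unfolding P_iff by blast

lemma P_sv: "p \<in> P \<Longrightarrow> cell i n b \<in> el p \<Longrightarrow> cell i n b' \<in> el p \<Longrightarrow> b = b'"
  unfolding P_iff cell_def by (metis num_inj)

lemma P_I: assumes "isset F" "finite F" "\<And>e. e \<in> F \<Longrightarrow> \<exists>i\<in>el I. \<exists>n b. b < 2 \<and> e = cell i n b"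
  "\<And>i n b b'. cell i n b \<in> F \<Longrightarrow> cell i n b' \<in> F \<Longrightarrow> b = b'"
  shows "mk F \<in> P"
proof -
  have "b = b'" if "pr z b \<in> F" "pr z b' \<in> F" for z b b'
  proof -
    obtain i n c where 1: "pr z b = cell i n c" using assms(3)[OF \<open>pr z b \<in> F\<close>] by blast
    obtain i' n' c' where 2: "pr z b' = cell i' n' c'" using assms(3)[OF \<open>pr z b' \<in> F\<close>] by blast
    then have "cell i n c' \<in> F" "cell i n c \<in> F" using that 1 unfolding cell_def by auto
    then have "c = c'" using assms(4) by blast
    then show ?thesis using 1 2 unfolding cell_def by simp
  qed
  then show ?thesis unfolding P_iff el_mk[OF assms(1)] using assms(2,3) by blast
qed

lemma le_iff: "Cohen_le M q p \<longleftrightarrow> el p \<subseteq> el q" by (simp add: Cohen_le_def)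

lemma I_ne: obtains i0 where "i0 \<in> el I"
proof -
  have "el I \<noteq> {}" using countableI[of "\<lambda>_. mk {}" I] uncountable by (auto simp: efun_def dfi)
  then show ?thesis using that by blast
qed

text \<open>The countable chain condition, in the form that for a definable family of sets of conditions
  there are countably many coordinates on which it is predense: close off under choosing, for each
  condition on the coordinates found so far, a compatible member of the set.\<close>

lemma ccc:
  assumes S: "dfn M (\<lambda>e. S (nof (e 0)) (e 1))"
  obtains j where "efun j" "range j \<subseteq> el I"
    "\<And>n c p. cnd j c \<in> P \<Longrightarrow> p \<in> P \<Longrightarrow> S n p \<Longrightarrow> \<exists>q\<in>P. el p \<union> el (cnd j c) \<subseteq> el q \<Longrightarrow>
      \<exists>d. cnd j d \<in> P \<and> S n (cnd j d) \<and> (\<exists>q\<in>P. el (cnd j d) \<union> el (cnd j c) \<subseteq> el q)"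
proof -
  obtain i0 where i0: "i0 \<in> el I" by (rule I_ne)
  \<comment> \<open>A task is a pair of a number \<open>n\<close> and a condition \<open>s\<close>;
    \<open>w\<close> solves it by a member of the \<open>n\<close>-th set that is compatible with
    \<open>s\<close>, if there is one.\<close>
  define R where "R = (\<lambda>z p. \<exists>n s. z = pr (num n) s \<and> S n p \<and> (\<exists>q\<in>el Pm. el p \<subseteq> el q \<and> el s \<subseteq> el q))"
  have S': "dfn M (\<lambda>e. S (nof (e i)) (e k))" for i k
    using dfn_rename[OF S, of "case_nat i (\<lambda>_. k)"] by simp
  have R: "dfn M (\<lambda>e. R (e 0) (e 1))" unfolding R_def by (intro dfi S')
  obtain w where w: "dt M (\<lambda>e. w (e 0))" "\<And>z. \<exists>p\<in>el Pm. R z p \<Longrightarrow> w z \<in> el Pm \<and> R z (w z)"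
    by (rule uniformize[OF R, of Pm]) (erule that)
  define B where "B = mk {f. el f \<subseteq> {pr n i | n i. n \<in> el Om \<and> i \<in> el I}}"
  have B: "el B = {f. el f \<subseteq> {pr n i | n i. n \<in> el Om \<and> i \<in> el I}}"
    unfolding B_def by (intro el_mk isset_Pow isset_prod isset_el)
  \<comment> \<open>\<open>f\<close> lists, as values of \<open>ap i0\<close>, coordinates among
    which are all those used by \<open>p\<close>.\<close>
  define R2 where "R2 = (\<lambda>p f. (\<forall>n. ap i0 f n \<in> el I) \<and> (\<forall>i n b. cell i n b \<in> el p \<longrightarrow> (\<exists>k. ap i0 f k = i)))"
  have R2: "dfn M (\<lambda>e. R2 (e 0) (e 1))" unfolding R2_def by (intro dfi dt_ap)
  have apB: "ap i0 f n \<in> el I" if "f \<in> el B" for f n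
  proof (cases "\<exists>!y. pr (num n) y \<in> el f")
    case True
    then obtain y where y: "pr (num n) y \<in> el f" "\<forall>z. pr (num n) z \<in> el f \<longrightarrow> z = y" unfolding Ex1_def by (elim exE conjE)
    have "ap i0 f n = y" by (rule ap_eq[OF y(1)]) (erule y(2)[rule_format])
    moreover have "pr (num n) y \<in> {pr n i | n i. n \<in> el Om \<and> i \<in> el I}" using \<open>f \<in> el B\<close> y(1) unfolding B by blast
    ultimately show ?thesis by auto
  next
    case False
    then have "ap i0 f n = i0" unfolding ap_def by (rule if_not_P)
    then show ?thesis using i0 by simp
  qed
  have R2ex: "\<exists>f\<in>el B. R2 p f" if p: "p \<in> P" for p
  proof -
    define F where "F = {i. \<exists>n b. cell i n b \<in> el p}"
    have "F \<subseteq> (\<lambda>e. THE i. \<exists>n b. e = cell i n b) ` el p"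
    proof
      fix i assume "i \<in> F"
      then obtain n b where nb: "cell i n b \<in> el p" unfolding F_def by blast
      have "(THE i'. \<exists>n' b'. cell i n b = cell i' n' b') = i" by (rule the_equality) auto
      then show "i \<in> (\<lambda>e. THE i. \<exists>n b. e = cell i n b) ` el p" using nb by (intro image_eqI[of _ _ "cell i n b"]) simp_all
    qed
    moreover have "finite (el p)" using p unfolding P_iff by blast
    ultimately have "finite F" by (rule finite_surj[rotated])
    then obtain xs where xs: "set xs = F" using finite_list by blast
    have FI: "F \<subseteq> el I"
    proof
      fix i assume "i \<in> F"
      then obtain n b where "cell i n b \<in> el p" unfolding F_def by blast
      then show "i \<in> el I" using P_cell[OF p, of "cell i n b"] by auto
    qed
    have "isset ((\<lambda>k. pr (num k) (xs ! k)) ` {..<length xs})" by (intro isset_finite) simp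
    then obtain f where f: "el f = (\<lambda>k. pr (num k) (xs ! k)) ` {..<length xs}" by (auto simp: isset_def)
    have fB: "f \<in> el B" unfolding B mem_Collect_eq f using FI xs by (auto simp: nth_mem subset_iff)
    have "\<exists>k. ap i0 f k = i" if "i \<in> F" for i
    proof -
      obtain k where k: "k < length xs" "xs ! k = i" using \<open>i \<in> F\<close> unfolding xs[symmetric] in_set_conv_nth by blast
      have "ap i0 f k = i" by (rule ap_eq) (use k in \<open>auto simp: f\<close>)
      then show ?thesis by blast
    qed
    then have "R2 p f" unfolding R2_def using apB[OF fB] unfolding F_def by blast
    then show ?thesis using fB by blast
  qed
  obtain g where g: "dt M (\<lambda>e. g (e 0))" "\<And>z. \<exists>f\<in>el B. R2 z f \<Longrightarrow> g z \<in> el B \<and> R2 z (g z)"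
    "\<And>z. \<not> (\<exists>f\<in>el B. R2 z f) \<Longrightarrow> g z = mk {}"
    by (rule uniformize[OF R2, of B]) (rule that)
  have gI: "ap i0 (g z) n \<in> el I" for z n
  proof (cases "\<exists>f\<in>el B. R2 z f")
    case False
    then have "ap i0 (g z) n = i0" using g(3) by (intro ap_empty) (simp add: isset_empty)
    then show ?thesis using i0 by simp
  qed (use g(2) apB in blast)
  \<comment> \<open>One closing-off step. \<open>V x\<close> repeats the list \<open>x\<close> on
    the pairs with first component 0; the other pairs list the coordinates of the solutions of all
    tasks whose conditions are coded over \<open>x\<close>.\<close>
  define W where "W = (\<lambda>x m. w (pr (num (fst (prod_decode m))) (cnd (ap i0 x) (snd (prod_decode m)))))"
  define V where "V = (\<lambda>x n. if fst (prod_decode n) = 0 then ap i0 x (snd (prod_decode n))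
      else ap i0 (g (W x (fst (prod_decode n) - 1))) (snd (prod_decode n)))"
  have cnd': "dt M (\<lambda>e. cnd (ap i0 (e k)) (t e))" if "ntm t" for k t
    by (rule dt_cnd) (intro dfi dt_ap that)+
  have W: "dt M (\<lambda>e. W (e k) (t e))" if "ntm t" for k t
    unfolding W_def by (intro dt_sub[OF w(1)] dfi cnd' that)
  have Vd: "dfn M (\<lambda>e. e i = V (e k) (nof (e l)))" for i k l
  proof -
    have "dfn M (\<lambda>e. if fst (prod_decode (nof (e l))) = 0 then e i = ap i0 (e k) (snd (prod_decode (nof (e l))))
      else e i = ap i0 (g (W (e k) (fst (prod_decode (nof (e l))) - 1))) (snd (prod_decode (nof (e l)))))"
      by (intro dfi dt_ap dt_sub[OF g(1)] W)
    then show ?thesis unfolding V_def by (simp add: if_distrib cong: if_cong)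
  qed
  define F where "F = (\<lambda>x. mk {z. \<exists>n y. y = V x n \<and> z = pr (num n) y})"
  have F: "el (F x) = {z. \<exists>n y. y = V x n \<and> z = pr (num n) y}" for x
  proof -
    have "dfn M (\<lambda>e. e 0 = V x (nof (e 1)))"
      by (rule dfn_sub[where Q="\<lambda>x e. e 0 = V x (nof (e 1))" and t="\<lambda>_. x"], use Vd[of "Suc 0" 0 "Suc (Suc 0)"] in simp, rule dt_const)
    then have "efun (V x)" unfolding efun_def dt_def by simp
    then have "isset (range (\<lambda>n. pr (num n) (V x n)))" by (intro isset_range) (unfold efun_def, intro dfi)
    moreover have "range (\<lambda>n. pr (num n) (V x n)) = {z. \<exists>n y. y = V x n \<and> z = pr (num n) y}" by blast
    ultimately show ?thesis unfolding F_def by (intro el_mk) simp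
  qed
  have apF: "ap i0 (F x) n = V x n" for x n by (rule ap_eq) (unfold F, auto)
  have Fd: "dt M (\<lambda>e. F (e k))" for k
  proof (rule dtI)
    have "dfn M (\<lambda>e. el (e 0) = {z. \<exists>n y. y = V (e (Suc k)) n \<and> z = pr (num n) y})" by (intro dfi Vd)
    then show "dfn M (\<lambda>e. e 0 = F (e (Suc k)))" unfolding F[symmetric] el_inj .
  qed
  define J where "J = (\<lambda>n. rec_nat (mk {}) (\<lambda>_ x. F x) n)"
  have J: "efun J" by (rule efun_rec[of "\<lambda>_ x. F x"]) (use Fd[of 1] in \<open>simp_all add: J_def\<close>)
  define h where "h = (\<lambda>k. ap i0 (J k))"
  have h0: "h 0 n = i0" for n unfolding h_def J_def by (intro ap_empty) (simp add: isset_empty)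
  have hS: "h (Suc k) n = V (J k) n" for k n unfolding h_def using apF by (simp add: J_def)
  have hV0: "h (Suc k) (prod_encode (0, n)) = h k n" for k n unfolding hS V_def by (simp add: h_def)
  have hV1: "h (Suc k) (prod_encode (Suc (prod_encode (n, c)), a)) = ap i0 (g (w (pr (num n) (cnd (h k) c)))) a" for k n c a
    unfolding hS V_def W_def by (simp add: h_def)
  have hmono: "k \<le> l \<Longrightarrow> range (h k) \<subseteq> range (h l)" for k l
  proof (induction l rule: dec_induct)
    case (step l)
    have "range (h l) \<subseteq> range (h (Suc l))" using hV0[of l] by (metis image_subsetI rangeI)
    then show ?case using step by blast
  qed simp
  have hI: "h k n \<in> el I" for k n
  proof (induction k arbitrary: n)
    case 0 then show ?case using h0 i0 by simp
  next
    case (Suc k)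
    have "ap i0 (J k) m \<in> el I" for m using Suc[of m] unfolding h_def .
    then show ?case unfolding hS V_def using gI by simp
  qed
  define j where "j = (\<lambda>m. h (fst (prod_decode m)) (snd (prod_decode m)))"
  have "efun j" unfolding j_def h_def efun_def by (intro dt_ap dt_efun[OF J] dfi)
  moreover have rj: "range (h k) \<subseteq> range j" for k
  proof
    fix i assume "i \<in> range (h k)"
    then obtain n where "i = h k n" by blast
    then have "i = j (prod_encode (k, n))" by (simp add: j_def)
    then show "i \<in> range j" by blast
  qed
  moreover have "range j \<subseteq> el I" unfolding j_def using hI by blast
  moreover have "\<exists>d. cnd j d \<in> P \<and> S n (cnd j d) \<and> (\<exists>q\<in>P. el (cnd j d) \<union> el (cnd j c) \<subseteq> el q)"
    if c: "cnd j c \<in> P" and p: "p \<in> P" "S n p" and comp: "\<exists>q\<in>P. el p \<union> el (cnd j c) \<subseteq> el q" for n c p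
  proof -
    \<comment> \<open>A condition over the union of all stages involves finitely many coordinates
      and so is coded over one stage \<open>K\<close>; the coordinates of its solution were added at
      the next stage.\<close>
    define K where "K = Max (insert 0 ((\<lambda>z. fst (prod_decode (fst (prod_decode z)))) ` set_decode c))"
    have K: "fst (prod_decode a) \<le> K" if "prod_encode (a, y) \<in> set_decode c" for a y
      unfolding K_def using that by (intro Max_ge) (auto intro!: image_eqI[of _ _ "prod_encode (a, y)"])
    have "\<exists>c'. el (cnd (h K) c') = el (cnd j c)"
    proof (rule cnd_ex[OF finite_cnd])
      fix e assume "e \<in> el (cnd j c)"
      then obtain a m b where e: "prod_encode (a, prod_encode (m, b)) \<in> set_decode c" "e = cell (j a) m b"
        unfolding el_cnd by blast
      have "j a \<in> range (h K)" using hmono[OF K[OF e(1)]] unfolding j_def by blast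
      then obtain a' where "j a = h K a'" by (elim rangeE)
      then show "\<exists>a m b. e = cell (h K a) m b" unfolding e(2) by (intro exI) (erule arg_cong)
    qed
    then obtain c' where c': "cnd (h K) c' = cnd j c" unfolding el_inj by blast
    define z where "z = pr (num n) (cnd j c)"
    have "R z p" unfolding R_def z_def using p(2) comp by blast
    then have "w z \<in> P \<and> R z (w z)" using w(2)[of z] p(1) by blast
    then have wz: "w z \<in> P" "S n (w z)" "\<exists>q\<in>P. el (w z) \<subseteq> el q \<and> el (cnd j c) \<subseteq> el q"
      unfolding R_def z_def by auto
    have gz: "R2 (w z) (g (w z))" using g(2)[OF R2ex[OF wz(1)]] by blast
    have "\<exists>d. el (cnd j d) = el (w z)"
    proof (rule cnd_ex)
      show "finite (el (w z))" using wz(1) unfolding P_iff by blast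
      fix e assume e: "e \<in> el (w z)"
      then obtain i m b where i: "e = cell i m b" using P_cell[OF wz(1)] by blast
      then obtain a where "ap i0 (g (w z)) a = i" using gz e unfolding R2_def by blast
      then have "h (Suc K) (prod_encode (Suc (prod_encode (n, c')), a)) = i" unfolding hV1 c' z_def .
      then have "i \<in> range j" using rj by blast
      then show "\<exists>a m b. e = cell (j a) m b" using i by blast
    qed
    then obtain d where d: "cnd j d = w z" unfolding el_inj by blast
    show ?thesis using wz unfolding d[symmetric] by blast
  qed
  ultimately show ?thesis using that[of j] by blast
qed

text \<open>By \<open>ccc\<close> the conditions on the coordinates \<open>range j\<close> suffice
  to decide membership in \<open>B\<close>, and these conditions are coded by numbers. Since
  \<open>I\<close> is uncountable there is an index \<open>i\<close> outside \<open>range j\<close>;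
  as conditions on disjoint sets of coordinates do not interfere, its real \<open>c\<close> is
  generic together with the filter \<open>H\<close>.\<close>

theorem real_generic:
  assumes B: "B \<in> N.AA"
  obtains Q T H c S where "generic_real AA N.AA Q T H c" "S \<in> AA" "B = {n. \<exists>q\<in>H. prod_encode (n, q) \<in> S}"
proof -
  obtain t where t: "nm t" "vl t = N.re B" by (rule name_of)
  define S0 where "S0 = (\<lambda>n p. Fmem p (nn n) t)"
  have S0: "dfn M (\<lambda>e. S0 (nof (e i)) (e k))" for i k
    unfolding S0_def by (intro dfn_Fmem dfi dt_efun[OF efun_nn])
  have B0: "n \<in> B \<longleftrightarrow> (\<exists>p\<in>G. S0 n p)" for n
  proof -
    have "n \<in> B \<longleftrightarrow> N.num n \<in> N.el (vl t)" unfolding t(2) N.re_AA[OF B] by auto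
    then show ?thesis unfolding N_num S0_def using Fmem_truth[OF nm_nn t(1)] by blast
  qed
  obtain j where j: "efun j" "range j \<subseteq> el I"
    and jc: "\<And>n c p. cnd j c \<in> P \<Longrightarrow> p \<in> P \<Longrightarrow> S0 n p \<Longrightarrow> \<exists>q\<in>P. el p \<union> el (cnd j c) \<subseteq> el q \<Longrightarrow>
      \<exists>d. cnd j d \<in> P \<and> S0 n (cnd j d) \<and> (\<exists>q\<in>P. el (cnd j d) \<union> el (cnd j c) \<subseteq> el q)"
    by (rule ccc[of S0, OF S0]) (erule that)
  obtain i where i: "i \<in> el I" "i \<notin> range j" using countableI[OF j(1), of I] uncountable by blast
  have cj: "dt M (\<lambda>e. cnd j (u e))" if "ntm u" for u
    by (rule dt_cnd) (intro dt_efun[OF j(1)] dfi that)+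
  define Q where "Q = {c. cnd j c \<in> el Pm}"
  define T where "T = {z. el (cnd j (snd (prod_decode z))) \<subseteq> el (cnd j (fst (prod_decode z)))}"
  define H where "H = {c \<in> Q. cnd j c \<in> G}"
  \<comment> \<open>Written as an unordered pair so that definability is an instance of the rule for
    these.\<close>
  define one_cell where "one_cell = (\<lambda>m. mk {cell i m 1, cell i m 1})"
  define c where "c = {m \<in> UNIV. one_cell m \<in> G}"
  define S where "S = {z. snd (prod_decode z) \<in> Q \<and> S0 (fst (prod_decode z)) (cnd j (snd (prod_decode z)))}"
  have QA: "Q \<in> AA" unfolding Q_def by (rule AA_I) (intro dfi cj)
  have TA: "T \<in> AA" unfolding T_def by (rule AA_I) (intro dfi cj)
  have SA: "S \<in> AA" unfolding S_def
  proof (rule AA_I)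
    have "dfn M (\<lambda>e. S0 (fst (prod_decode (nof (e 0)))) (cnd j (snd (prod_decode (nof (e 0))))))"
      unfolding S0_def by (intro dfn_Fmem dfi dt_efun[OF efun_nn] cj)
    then show "dfn M (\<lambda>e. snd (prod_decode (nof (e 0))) \<in> Q \<and> S0 (fst (prod_decode (nof (e 0)))) (cnd j (snd (prod_decode (nof (e 0))))))"
      by (intro dfi QA)
  qed
  have HA: "H \<in> N.AA" unfolding H_def
  proof (rule real_name)
    show "efun (cnd j)" unfolding efun_def by (intro cj dfi)
  qed (use QA in \<open>simp_all add: Q_def\<close>)
  have UNIV: "UNIV \<in> AA" by (rule AA_stm) (intro dfi)
  have el1: "el (one_cell m) = {cell i m 1}" for m unfolding one_cell_def by (simp add: isset_rules)
  have oneP: "one_cell m \<in> P" for m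
  proof -
    have "mk {cell i m 1} \<in> P"
    proof (rule P_I)
      show "\<exists>i\<in>el I. \<exists>n b. b < 2 \<and> e = cell i n b" if "e \<in> {cell i m 1}" for e
        using i(1) that by (intro bexI[of _ i] exI[of _ m] exI[of _ 1]) auto
    qed (simp_all add: isset_sing)
    then show ?thesis unfolding one_cell_def by simp
  qed
  have cA: "c \<in> N.AA" unfolding c_def
  proof (rule real_name)
    show "efun one_cell" unfolding efun_def one_cell_def by (intro dfn_el_upair dfi)
  qed (use UNIV oneP in auto)
  have c_iff: "m \<in> c \<longleftrightarrow> (\<exists>p\<in>G. cell i m 1 \<in> el p)" for m
  proof
    assume "m \<in> c" then show "\<exists>p\<in>G. cell i m 1 \<in> el p" unfolding c_def using el1 by blast
  next
    assume "\<exists>p\<in>G. cell i m 1 \<in> el p"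
    then obtain p where "p \<in> G" "cell i m 1 \<in> el p" by blast
    then show "m \<in> c" unfolding c_def using G_up[OF _ oneP, of p m] by (simp add: le_iff el1)
  qed
  have c_bit: "b = (if m \<in> c then 1 else 0)" if p: "p \<in> G" "cell i m b \<in> el p" for p m b
  proof -
    have pP: "p \<in> P" using p(1) G_P by blast
    then have "b < 2" using P_cell[OF pP p(2)] by auto
    then consider "b = 1" | "b = 0" by linarith
    then show ?thesis
    proof cases
      case 1 then show ?thesis using c_iff p by auto
    next
      case 2
      have "m \<notin> c"
      proof
        assume "m \<in> c"
        then obtain q where q: "q \<in> G" "cell i m 1 \<in> el q" using c_iff by blast
        obtain r where r: "r \<in> G" "Cohen_le M r p" "Cohen_le M r q" using G_dir[OF p(1) q(1)] by blast
        have "r \<in> P" using r(1) G_P by blast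
        then have "(0::nat) = 1" by (rule P_sv) (use r p(2) q(2) 2 in \<open>auto simp: le_iff\<close>)
        then show False by simp
      qed
      then show ?thesis using 2 by simp
    qed
  qed
  have restrict: "\<exists>q. el (cnd j q) = {e \<in> el p. \<exists>a m b. e = cell (j a) m b}" if "p \<in> P" for p
    by (rule cnd_ex) (use that in \<open>auto simp: P_iff\<close>)
  have restrictP: "cnd j q \<in> P" if "p \<in> P" "el (cnd j q) \<subseteq> el p" for p q
    using that finite_cnd unfolding P_iff by blast
  have "B = {n. \<exists>q\<in>H. prod_encode (n, q) \<in> S}"
  proof (intro equalityI subsetI)
    fix n assume "n \<in> {n. \<exists>q\<in>H. prod_encode (n, q) \<in> S}"
    then show "n \<in> B" unfolding B0 H_def S_def by auto
  next
    fix n assume "n \<in> B"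
    then obtain p where p: "p \<in> G" "S0 n p" using B0 by blast
    \<comment> \<open>Density below \<open>p\<close>: the part of \<open>q\<close> on
      \<open>range j\<close> is compatible with \<open>p\<close>, hence with some
      \<open>cnd j d\<close> that also forces \<open>n\<close> into \<open>B\<close>. Joined with
      all of \<open>q\<close> this is still a condition, because \<open>cnd j d\<close> uses no
      coordinate outside \<open>range j\<close>.\<close>
    define D where "D = (\<lambda>r. \<exists>d. cnd j d \<in> el Pm \<and> S0 n (cnd j d) \<and> el (cnd j d) \<subseteq> el r)"
    have "dfn M (\<lambda>e. S0 n (cnd j (nof (e 0))))" unfolding S0_def by (intro dfn_Fmem dfi cj)
    then have D: "dfn M (\<lambda>e. D (e 0))" unfolding D_def S0_def by (intro dfi cj dfn_Fmem)
    have "\<exists>r\<in>G. Cohen_le M r p \<and> D r"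
    proof (rule gen_below[OF D p(1)])
      fix q assume q: "q \<in> P" "Cohen_le M q p"
      obtain q' where q': "el (cnd j q') = {e \<in> el q. \<exists>a m b. e = cell (j a) m b}" using restrict[OF q(1)] by blast
      have q'P: "cnd j q' \<in> P" by (rule restrictP[OF q(1)]) (use q' in blast)
      have pP: "p \<in> P" using p(1) G_P by blast
      have "\<exists>r\<in>P. el p \<union> el (cnd j q') \<subseteq> el r" using q q' unfolding le_iff by (intro bexI[of _ q]) auto
      then obtain d r where d: "cnd j d \<in> P" "S0 n (cnd j d)" "r \<in> P" "el (cnd j d) \<union> el (cnd j q') \<subseteq> el r"
        using jc[OF q'P pP p(2)] by blast
      have fin: "finite (el q \<union> el (cnd j d))" using q(1) finite_cnd unfolding P_iff by blast
      have "mk (el q \<union> el (cnd j d)) \<in> P"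
      proof (rule P_I)
        fix e assume "e \<in> el q \<union> el (cnd j d)"
        then show "\<exists>i\<in>el I. \<exists>n b. b < 2 \<and> e = cell i n b" using P_cell q(1) d(1) by blast
      next
        fix i' n b b' assume a: "cell i' n b \<in> el q \<union> el (cnd j d)" "cell i' n b' \<in> el q \<union> el (cnd j d)"
        show "b = b'"
        proof (cases "i' \<in> range j")
          case True
          then have "cell i' n x \<in> el q \<Longrightarrow> cell i' n x \<in> el (cnd j q')" for x unfolding q' by blast
          then have "cell i' n b \<in> el r" "cell i' n b' \<in> el r" using a d(4) by blast+
          then show ?thesis by (rule P_sv[OF d(3)])
        next
          case False
          then have "cell i' n x \<notin> el (cnd j d)" for x unfolding el_cnd by auto
          then show ?thesis using a P_sv[OF q(1)] by blast
        qed
      qed (use fin isset_finite in auto)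
      moreover have "el (mk (el q \<union> el (cnd j d))) = el q \<union> el (cnd j d)" using fin isset_finite by auto
      ultimately show "\<exists>r\<in>P. Cohen_le M r q \<and> D r" unfolding D_def le_iff using d(1,2) by blast
    qed
    then obtain r d where r: "r \<in> G" "cnd j d \<in> P" "S0 n (cnd j d)" "el (cnd j d) \<subseteq> el r" unfolding D_def by blast
    then have "cnd j d \<in> G" using G_up by (simp add: le_iff)
    then show "n \<in> {n. \<exists>q\<in>H. prod_encode (n, q) \<in> S}" using r unfolding H_def S_def Q_def by auto
  qed
  moreover have "generic_real AA N.AA Q T H c"
  proof
    have "mk {} \<in> P" using one G_P by blast
    obtain q where "el (cnd j q) = {}" using cnd_ex[of "{}" j] by auto
    then have "cnd j q \<in> G" using el_inj[of "cnd j q" "mk {}"] one by (simp add: isset_empty)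
    then show "H \<noteq> {}" unfolding H_def Q_def using G_P by blast
    show "prod_encode (q, q) \<in> T" for q unfolding T_def by simp
    show "prod_encode (p, r) \<in> T" if "prod_encode (p, q) \<in> T" "prod_encode (q, r) \<in> T" for p q r
      using that unfolding T_def by auto
    show "r \<in> H" if "q \<in> H" "r \<in> Q" "prod_encode (q, r) \<in> T" for q r
      using that G_up unfolding H_def Q_def T_def by (auto simp: le_iff)
    show "\<exists>p\<in>H. prod_encode (p, q) \<in> T \<and> prod_encode (p, r) \<in> T" if qr: "q \<in> H" "r \<in> H" for q r
    proof -
      obtain p where p: "p \<in> G" "el (cnd j q) \<subseteq> el p" "el (cnd j r) \<subseteq> el p"
        using G_dir[of "cnd j q" "cnd j r"] qr unfolding H_def le_iff by blast
      have pP: "p \<in> P" using p(1) G_P by blast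
      obtain s where s: "el (cnd j s) = {e \<in> el p. \<exists>a m b. e = cell (j a) m b}" using restrict[OF pP] by blast
      then have sP: "cnd j s \<in> P" by (intro restrictP[OF pP]) blast
      then have "cnd j s \<in> G" using G_up[OF p(1)] s unfolding le_iff by blast
      moreover have "el (cnd j q) \<subseteq> el (cnd j s)" "el (cnd j r) \<subseteq> el (cnd j s)"
      proof -
        have "\<exists>a m b. e = cell (j a) m b" if "e \<in> el (cnd j u)" for e u using that unfolding el_cnd by blast
        then show "el (cnd j q) \<subseteq> el (cnd j s)" "el (cnd j r) \<subseteq> el (cnd j s)" using p(2,3) unfolding s by blast+
      qed
      ultimately show ?thesis using sP unfolding H_def Q_def T_def by (intro bexI[of _ s]) auto
    qed
    fix D assume D: "D \<in> AA"
    \<comment> \<open>These conditions realise a pair in \<open>D\<close>: they contain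
      \<open>cnd j q\<close> and spell out, at the coordinate \<open>i\<close>, the sequence of
      length \<open>k\<close> that \<open>s\<close> codes.\<close>
    define D' where "D' = (\<lambda>p. \<exists>q\<in>Q. \<exists>s. prod_encode (q, s) \<in> D \<and> el (cnd j q) \<subseteq> el p \<and>
      (\<exists>k\<in>set_decode s. (\<forall>m. m < k \<longrightarrow> cell i m (if m \<in> set_decode s then 1 else 0) \<in> el p) \<and> (\<forall>m\<in>set_decode s. m \<le> k)))"
    have D': "dfn M (\<lambda>e. D' (e 0))" unfolding D'_def by (intro dfi cj QA D)
    from gen[OF D'] show "(\<exists>q\<in>H. \<exists>k. prod_encode (q, cyl c k) \<in> D) \<or>
      (\<exists>q\<in>H. \<exists>k. \<forall>q'\<in>Q. prod_encode (q', q) \<in> T \<longrightarrow>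
        (\<forall>x k'. k \<le> k' \<longrightarrow> x \<inter> {..<k} = c \<inter> {..<k} \<longrightarrow> prod_encode (q', cyl x k') \<notin> D))"
    proof
      assume "\<exists>p\<in>G. D' p"
      then obtain p q s k where p: "p \<in> G" "q \<in> Q" "prod_encode (q, s) \<in> D" "el (cnd j q) \<subseteq> el p" "k \<in> set_decode s"
        "\<forall>m. m < k \<longrightarrow> cell i m (if m \<in> set_decode s then 1 else 0) \<in> el p" "\<forall>m\<in>set_decode s. m \<le> k" unfolding D'_def by blast
      have qH: "q \<in> H" using p(1,2,4) G_up unfolding H_def Q_def by (auto simp: le_iff)
      have bit: "m \<in> set_decode s \<longleftrightarrow> m \<in> c" if "m < k" for m
      proof -
        have "cell i m (if m \<in> set_decode s then 1 else 0) \<in> el p" using p(6) that by blast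
        from c_bit[OF p(1) this] show ?thesis by (auto split: if_splits)
      qed
      have "set_decode s = insert k (c \<inter> {..<k})"
      proof (intro equalityI subsetI)
        fix m assume m: "m \<in> set_decode s"
        then have "m = k \<or> m < k" using p(7) by fastforce
        then show "m \<in> insert k (c \<inter> {..<k})" using bit m by auto
      qed (use bit p(5) in auto)
      then have "s = cyl c k" unfolding cyl_def by (metis set_decode_inverse)
      then show ?thesis using p(3) qH by blast
    next
      assume "\<exists>p\<in>G. \<forall>q\<in>P. Cohen_le M q p \<longrightarrow> \<not> D' q"
      then obtain p where p: "p \<in> G" "\<forall>q\<in>P. Cohen_le M q p \<longrightarrow> \<not> D' q" by blast
      have pP: "p \<in> P" using p(1) G_P by blast
      obtain q where q: "el (cnd j q) = {e \<in> el p. \<exists>a m b. e = cell (j a) m b}" using restrict[OF pP] by blast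
      have qP: "cnd j q \<in> P" by (rule restrictP[OF pP]) (use q in blast)
      then have "cnd j q \<in> G" using G_up[OF p(1)] q unfolding le_iff by blast
      then have qH: "q \<in> H" unfolding H_def Q_def using qP by blast
      define bd where "bd = (\<lambda>e. THE m. \<exists>i b. e = cell i m b)"
      have bd: "bd (cell i m b) = m" for i m b unfolding bd_def by (rule the_equality) auto
      \<comment> \<open>From \<open>k\<close> on the condition \<open>p\<close> says nothing about
        any of the reals, so the digits of \<open>x\<close> there are free.\<close>
      define k where "k = Suc (Max (insert 0 (bd ` el p)))"
      have k: "m < k" if "cell i' m b \<in> el p" for i' m b
      proof -
        have "finite (el p)" using pP unfolding P_iff by blast
        moreover have "m \<in> bd ` el p" using bd[of i' m b] that by (metis imageI)
        ultimately have "m \<le> Max (insert 0 (bd ` el p))" by (intro Max_ge) auto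
        then show ?thesis by (simp add: k_def)
      qed
      have "prod_encode (q', cyl x k') \<notin> D" if q': "q' \<in> Q" "prod_encode (q', q) \<in> T" and x: "k \<le> k'" "x \<inter> {..<k} = c \<inter> {..<k}" for q' x k'
      proof
        assume inD: "prod_encode (q', cyl x k') \<in> D"
        define Y where "Y = (\<lambda>m. cell i m (if m \<in> x then 1 else 0)) ` {..<k'}"
        \<comment> \<open>No conflict arises: on \<open>range j\<close> the condition coded by
          \<open>q'\<close> contains all that \<open>p\<close> says, at \<open>i\<close> both
          \<open>p\<close> and \<open>Y\<close> agree with \<open>x\<close>, and elsewhere only
          \<open>p\<close> speaks.\<close>
        define F where "F = el p \<union> el (cnd j q') \<union> Y"
        have fin: "finite F" unfolding F_def Y_def using finite_cnd pP unfolding P_iff by blast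
        have q'P: "cnd j q' \<in> P" using q'(1) unfolding Q_def by blast
        have sub: "el (cnd j q) \<subseteq> el (cnd j q')" using q'(2) unfolding T_def by simp
        have iF: "b = (if m \<in> x then 1 else 0)" if cF: "cell i m b \<in> F" for m b
        proof -
          have "cell i m b \<notin> el (cnd j q')" using i(2) unfolding el_cnd by auto
          then consider "cell i m b \<in> el p" | "cell i m b \<in> Y" using cF unfolding F_def by blast
          then show ?thesis
          proof cases
            case 1
            have "m \<in> x \<longleftrightarrow> m \<in> c" using k[OF 1] x(2) by blast
            then show ?thesis using c_bit[OF p(1) 1] by simp
          qed (auto simp: Y_def)
        qed
        have FP: "mk F \<in> P"
        proof (rule P_I)
          fix e assume "e \<in> F"
          then show "\<exists>i\<in>el I. \<exists>n b. b < 2 \<and> e = cell i n b" unfolding F_def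
          proof (elim UnE)
            assume "e \<in> Y"
            then obtain m where "e = cell i m (if m \<in> x then 1 else 0)" unfolding Y_def by blast
            moreover have "(if m \<in> x then 1 else 0) < (2::nat)" by simp
            ultimately show ?thesis using i(1) by blast
          qed (use P_cell pP q'P in blast)+
        next
          fix i' n b b' assume a: "cell i' n b \<in> F" "cell i' n b' \<in> F"
          consider "i' = i" | "i' \<noteq> i" "i' \<in> range j" | "i' \<noteq> i" "i' \<notin> range j" by blast
          then show "b = b'"
          proof cases
            case 1 then show ?thesis using iF a by metis
          next
            case 2
            then have 2: "\<exists>a m b. cell i' n y = cell (j a) m b" for y by (auto simp: image_iff)
            have "cell i' n y \<notin> Y" for y using \<open>i' \<noteq> i\<close> unfolding Y_def by auto
            then have "cell i' n y \<in> F \<Longrightarrow> cell i' n y \<in> el (cnd j q')" for y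
              using subsetD[OF sub, of "cell i' n y"] 2[of y] unfolding F_def q Un_iff mem_Collect_eq by metis
            then show ?thesis using P_sv[OF q'P] a by blast
          next
            case 3
            then have "cell i' n y \<notin> el (cnd j q')" "cell i' n y \<notin> Y" for y unfolding el_cnd Y_def by auto
            then show ?thesis using P_sv[OF pP] a unfolding F_def by blast
          qed
        qed (use fin isset_finite in auto)
        have elF: "el (mk F) = F" using fin isset_finite by auto
        have cells: "cell i m (if m \<in> set_decode (cyl x k') then 1 else 0) \<in> el (mk F)" if "m < k'" for m
        proof -
          have "m \<in> set_decode (cyl x k') \<longleftrightarrow> m \<in> x" using that unfolding cyl_decode by auto
          then have "cell i m (if m \<in> set_decode (cyl x k') then 1 else 0) \<in> F"
            using that unfolding F_def Y_def by auto
          then show ?thesis unfolding elF .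
        qed
        have "el (cnd j q') \<subseteq> F" unfolding F_def by blast
        then have sub2: "el (cnd j q') \<subseteq> el (mk F)" unfolding elF .
        have ks: "k' \<in> set_decode (cyl x k')" "\<forall>m\<in>set_decode (cyl x k'). m \<le> k'" unfolding cyl_decode by auto
        have "D' (mk F)" unfolding D'_def
          by (rule bexI[OF _ q'(1)], rule exI[of _ "cyl x k'"], intro conjI inD sub2, rule bexI[OF _ ks(1)])
            (use cells ks(2) in blast)
        moreover have "el p \<subseteq> el (mk F)"
        proof -
          have "el p \<subseteq> F" unfolding F_def by blast
          then show ?thesis unfolding elF .
        qed
        ultimately show False using p(2) FP unfolding le_iff by blast
      qed
      then show ?thesis using qH by blast
    qed
  qed (use QA TA HA cA in \<open>auto simp: H_def\<close>)
  ultimately show ?thesis using that SA by blast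
qed

end

section \<open>Two sets of reals with a large symmetric difference\<close>

text \<open>A basic clopen set of the Cantor space: a union of finitely many cylinders.\<close>

definition cov :: "nat \<Rightarrow> nat set set" where "cov b = {x. \<exists>k. cyl x k \<in> set_decode b}"
definition sd :: "nat set \<Rightarrow> nat set \<Rightarrow> nat set" where "sd x y = {n. (n \<in> x) \<noteq> (n \<in> y)}"
definition md :: "nat set \<Rightarrow> nat \<Rightarrow> nat \<Rightarrow> nat set" where "md x s k = {n. if n < k then n \<in> set_decode s else n \<in> x}"
definition fn :: "nat set \<Rightarrow> nat \<Rightarrow> nat" where "fn h i = mu (\<lambda>y. prod_encode (i, y) \<in> h)"
definition gr :: "(nat \<Rightarrow> nat) \<Rightarrow> nat set" where "gr f = {p. snd (prod_decode p) = f (fst (prod_decode p))}"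

lemma fn_gr [simp]: "fn (gr f) = f"
proof
  fix i show "fn (gr f) i = f i" unfolding fn_def gr_def by (rule sym, subst mu_iff) auto
qed

lemma decode_less: assumes "n \<in> set_decode c" shows "n < c"
proof -
  have "odd (c div 2 ^ n)" using assms by (simp add: set_decode_def)
  then have "c div 2 ^ n \<noteq> 0" by (intro notI) simp
  then have "2 ^ n \<le> c" by (metis div_less not_le)
  then show ?thesis using less_exp[of n] by linarith
qed

lemma cyl_decode_less: "cyl x k \<in> set_decode b \<Longrightarrow> k < b"
  using decode_less[of "cyl x k" b] decode_less[of k "cyl x k"] cyl_decode[of x k] by simp

text \<open>The elements of a coded finite set are smaller than its code, so all cylinders in
  \<open>cov b\<close> have length below \<open>b\<close>: the code bounds the number of digits that
  matter.\<close>

lemma cov_cong: assumes "x \<inter> {..<b} = y \<inter> {..<b}" shows "x \<in> cov b \<longleftrightarrow> y \<in> cov b"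
proof -
  have eq: "cyl x k = cyl y k" if "k < b" for k
  proof -
    have "x \<inter> {..<k} = (x \<inter> {..<b}) \<inter> {..<k}" "y \<inter> {..<k} = (y \<inter> {..<b}) \<inter> {..<k}" using that by auto
    then show ?thesis using assms unfolding cyl_eq by simp
  qed
  show ?thesis
  proof
    assume "x \<in> cov b"
    then obtain k where k: "cyl x k \<in> set_decode b" unfolding cov_def by blast
    then have "cyl y k \<in> set_decode b" using eq[OF cyl_decode_less[OF k]] by simp
    then show "y \<in> cov b" unfolding cov_def by blast
  next
    assume "y \<in> cov b"
    then obtain k where k: "cyl y k \<in> set_decode b" unfolding cov_def by blast
    then have "cyl x k \<in> set_decode b" using eq[OF cyl_decode_less[OF k]] by simp
    then show "x \<in> cov b" unfolding cov_def by blast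
  qed
qed

lemma sd_iff [simp]: "n \<in> sd x y \<longleftrightarrow> (n \<in> x) \<noteq> (n \<in> y)" by (simp add: sd_def)

text \<open>A stage of the construction is coded by one real with columns \<open>as\<close>, \<open>ws\<close>, \<open>al\<close>, \<open>wl\<close>: it
  contributes the point \<open>ws\<close> to \<open>X\<close> and the point \<open>uy\<close> to \<open>Y\<close>, and it confines all later stages to
  agree with \<open>wl\<close> off the infinite set \<open>al\<close>, up to finite sets.\<close>

definition as :: "nat set \<Rightarrow> nat set" where "as c = col 0 c"
definition ws :: "nat set \<Rightarrow> nat set" where "ws c = col 1 c"
definition al :: "nat set \<Rightarrow> nat set" where "al c = col 2 c"
definition wl :: "nat set \<Rightarrow> nat set" where "wl c = col 3 c"
definition uy :: "nat set \<Rightarrow> nat set" where "uy c = sd (ws c) (as c)"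

text \<open>\<open>y\<close> comes after \<open>x\<close>. Since \<open>uy y\<close> differs from
  \<open>ws y\<close> on \<open>as y\<close> only, both points of \<open>y\<close> agree with
  \<open>wl x\<close> at almost all places off \<open>al x\<close>.\<close>

definition later :: "nat set \<Rightarrow> nat set \<Rightarrow> bool" where
  "later x y \<longleftrightarrow> finite (as y - al x) \<and> finite (sd (ws y) (wl x) - al x)"

text \<open>The two infinite sets keep the points of the stage apart from later ones. At places of
  \<open>as\<close> off \<open>al\<close>, later points almost always follow \<open>wl\<close>:
  where it agrees with \<open>ws\<close> they differ from \<open>uy\<close>, and where it disagrees
  they differ from \<open>ws\<close>.\<close>

definition valid :: "nat set \<Rightarrow> bool" where
  "valid c \<longleftrightarrow> infinite (al c) \<and> al c \<subseteq> as c \<and> sd (wl c) (ws c) \<subseteq> as c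
    \<and> infinite {n. n \<in> as c - al c \<and> (n \<in> wl c) = (n \<in> ws c)} \<and> infinite {n. n \<in> as c - al c \<and> (n \<in> wl c) \<noteq> (n \<in> ws c)}"

text \<open>The premise exempts reals that code no increasing sequence, as every real is a task at
  some stage.\<close>

definition sparse :: "(nat \<Rightarrow> nat) \<Rightarrow> nat set \<Rightarrow> bool" where
  "sparse m a \<longleftrightarrow> ((\<forall>n. m n < m (Suc n)) \<longrightarrow> (\<forall>k. \<exists>n. k \<le> n \<and> a \<inter> {m n..<m (Suc n)} = {}))"

text \<open>All changes below \<open>k\<close> of the first points of the list are covered at once.
  A stage can look for such codes without knowing whether \<open>B\<close> is an \<omega>-cover of
  the sets still under construction.\<close>

definition cand :: "nat set \<Rightarrow> (nat \<Rightarrow> nat set) \<Rightarrow> nat \<Rightarrow> nat \<Rightarrow> nat \<Rightarrow> bool" where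
  "cand B v i k b \<longleftrightarrow> b \<in> B \<and> (\<forall>j. j \<le> i \<longrightarrow> (\<forall>s. md (v j) s k \<in> cov b))"

definition omc :: "nat set set \<Rightarrow> nat set \<Rightarrow> bool" where
  "omc X B \<longleftrightarrow> (\<forall>F. finite F \<and> F \<subseteq> X \<longrightarrow> (\<exists>b\<in>B. F \<subseteq> cov b))"

lemma finite_md: "finite (range (\<lambda>s. md x s k))"
proof -
  have "range (\<lambda>s. md x s k) \<subseteq> (\<lambda>S. S \<union> {n. k \<le> n \<and> n \<in> x}) ` Pow {..<k}"
  proof
    fix y assume "y \<in> range (\<lambda>s. md x s k)"
    then obtain s where "y = md x s k" by blast
    then have "y = (set_decode s \<inter> {..<k}) \<union> {n. k \<le> n \<and> n \<in> x}" by (auto simp: md_def)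
    then show "y \<in> (\<lambda>S. S \<union> {n. k \<le> n \<and> n \<in> x}) ` Pow {..<k}" by blast
  qed
  then show ?thesis by (rule finite_surj[rotated]) simp
qed

lemma md_fin: "finite (sd (md x s k) x)"
  by (rule finite_subset[of _ "{..<k}"]) (auto simp: md_def split: if_splits)

text \<open>\<open>md\<close> reads \<open>s\<close> below \<open>k\<close> only, so finitely many
  points have to be covered.\<close>

lemma omc_cand: assumes "omc X B" "\<And>j s. md (v j) s k \<in> X" shows "\<exists>b. cand B v i k b"
proof -
  define F where "F = (\<Union>j\<le>i. range (\<lambda>s. md (v j) s k))"
  have "finite F" unfolding F_def by (rule finite_UN_I[OF finite_atMost finite_md])
  moreover have "F \<subseteq> X" unfolding F_def using assms(2) by blast
  ultimately have "\<exists>b\<in>B. F \<subseteq> cov b" using assms(1)[unfolded omc_def, rule_format, of F] by simp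
  then obtain b where b: "b \<in> B" "F \<subseteq> cov b" by (elim bexE)
  have "md (v j) s k \<in> cov b" if "j \<le> i" for j s using b(2) that unfolding F_def by auto
  then show ?thesis unfolding cand_def using b(1) by (intro exI[of _ b]) simp
qed

context zm
begin

lemma stm_sd [dfi]: assumes "stm A" "stm B" shows "stm (\<lambda>e. sd (A e) (B e))"
  unfolding sd_def by (intro dfi stm_rename[OF assms(1)] stm_rename[OF assms(2)])

lemma stm_md [dfi]: assumes "stm A" "ntm s" "ntm k" shows "stm (\<lambda>e. md (A e) (s e) (k e))"
  unfolding md_def by (intro dfi stm_rename[OF assms(1)] ntm_rename[OF assms(2)] ntm_rename[OF assms(3)])

lemma stm_insert [dfi]: assumes "ntm t" "stm S" shows "stm (\<lambda>e. insert (t e) (S e))"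
  unfolding insert_def Un_iff by (intro dfi ntm_rename[OF assms(1)] stm_rename[OF assms(2)] assms)

lemma ntm_cyl [dfi]: assumes "stm S" "ntm t" shows "ntm (\<lambda>e. cyl (S e) (t e))"
  unfolding cyl_def by (intro dfi assms)

lemma dfn_cov [dfi]: assumes "stm S" "ntm t" shows "dfn E (\<lambda>e. S e \<in> cov (t e))"
  unfolding cov_def mem_Collect_eq by (intro dfi stm_rename[OF assms(1)] ntm_rename[OF assms(2)])

lemma ntm_fn [dfi]: assumes "stm S" "ntm t" shows "ntm (\<lambda>e. fn (S e) (t e))"
  unfolding fn_def by (intro dfi stm_rename[OF assms(1)] ntm_rename[OF assms(2)])

lemma stm_cols [dfi]: assumes "stm S"
  shows "stm (\<lambda>e. as (S e))" "stm (\<lambda>e. ws (S e))" "stm (\<lambda>e. al (S e))" "stm (\<lambda>e. wl (S e))" "stm (\<lambda>e. uy (S e))"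
  unfolding uy_def as_def ws_def al_def wl_def by (intro dfi assms)+

lemma gr_AA: "nfun f \<Longrightarrow> gr f \<in> AA" unfolding gr_def nfun_AA .

lemma nfun_fn: "A \<in> AA \<Longrightarrow> nfun (fn A)" by (intro nfunI dfi)

text \<open>A diagonal pseudo-intersection. As the stages are linearly ordered, there is an index
  \<open>I n\<close> at least as late as all those up to \<open>n\<close>. The sets \<open>a\<close>
  and \<open>w\<close> copy \<open>A (I n)\<close> and \<open>W (I n)\<close> on the interval from
  \<open>t n\<close> to \<open>t (Suc n)\<close>, which starts beyond the finitely many exceptions
  to the relations between \<open>I n\<close> and these indices.\<close>

lemma lower_bound:
  assumes e: "e \<in> AA"
    and val: "\<And>j. j \<in> col 0 e \<Longrightarrow> valid (col (Suc j) e)"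
    and lin: "\<And>i j. i \<in> col 0 e \<Longrightarrow> j \<in> col 0 e \<Longrightarrow>
      col (Suc i) e = col (Suc j) e \<or> later (col (Suc i) e) (col (Suc j) e) \<or> later (col (Suc j) e) (col (Suc i) e)"
  shows "\<exists>a\<in>AA. \<exists>w\<in>AA. infinite a \<and> (\<forall>j\<in>col 0 e. finite (a - al (col (Suc j) e)) \<and>
      finite (sd w (wl (col (Suc j) e)) - al (col (Suc j) e)))"
proof (cases "col 0 e = {}")
  case True
  have "UNIV \<in> AA" by (rule AA_stm) (intro dfi)
  then show ?thesis using True by (intro bexI[of _ UNIV]) auto
next
  case False
  define D where "D = col 0 e"
  define A where "A = (\<lambda>j. al (col (Suc j) e))"
  define W where "W = (\<lambda>j. wl (col (Suc j) e))"
  have DA: "D \<in> AA" unfolding D_def by (rule AA_stm) (intro dfi e)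
  have As: "stm (\<lambda>e. A (t e))" and Ws: "stm (\<lambda>e. W (t e))" if "ntm t" for t
    unfolding A_def W_def by (intro dfi e that)+
  \<comment> \<open>Stage \<open>i\<close> is at least as late as stage \<open>j\<close>, in a form
    that is reflexive and transitive.\<close>
  define le where "le = (\<lambda>i j. finite (A i - A j) \<and> finite (sd (W i) (W j) - A j))"
  have le_d: "dfn E (\<lambda>e. le (s e) (t e))" if "ntm s" "ntm t" for s t
    unfolding le_def by (intro dfi As Ws that)
  have le_refl: "le i i" for i by (simp add: le_def sd_def)
  have le_trans: "le i k" if "le i j" "le j k" for i j k
  proof -
    have "A i - A k \<subseteq> (A i - A j) \<union> (A j - A k)" by blast
    then have 1: "finite (A i - A k)" using that unfolding le_def by (meson finite_UnI finite_subset)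
    have "sd (W i) (W k) - A k \<subseteq> (sd (W i) (W j) - A j) \<union> (A j - A k) \<union> (sd (W j) (W k) - A k)" by auto
    then have "finite (sd (W i) (W k) - A k)" using that unfolding le_def by (meson finite_UnI finite_subset)
    then show ?thesis using 1 le_def by blast
  qed
  have later_le: "le j i" if "j \<in> D" "later (col (Suc i) e) (col (Suc j) e)" for i j
  proof -
    let ?x = "col (Suc i) e" and ?y = "col (Suc j) e"
    have v: "al ?y \<subseteq> as ?y" "sd (wl ?y) (ws ?y) \<subseteq> as ?y" using val[of j] that(1) unfolding D_def valid_def by blast+
    have l: "finite (as ?y - al ?x)" "finite (sd (ws ?y) (wl ?x) - al ?x)" using that(2) unfolding later_def by blast+
    have 1: "al ?y - al ?x \<subseteq> as ?y - al ?x" using v by blast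
    have 2: "sd (wl ?y) (wl ?x) - al ?x \<subseteq> (sd (ws ?y) (wl ?x) - al ?x) \<union> (as ?y - al ?x)" using v(2) by fastforce
    show ?thesis unfolding le_def A_def W_def using finite_subset[OF 1 l(1)] finite_subset[OF 2] l by blast
  qed
  have tot: "le i j \<or> le j i" if ij: "i \<in> D" "j \<in> D" for i j
  proof -
    consider "col (Suc i) e = col (Suc j) e" | "later (col (Suc i) e) (col (Suc j) e)" | "later (col (Suc j) e) (col (Suc i) e)"
      using lin ij unfolding D_def by blast
    then show ?thesis
    proof cases
      case 1
      then have "A i = A j" "W i = W j" unfolding A_def W_def by simp_all
      then show ?thesis by (simp add: le_def sd_def)
    qed (use later_le ij in blast)+
  qed
  define I where "I = (\<lambda>n. mu (\<lambda>i. i \<in> D \<and> (\<forall>j\<in>D. j \<le> n \<longrightarrow> le i j)))"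
  have Iex: "\<exists>i. i \<in> D \<and> (\<forall>j\<in>D. j \<le> n \<longrightarrow> le i j)" for n
  proof (induction n)
    case 0
    show ?case
    proof (cases "0 \<in> D")
      case True then show ?thesis using le_refl by (intro exI[of _ 0]) auto
    next
      case no: False
      obtain d where "d \<in> D" using False D_def by blast
      then show ?thesis using no by (intro exI[of _ d]) auto
    qed
  next
    case (Suc n)
    then obtain i where i: "i \<in> D" "\<forall>j\<in>D. j \<le> n \<longrightarrow> le i j" by blast
    show ?case
    proof (cases "Suc n \<in> D \<and> \<not> le i (Suc n)")
      case True
      then have "le (Suc n) i" using tot i by blast
      then have "\<forall>j\<in>D. j \<le> Suc n \<longrightarrow> le (Suc n) j" using i le_trans le_refl by (auto simp: le_Suc_eq)
      then show ?thesis using True by blast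
    next
      case False
      then have "\<forall>j\<in>D. j \<le> Suc n \<longrightarrow> le i j" using i by (auto simp: le_Suc_eq)
      then show ?thesis using i(1) by blast
    qed
  qed
  have I: "I n \<in> D" "\<And>j. j \<in> D \<Longrightarrow> j \<le> n \<Longrightarrow> le (I n) j" for n
    using muI[of "\<lambda>i. i \<in> D \<and> (\<forall>j\<in>D. j \<le> n \<longrightarrow> le i j)"] Iex[of n] unfolding I_def by blast+
  have In: "ntm (\<lambda>e. I (t e))" if "ntm t" for t
    unfolding I_def by (intro dfi DA le_d ntm_rename[OF that])
  define bd where "bd = (\<lambda>n t. \<forall>j\<in>D. j \<le> n \<longrightarrow> A (I n) - A j \<subseteq> {..<t} \<and> sd (W (I n)) (W j) - A j \<subseteq> {..<t})"
  have bd_d: "dfn E (\<lambda>e. bd (s e) (t e))" if "ntm s" "ntm t" for s t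
    unfolding bd_def by (intro dfi DA As Ws In ntm_rename[OF that(1)] ntm_rename[OF that(2)])
  have bd_ex: "\<exists>t\<ge>t0. bd n t" for n t0
  proof -
    have fin: "finite (\<Union>j\<in>{j\<in>D. j \<le> n}. (A (I n) - A j) \<union> (sd (W (I n)) (W j) - A j))"
      using I(2) unfolding le_def by (intro finite_UN_I) auto
    then obtain t where "\<forall>x\<in>(\<Union>j\<in>{j\<in>D. j \<le> n}. (A (I n) - A j) \<union> (sd (W (I n)) (W j) - A j)). x < t"
      unfolding finite_nat_set_iff_bounded by blast
    then have "bd n (max t t0)" unfolding bd_def by (auto simp: less_max_iff_disj)
    then show ?thesis by (intro exI[of _ "max t t0"]) auto
  qed
  obtain x0 where x0: "bd 0 x0" using bd_ex[of 0 0] by blast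
  \<comment> \<open>Each interval contains a point of the set that it copies, so that
    \<open>a\<close> is infinite, and ends where the exceptions for \<open>Suc n\<close> are
    exhausted.\<close>
  define P where "P = (\<lambda>n t t'. t < t' \<and> bd (Suc n) t' \<and> (\<exists>x\<in>A (I n). t \<le> x \<and> x < t'))"
  have Pd: "dfn E (\<lambda>e. P (nof (e 0)) (nof (e 1)) (nof (e 2)))" unfolding P_def by (intro dfi bd_d As In)
  have Pex: "\<exists>t'. P n t t'" for n t
  proof -
    have "infinite (A (I n))" using val[of "I n"] I(1)[of n] unfolding D_def A_def valid_def by blast
    then obtain x where x: "x \<in> A (I n)" "t \<le> x" unfolding infinite_nat_iff_unbounded_le by blast
    obtain t' where "t' \<ge> Suc x" "bd (Suc n) t'" using bd_ex[of "Suc x" "Suc n"] by blast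
    then show ?thesis unfolding P_def using x by (intro exI[of _ t']) auto
  qed
  obtain t where t: "nfun t" "t 0 = x0" "\<And>n. P n (t n) (t (Suc n))"
    by (rule nat_dc[OF Pd, of "\<lambda>_ _. True" x0]) (use Pex in simp_all)
  have tmono: "strict_mono t" using t(3) unfolding P_def strict_mono_Suc_iff by blast
  have tbd: "bd n (t n)" for n using t(2,3) x0 unfolding P_def by (cases n) auto
  define a where "a = {x. \<exists>n. t n \<le> x \<and> x < t (Suc n) \<and> x \<in> A (I n)}"
  define w where "w = {x. \<exists>n. t n \<le> x \<and> x < t (Suc n) \<and> x \<in> W (I n)}"
  have aA: "a \<in> AA" unfolding a_def by (rule AA_I) (intro dfi As In ntm_nfun[OF t(1)])
  have wA: "w \<in> AA" unfolding w_def by (rule AA_I) (intro dfi Ws In ntm_nfun[OF t(1)])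
  have uniq: "n = n'" if "t n \<le> x" "x < t (Suc n)" "t n' \<le> x" "x < t (Suc n')" for n n' x
  proof -
    have "t n < t (Suc n')" "t n' < t (Suc n)" using that by linarith+
    then show ?thesis using strict_mono_less[OF tmono] by force
  qed
  have loc: "\<exists>n\<ge>j. t n \<le> x \<and> x < t (Suc n)" if "t j \<le> x" for j x
  proof -
    define n where "n = Max {n. t n \<le> x}"
    have sub: "{n. t n \<le> x} \<subseteq> {..x}" using strict_mono_imp_increasing[OF tmono] le_trans by (auto intro: order_trans)
    then have fin: "finite {n. t n \<le> x}" using finite_subset by blast
    have "n \<in> {n. t n \<le> x}" unfolding n_def by (rule Max_in[OF fin]) (use that in blast)
    moreover have "j \<le> n" unfolding n_def by (rule Max_ge[OF fin]) (use that in simp)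
    moreover have "Suc n \<notin> {n. t n \<le> x}" using Max_ge[OF fin, of "Suc n"] unfolding n_def by auto
    ultimately show ?thesis by (intro exI[of _ n]) auto
  qed
  have "infinite a" unfolding infinite_nat_iff_unbounded_le
  proof
    fix m
    obtain x where "x \<in> A (I m)" "t m \<le> x" "x < t (Suc m)" using t(3)[of m] unfolding P_def by blast
    moreover have "m \<le> t m" using strict_mono_imp_increasing[OF tmono] .
    ultimately show "\<exists>n\<ge>m. n \<in> a" unfolding a_def by (intro exI[of _ x]) auto
  qed
  moreover have "finite (a - A j) \<and> finite (sd w (W j) - A j)" if j: "j \<in> D" for j
  proof -
    have "a - A j \<subseteq> {..<t j}"
    proof
      fix x assume x: "x \<in> a - A j"
      show "x \<in> {..<t j}"
      proof (rule ccontr)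
        assume "x \<notin> {..<t j}"
        then obtain n where n: "n \<ge> j" "t n \<le> x" "x < t (Suc n)" using loc[of j x] by auto
        then have "x \<in> A (I n)" using x uniq unfolding a_def by blast
        then have "x < t n" using tbd[of n] j n(1) x unfolding bd_def by blast
        then show False using n by simp
      qed
    qed
    moreover have "sd w (W j) - A j \<subseteq> {..<t j}"
    proof
      fix x assume x: "x \<in> sd w (W j) - A j"
      show "x \<in> {..<t j}"
      proof (rule ccontr)
        assume "x \<notin> {..<t j}"
        then obtain n where n: "n \<ge> j" "t n \<le> x" "x < t (Suc n)" using loc[of j x] by auto
        then have "x \<in> w \<longleftrightarrow> x \<in> W (I n)" using uniq unfolding w_def by blast
        then have "x \<in> sd (W (I n)) (W j) - A j" using x by simp
        moreover have "sd (W (I n)) (W j) - A j \<subseteq> {..<t n}" using tbd[of n] j n(1) unfolding bd_def by blast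
        ultimately have "x < t n" by blast
        then show False using n by simp
      qed
    qed
    ultimately show ?thesis by (meson finite_lessThan finite_subset)
  qed
  ultimately show ?thesis using aA wA unfolding A_def W_def D_def by blast
qed

text \<open>The interval from \<open>k\<close> to \<open>k'\<close> is reserved for task
  \<open>i\<close>. Changes below \<open>k\<close> are covered by \<open>b\<close>, and as
  \<open>b \<le> k'\<close>, membership in \<open>cov b\<close> is settled below \<open>k'\<close>;
  so a point that follows \<open>v 0\<close> on the interval is covered. The point of
  \<open>a\<close> provides the infinite sets in \<open>valid\<close>.\<close>

definition block :: "(nat \<Rightarrow> nat set) \<Rightarrow> (nat \<Rightarrow> nat set) \<Rightarrow> nat set \<Rightarrow> nat \<Rightarrow> nat \<Rightarrow> nat \<Rightarrow> nat \<Rightarrow> bool" where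
  "block V v a i k b k' \<longleftrightarrow> ((\<exists>b. cand (V i) v i k b) \<longrightarrow> cand (V i) v i k b) \<and> k < k' \<and> b \<le> k' \<and> (\<exists>x\<in>a. k \<le> x \<and> x < k')"

lemma block_ex: assumes "infinite a" shows "\<exists>b k'. block V v a i k b k'"
proof -
  obtain b where b: "(\<exists>b. cand (V i) v i k b) \<longrightarrow> cand (V i) v i k b" by blast
  obtain x where "x \<in> a" "k \<le> x" using assms unfolding infinite_nat_iff_unbounded_le by blast
  then show ?thesis unfolding block_def using b by (intro exI[of _ b] exI[of _ "Suc (max x b)"]) auto
qed

text \<open>On \<open>[k i, k' i)\<close> later points follow \<open>v 0\<close>, so that they fall into the clopen set chosen at \<open>i\<close>.\<close>

lemma block_cov:
  assumes "\<And>i. block V v a i (k i) (h i) (k' i)" and k: "\<And>i. k i < k (Suc i)"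
    and x: "(\<exists>j. finite (sd x (v j))) \<or> (\<exists>i0. \<forall>i\<ge>i0. \<forall>n. k i \<le> n \<longrightarrow> n < k' i \<longrightarrow> (n \<in> x \<longleftrightarrow> n \<in> v 0))"
  shows "\<exists>i0. \<forall>i\<ge>i0. (\<exists>b. cand (V i) v i (k i) b) \<longrightarrow> x \<in> cov (h i)"
proof -
  have c: "md (v j) s (k i) \<in> cov (h i)" "h i \<le> k' i" if "\<exists>b. cand (V i) v i (k i) b" "j \<le> i" for i j s
    using assms(1)[of i] that unfolding block_def cand_def by blast+
  have ki: "i \<le> k i" for i using strict_mono_imp_increasing[of k] k unfolding strict_mono_Suc_iff by blast
  from x show ?thesis
  proof
    assume "\<exists>j. finite (sd x (v j))"
    then obtain j m where m: "\<forall>n\<in>sd x (v j). n < m" unfolding finite_nat_set_iff_bounded by blast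
    show ?thesis
    proof (intro exI[of _ "max j m"] allI impI)
      fix i assume i: "max j m \<le> i" "\<exists>b. cand (V i) v i (k i) b"
      have "n \<in> x \<longleftrightarrow> n \<in> v j" if "k i \<le> n" for n
        using m ki[of i] that i(1) by (meson leD max.boundedE order_trans sd_iff)
      then have "x = md (v j) (set_encode (x \<inter> {..<k i})) (k i)" by (auto simp: md_def not_less)
      then show "x \<in> cov (h i)" using c(1)[OF i(2)] i(1) by (metis max.boundedE)
    qed
  next
    assume "\<exists>i0. \<forall>i\<ge>i0. \<forall>n. k i \<le> n \<longrightarrow> n < k' i \<longrightarrow> (n \<in> x \<longleftrightarrow> n \<in> v 0)"
    then obtain i0 where i0: "\<forall>i\<ge>i0. \<forall>n. k i \<le> n \<longrightarrow> n < k' i \<longrightarrow> (n \<in> x \<longleftrightarrow> n \<in> v 0)" by blast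
    show ?thesis
    proof (intro exI[of _ i0] allI impI)
      fix i assume i: "i0 \<le> i" "\<exists>b. cand (V i) v i (k i) b"
      have "x \<inter> {..<h i} = md (v 0) (set_encode (x \<inter> {..<k i})) (k i) \<inter> {..<h i}"
        using i0 i(1) c(2)[OF i(2), of 0] by (auto simp: md_def)
      from cov_cong[OF this] show "x \<in> cov (h i)" using c(1)[OF i(2), of 0] by simp
    qed
  qed
qed

text \<open>Indices without a candidate are exempt, since the stage cannot tell which
  \<open>V i\<close> will be \<omega>-covers. \<open>vs\<close> collects the points present at the
  stage, \<open>near\<close> describes those to come, and \<open>h\<close>, \<open>k\<close>,
  \<open>v\<close> are reals to keep the notion definable.\<close>

definition handled :: "nat set set \<Rightarrow> (nat \<Rightarrow> nat set) \<Rightarrow> (nat set \<Rightarrow> bool) \<Rightarrow> bool" where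
  "handled vs V near \<longleftrightarrow> (\<exists>h\<in>AA. \<exists>k\<in>AA. \<exists>v\<in>AA. (\<forall>j. col j v \<in> vs) \<and>
     (\<forall>i. (\<exists>b. cand (V i) (\<lambda>j. col j v) i (fn k i) b) \<longrightarrow> fn h i \<in> V i) \<and>
     (\<forall>x\<in>AA. (\<exists>y\<in>vs. finite (sd x y)) \<or> near x \<longrightarrow>
       (\<exists>i0. \<forall>i. i0 \<le> i \<longrightarrow> (\<exists>b. cand (V i) (\<lambda>j. col j v) i (fn k i) b) \<longrightarrow> x \<in> cov (fn h i))))"

text \<open>Round \<open>i\<close> consists of a block for \<open>X\<close> from \<open>K i\<close>
  to \<open>K1 i\<close>, a block for \<open>Y\<close> up to \<open>K2 i\<close>, a gap up to
  \<open>K3 i\<close> that contains an interval of \<open>m\<close> (if \<open>m\<close> is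
  increasing), and then a point \<open>ee i\<close> of \<open>a\<close>. The points
  \<open>ee i\<close> form \<open>b\<close>; \<open>z\<close> follows \<open>w\<close> except on the
  blocks for \<open>Y\<close>, where it follows \<open>sd w a\<close>. Points that agree with
  \<open>z\<close> at almost all places off \<open>b\<close> thus follow \<open>v 0\<close> on
  almost all blocks of the first kind and \<open>u 0\<close> on almost all of the second.\<close>

lemma step:
  assumes a: "a \<in> AA" "infinite a" and w: "w \<in> AA" and r: "r \<in> AA"
    and v: "sfun v" "v 0 = w" and u: "sfun u" "u 0 = sd w a"
  shows "\<exists>b\<in>AA. \<exists>z\<in>AA. infinite b \<and> b \<subseteq> a \<and> sd z w \<subseteq> a
    \<and> infinite {n. n \<in> a - b \<and> (n \<in> z) = (n \<in> w)} \<and> infinite {n. n \<in> a - b \<and> (n \<in> z) \<noteq> (n \<in> w)}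
    \<and> handled (range v) (\<lambda>i. col i (col 0 r)) (\<lambda>x. finite (sd x z - b))
    \<and> handled (range u) (\<lambda>i. col i (col 1 r)) (\<lambda>x. finite (sd x z - b))
    \<and> sparse (fn (col 2 r)) b"
proof -
  define V where "V = (\<lambda>q i. col i (col q r))"
  define m where "m = fn (col 2 r)"
  define p1 where "p1 = (\<lambda>z. fst (prod_decode z))"
  define p2 where "p2 = (\<lambda>z. fst (prod_decode (snd (prod_decode z))))"
  define p3 where "p3 = (\<lambda>z. fst (prod_decode (snd (prod_decode (snd (prod_decode z))))))"
  define p4 where "p4 = (\<lambda>z. fst (prod_decode (snd (prod_decode (snd (prod_decode (snd (prod_decode z))))))))"
  define p5 where "p5 = (\<lambda>z. fst (prod_decode (snd (prod_decode (snd (prod_decode (snd (prod_decode (snd (prod_decode z))))))))))"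
  define p6 where "p6 = (\<lambda>z. fst (prod_decode (snd (prod_decode (snd (prod_decode (snd (prod_decode (snd (prod_decode (snd (prod_decode z))))))))))))"
  define p7 where "p7 = (\<lambda>z. snd (prod_decode (snd (prod_decode (snd (prod_decode (snd (prod_decode (snd (prod_decode (snd (prod_decode z))))))))))))"
  note pdefs = p1_def p2_def p3_def p4_def p5_def p6_def p7_def
  \<comment> \<open>A whole round is packed into one number, as \<open>nat_dc\<close> chooses
    numbers.\<close>
  define tup where "tup = (\<lambda>k b k1 b' k2 k3 e. prod_encode (k, prod_encode (b, prod_encode (k1, prod_encode (b', prod_encode (k2, prod_encode (k3, e)))))))"
  have tup: "p1 (tup k b k1 b' k2 k3 e) = k" "p2 (tup k b k1 b' k2 k3 e) = b" "p3 (tup k b k1 b' k2 k3 e) = k1"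
    "p4 (tup k b k1 b' k2 k3 e) = b'" "p5 (tup k b k1 b' k2 k3 e) = k2" "p6 (tup k b k1 b' k2 k3 e) = k3"
    "p7 (tup k b k1 b' k2 k3 e) = e" for k b k1 b' k2 k3 e
    unfolding pdefs tup_def by simp_all
  have pn: "ntm (\<lambda>e. p1 (t e))" "ntm (\<lambda>e. p2 (t e))" "ntm (\<lambda>e. p3 (t e))" "ntm (\<lambda>e. p4 (t e))"
    "ntm (\<lambda>e. p5 (t e))" "ntm (\<lambda>e. p6 (t e))" "ntm (\<lambda>e. p7 (t e))" if "ntm t" for t
    unfolding pdefs by (intro dfi that)+
  define mok where "mok = (\<lambda>i k2 k3. (\<forall>n. m n < m (Suc n)) \<longrightarrow> (\<exists>n. i \<le> n \<and> k2 \<le> m n \<and> m (Suc n) \<le> k3))"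
  define OK where "OK = (\<lambda>i z. block (V 0) v a i (p1 z) (p2 z) (p3 z) \<and> block (V 1) u a i (p3 z) (p4 z) (p5 z)
    \<and> p5 z \<le> p6 z \<and> mok i (p5 z) (p6 z) \<and> p7 z \<in> a \<and> p6 z \<le> p7 z)"
  have OKex: "\<exists>z. OK i z \<and> p1 z = k" for i k
  proof -
    obtain b k1 where 1: "block (V 0) v a i k b k1" using block_ex[OF a(2)] by blast
    obtain b' k2 where 2: "block (V 1) u a i k1 b' k2" using block_ex[OF a(2)] by blast
    have "\<exists>k3\<ge>k2. mok i k2 k3"
    proof (cases "\<forall>n. m n < m (Suc n)")
      case True
      then have "n \<le> m n" for n using strict_mono_imp_increasing[of m] unfolding strict_mono_Suc_iff by blast
      then have "k2 \<le> m (max i k2)" by (meson max.cobounded2 order_trans)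
      then have "mok i k2 (max k2 (m (Suc (max i k2))))" unfolding mok_def by (intro impI exI[of _ "max i k2"]) auto
      then show ?thesis by (intro exI[of _ "max k2 (m (Suc (max i k2)))"]) auto
    qed (auto simp: mok_def)
    then obtain k3 where 3: "k2 \<le> k3" "mok i k2 k3" by blast
    obtain e where "e \<in> a" "k3 \<le> e" using a(2) unfolding infinite_nat_iff_unbounded_le by blast
    then show ?thesis using 1 2 3 by (intro exI[of _ "tup k b k1 b' k2 k3 e"]) (simp add: OK_def tup)
  qed
  define R where "R = (\<lambda>i z z'. OK (Suc i) z' \<and> p1 z' = Suc (p7 z))"
  have Vs: "stm (\<lambda>e. V q (t e))" if "ntm t" for t q unfolding V_def by (intro dfi r that)
  have ms: "ntm (\<lambda>e. m (t e))" if "ntm t" for t unfolding m_def by (intro dfi r that)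
  have candd: "dfn E (\<lambda>e. cand (V q (i e)) y (i e) (k e) (b e))" if "sfun y" "ntm i" "ntm k" "ntm b" for q i y k b
    unfolding cand_def by (intro dfi Vs stm_sfun[OF that(1)] ntm_rename[OF that(2)] ntm_rename[OF that(3)] ntm_rename[OF that(4)] that(2,3,4))
  have blockd: "dfn E (\<lambda>e. block (V q) y a (i e) (k e) (b e) (k' e))" if "sfun y" "ntm i" "ntm k" "ntm b" "ntm k'" for q i y k b k'
    unfolding block_def by (intro dfi a candd that ntm_rename[OF that(2)] ntm_rename[OF that(3)] ntm_rename[OF that(4)] ntm_rename[OF that(5)])
  have mokd: "dfn E (\<lambda>e. mok (i e) (k e) (b e))" if "ntm i" "ntm k" "ntm b" for i k b
    unfolding mok_def by (intro dfi ms ntm_rename[OF that(1)] ntm_rename[OF that(2)] ntm_rename[OF that(3)])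
  have Rd: "dfn E (\<lambda>e. R (nof (e 0)) (nof (e 1)) (nof (e 2)))"
    unfolding R_def OK_def by (intro dfi blockd mokd pn v u a)
  obtain z0 where z0: "OK 0 z0" using OKex by blast
  obtain f where f: "nfun f" "f 0 = z0" "\<And>i. R i (f i) (f (Suc i))" "\<And>i. OK i (f i)"
    by (rule nat_dc[OF Rd, of OK z0]) (use z0 OKex in \<open>auto simp: R_def\<close>)
  define K where "K = (\<lambda>i. p1 (f i))" define h where "h = (\<lambda>i. p2 (f i))" define K1 where "K1 = (\<lambda>i. p3 (f i))"
  define h' where "h' = (\<lambda>i. p4 (f i))" define K2 where "K2 = (\<lambda>i. p5 (f i))" define K3 where "K3 = (\<lambda>i. p6 (f i))"
  define ee where "ee = (\<lambda>i. p7 (f i))"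
  note kdefs = K_def h_def K1_def h'_def K2_def K3_def ee_def
  have nK: "nfun K" "nfun h" "nfun K1" "nfun h'" "nfun K2" "nfun ee"
    unfolding kdefs by (intro nfunI pn ntm_nfun[OF f(1)] dfi)+
  have ok: "block (V 0) v a i (K i) (h i) (K1 i)" "block (V 1) u a i (K1 i) (h' i) (K2 i)"
    "K2 i \<le> K3 i" "mok i (K2 i) (K3 i)" "ee i \<in> a" "K3 i \<le> ee i" "K (Suc i) = Suc (ee i)" for i
    using f(4)[of i] f(3)[of i] unfolding OK_def R_def kdefs by blast+
  have lt: "K i < K1 i" "K1 i < K2 i" for i using ok(1,2)[of i] unfolding block_def by blast+
  have Kmono: "K i < K (Suc i)" "K1 i < K1 (Suc i)" for i using lt[of i] lt[of "Suc i"] ok(3,6,7)[of i] by linarith+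
  have Kle: "Suc (ee i) \<le> K j" if "i < j" for i j
  proof -
    have "strict_mono K" using Kmono(1) unfolding strict_mono_Suc_iff by blast
    then have "K (Suc i) \<le> K j" using that by (simp add: strict_mono_less_eq)
    then show ?thesis using ok(7) by simp
  qed
  have chain: "K i \<le> K1 i" "K1 i \<le> K2 i" "K2 i \<le> K3 i" "K3 i \<le> ee i" for i using lt[of i] ok(3,6)[of i] by linarith+
  have apart: "i = j" if "K i \<le> n" "n \<le> ee i" "K j \<le> n" "n \<le> ee j" for i j n
    using Kle[of i j] Kle[of j i] that by (metis Suc_n_not_le_n linorder_neqE_nat order_trans)
  define b where "b = {n. \<exists>i. n = ee i}"
  define z where "z = {n. if \<exists>i. K1 i \<le> n \<and> n < K2 i then n \<in> sd w a else n \<in> w}"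
  have bA: "b \<in> AA" unfolding b_def by (rule AA_I) (intro dfi ntm_nfun[OF nK(6)])
  have zA: "z \<in> AA" unfolding z_def by (rule AA_I) (intro dfi w a ntm_nfun[OF nK(3)] ntm_nfun[OF nK(5)])
  have ki: "i \<le> K i" for i using strict_mono_imp_increasing[of K] Kmono(1) unfolding strict_mono_Suc_iff by blast
  have bigI: "infinite A" if "\<And>i. \<exists>n\<in>A. K i \<le> n" for A
    unfolding infinite_nat_iff_unbounded_le using that ki by (meson order_trans)
  have nob: "n \<notin> b" if "K i \<le> n" "n < K3 i" for i n
  proof
    assume "n \<in> b"
    then obtain j where j: "n = ee j" unfolding b_def by blast
    then have "i = j" using apart[of i n j] that chain[of i] chain[of j] by linarith
    then show False using j that chain[of i] by simp
  qed
  have zX: "n \<in> z \<longleftrightarrow> n \<in> w" if "K i \<le> n" "n < K1 i" for i n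
  proof -
    have "\<not> (\<exists>j. K1 j \<le> n \<and> n < K2 j)"
    proof
      assume "\<exists>j. K1 j \<le> n \<and> n < K2 j"
      then obtain j where j: "K1 j \<le> n" "n < K2 j" by blast
      then have "i = j" using apart[of i n j] that chain[of i] chain[of j] by linarith
      then show False using j that by simp
    qed
    then show ?thesis unfolding z_def mem_Collect_eq by (simp only: if_False)
  qed
  have zY: "n \<in> z \<longleftrightarrow> n \<in> sd w a" if "K1 i \<le> n" "n < K2 i" for i n using that by (auto simp: z_def)
  have 1: "infinite b"
  proof (rule bigI)
    fix i
    have "ee i \<in> b" unfolding b_def by blast
    moreover have "K i \<le> ee i" using chain[of i] by linarith
    ultimately show "\<exists>n\<in>b. K i \<le> n" by blast
  qed
  have 2: "b \<subseteq> a" unfolding b_def using ok(5) by auto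
  have 3: "sd z w \<subseteq> a" by (auto simp: z_def split: if_splits)
  have 4: "infinite {n. n \<in> a - b \<and> (n \<in> z) = (n \<in> w)}"
  proof (rule bigI)
    fix i
    obtain n where n: "n \<in> a" "K i \<le> n" "n < K1 i" using ok(1)[of i] unfolding block_def by blast
    have "n \<notin> b" using nob[of i n] n chain[of i] by linarith
    then show "\<exists>n\<in>{n. n \<in> a - b \<and> (n \<in> z) = (n \<in> w)}. K i \<le> n" using n zX[OF n(2,3)] by blast
  qed
  have 5: "infinite {n. n \<in> a - b \<and> (n \<in> z) \<noteq> (n \<in> w)}"
  proof (rule bigI)
    fix i
    obtain n where n: "n \<in> a" "K1 i \<le> n" "n < K2 i" using ok(2)[of i] unfolding block_def by blast
    have "n \<notin> b" using nob[of i n] n chain[of i] by linarith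
    moreover have "(n \<in> z) \<noteq> (n \<in> w)" using n zY[OF n(2,3)] by simp
    moreover have "K i \<le> n" using n chain[of i] by linarith
    ultimately show "\<exists>n\<in>{n. n \<in> a - b \<and> (n \<in> z) \<noteq> (n \<in> w)}. K i \<le> n" using n by blast
  qed
  have near: "\<exists>i0. \<forall>i\<ge>i0. \<forall>n. K i \<le> n \<longrightarrow> n < K3 i \<longrightarrow> (n \<in> x \<longleftrightarrow> n \<in> z)" if "finite (sd x z - b)" for x
  proof -
    obtain i0 where i0: "\<forall>n\<in>sd x z - b. n < i0" using \<open>finite (sd x z - b)\<close> unfolding finite_nat_set_iff_bounded by blast
    have "n \<in> x \<longleftrightarrow> n \<in> z" if i: "i0 \<le> i" "K i \<le> n" "n < K3 i" for i n
      using i0 nob[OF i(2,3)] ki[of i] i by (meson DiffI leD order_trans sd_iff)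
    then show ?thesis by blast
  qed
  have H: "handled (range y) (V q) (\<lambda>x. finite (sd x z - b))"
    if y: "sfun y" and B: "\<And>i. block (V q) y a i (k i) (g i) (k' i)" and k: "\<And>i. k i < k (Suc i)" and nf: "nfun k" "nfun g"
      and ag: "\<And>i n. k i \<le> n \<Longrightarrow> n < k' i \<Longrightarrow> (n \<in> z \<longleftrightarrow> n \<in> y 0) \<and> K i \<le> n \<and> n < K3 i" for y q k g k'
  proof -
    define vv where "vv = {p. snd (prod_decode p) \<in> y (fst (prod_decode p))}"
    have vv: "vv \<in> AA" unfolding vv_def using sfun_AA[OF y] .
    have colv: "col j vv = y j" for j by (auto simp: vv_def)
    show ?thesis unfolding handled_def
    proof (rule bexI[of _ "gr g"], rule bexI[of _ "gr k"], rule bexI[of _ vv], intro conjI allI ballI impI, unfold colv fn_gr)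
      fix i assume "\<exists>b. cand (V q i) y i (k i) b"
      then show "g i \<in> V q i" using B[of i] unfolding block_def cand_def by blast
    next
      fix x assume "(\<exists>y\<in>range y. finite (sd x y)) \<or> finite (sd x z - b)"
      then have "(\<exists>j. finite (sd x (y j))) \<or> (\<exists>i0. \<forall>i\<ge>i0. \<forall>n. k i \<le> n \<longrightarrow> n < k' i \<longrightarrow> (n \<in> x \<longleftrightarrow> n \<in> y 0))"
      proof
        assume "finite (sd x z - b)"
        then obtain i0 where "\<forall>i\<ge>i0. \<forall>n. K i \<le> n \<longrightarrow> n < K3 i \<longrightarrow> (n \<in> x \<longleftrightarrow> n \<in> z)" using near by blast
        then have "\<forall>i\<ge>i0. \<forall>n. k i \<le> n \<longrightarrow> n < k' i \<longrightarrow> (n \<in> x \<longleftrightarrow> n \<in> y 0)" using ag by blast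
        then show ?thesis by blast
      qed blast
      from block_cov[OF B k this] show "\<exists>i0. \<forall>i. i0 \<le> i \<longrightarrow> (\<exists>b. cand (V q i) y i (k i) b) \<longrightarrow> x \<in> cov (g i)" .
    qed (use gr_AA nf vv in auto)
  qed
  have 6: "handled (range v) (V 0) (\<lambda>x. finite (sd x z - b))"
  proof (rule H[OF v(1) ok(1) Kmono(1) nK(1,2)])
    fix i n assume n: "K i \<le> n" "n < K1 i"
    have "n < K3 i" using n chain[of i] by linarith
    then show "(n \<in> z \<longleftrightarrow> n \<in> v 0) \<and> K i \<le> n \<and> n < K3 i" using zX[OF n] v(2) n by simp
  qed
  have 7: "handled (range u) (V 1) (\<lambda>x. finite (sd x z - b))"
  proof (rule H[OF u(1) ok(2) Kmono(2) nK(3,4)])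
    fix i n assume n: "K1 i \<le> n" "n < K2 i"
    have "n < K3 i" "K i \<le> n" using n chain[of i] by linarith+
    then show "(n \<in> z \<longleftrightarrow> n \<in> u 0) \<and> K i \<le> n \<and> n < K3 i" using zY[OF n] u(2) by simp
  qed
  have 8: "sparse m b" unfolding sparse_def
  proof (intro impI allI)
    fix i assume "\<forall>n. m n < m (Suc n)"
    then obtain n where n: "i \<le> n" "K2 i \<le> m n" "m (Suc n) \<le> K3 i" using ok(4)[of i] unfolding mok_def by blast
    have "x \<notin> b" if "m n \<le> x" "x < m (Suc n)" for x using nob[of i x] that n chain[of i] by linarith
    then show "\<exists>n. i \<le> n \<and> b \<inter> {m n..<m (Suc n)} = {}" using n(1) by (intro exI[of _ n]) auto
  qed
  show ?thesis using bA zA 1 2 3 4 5 6 7 8 unfolding V_def m_def by (intro bexI[of _ b] bexI[of _ z]) simp_all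
qed

text \<open>The real \<open>r\<close> carries three tasks: columns 0 and 1 hold sequences of
  families of codes for \<open>X\<close> and for \<open>Y\<close>, column 2 an interval partition
  for \<open>al\<close> to miss.\<close>

definition Req :: "nat set \<Rightarrow> nat set \<Rightarrow> nat set \<Rightarrow> bool" where
  "Req e r c \<longleftrightarrow> (\<forall>j\<in>col 0 e. later (col (Suc j) e) c) \<and> valid c
     \<and> handled {y. y = ws c \<or> (\<exists>j\<in>col 0 e. y = ws (col (Suc j) e))} (\<lambda>i. col i (col 0 r)) (\<lambda>x. finite (sd x (wl c) - al c))
     \<and> handled {y. y = uy c \<or> (\<exists>j\<in>col 0 e. y = uy (col (Suc j) e))} (\<lambda>i. col i (col 1 r)) (\<lambda>x. finite (sd x (wl c) - al c))
     \<and> sparse (fn (col 2 r)) (al c)"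

lemma bex_insert_image: "(\<exists>x\<in>{y. y = y0 \<or> (\<exists>j\<in>D. y = f j)}. Q x) \<longleftrightarrow> Q y0 \<or> (\<exists>j\<in>D. Q (f j))"
  by blast

lemma dfn_Req: "dfn E (\<lambda>e. Req (sof (e 0)) (sof (e 1)) (sof (e 2)))"
  unfolding Req_def later_def valid_def handled_def sparse_def cand_def bex_insert_image mem_Collect_eq
  by (intro dfi)

lemma Req_ex:
  assumes e: "e \<in> AA" and r: "r \<in> AA"
    and val: "\<And>j. j \<in> col 0 e \<Longrightarrow> valid (col (Suc j) e)"
    and lin: "\<And>i j. i \<in> col 0 e \<Longrightarrow> j \<in> col 0 e \<Longrightarrow>
      col (Suc i) e = col (Suc j) e \<or> later (col (Suc i) e) (col (Suc j) e) \<or> later (col (Suc j) e) (col (Suc i) e)"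
  shows "\<exists>c\<in>AA. Req e r c"
proof -
  obtain a w where a: "a \<in> AA" "w \<in> AA" "infinite a" and lb: "\<forall>j\<in>col 0 e. finite (a - al (col (Suc j) e)) \<and>
      finite (sd w (wl (col (Suc j) e)) - al (col (Suc j) e))" using lower_bound[OF e val lin] by blast
  \<comment> \<open>A list of all points up to this stage, with the new point at index 0 because
    that is the point which \<open>step\<close> makes later ones follow. Idle indices repeat
    it.\<close>
  define g where "g = (\<lambda>y0 (s::nat set \<Rightarrow> nat set) j. if j - 1 \<in> col 0 e \<and> j \<noteq> 0 then s (col (Suc (j - 1)) e) else y0)"
  have g0: "g y0 s 0 = y0" for y0 s by (simp add: g_def)
  have gr: "range (g y0 s) = {y. y = y0 \<or> (\<exists>j\<in>col 0 e. y = s (col (Suc j) e))}" for y0 s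
  proof (intro equalityI subsetI)
    fix y assume "y \<in> {y. y = y0 \<or> (\<exists>j\<in>col 0 e. y = s (col (Suc j) e))}"
    then consider "y = y0" | j where "j \<in> col 0 e" "y = s (col (Suc j) e)" by blast
    then show "y \<in> range (g y0 s)"
    proof cases
      case 1 then show ?thesis using g0[of y0 s] by (metis rangeI)
    next
      case 2
      then have "y = g y0 s (Suc j)" by (simp add: g_def)
      then show ?thesis by blast
    qed
  next
    fix y assume "y \<in> range (g y0 s)"
    then obtain j where "y = g y0 s j" by blast
    then show "y \<in> {y. y = y0 \<or> (\<exists>j\<in>col 0 e. y = s (col (Suc j) e))}"
    proof (cases "j - 1 \<in> col 0 e \<and> j \<noteq> 0")
      case True
      then have "g y0 s j = s (col (Suc (j - 1)) e)" unfolding g_def by (rule if_P)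
      then show ?thesis using \<open>y = g y0 s j\<close> True by blast
    next
      case False
      then have "g y0 s j = y0" unfolding g_def by (rule if_not_P)
      then show ?thesis using \<open>y = g y0 s j\<close> by blast
    qed
  qed
  have saA: "sd w a \<in> AA" by (rule AA_stm) (intro dfi a)
  have v: "sfun (g w ws)" unfolding g_def by (intro sfunI dfi a e)
  have u: "sfun (g (sd w a) uy)" unfolding g_def by (intro sfunI dfi saA e)
  obtain b z where bz: "b \<in> AA" "z \<in> AA" "infinite b \<and> b \<subseteq> a \<and> sd z w \<subseteq> a
    \<and> infinite {n. n \<in> a - b \<and> (n \<in> z) = (n \<in> w)} \<and> infinite {n. n \<in> a - b \<and> (n \<in> z) \<noteq> (n \<in> w)}
    \<and> handled (range (g w ws)) (\<lambda>i. col i (col 0 r)) (\<lambda>x. finite (sd x z - b))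
    \<and> handled (range (g (sd w a) uy)) (\<lambda>i. col i (col 1 r)) (\<lambda>x. finite (sd x z - b))
    \<and> sparse (fn (col 2 r)) b"
    using step[OF a(1,3,2) r v g0 u g0] by blast
  define c where "c = {p. (fst (prod_decode p) = 0 \<and> snd (prod_decode p) \<in> a) \<or> (fst (prod_decode p) = 1 \<and> snd (prod_decode p) \<in> w)
    \<or> (fst (prod_decode p) = 2 \<and> snd (prod_decode p) \<in> b) \<or> (fst (prod_decode p) = 3 \<and> snd (prod_decode p) \<in> z)}"
  have cA: "c \<in> AA" unfolding c_def by (rule AA_I) (intro dfi a bz)
  have cc: "as c = a" "ws c = w" "al c = b" "wl c = z" unfolding as_def ws_def al_def wl_def c_def by auto
  have "uy c = sd w a" by (simp add: uy_def cc)
  then have "Req e r c" using lb bz(3) unfolding Req_def later_def valid_def cc gr by simp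
  then show ?thesis using cA by blast
qed

end

section \<open>The sets \<open>X\<close> and \<open>Y\<close> of the ground model\<close>

context chm
begin

text \<open>One \<open>h\<close> serves the whole sequence, as in the selection principle
  S_1(\<Omega>, \<Gamma>), except that families which are no \<omega>-covers are passed over. A
  sequence indexed by all conditions can be fed in.\<close>

definition sgam :: "nat set set \<Rightarrow> bool" where
  "sgam X \<longleftrightarrow> (\<forall>V\<in>AA. \<exists>h. nfun h \<and> (\<forall>i. omc X (col i V) \<longrightarrow> h i \<in> col i V) \<and>
     (\<forall>x\<in>X. \<exists>i0. \<forall>i. i0 \<le> i \<longrightarrow> omc X (col i V) \<longrightarrow> x \<in> cov (h i)))"

lemma sd_self: "finite (sd x x)" by (simp add: sd_def)

text \<open>\<open>X\<close> and \<open>Y\<close> are the points of all stages closed under finite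
  changes; this closure makes every \<omega>-cover yield candidates. A sequence \<open>V\<close> is
  the task of some stage \<open>a\<close>: points up to \<open>a\<close> are on its list, and those
  after \<open>a\<close> are caught because they follow \<open>wl (c a)\<close>.\<close>

lemma XY_exist:
  obtains X Y where "X \<subseteq> AA" "Y \<subseteq> AA" "isset (re ` X)" "isset (re ` Y)" "sgam X" "sgam Y"
    "\<And>x y. x \<in> X \<Longrightarrow> y \<in> Y \<Longrightarrow> infinite (sd x y)"
    "\<And>x s k. x \<in> X \<Longrightarrow> md x s k \<in> X"
    "\<And>m. nfun m \<Longrightarrow> \<forall>n. m n < m (Suc n) \<Longrightarrow> \<exists>x\<in>X. \<exists>y\<in>Y. \<forall>k. \<exists>n. k \<le> n \<and> sd x y \<inter> {m n..<m (Suc n)} = {}"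
proof -
  have ex: "\<exists>c\<in>AA. Req e r c" if "e \<in> AA" "r \<in> AA" "\<And>x. x \<in> cols e \<Longrightarrow> valid x"
      "\<And>x y. x \<in> cols e \<Longrightarrow> y \<in> cols e \<Longrightarrow> x = y \<or> later x y \<or> later y x" for e r
    by (rule Req_ex[OF that(1,2)]) (use that(3,4) in \<open>unfold cols_def, blast\<close>)+
  have lt: "later x c" if "Req e r c" "x \<in> cols e" for e r c x
    using that unfolding Req_def cols_def by blast
  have vl: "valid c" if "Req e r c" for e r c using that unfolding Req_def by blast
  obtain ka c r where c: "stm (\<lambda>e. c (e 0))" and ka: "Ord ka" and r: "r ` el ka = AA"
    and R0: "\<forall>a\<in>el ka. \<exists>e\<in>AA. cols e = c ` el a \<and> Req e (r a) (c a)"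
    and L0: "\<forall>a\<in>el ka. \<forall>b\<in>el a. later (c b) (c a)" and nomax: "\<forall>a\<in>el ka. \<exists>b\<in>el ka. a \<in> el b"
    by (rule CH_rec[of Req valid later, OF dfn_Req ex lt vl])
  define Z where "Z = (\<lambda>s. {x \<in> AA. \<exists>a\<in>el ka. finite (sd x (s (c a)))})"
  have cc: "stm (\<lambda>e. c (e k))" for k using stm_rename[OF c, of "\<lambda>_. k"] by simp
  have cA: "c a \<in> AA" for a using stm_AA[OF c, of "\<lambda>_. a"] .
  have Zset: "isset (re ` Z s)" if s: "\<And>S. stm S \<Longrightarrow> stm (\<lambda>e. s (S e))" for s
  proof -
    have "isset {z. el z \<subseteq> el Om}" by (intro isset_rules)
    then have "isset {z \<in> {z. el z \<subseteq> el Om}. \<exists>a\<in>el ka. finite (sd (sof z) (s (c a)))}"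
      by (rule isset_sep) (intro dfi s cc)
    moreover have "{z \<in> {z. el z \<subseteq> el Om}. \<exists>a\<in>el ka. finite (sd (sof z) (s (c a)))} = re ` Z s"
    proof (intro equalityI subsetI)
      fix z assume z: "z \<in> {z \<in> {z. el z \<subseteq> el Om}. \<exists>a\<in>el ka. finite (sd (sof z) (s (c a)))}"
      then have "z = re (sof z)" using re_sof by simp
      moreover have "sof z \<in> Z s" unfolding Z_def using z by simp
      ultimately show "z \<in> re ` Z s" by blast
    next
      fix z assume "z \<in> re ` Z s"
      then obtain x where x: "z = re x" "x \<in> AA" "\<exists>a\<in>el ka. finite (sd x (s (c a)))" unfolding Z_def by blast
      moreover have "el z \<subseteq> el Om" using re_AA[OF x(2)] x(1) by auto
      ultimately show "z \<in> {z \<in> {z. el z \<subseteq> el Om}. \<exists>a\<in>el ka. finite (sd (sof z) (s (c a)))}" by simp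
    qed
    ultimately show ?thesis by simp
  qed
  have below: "b \<in> el ka" if "a \<in> el ka" "b \<in> el a" for a b using Ord_trans[OF ka that] .
  have tri: "a = b \<or> a \<in> el b \<or> b \<in> el a" if "a \<in> el ka" "b \<in> el ka" for a b
    using Ord_linear[OF Ord_el[OF ka that(1)] Ord_el[OF ka that(2)]] by blast
  have val: "valid (c a)" if "a \<in> el ka" for a using R0 vl that by blast
  have surj: "\<exists>a\<in>el ka. r a = A" if "A \<in> AA" for A using that unfolding r[symmetric] by blast
  have fin3: "finite (sd x z - A)" if "finite (sd x y - A)" "finite (sd y z - A)" for x y z A
  proof -
    have "sd x z - A \<subseteq> (sd x y - A) \<union> (sd y z - A)" by auto
    then show ?thesis using that by (meson finite_UnI finite_subset)
  qed
  have sg: "sgam (Z s)"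
    if q: "q < (2::nat)" and near: "\<And>a b. a \<in> el ka \<Longrightarrow> b \<in> el a \<Longrightarrow> finite (sd (s (c a)) (wl (c b)) - al (c b))"
      and sA: "\<And>S. stm S \<Longrightarrow> stm (\<lambda>e. s (S e))"
      and hd: "\<And>e r c. Req e r c \<Longrightarrow> handled {y. y = s c \<or> (\<exists>j\<in>col 0 e. y = s (col (Suc j) e))}
            (\<lambda>i. col i (col q r)) (\<lambda>x. finite (sd x (wl c) - al c))" for s q
    unfolding sgam_def
  proof
    fix V assume V: "V \<in> AA"
    have "{p. fst (prod_decode p) = q \<and> snd (prod_decode p) \<in> V} \<in> AA" by (rule AA_I) (intro dfi V)
    from surj[OF this] obtain a where a: "a \<in> el ka" "r a = {p. fst (prod_decode p) = q \<and> snd (prod_decode p) \<in> V}" by (elim bexE)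
    have colq: "col q (r a) = V" unfolding a(2) by (simp add: col_def)
    obtain e where e: "e \<in> AA" "cols e = c ` el a" "Req e (r a) (c a)" using R0 a(1) by blast
    define vs where "vs = {y. y = s (c a) \<or> (\<exists>j\<in>col 0 e. y = s (col (Suc j) e))}"
    have "vs = insert (s (c a)) (s ` cols e)" unfolding vs_def cols_def by blast
    then have vs: "vs = insert (s (c a)) (s ` c ` el a)" unfolding e(2) .
    obtain h k v where h: "h \<in> AA" "k \<in> AA" "v \<in> AA" "\<forall>j. col j v \<in> vs"
      "\<forall>i. (\<exists>b. cand (col i V) (\<lambda>j. col j v) i (fn k i) b) \<longrightarrow> fn h i \<in> col i V"
      "\<forall>x\<in>AA. (\<exists>y\<in>vs. finite (sd x y)) \<or> finite (sd x (wl (c a)) - al (c a)) \<longrightarrow>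
       (\<exists>i0. \<forall>i. i0 \<le> i \<longrightarrow> (\<exists>b. cand (col i V) (\<lambda>j. col j v) i (fn k i) b) \<longrightarrow> x \<in> cov (fn h i))"
      using hd[OF e(3)] unfolding handled_def colq vs_def[symmetric] by (elim bexE conjE) (rule that; assumption)
    have mdZ: "md (col j v) t n \<in> Z s" for j t n
    proof -
      have "\<exists>b\<in>el ka. col j v = s (c b)" using h(4) a(1) below[OF a(1)] unfolding vs by blast
      then obtain b where b: "b \<in> el ka" "col j v = s (c b)" by (elim bexE)
      have "finite (sd (md (col j v) t n) (s (c b)))" unfolding b(2)[symmetric] by (rule md_fin)
      moreover have "md (col j v) t n \<in> AA" by (rule AA_stm) (intro dfi h)
      ultimately show ?thesis unfolding Z_def using b(1) by blast
    qed
    have cand: "\<exists>b. cand (col i V) (\<lambda>j. col j v) i (fn k i) b" if "omc (Z s) (col i V)" for i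
      by (rule omc_cand[OF that mdZ])
    show "\<exists>h. nfun h \<and> (\<forall>i. omc (Z s) (col i V) \<longrightarrow> h i \<in> col i V) \<and>
     (\<forall>x\<in>Z s. \<exists>i0. \<forall>i. i0 \<le> i \<longrightarrow> omc (Z s) (col i V) \<longrightarrow> x \<in> cov (h i))"
    proof (intro exI[of _ "fn h"] conjI allI impI ballI)
      show "nfun (fn h)" by (rule nfun_fn[OF h(1)])
      show "fn h i \<in> col i V" if "omc (Z s) (col i V)" for i using h(5) cand[OF that] by blast
      fix x assume "x \<in> Z s"
      then obtain b where x: "x \<in> AA" "b \<in> el ka" "finite (sd x (s (c b)))" unfolding Z_def by blast
      have "(\<exists>y\<in>vs. finite (sd x y)) \<or> finite (sd x (wl (c a)) - al (c a))"
      proof (cases "b = a \<or> b \<in> el a")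
        case True then show ?thesis using x(3) unfolding vs by blast
      next
        case False
        then have "a \<in> el b" using tri[OF a(1) x(2)] by blast
        have "finite (sd x (s (c b)) - al (c a))" using x(3) by simp
        from fin3[OF this near[OF x(2) \<open>a \<in> el b\<close>]] show ?thesis ..
      qed
      then obtain i0 where "\<forall>i. i0 \<le> i \<longrightarrow> (\<exists>b. cand (col i V) (\<lambda>j. col j v) i (fn k i) b) \<longrightarrow> x \<in> cov (fn h i)"
        using h(6) x(1) by blast
      then show "\<exists>i0. \<forall>i. i0 \<le> i \<longrightarrow> omc (Z s) (col i V) \<longrightarrow> x \<in> cov (fn h i)" using cand by blast
    qed
  qed
  have lat: "finite (as (c a) - al (c b))" "finite (sd (ws (c a)) (wl (c b)) - al (c b))" if "a \<in> el ka" "b \<in> el a" for a b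
    using L0 that unfolding later_def by blast+
  have nearY: "finite (sd (uy (c a)) (wl (c b)) - al (c b))" if "a \<in> el ka" "b \<in> el a" for a b
  proof -
    have "sd (uy (c a)) (ws (c a)) - al (c b) \<subseteq> as (c a) - al (c b)" by (auto simp: uy_def)
    then have "finite (sd (uy (c a)) (ws (c a)) - al (c b))" using lat(1)[OF that] by (rule finite_subset)
    then show ?thesis using fin3 lat(2)[OF that] by blast
  qed
  have sgX: "sgam (Z ws)" by (rule sg[of 0]) (use lat(2) in \<open>auto simp: Req_def intro: stm_cols\<close>)
  have sgY: "sgam (Z uy)" by (rule sg[of 1]) (use nearY in \<open>auto simp: Req_def intro: stm_cols\<close>)
  have inf: "infinite (sd x y)" if xy: "x \<in> Z ws" "y \<in> Z uy" for x y
  proof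
    assume fxy: "finite (sd x y)"
    obtain a where a: "a \<in> el ka" "finite (sd x (ws (c a)))" using xy(1) unfolding Z_def by blast
    obtain b where b: "b \<in> el ka" "finite (sd y (uy (c b)))" using xy(2) unfolding Z_def by blast
    have f: "finite (sd (ws (c a)) (uy (c b)))"
    proof -
      have "sd (ws (c a)) (uy (c b)) \<subseteq> sd x (ws (c a)) \<union> sd x y \<union> sd y (uy (c b))" by auto
      then show ?thesis using a(2) b(2) fxy by (meson finite_UnI finite_subset)
    qed
    have va: "infinite (al (c d))" "al (c d) \<subseteq> as (c d)"
      "infinite {n. n \<in> as (c d) - al (c d) \<and> (n \<in> wl (c d)) = (n \<in> ws (c d))}"
      "infinite {n. n \<in> as (c d) - al (c d) \<and> (n \<in> wl (c d)) \<noteq> (n \<in> ws (c d))}" if "d \<in> el ka" for d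
      using val[OF that] unfolding valid_def by blast+
    \<comment> \<open>Same stage: the points differ on \<open>as\<close>. Otherwise the point of the
      later stage follows \<open>wl\<close> of the earlier one, and \<open>valid\<close> gives
      infinitely many places where \<open>wl\<close> departs from the earlier point, which is
      \<open>ws (c a)\<close> in the second case and \<open>uy (c b)\<close> in the third.\<close>
    consider "a = b" | "a \<in> el b" | "b \<in> el a" using tri[OF a(1) b(1)] by blast
    then show False
    proof cases
      case 1
      have "al (c a) \<subseteq> sd (ws (c a)) (uy (c b))" using va(2)[OF a(1)] 1 by (auto simp: uy_def)
      then show False using va(1)[OF a(1)] f finite_subset by blast
    next
      case 2
      have "{n. n \<in> as (c a) - al (c a) \<and> (n \<in> wl (c a)) \<noteq> (n \<in> ws (c a))} \<subseteq>
        sd (ws (c a)) (uy (c b)) \<union> (sd (uy (c b)) (wl (c a)) - al (c a))" by auto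
      then show False using va(4)[OF a(1)] f nearY[OF b(1) 2] by (meson finite_UnI finite_subset)
    next
      case 3
      have "{n. n \<in> as (c b) - al (c b) \<and> (n \<in> wl (c b)) = (n \<in> ws (c b))} \<subseteq>
        sd (ws (c a)) (uy (c b)) \<union> (sd (ws (c a)) (wl (c b)) - al (c b))" by (auto simp: uy_def)
      then show False using va(3)[OF b(1)] f lat(2)[OF a(1) 3] by (meson finite_UnI finite_subset)
    qed
  qed
  have unb: "\<exists>x\<in>Z ws. \<exists>y\<in>Z uy. \<forall>k. \<exists>n. k \<le> n \<and> sd x y \<inter> {m n..<m (Suc n)} = {}"
    if m: "nfun m" "\<forall>n. m n < m (Suc n)" for m
  proof -
    have "{p. fst (prod_decode p) = 2 \<and> snd (prod_decode p) \<in> gr m} \<in> AA" by (rule AA_I) (intro dfi gr_AA m)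
    from surj[OF this] obtain a where a: "a \<in> el ka" "r a = {p. fst (prod_decode p) = 2 \<and> snd (prod_decode p) \<in> gr m}" by (elim bexE)
    have "col 2 (r a) = gr m" unfolding a(2) by (simp add: col_def)
    then have "fn (col 2 (r a)) = m" by simp
    moreover obtain e where "Req e (r a) (c a)" using R0 a(1) by blast
    ultimately have sp: "\<forall>k. \<exists>n. k \<le> n \<and> al (c a) \<inter> {m n..<m (Suc n)} = {}" using m(2) unfolding Req_def sparse_def by metis
    \<comment> \<open>Stage \<open>a\<close> makes only \<open>al (c a)\<close> sparse. The points
      of a later stage \<open>b\<close> differ exactly on \<open>as (c b)\<close>, which lies in it
      up to finitely many numbers.\<close>
    obtain b where b: "b \<in> el ka" "a \<in> el b" using nomax a(1) by blast
    obtain N where N: "\<forall>n\<in>as (c b) - al (c a). n < N" using lat(1)[OF b] unfolding finite_nat_set_iff_bounded by blast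
    have eq: "sd (ws (c b)) (uy (c b)) = as (c b)" by (auto simp: uy_def)
    have "\<exists>n. k \<le> n \<and> as (c b) \<inter> {m n..<m (Suc n)} = {}" for k
    proof -
      obtain n where n: "max k N \<le> n" "al (c a) \<inter> {m n..<m (Suc n)} = {}" using sp by blast
      have "n \<le> m n" using strict_mono_imp_increasing[of m] m(2) unfolding strict_mono_Suc_iff by blast
      then have "x \<notin> as (c b)" if "x \<in> {m n..<m (Suc n)}" for x
        using N n that by (metis DiffI IntI atLeastLessThan_iff empty_iff leD max.boundedE order_trans)
      then show ?thesis using n(1) by (intro exI[of _ n]) auto
    qed
    moreover have "ws (c b) \<in> Z ws" "uy (c b) \<in> Z uy"
    proof -
      have "ws (c b) \<in> AA" "uy (c b) \<in> AA"
        using stm_AA[OF stm_cols(2)[OF c], of "\<lambda>_. b"] stm_AA[OF stm_cols(5)[OF c], of "\<lambda>_. b"] by simp_all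
      then show "ws (c b) \<in> Z ws" "uy (c b) \<in> Z uy" unfolding Z_def using b(1) sd_self by blast+
    qed
    ultimately show ?thesis using eq by metis
  qed
  have sub: "Z s \<subseteq> AA" for s unfolding Z_def by blast
  have mdc: "md x s k \<in> Z ws" if x: "x \<in> Z ws" for x s k
  proof -
    obtain a where a: "a \<in> el ka" "finite (sd x (ws (c a)))" and xA: "x \<in> AA" using x unfolding Z_def by blast
    have "sd (md x s k) (ws (c a)) \<subseteq> sd (md x s k) x \<union> sd x (ws (c a))" by auto
    then have "finite (sd (md x s k) (ws (c a)))" using md_fin a(2) by (meson finite_UnI finite_subset)
    moreover have "md x s k \<in> AA" by (rule AA_stm) (intro dfi xA)
    ultimately show ?thesis unfolding Z_def using a(1) by blast
  qed
  show ?thesis by (rule that[OF sub sub Zset[OF stm_cols(2)] Zset[OF stm_cols(5)] sgX sgY inf mdc unb])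
qed

end

section \<open>Preservation by Cohen reals\<close>

lemma prod_encode_less: assumes "i < j" shows "prod_encode (n, i) < prod_encode (n, j)"
proof -
  have "strict_mono (\<lambda>j. prod_encode (n, j))" unfolding strict_mono_Suc_iff by (simp add: prod_encode_def)
  from strict_monoD[OF this assms] show ?thesis .
qed

context cohen
begin

lemma nfun_N: "nfun f \<Longrightarrow> N.nfun f"
  using AA_sub unfolding nfun_AA N.nfun_AA by blast

definition force_set :: "nat set \<Rightarrow> nat set \<Rightarrow> nat set \<Rightarrow> nat \<Rightarrow> nat set" where
  "force_set Q T S q = {b. \<exists>l\<in>Q. \<exists>q'\<in>Q. prod_encode (b, l) \<in> S \<and> prod_encode (q', q) \<in> T \<and> prod_encode (q', l) \<in> T}"

text \<open>Apply the property of \<open>X\<close> in the ground model to the sequence, indexed by all conditions, of the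
  sets of those basic sets that some extension of the condition puts into the cover.\<close>

lemma gamma_preserved:
  assumes X: "sgam X" and B: "B \<in> N.AA" and om: "omc X B"
  obtains h Z where "nfun h" "Z \<in> N.AA" "infinite Z" "\<And>i. i \<in> Z \<Longrightarrow> h i \<in> B"
    "\<And>x. x \<in> X \<Longrightarrow> \<exists>i0. \<forall>i\<in>Z. i0 \<le> i \<longrightarrow> x \<in> cov (h i)"
proof -
  obtain Q T H c S where g: "generic_real AA N.AA Q T H c" and S: "S \<in> AA" and BH: "B = {n. \<exists>q\<in>H. prod_encode (n, q) \<in> S}"
    by (rule real_generic[OF B])
  interpret g: generic_real AA N.AA Q T H c by (rule g)
  \<comment> \<open>An index is a pair of a condition and a number, so every condition occurs at
    arbitrarily large indices.\<close>
  define V where "V = {p. snd (prod_decode p) \<in> force_set Q T S (fst (prod_decode (fst (prod_decode p))))}"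
  have V: "V \<in> AA" unfolding V_def force_set_def mem_Collect_eq by (rule AA_I) (intro dfi g.AQ S)
  have colV: "col i V = force_set Q T S (fst (prod_decode i))" for i by (auto simp: V_def)
  obtain h where h: "nfun h" "\<And>i. omc X (col i V) \<Longrightarrow> h i \<in> col i V"
    "\<And>x. x \<in> X \<Longrightarrow> \<exists>i0. \<forall>i. i0 \<le> i \<longrightarrow> omc X (col i V) \<longrightarrow> x \<in> cov (h i)"
    using X V unfolding sgam_def by blast
  have omH: "omc X (col i V)" if q: "fst (prod_decode i) \<in> H" for i
    unfolding omc_def
  proof (intro allI impI)
    fix F assume F: "finite F \<and> F \<subseteq> X"
    obtain b where b: "b \<in> B" "F \<subseteq> cov b" using om[unfolded omc_def, rule_format, OF F] by (elim bexE)
    obtain l where l: "l \<in> H" "prod_encode (b, l) \<in> S" using b(1) unfolding BH by blast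
    obtain q' where "q' \<in> H" "prod_encode (q', fst (prod_decode i)) \<in> T" "prod_encode (q', l) \<in> T" using g.H_dir[OF q l(1)] by blast
    then have "b \<in> col i V" unfolding colV force_set_def using l g.HQ by blast
    then show "\<exists>b\<in>col i V. F \<subseteq> cov b" using b(2) by blast
  qed
  \<comment> \<open>The indices whose condition is in \<open>H\<close> and whose selected code
    really enters \<open>B\<close>. For these \<open>h\<close> behaves well, since the family of a
    condition in \<open>H\<close> contains \<open>B\<close>.\<close>
  define Z where "Z = {i. fst (prod_decode i) \<in> H \<and> (\<exists>l\<in>H. prod_encode (h i, l) \<in> S)}"
  have "Z \<in> N.AA" unfolding Z_def
    by (rule N.AA_I) (intro N.ntm_nfun[OF nfun_N[OF h(1)]] N.dfn_nbex N.dfn_nmem N.stm_const N.ntm_fst N.ntm_nof N.ntm_pair dt_var g.AH AA_sub[OF S] dfn_conj)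
  moreover have "infinite Z" unfolding infinite_nat_iff_unbounded_le
  proof
    fix n
    define D where "D = {p. fst (prod_decode p) \<in> Q \<and> (\<exists>i l. n \<le> i \<and> prod_encode (h i, l) \<in> S \<and> l \<in> Q \<and> fst (prod_decode i) \<in> Q
       \<and> prod_encode (fst (prod_decode p), l) \<in> T \<and> prod_encode (fst (prod_decode p), fst (prod_decode i)) \<in> T)}"
    have D: "D \<in> AA" unfolding D_def by (rule AA_I) (intro dfi g.AQ S ntm_nfun[OF h(1)])
    from g.H_gen[OF D] show "\<exists>i\<ge>n. i \<in> Z"
    proof
      assume "\<exists>q\<in>H. \<exists>k. prod_encode (q, cyl c k) \<in> D"
      then obtain q i l where q: "q \<in> H" "n \<le> i" "prod_encode (h i, l) \<in> S" "l \<in> Q" "fst (prod_decode i) \<in> Q"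
        "prod_encode (q, l) \<in> T" "prod_encode (q, fst (prod_decode i)) \<in> T" unfolding D_def by auto
      then have "l \<in> H" "fst (prod_decode i) \<in> H" using g.H_up by blast+
      then show ?thesis using q unfolding Z_def by blast
    next
      assume "\<exists>q\<in>H. \<exists>k. \<forall>q'\<in>Q. prod_encode (q', q) \<in> T \<longrightarrow>
        (\<forall>x k'. k \<le> k' \<longrightarrow> x \<inter> {..<k} = c \<inter> {..<k} \<longrightarrow> prod_encode (q', cyl x k') \<notin> D)"
      then obtain q k where q: "q \<in> H" and no0: "\<forall>q'\<in>Q. prod_encode (q', q) \<in> T \<longrightarrow>
        (\<forall>x l. k \<le> l \<longrightarrow> x \<inter> {..<k} = c \<inter> {..<k} \<longrightarrow> prod_encode (q', cyl x l) \<notin> D)" by (elim bexE exE)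
      note no = no0[rule_format, OF _ _ order_refl refl]
      \<comment> \<open>At this index the code was selected among those that \<open>q\<close>
        permits, so some \<open>q'\<close> below \<open>q\<close> places it in \<open>B\<close>: the
        filter cannot avoid \<open>D\<close> from \<open>q\<close> on.\<close>
      define i where "i = prod_encode (q, n)"
      have i: "n \<le> i" "fst (prod_decode i) = q" unfolding i_def by (simp_all add: le_prod_encode_2)
      have "h i \<in> force_set Q T S q" using h(2)[OF omH] i(2) q unfolding colV by auto
      then obtain l q' where l: "l \<in> Q" "q' \<in> Q" "prod_encode (h i, l) \<in> S" "prod_encode (q', q) \<in> T" "prod_encode (q', l) \<in> T"
        unfolding force_set_def by blast
      have "q \<in> Q" using q g.HQ by blast
      then have "prod_encode (q', cyl c k) \<in> D" unfolding D_def using l i by auto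
      then show ?thesis using no l(2,4) by blast
    qed
  qed
  moreover have "h i \<in> B" if "i \<in> Z" for i using that unfolding Z_def BH by blast
  moreover have "\<exists>i0. \<forall>i\<in>Z. i0 \<le> i \<longrightarrow> x \<in> cov (h i)" if "x \<in> X" for x
    using h(3)[OF that] omH unfolding Z_def by blast
  ultimately show ?thesis using that h(1) by blast
qed

text \<open>A Cohen real over a model containing the sequence of covers selects from it; \<open>K j\<close> is the basic
  set coded by \<open>j\<close>, of which only finitely many traces on finite sets matter.\<close>

lemma S1_preserved:
  fixes K :: "nat \<Rightarrow> 'z set" and W :: "'z set"
  assumes B: "B \<in> N.AA" and KA: "\<And>F. finite F \<Longrightarrow> F \<subseteq> W \<Longrightarrow> {j. F \<subseteq> K j} \<in> AA"
    and om: "\<And>n F. finite F \<Longrightarrow> F \<subseteq> W \<Longrightarrow> \<exists>j\<in>col n B. F \<subseteq> K j"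
  obtains h where "N.nfun h" "\<And>n. h n \<in> col n B" "\<And>F. finite F \<Longrightarrow> F \<subseteq> W \<Longrightarrow> \<exists>n. F \<subseteq> K (h n)"
proof -
  obtain Q T H c S where g: "generic_real AA N.AA Q T H c" and S: "S \<in> AA" and BH: "B = {n. \<exists>q\<in>H. prod_encode (n, q) \<in> S}"
    by (rule real_generic[OF B])
  interpret g: generic_real AA N.AA Q T H c by (rule g)
  \<comment> \<open>The Cohen real is read as a function whose value at \<open>n\<close> is the
    first element of its \<open>n\<close>-th column; a value that misses the \<open>n\<close>-th
    cover is replaced by the least code of that cover.\<close>
  define sel where "sel = (\<lambda>n. mu (\<lambda>j. prod_encode (n, j) \<in> c))"
  define h where "h = (\<lambda>n. if sel n \<in> col n B then sel n else mu (\<lambda>j. j \<in> col n B))"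
  have "N.nfun h" unfolding h_def sel_def
    by (intro N.nfunI N.ntm_if N.dfn_nmem N.ntm_mu N.stm_col N.stm_const N.ntm_nof N.ntm_pair dt_var B g.AH)
  moreover have hB: "h n \<in> col n B" for n
  proof -
    obtain j where "j \<in> col n B" using om[of "{}" n] by auto
    then show ?thesis unfolding h_def using muI[of "\<lambda>j. j \<in> col n B"] by auto
  qed
  moreover have "\<exists>n. F \<subseteq> K (h n)" if F: "finite F" "F \<subseteq> W" for F
  proof -
    define D where "D = {p. fst (prod_decode p) \<in> Q \<and> (\<exists>n j l. j \<in> {j. F \<subseteq> K j} \<and> l \<in> Q \<and> prod_encode (prod_encode (n, j), l) \<in> S
        \<and> prod_encode (fst (prod_decode p), l) \<in> T
        \<and> prod_encode (n, j) \<in> set_decode (snd (prod_decode p))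
        \<and> (\<exists>m\<in>set_decode (snd (prod_decode p)). prod_encode (n, j) < m)
        \<and> (\<forall>i. i < j \<longrightarrow> prod_encode (n, i) \<notin> set_decode (snd (prod_decode p))))}"
    have D: "D \<in> AA" unfolding D_def by (rule AA_I) (intro dfi g.AQ S KA F)
    from g.H_gen[OF D] show ?thesis
    proof
      assume "\<exists>q\<in>H. \<exists>k. prod_encode (q, cyl c k) \<in> D"
      then obtain q k n j l where q: "q \<in> H" "F \<subseteq> K j" "l \<in> Q" "prod_encode (prod_encode (n, j), l) \<in> S" "prod_encode (q, l) \<in> T"
        "prod_encode (n, j) \<in> set_decode (cyl c k)" "\<exists>m\<in>set_decode (cyl c k). prod_encode (n, j) < m"
        "\<forall>i. i < j \<longrightarrow> prod_encode (n, i) \<notin> set_decode (cyl c k)"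
        unfolding D_def mem_Collect_eq prod_encode_inverse fst_conv snd_conv by blast
      have k: "prod_encode (n, j) < k" using q(7) unfolding cyl_decode by auto
      have "prod_encode (n, j) \<in> c" using q(6) k unfolding cyl_decode by auto
      moreover have "prod_encode (n, i) \<notin> c" if "i < j" for i
      proof -
        have "prod_encode (n, i) < prod_encode (n, j)" using that by (rule prod_encode_less)
        then show ?thesis using q(8) that k unfolding cyl_decode by auto
      qed
      ultimately have sel: "sel n = j" unfolding sel_def by (intro sym[OF mu_iff[THEN iffD2]]) auto
      have "l \<in> H" using g.H_up q by blast
      then have "j \<in> col n B" unfolding BH mem_col using q(4) by blast
      then have "h n = j" unfolding h_def sel by simp
      then show ?thesis using q(2) by blast
    next
      assume "\<exists>q\<in>H. \<exists>k. \<forall>q'\<in>Q. prod_encode (q', q) \<in> T \<longrightarrow>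
        (\<forall>x k'. k \<le> k' \<longrightarrow> x \<inter> {..<k} = c \<inter> {..<k} \<longrightarrow> prod_encode (q', cyl x k') \<notin> D)"
      then obtain q k where q: "q \<in> H" and no0: "\<forall>q'\<in>Q. prod_encode (q', q) \<in> T \<longrightarrow>
        (\<forall>x l. k \<le> l \<longrightarrow> x \<inter> {..<k} = c \<inter> {..<k} \<longrightarrow> prod_encode (q', cyl x l) \<notin> D)" by (elim bexE exE)
      note no = no0[rule_format]
      \<comment> \<open>The first \<open>k\<close> digits of \<open>c\<close> decide nothing in
        column \<open>k\<close>, since a code of a pair is at least its first component. They can
        therefore be extended so that \<open>j\<close> becomes the first element of that
        column.\<close>
      obtain j where j: "j \<in> col k B" "F \<subseteq> K j" using om[OF F, of k] by blast
      obtain l where l: "l \<in> H" "prod_encode (prod_encode (k, j), l) \<in> S" using j(1) unfolding BH mem_col by blast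
      obtain q' where q': "q' \<in> H" "prod_encode (q', q) \<in> T" "prod_encode (q', l) \<in> T" using g.H_dir[OF q l(1)] by blast
      define x where "x = (c \<inter> {..<k}) \<union> {prod_encode (k, j)}"
      define k' where "k' = Suc (prod_encode (k, j))"
      have kp: "k \<le> prod_encode (k, i)" for i by (rule le_prod_encode_1)
      have 1: "k \<le> k'" unfolding k'_def using kp[of j] by simp
      have 2: "x \<inter> {..<k} = c \<inter> {..<k}" unfolding x_def using kp[of j] by auto
      have dec: "set_decode (cyl x k') = insert k' x" unfolding cyl_decode x_def k'_def using kp[of j] by auto
      have "prod_encode (k, i) \<notin> insert k' x" if i: "i < j" for i
      proof -
        have "prod_encode (k, i) < k'"
          using prod_encode_less[OF i, of k] unfolding k'_def by simp
        then show ?thesis unfolding x_def using kp[of i] i by auto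
      qed
      then have "prod_encode (q', cyl x k') \<in> D"
        unfolding D_def mem_Collect_eq prod_encode_inverse fst_conv snd_conv dec
        using q' l j g.HQ by (intro conjI exI[of _ k] exI[of _ j] exI[of _ l]) (auto simp: x_def k'_def)
      then show ?thesis using no[OF _ q'(2) 1 2] q'(1) g.HQ by blast
    qed
  qed
  ultimately show ?thesis using that by blast
qed

text \<open>An increasing sequence of the extension is bounded, on many intervals, by one of the ground model:
  the interval \<open>[f i, f (i+1))\<close> contains, for each of the first \<open>i\<close> conditions that permit it, an interval
  of the new sequence that some stronger condition decides.\<close>

lemma unbounded_preserved:
  assumes un: "\<And>m. nfun m \<Longrightarrow> \<forall>n. m n < m (Suc n) \<Longrightarrow> \<exists>x\<in>X. \<exists>y\<in>Y. \<forall>k. \<exists>n. k \<le> n \<and> sd x y \<inter> {m n..<m (Suc n)} = {}"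
    and XY: "X \<subseteq> AA" "Y \<subseteq> AA"
    and m: "N.nfun m" "\<forall>n. m n < m (Suc n)"
  shows "\<exists>x\<in>X. \<exists>y\<in>Y. \<forall>k. \<exists>n. k \<le> n \<and> sd x y \<inter> {m n..<m (Suc n)} = {}"
proof -
  define B where "B = {p. \<exists>n. p = prod_encode (n, prod_encode (m n, m (Suc n)))}"
  have B: "B \<in> N.AA" unfolding B_def
    by (rule N.AA_I) (intro N.dfn_nex N.dfn_neq N.ntm_pair N.ntm_nfun[OF m(1)] N.ntm_nof N.ntm_Suc dt_var)
  obtain Q T H c S where g: "generic_real AA N.AA Q T H c" and S: "S \<in> AA" and BH: "B = {n. \<exists>q\<in>H. prod_encode (n, q) \<in> S}"
    by (rule real_generic[OF B])
  interpret g: generic_real AA N.AA Q T H c by (rule g)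
  \<comment> \<open>\<open>s\<close> extends both \<open>q\<close> and a condition \<open>l\<close>
    that makes the interval from \<open>u\<close> to \<open>v\<close> the \<open>n\<close>-th
    one.\<close>
  define ok where "ok = (\<lambda>q s n u v l. l \<in> Q \<and> prod_encode (prod_encode (n, prod_encode (u, v)), l) \<in> S \<and> s \<in> Q
      \<and> prod_encode (s, q) \<in> T \<and> prod_encode (s, l) \<in> T)"
  have okd: "dfn M (\<lambda>e. ok (q e) (s e) (n e) (u e) (v e) (l e))" if "ntm q" "ntm s" "ntm n" "ntm u" "ntm v" "ntm l" for q s n u v l
    unfolding ok_def by (intro dfi g.AQ S that)
  \<comment> \<open>Finitely many conditions are served at each step: for every code up to
    \<open>i\<close> that permits an interval of index at least \<open>i\<close> starting at or
    after \<open>t\<close>, one such interval ends by \<open>t'\<close>.\<close>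
  define R where "R = (\<lambda>i t t'. t < t' \<and> (\<forall>q. q \<le> i \<longrightarrow> (\<exists>s n u v l. ok q s n u v l \<and> i \<le> n \<and> t \<le> u) \<longrightarrow>
      (\<exists>s n u v l. ok q s n u v l \<and> i \<le> n \<and> t \<le> u \<and> v \<le> t')))"
  have Rd: "dfn M (\<lambda>e. R (nof (e 0)) (nof (e 1)) (nof (e 2)))" unfolding R_def by (intro dfi okd)
  have Rex: "\<exists>t'. R i t t'" for i t
  proof -
    define Pq where "Pq = (\<lambda>q v. \<exists>s n u l. ok q s n u v l \<and> i \<le> n \<and> t \<le> u)"
    define b where "b = (\<lambda>q. mu (Pq q))"
    have b: "Pq q (b q)" if "Pq q v" for q v unfolding b_def by (rule muI[of "Pq q", OF that])
    define t' where "t' = Max (insert (Suc t) (b ` {..i}))"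
    have bt: "b q \<le> t'" if "q \<le> i" for q unfolding t'_def using that by (intro Max_ge) auto
    have "Suc t \<le> t'" unfolding t'_def by (intro Max_ge) auto
    moreover have "\<exists>s n u v l. ok q s n u v l \<and> i \<le> n \<and> t \<le> u \<and> v \<le> t'"
      if q: "q \<le> i" and e: "\<exists>s n u v l. ok q s n u v l \<and> i \<le> n \<and> t \<le> u" for q
    proof -
      obtain v where "Pq q v" using e unfolding Pq_def by blast
      then show ?thesis using b[of q v] bt[OF q] unfolding Pq_def by blast
    qed
    ultimately have "R i t t'" unfolding R_def by auto
    then show ?thesis by blast
  qed
  obtain f where f: "nfun f" "f 0 = 0" "\<And>i. R i (f i) (f (Suc i))"
    by (rule nat_dc[OF Rd, of "\<lambda>_ _. True" 0]) (use Rex in simp_all)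
  have f2: "\<forall>i. f i < f (Suc i)" using f(3) unfolding R_def by blast
  obtain x y where xy: "x \<in> X" "y \<in> Y" "\<forall>k. \<exists>n. k \<le> n \<and> sd x y \<inter> {f n..<f (Suc n)} = {}" using un[OF f(1) f2] by blast
  have xyA: "x \<in> AA" "y \<in> AA" using xy XY by blast+
  have "\<exists>n. k \<le> n \<and> sd x y \<inter> {m n..<m (Suc n)} = {}" for k
  proof -
    define D where "D = {p. \<exists>n u v l. k \<le> n \<and> ok (fst (prod_decode p)) (fst (prod_decode p)) n u v l \<and> sd x y \<inter> {u..<v} = {}}"
    have D: "D \<in> AA" unfolding D_def by (rule AA_I) (intro dfi okd xyA)
    from g.H_gen[OF D] show ?thesis
    proof
      assume "\<exists>q\<in>H. \<exists>k. prod_encode (q, cyl c k) \<in> D"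
      then obtain q n u v l where q: "q \<in> H" "k \<le> n" "ok q q n u v l" "sd x y \<inter> {u..<v} = {}" unfolding D_def by auto
      have "l \<in> H" using q(1,3) g.H_up unfolding ok_def by blast
      then have "prod_encode (n, prod_encode (u, v)) \<in> B" unfolding BH using q(3) unfolding ok_def by blast
      then have uv: "u = m n" "v = m (Suc n)" unfolding B_def by auto
      show ?thesis using q(2,4) unfolding uv by (intro exI conjI)
    next
      assume "\<exists>q\<in>H. \<exists>k. \<forall>q'\<in>Q. prod_encode (q', q) \<in> T \<longrightarrow>
        (\<forall>x k'. k \<le> k' \<longrightarrow> x \<inter> {..<k} = c \<inter> {..<k} \<longrightarrow> prod_encode (q', cyl x k') \<notin> D)"
      then obtain q k' where q: "q \<in> H" and no0: "\<forall>q'\<in>Q. prod_encode (q', q) \<in> T \<longrightarrow>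
        (\<forall>x l. k' \<le> l \<longrightarrow> x \<inter> {..<k'} = c \<inter> {..<k'} \<longrightarrow> prod_encode (q', cyl x l) \<notin> D)" by (elim bexE exE)
      note no = no0[rule_format, OF _ _ order_refl refl]
      \<comment> \<open>With \<open>i \<ge> q\<close> the condition \<open>q\<close> is served at
        step \<open>i\<close>: some extension of it puts a whole interval of the new sequence
        between \<open>f i\<close> and \<open>f (Suc i)\<close>, where \<open>x\<close> and
        \<open>y\<close> agree.\<close>
      obtain i where i: "max q k \<le> i" "sd x y \<inter> {f i..<f (Suc i)} = {}" using xy(3) by blast
      define n where "n = max i (f i)"
      have mn: "n \<le> m n" using strict_mono_imp_increasing[of m] m(2) unfolding strict_mono_Suc_iff by blast
      have "prod_encode (n, prod_encode (m n, m (Suc n))) \<in> B" unfolding B_def by blast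
      then obtain l where l: "l \<in> H" "prod_encode (prod_encode (n, prod_encode (m n, m (Suc n))), l) \<in> S" unfolding BH by blast
      obtain s where s: "s \<in> H" "prod_encode (s, q) \<in> T" "prod_encode (s, l) \<in> T" using g.H_dir[OF q l(1)] by blast
      have "ok q s n (m n) (m (Suc n)) l" unfolding ok_def using l s g.HQ by blast
      moreover have "i \<le> n" "f i \<le> m n" using mn unfolding n_def by linarith+
      ultimately have "\<exists>s n u v l. ok q s n u v l \<and> i \<le> n \<and> f i \<le> u" by blast
      moreover have "q \<le> i" using i(1) by simp
      ultimately have "\<exists>s n u v l. ok q s n u v l \<and> i \<le> n \<and> f i \<le> u \<and> v \<le> f (Suc i)"
        using f(3)[of i, unfolded R_def, THEN conjunct2, rule_format, of q] by simp
      then obtain s n u v l where o: "ok q s n u v l" "i \<le> n" "f i \<le> u" "v \<le> f (Suc i)" by blast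
      have sQ: "s \<in> Q" "prod_encode (s, q) \<in> T" using o(1) unfolding ok_def by blast+
      have "ok s s n u v l" using o(1) g.T_refl[OF sQ(1)] unfolding ok_def by blast
      moreover have "sd x y \<inter> {u..<v} = {}" using i(2) o(3,4) by fastforce
      moreover have "k \<le> n" using i(1) o(2) by simp
      ultimately have "prod_encode (s, cyl c k') \<in> D" unfolding D_def by auto
      then show ?thesis using no sQ by blast
    qed
  qed
  then show ?thesis using xy(1,2) by blast
qed

end

section \<open>The real line of a model\<close>

definition qv :: "nat \<Rightarrow> real" where
  "qv z = (real (fst (prod_decode z)) - real (fst (prod_decode (snd (prod_decode z))))) / (real (snd (prod_decode (snd (prod_decode z)))) + 1)"

text \<open>A real of a model is represented by a HOL real whose cut, as a set of codes of
  rationals, belongs to the model. The laws of arithmetic then come from HOL; what remains is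
  closure under the operations.\<close>

definition cut :: "real \<Rightarrow> nat set" where "cut x = {z. qv z < x}"

lemma qv_ex: assumes "q \<in> \<rat>" shows "\<exists>z. qv z = q"
proof -
  obtain a b where ab: "b > 0" "q = of_int a / of_int b" using assms Rats_cases' by metis
  define z where "z = prod_encode (nat a, prod_encode (nat (- a), nat b - 1))"
  have "real (nat a) - real (nat (- a)) = of_int a" by (cases "0 \<le> a") auto
  moreover have "real (nat b - 1) + 1 = of_int b" using ab(1) by (simp add: of_nat_diff)
  ultimately have "qv z = q" unfolding qv_def z_def ab(2) by simp
  then show ?thesis by blast
qed

lemma qv_dense: assumes "x < y" obtains z where "x < qv z" "qv z < y"
proof -
  obtain q where "q \<in> \<rat>" "x < q" "q < y" using Rats_dense_in_real[OF assms] by blast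
  then show ?thesis using qv_ex that by metis
qed

lemma mem_cut [simp]: "z \<in> cut x \<longleftrightarrow> qv z < x" by (simp add: cut_def)

lemma cut_sub: "cut x \<subseteq> cut y \<longleftrightarrow> x \<le> y"
proof
  assume "cut x \<subseteq> cut y"
  then show "x \<le> y" using qv_dense[of y x] by (metis mem_cut less_asym not_le subsetD)
qed auto

lemma cut_inj: "cut x = cut y \<longleftrightarrow> x = y" using cut_sub by (metis order_antisym subset_refl)

definition iscut :: "nat set \<Rightarrow> bool" where
  "iscut A \<longleftrightarrow> (\<exists>z. z \<in> A) \<and> (\<exists>z. z \<notin> A) \<and> (\<forall>z\<in>A. \<forall>w. qv w \<le> qv z \<longrightarrow> w \<in> A) \<and> (\<forall>z\<in>A. \<exists>w\<in>A. qv z < qv w)"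

lemma iscut_iff: "iscut A \<longleftrightarrow> (\<exists>x. A = cut x)"
proof
  assume A: "iscut A"
  then obtain z0 w0 where z0: "z0 \<in> A" and w0: "w0 \<notin> A" unfolding iscut_def by blast
  have dn: "w \<in> A" if "z \<in> A" "qv w \<le> qv z" for z w using A that unfolding iscut_def by blast
  have ub: "qv z \<le> qv w0" if "z \<in> A" for z using dn[OF that, of w0] w0 by fastforce
  have bdd: "bdd_above (qv ` A)" using ub by (auto intro!: bdd_aboveI2)
  have "A = cut (Sup (qv ` A))"
  proof (intro equalityI subsetI)
    fix z assume z: "z \<in> A"
    then obtain w where w: "w \<in> A" "qv z < qv w" using A unfolding iscut_def by blast
    then have "qv w \<le> Sup (qv ` A)" using bdd by (intro cSup_upper) auto
    then show "z \<in> cut (Sup (qv ` A))" using w by simp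
  next
    fix z assume "z \<in> cut (Sup (qv ` A))"
    then have "qv z < Sup (qv ` A)" by simp
    then obtain w where "w \<in> A" "qv z < qv w" using less_cSup_iff[OF _ bdd] z0 by auto
    then show "z \<in> A" using dn[of w z] by simp
  qed
  then show "\<exists>x. A = cut x" by blast
next
  assume "\<exists>x. A = cut x"
  then obtain x where A: "A = cut x" by blast
  obtain z where "qv z < x" using qv_dense[of "x - 1" x] by auto
  moreover obtain w where "x < qv w" using qv_dense[of x "x + 1"] by auto
  moreover have "\<exists>w. qv w < x \<and> qv z < qv w" if "qv z < x" for z using qv_dense[OF that] by metis
  ultimately show "iscut A" unfolding iscut_def A Bex_def Ball_def mem_cut by (meson less_asym le_less_trans)
qed

section \<open>Arithmetic of cuts\<close>

definition addc :: "nat set \<Rightarrow> nat set \<Rightarrow> nat set" where "addc A B = {z. \<exists>a\<in>A. \<exists>b\<in>B. qv z \<le> qv a + qv b}"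
definition negc :: "nat set \<Rightarrow> nat set" where "negc A = {z. \<exists>a. a \<notin> A \<and> qv z < - qv a}"
text \<open>The union of the cuts of a real and its negative is the cut of the absolute value, which
  avoids a case distinction on the sign.\<close>

definition sqc :: "nat set \<Rightarrow> nat set" where
  "sqc A = {z. qv z < 0 \<or> (\<exists>a\<in>A \<union> negc A. 0 \<le> qv a \<and> qv z < qv a * qv a)}"
definition quc :: "nat set \<Rightarrow> nat set" where "quc A = {z. \<exists>a\<in>A. real 4 * qv z \<le> qv a}"
text \<open>Multiplication through (x + y)^2 - (x - y)^2 = 4xy.\<close>

definition mulc :: "nat set \<Rightarrow> nat set \<Rightarrow> nat set" where
  "mulc A B = quc (addc (sqc (addc A B)) (negc (sqc (addc A (negc B)))))"
text \<open>Reciprocals of positive reals; negative ones are reduced to these in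
  \<open>RR_ops\<close>.\<close>

definition invc :: "nat set \<Rightarrow> nat set" where "invc A = {z. qv z \<le> 0 \<or> (\<exists>b. b \<notin> A \<and> qv z * qv b < 1)}"

lemma addc_cut: "addc (cut x) (cut y) = cut (x + y)"
proof (intro equalityI subsetI)
  fix z assume "z \<in> addc (cut x) (cut y)"
  then obtain a b where "qv a < x" "qv b < y" "qv z \<le> qv a + qv b" unfolding addc_def by auto
  then show "z \<in> cut (x + y)" by simp
next
  fix z assume "z \<in> cut (x + y)"
  then have "qv z - y < x" by simp
  then obtain a where a: "qv z - y < qv a" "qv a < x" by (rule qv_dense)
  then have "qv z - qv a < y" by simp
  then obtain b where "qv z - qv a < qv b" "qv b < y" by (rule qv_dense)
  then show "z \<in> addc (cut x) (cut y)" unfolding addc_def using a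
    by (intro CollectI bexI[of _ a] bexI[of _ b]) auto
qed

lemma negc_cut: "negc (cut x) = cut (- x)"
proof (intro equalityI subsetI)
  fix z assume "z \<in> cut (- x)"
  then have "x < - qv z" by simp
  then obtain a where "x < qv a" "qv a < - qv z" by (rule qv_dense)
  then show "z \<in> negc (cut x)" unfolding negc_def by (intro CollectI exI[of _ a]) auto
qed (auto simp: negc_def)

lemma sqc_cut: "sqc (cut x) = cut (x * x)"
proof -
  have u: "cut x \<union> negc (cut x) = cut \<bar>x\<bar>" unfolding negc_cut by auto
  show ?thesis
  proof (intro equalityI subsetI)
    fix z assume "z \<in> sqc (cut x)"
    then consider "qv z < 0" | a where "qv a < \<bar>x\<bar>" "0 \<le> qv a" "qv z < qv a * qv a" unfolding sqc_def u by auto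
    then have "qv z < x * x"
    proof cases
      case 1 then show ?thesis using zero_le_square[of x] by linarith
    next
      case 2
      have "qv a * qv a \<le> \<bar>x\<bar> * \<bar>x\<bar>" using 2 by (intro mult_mono) auto
      then show ?thesis using 2 by simp
    qed
    then show "z \<in> cut (x * x)" by simp
  next
    fix z assume "z \<in> cut (x * x)"
    then have z: "qv z < x * x" by simp
    show "z \<in> sqc (cut x)"
    proof (cases "qv z < 0")
      case False
      have "sqrt (qv z) < sqrt (x * x)" using z by (rule real_sqrt_less_mono)
      then have "sqrt (qv z) < \<bar>x\<bar>" by simp
      then obtain a where a: "sqrt (qv z) < qv a" "qv a < \<bar>x\<bar>" by (rule qv_dense)
      have s0: "0 \<le> sqrt (qv z)" using False by simp
      then have "sqrt (qv z) * sqrt (qv z) < qv a * qv a" using a(1) by (intro mult_strict_mono) (use a(1) s0 in linarith)+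
      then have "qv z < qv a * qv a" using False by simp
      then show ?thesis unfolding sqc_def u using a order_trans[OF s0 less_imp_le[OF a(1)]] by (intro CollectI disjI2 bexI[of _ a]) auto
    qed (simp add: sqc_def)
  qed
qed

lemma quc_cut: "quc (cut x) = cut (x / 4)"
proof (intro equalityI subsetI)
  fix z assume "z \<in> cut (x / 4)"
  then have "4 * qv z < x" by simp
  then obtain a where "4 * qv z < qv a" "qv a < x" by (rule qv_dense)
  then show "z \<in> quc (cut x)" unfolding quc_def by (intro CollectI bexI[of _ a]) auto
qed (auto simp: quc_def)

lemma mulc_cut: "mulc (cut x) (cut y) = cut (x * y)"
proof -
  have "((x + y) * (x + y) + - ((x + - y) * (x + - y))) / 4 = x * y" by (simp add: algebra_simps)
  then show ?thesis unfolding mulc_def addc_cut negc_cut sqc_cut quc_cut by simp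
qed

lemma invc_cut: assumes "0 < x" shows "invc (cut x) = cut (1 / x)"
proof (intro equalityI subsetI)
  fix z assume "z \<in> invc (cut x)"
  then have "qv z \<le> 0 \<or> (\<exists>b. \<not> qv b < x \<and> qv z * qv b < 1)" unfolding invc_def mem_Collect_eq mem_cut .
  then consider "qv z \<le> 0" | b where "x \<le> qv b" "qv z * qv b < 1" "0 < qv z" by (meson not_le)
  then show "z \<in> cut (1 / x)"
  proof cases
    case 1
    have "0 < 1 / x" using assms by simp
    then show ?thesis unfolding mem_cut using 1 by linarith
  next
    case 2
    have "qv z * x \<le> qv z * qv b" using 2 by (intro mult_left_mono) auto
    then have "qv z * x < 1" using 2 by linarith
    then show ?thesis using assms by (simp add: pos_less_divide_eq)
  qed
next
  fix z assume "z \<in> cut (1 / x)"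
  then have z: "qv z * x < 1" using assms by (simp add: pos_less_divide_eq)
  show "z \<in> invc (cut x)"
  proof (cases "qv z \<le> 0")
    case False
    then have "x < 1 / qv z" using z by (simp add: pos_less_divide_eq mult.commute)
    then obtain b where "x < qv b" "qv b < 1 / qv z" by (rule qv_dense)
    then show ?thesis unfolding invc_def using False by (intro CollectI disjI2 exI[of _ b]) (auto simp: pos_less_divide_eq mult.commute)
  qed (simp add: invc_def)
qed

subsection \<open>A Cantor set\<close>

text \<open>Digits 0 and 1 in base 4: \<open>cm x\<close> is the sum of
  \<open>1 / 4 ^ (i + 1)\<close> over \<open>i \<in> x\<close>. The missing digits leave gaps, so
  that closeness on the line amounts to a common initial segment.\<close>

definition cT :: "nat set \<Rightarrow> nat \<Rightarrow> nat" where "cT x k = rec_nat 0 (\<lambda>i y. 4 * y + (if i \<in> x then 1 else 0)) k"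
definition cm :: "nat set \<Rightarrow> real" where "cm x = (SUP k. real (cT x k) / 4 ^ k)"
definition ccm :: "nat set \<Rightarrow> nat set" where "ccm x = {z. \<exists>k. qv z * real (4 ^ k) < real (cT x k)}"

lemma cT_simps [simp]: "cT x 0 = 0" "cT x (Suc k) = 4 * cT x k + (if k \<in> x then 1 else 0)"
  by (simp_all add: cT_def)

lemma cT_up: "real (cT x k) / 4 ^ k \<le> real (cT x (k + j)) / 4 ^ (k + j)"
proof (induction j)
  case (Suc j)
  have "real (cT x (k + j)) / 4 ^ (k + j) \<le> real (cT x (Suc (k + j))) / 4 ^ Suc (k + j)"
    by (simp add: field_simps)
  then show ?case using Suc by simp
qed simp

lemma cT_lo: "real (cT x (k + j)) / 4 ^ (k + j) \<le> real (cT x k) / 4 ^ k + (1 / 4 ^ k - 1 / 4 ^ (k + j)) / 3"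
proof (induction j)
  case (Suc j)
  have "real (cT x (Suc (k + j))) / 4 ^ Suc (k + j) \<le> real (cT x (k + j)) / 4 ^ (k + j) + 1 / 4 ^ Suc (k + j)"
    by (simp add: field_simps)
  also have "\<dots> \<le> real (cT x k) / 4 ^ k + (1 / 4 ^ k - 1 / 4 ^ (k + j)) / 3 + 1 / 4 ^ Suc (k + j)" using Suc by simp
  also have "\<dots> = real (cT x k) / 4 ^ k + (1 / 4 ^ k - 1 / 4 ^ (k + Suc j)) / 3" by (simp add: field_simps)
  finally show ?case by simp
qed simp

lemma cm_bounds: "real (cT x k) / 4 ^ k \<le> cm x" "cm x \<le> real (cT x k) / 4 ^ k + 1 / (3 * 4 ^ k)"
proof -
  have ub: "real (cT x n) / 4 ^ n \<le> real (cT x k) / 4 ^ k + 1 / (3 * 4 ^ k)" for n k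
  proof (cases "k \<le> n")
    case True
    then obtain j where n: "n = k + j" using le_Suc_ex by blast
    have "(1 / 4 ^ k - 1 / 4 ^ (k + j)) / 3 \<le> (1::real) / (3 * 4 ^ k)" by simp
    then show ?thesis using cT_lo[of x k j] unfolding n by linarith
  next
    case False
    then obtain j where "k = n + j" using le_Suc_ex[of n k] by auto
    then have "real (cT x n) / 4 ^ n \<le> real (cT x k) / 4 ^ k" using cT_up[of x n j] by simp
    moreover have "0 \<le> 1 / (3 * 4 ^ k :: real)" by simp
    ultimately show ?thesis by linarith
  qed
  have bdd: "bdd_above (range (\<lambda>k. real (cT x k) / 4 ^ k))" by (rule bdd_aboveI2[of _ _ "real (cT x 0) / 4 ^ 0 + 1 / (3 * 4 ^ 0)"]) (rule ub)
  show "real (cT x k) / 4 ^ k \<le> cm x" unfolding cm_def by (rule cSUP_upper[OF _ bdd]) simp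
  show "cm x \<le> real (cT x k) / 4 ^ k + 1 / (3 * 4 ^ k)" unfolding cm_def by (rule cSUP_least) (simp, rule ub)
qed

lemma cut_cm: "cut (cm x) = ccm x"
proof (intro equalityI subsetI)
  fix z assume "z \<in> cut (cm x)"
  then have z: "qv z < cm x" by simp
  have "\<exists>k. qv z < real (cT x k) / 4 ^ k"
  proof (rule ccontr)
    assume "\<not> ?thesis"
    then have "cm x \<le> qv z" unfolding cm_def by (intro cSUP_least) (auto simp: not_less)
    then show False using z by simp
  qed
  then obtain k where "qv z < real (cT x k) / 4 ^ k" by blast
  then have "qv z * real (4 ^ k) < real (cT x k)" by (simp add: pos_less_divide_eq)
  then show "z \<in> ccm x" unfolding ccm_def by blast
next
  fix z assume "z \<in> ccm x"
  then obtain k where "qv z * real (4 ^ k) < real (cT x k)" unfolding ccm_def by blast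
  then have "qv z < real (cT x k) / 4 ^ k" by (simp add: pos_less_divide_eq)
  then show "z \<in> cut (cm x)" using cm_bounds(1)[of x k] by simp
qed

lemma cT_cong: "x \<inter> {..<k} = y \<inter> {..<k} \<longleftrightarrow> cT x k = cT y k"
proof (induction k)
  case (Suc k)
  have "x \<inter> {..<Suc k} = y \<inter> {..<Suc k} \<longleftrightarrow> x \<inter> {..<k} = y \<inter> {..<k} \<and> (k \<in> x \<longleftrightarrow> k \<in> y)"
    by (auto simp: lessThan_Suc)
  also have "\<dots> \<longleftrightarrow> cT x k = cT y k \<and> (k \<in> x \<longleftrightarrow> k \<in> y)" using Suc by simp
  also have "\<dots> \<longleftrightarrow> cT x (Suc k) = cT y (Suc k)" by (auto split: if_splits) presburger+
  finally show ?case .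
qed simp

lemma cm_near: assumes "x \<inter> {..<k} = y \<inter> {..<k}" shows "\<bar>cm x - cm y\<bar> < 1 / 4 ^ k"
proof -
  have "cT x k = cT y k" using assms cT_cong by blast
  then have "\<bar>cm x - cm y\<bar> \<le> 1 / (3 * 4 ^ k)" using cm_bounds[of x k] cm_bounds[of y k] by simp
  also have "\<dots> < 1 / 4 ^ k" by (simp add: field_simps)
  finally show ?thesis .
qed

text \<open>If the expansions differ below \<open>k\<close>, the truncations are at least
  \<open>1 / 4 ^ k\<close> apart, and a tail makes up at most a third of this.\<close>

lemma cm_far: assumes "\<bar>cm x - cm y\<bar> < 1 / (2 * 4 ^ k)" shows "x \<inter> {..<k} = y \<inter> {..<k}"
proof (rule ccontr)
  assume "x \<inter> {..<k} \<noteq> y \<inter> {..<k}"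
  then have "cT x k \<noteq> cT y k" using cT_cong by blast
  then have "real (cT x k) + 1 \<le> real (cT y k) \<or> real (cT y k) + 1 \<le> real (cT x k)" by linarith
  then have "real (cT x k) / 4 ^ k + 1 / 4 ^ k \<le> real (cT y k) / 4 ^ k \<or> real (cT y k) / 4 ^ k + 1 / 4 ^ k \<le> real (cT x k) / 4 ^ k"
    unfolding add_divide_distrib[symmetric] by (metis divide_right_mono zero_le_numeral zero_le_power)
  then have "1 / 4 ^ k - 1 / (3 * 4 ^ k) \<le> \<bar>cm x - cm y\<bar>" using cm_bounds[of x k] cm_bounds[of y k] by linarith
  moreover have "1 / (2 * 4 ^ k) \<le> 1 / 4 ^ k - 1 / (3 * 4 ^ k :: real)" by (simp add: field_simps)
  ultimately show False using assms by linarith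
qed

lemma cm_inj: "cm x = cm y \<Longrightarrow> x = y"
proof -
  assume "cm x = cm y"
  then have "x \<inter> {..<Suc n} = y \<inter> {..<Suc n}" for n by (intro cm_far) simp
  then have "n \<in> x \<longleftrightarrow> n \<in> y" for n by (metis IntD1 IntI lessI lessThan_iff)
  then show "x = y" by blast
qed

section \<open>Rational terms and the real line of a model\<close>

context zm
begin

text \<open>The denominators are positive definable numbers, so comparisons of such terms become
  polynomial inequalities between numbers of the model.\<close>

definition qtm :: "((nat \<Rightarrow> 'a) \<Rightarrow> real) \<Rightarrow> bool" where
  "qtm t \<longleftrightarrow> (\<exists>p n d. ntm p \<and> ntm n \<and> ntm d \<and> (\<forall>e. t e = (real (p e) - real (n e)) / (real (d e) + 1)))"

lemma qtmI: "ntm p \<Longrightarrow> ntm n \<Longrightarrow> ntm d \<Longrightarrow> (\<And>e. t e = (real (p e) - real (n e)) / (real (d e) + 1)) \<Longrightarrow> qtm t"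
  unfolding qtm_def by blast

lemma qtmE: assumes "qtm t" obtains p n d where "ntm p" "ntm n" "ntm d" "t = (\<lambda>e. (real (p e) - real (n e)) / (real (d e) + 1))"
  using assms unfolding qtm_def fun_eq_iff[symmetric] by blast

lemma qtm_qv [dfi]: "ntm t \<Longrightarrow> qtm (\<lambda>e. qv (t e))"
  by (rule qtmI[where p="\<lambda>e. fst (prod_decode (t e))" and n="\<lambda>e. fst (prod_decode (snd (prod_decode (t e))))"
      and d="\<lambda>e. snd (prod_decode (snd (prod_decode (t e))))"]) ((intro dfi, assumption)+, simp add: qv_def)

lemma qtm_real [dfi]: "ntm t \<Longrightarrow> qtm (\<lambda>e. real (t e))"
  by (rule qtmI[where p=t and n="\<lambda>e. 0" and d="\<lambda>e. 0"]) (assumption, (rule ntm_const)+, simp)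

lemma qtm_zero [dfi]: "qtm (\<lambda>e. 0)" using qtm_real[OF ntm_const[of 0]] by simp
lemma qtm_one [dfi]: "qtm (\<lambda>e. 1)" using qtm_real[OF ntm_const[of 1]] by simp

lemma qtm_add [dfi]: assumes "qtm s" "qtm t" shows "qtm (\<lambda>e. s e + t e)"
proof -
  obtain p n d where 1: "ntm p" "ntm n" "ntm d" "s = (\<lambda>e. (real (p e) - real (n e)) / (real (d e) + 1))" using assms(1) by (rule qtmE)
  obtain p' n' d' where 2: "ntm p'" "ntm n'" "ntm d'" "t = (\<lambda>e. (real (p' e) - real (n' e)) / (real (d' e) + 1))" using assms(2) by (rule qtmE)
  show ?thesis
  proof (rule qtmI)
    show "ntm (\<lambda>e. p e * Suc (d' e) + p' e * Suc (d e))" "ntm (\<lambda>e. n e * Suc (d' e) + n' e * Suc (d e))"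
      "ntm (\<lambda>e. d e * d' e + (d e + d' e))" by (intro dfi 1(1-3) 2(1-3))+
    have nz: "real a + 1 \<noteq> 0" for a :: nat by linarith
    have "(real a - real b) / (real c + 1) + (real a' - real b') / (real c' + 1)
      = (real (a * Suc c' + a' * Suc c) - real (b * Suc c' + b' * Suc c)) / (real (c * c' + (c + c')) + 1)" for a b c a' b' c' :: nat
    proof -
      have "real (c * c' + (c + c')) + 1 = (real c + 1) * (real c' + 1)" by (simp add: algebra_simps)
      then show ?thesis using nz[of c] nz[of c'] by (simp add: add_frac_eq algebra_simps)
    qed
    then show "s e + t e = (real (p e * Suc (d' e) + p' e * Suc (d e)) - real (n e * Suc (d' e) + n' e * Suc (d e))) / (real (d e * d' e + (d e + d' e)) + 1)" for e
      unfolding 1(4) 2(4) .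
  qed
qed

lemma qtm_mult [dfi]: assumes "qtm s" "qtm t" shows "qtm (\<lambda>e. s e * t e)"
proof -
  obtain p n d where 1: "ntm p" "ntm n" "ntm d" "s = (\<lambda>e. (real (p e) - real (n e)) / (real (d e) + 1))" using assms(1) by (rule qtmE)
  obtain p' n' d' where 2: "ntm p'" "ntm n'" "ntm d'" "t = (\<lambda>e. (real (p' e) - real (n' e)) / (real (d' e) + 1))" using assms(2) by (rule qtmE)
  show ?thesis
  proof (rule qtmI)
    show "ntm (\<lambda>e. p e * p' e + n e * n' e)" "ntm (\<lambda>e. p e * n' e + n e * p' e)"
      "ntm (\<lambda>e. d e * d' e + (d e + d' e))" by (intro dfi 1(1-3) 2(1-3))+
    have "(real a - real b) / (real c + 1) * ((real a' - real b') / (real c' + 1))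
      = (real (a * a' + b * b') - real (a * b' + b * a')) / (real (c * c' + (c + c')) + 1)" for a b c a' b' c' :: nat
    proof -
      have "real (c * c' + (c + c')) + 1 = (real c + 1) * (real c' + 1)" by (simp add: algebra_simps)
      then show ?thesis by (simp add: times_divide_times_eq algebra_simps)
    qed
    then show "s e * t e = (real (p e * p' e + n e * n' e) - real (p e * n' e + n e * p' e)) / (real (d e * d' e + (d e + d' e)) + 1)" for e
      unfolding 1(4) 2(4) .
  qed
qed

lemma qtm_minus [dfi]: assumes "qtm s" shows "qtm (\<lambda>e. - s e)"
proof -
  obtain p n d where 1: "ntm p" "ntm n" "ntm d" "s = (\<lambda>e. (real (p e) - real (n e)) / (real (d e) + 1))" using assms(1) by (rule qtmE)
  show ?thesis by (rule qtmI[OF 1(2,1,3)]) (simp only: 1(4) minus_divide_left minus_diff_eq)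
qed

lemma dfn_qless [dfi]: assumes "qtm s" "qtm t" shows "dfn E (\<lambda>e. s e < t e)"
proof -
  obtain p n d where 1: "ntm p" "ntm n" "ntm d" "s = (\<lambda>e. (real (p e) - real (n e)) / (real (d e) + 1))" using assms(1) by (rule qtmE)
  obtain p' n' d' where 2: "ntm p'" "ntm n'" "ntm d'" "t = (\<lambda>e. (real (p' e) - real (n' e)) / (real (d' e) + 1))" using assms(2) by (rule qtmE)
  have fr: "u / B < u' / B' \<longleftrightarrow> u * B' < u' * B" if "0 < B" "0 < B'" for u u' B B' :: real
    using that by (simp only: pos_divide_less_eq times_divide_eq_left pos_less_divide_eq)
  have "(real a - real b) / (real c + 1) < (real a' - real b') / (real c' + 1) \<longleftrightarrow> a * Suc c' + b' * Suc c < a' * Suc c + b * Suc c'" for a b c a' b' c' :: nat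
  proof -
    have "(real a - real b) / (real c + 1) < (real a' - real b') / (real c' + 1) \<longleftrightarrow>
      (real a - real b) * (real c' + 1) < (real a' - real b') * (real c + 1)"
      using fr[of "real c + 1" "real c' + 1" "real a - real b" "real a' - real b'"] by linarith
    also have "\<dots> \<longleftrightarrow> real (a * Suc c' + b' * Suc c) < real (a' * Suc c + b * Suc c')" by (simp add: algebra_simps)
    finally show ?thesis by (simp only: of_nat_less_iff)
  qed
  then have "s e < t e \<longleftrightarrow> p e * Suc (d' e) + n' e * Suc (d e) < p' e * Suc (d e) + n e * Suc (d' e)" for e unfolding 1(4) 2(4) .
  moreover have "dfn E (\<lambda>e. p e * Suc (d' e) + n' e * Suc (d e) < p' e * Suc (d e) + n e * Suc (d' e))" by (intro dfi 1(1-3) 2(1-3))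
  ultimately show ?thesis by simp
qed

lemma dfn_qle [dfi]: assumes "qtm s" "qtm t" shows "dfn E (\<lambda>e. s e \<le> t e)"
  using dfn_not[OF dfn_qless[OF assms(2,1)]] by (simp add: not_less)

lemma stm_cuts [dfi]: assumes "stm A" shows "stm (\<lambda>e. negc (A e))" "stm (\<lambda>e. quc (A e))" "stm (\<lambda>e. invc (A e))"
  unfolding negc_def quc_def invc_def by (intro dfi stm_rename[OF assms])+

lemma stm_sqc [dfi]: assumes "stm A" shows "stm (\<lambda>e. sqc (A e))"
  unfolding sqc_def by (intro dfi stm_rename[OF assms])

lemma stm_addc [dfi]: assumes "stm A" "stm B" shows "stm (\<lambda>e. addc (A e) (B e))"
  unfolding addc_def by (intro dfi stm_rename[OF assms(1)] stm_rename[OF assms(2)])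

lemma stm_mulc [dfi]: assumes "stm A" "stm B" shows "stm (\<lambda>e. mulc (A e) (B e))"
  unfolding mulc_def by (intro dfi assms)

lemma dfn_iscut [dfi]: assumes "stm A" shows "dfn E (\<lambda>e. iscut (A e))"
  unfolding iscut_def by (intro dfi stm_rename[OF assms])

lemma ntm_cT: assumes "stm S" "ntm t" shows "ntm (\<lambda>e. cT (S e) (t e))"
  unfolding cT_def by (intro dfi stm_rename[OF assms(1)] assms)

lemma stm_ccm [dfi]: assumes "stm S" shows "stm (\<lambda>e. ccm (S e))"
  unfolding ccm_def by (intro dfi ntm_cT stm_rename[OF assms])

definition RR :: "real set" where "RR = {x. cut x \<in> AA}"
definition rh :: "real \<Rightarrow> 'a" where "rh x = re (cut x)"

lemma re_inj: "A \<in> AA \<Longrightarrow> B \<in> AA \<Longrightarrow> re A = re B \<longleftrightarrow> A = B" by (metis sof_re)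

lemma rh_inj: "x \<in> RR \<Longrightarrow> y \<in> RR \<Longrightarrow> rh x = rh y \<longleftrightarrow> x = y"
  unfolding RR_def rh_def by (simp add: re_inj cut_inj)

lemma sof_rh [simp]: "x \<in> RR \<Longrightarrow> sof (rh x) = cut x" unfolding RR_def rh_def by simp

lemma RR_q: "qv z \<in> RR" unfolding RR_def cut_def mem_Collect_eq by (rule AA_I) (intro dfi)

lemma RR_Rats: "q \<in> \<rat> \<Longrightarrow> q \<in> RR" using qv_ex RR_q by metis

lemma RR_ops: assumes "x \<in> RR" "y \<in> RR" shows "x + y \<in> RR" "x * y \<in> RR" "- x \<in> RR" "x - y \<in> RR" "x \<noteq> 0 \<Longrightarrow> 1 / x \<in> RR"
proof -
  have A: "cut x \<in> AA" "cut y \<in> AA" using assms by (simp_all add: RR_def)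
  show add: "x + y \<in> RR" unfolding RR_def mem_Collect_eq addc_cut[symmetric] by (rule AA_stm) (intro stm_addc stm_const A)
  show "x * y \<in> RR" unfolding RR_def mem_Collect_eq mulc_cut[symmetric] by (rule AA_stm) (intro stm_mulc stm_const A)
  have neg: "- x \<in> RR" if "x \<in> RR" for x unfolding RR_def mem_Collect_eq negc_cut[symmetric]
    by (rule AA_stm) (intro stm_cuts(1) stm_const that[unfolded RR_def mem_Collect_eq])
  then show "- x \<in> RR" using assms by blast
  have "- y \<in> RR" using neg assms by blast
  then have yA: "cut (- y) \<in> AA" by (simp add: RR_def)
  have "cut (x + - y) \<in> AA" unfolding addc_cut[symmetric] by (rule AA_stm) (intro stm_addc stm_const A yA)
  then show "x - y \<in> RR" by (simp add: RR_def)
  have pos: "1 / x \<in> RR" if "0 < x" "x \<in> RR" for x unfolding RR_def mem_Collect_eq invc_cut[OF that(1), symmetric]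
    by (rule AA_stm) (intro stm_cuts(3) stm_const that(2)[unfolded RR_def mem_Collect_eq])
  show "1 / x \<in> RR" if "x \<noteq> 0"
  proof (cases "0 < x")
    case False
    then have "1 / (- x) \<in> RR" using that assms neg by (intro pos) auto
    then have "- (1 / (- x)) \<in> RR" by (rule neg)
    then show ?thesis by simp
  qed (use pos assms in blast)
qed

lemma isset_rh: "isset (rh ` RR)"
proof -
  have "isset {a \<in> {y. el y \<subseteq> el Om}. iscut (sof a)}" by (intro isset_sep isset_rules dfi)
  moreover have "{a \<in> {y. el y \<subseteq> el Om}. iscut (sof a)} = rh ` RR"
  proof (intro equalityI subsetI)
    fix a assume a: "a \<in> {a \<in> {y. el y \<subseteq> el Om}. iscut (sof a)}"
    then obtain x where x: "sof a = cut x" using iscut_iff by auto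
    moreover have "re (sof a) = a" using a re_sof by simp
    ultimately have "a = rh x" "x \<in> RR" unfolding rh_def RR_def using sof_AA[of a] by simp_all
    then show "a \<in> rh ` RR" by blast
  next
    fix a assume "a \<in> rh ` RR"
    then obtain x where x: "x \<in> RR" "a = rh x" by blast
    have "el a \<subseteq> el Om" using x re_AA[of "cut x"] unfolding rh_def RR_def by auto
    then show "a \<in> {a \<in> {y. el y \<subseteq> el Om}. iscut (sof a)}" using x iscut_iff by auto
  qed
  ultimately show ?thesis by simp
qed

definition Re :: 'a where "Re = mk (rh ` RR)"
lemma el_Re: "el Re = rh ` RR" unfolding Re_def by (rule el_mk[OF isset_rh])

definition le_el :: 'a where "le_el = mk {pr a b | a b. a \<in> rh ` RR \<and> b \<in> rh ` RR \<and> sof a \<subseteq> sof b}"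

lemma el_le: "el le_el = {pr a b | a b. a \<in> rh ` RR \<and> b \<in> rh ` RR \<and> sof a \<subseteq> sof b}"
  unfolding le_el_def by (intro el_mk isset_rel isset_rh dfi)

lemma le_iff: assumes "x \<in> RR" "y \<in> RR" shows "(rh x, rh y) \<in> graph E le_el \<longleftrightarrow> x \<le> y"
  unfolding graph_iff el_le using assms by (auto simp: cut_sub)

lemma le_RR: "(a, b) \<in> graph E le_el \<Longrightarrow> a \<in> rh ` RR \<and> b \<in> rh ` RR"
  unfolding graph_iff el_le by auto

lemma lt_iff: assumes "x \<in> RR" "y \<in> RR" shows "(rh x, rh y) \<in> graph E le_el - Id \<longleftrightarrow> x < y"
  using le_iff[OF assms] rh_inj[OF assms] by auto

text \<open>It turns a definable operation on cuts into an operation on the line that is an element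
  of the model.\<close>

lemma binop_ex:
  assumes opc: "\<And>S T. stm S \<Longrightarrow> stm T \<Longrightarrow> stm (\<lambda>e. opc (S e) (T e))"
    and f: "\<And>x y. opc (cut x) (cut y) = cut (f x y)"
  shows "\<exists>p. is_binop E p Re \<and> (\<forall>x\<in>RR. \<forall>y\<in>RR. f x y \<in> RR \<and> binop E p (rh x) (rh y) = rh (f x y))"
proof -
  have fR: "f x y \<in> RR" if "x \<in> RR" "y \<in> RR" for x y
  proof -
    have "opc (cut x) (cut y) \<in> AA" by (rule AA_stm) (intro opc stm_const that[unfolded RR_def mem_Collect_eq])
    then show ?thesis unfolding f RR_def by simp
  qed
  define C where "C = {pr a b | a b. a \<in> rh ` RR \<and> b \<in> rh ` RR}"
  have C: "isset C" unfolding C_def by (intro isset_prod isset_rh)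
  define Q where "Q = (\<lambda>z c. \<exists>a b. z = pr a b \<and> c = re (opc (sof a) (sof b)))"
  have "dfn E (\<lambda>e. Q (e 0) (e 1))" unfolding Q_def by (intro dfi opc)
  then have "isset {pr z c | z c. z \<in> C \<and> c \<in> rh ` RR \<and> Q z c}" by (intro isset_rel C isset_rh)
  then obtain p where p: "el p = {pr z c | z c. z \<in> C \<and> c \<in> rh ` RR \<and> Q z c}" by (auto simp: isset_def)
  have opr: "re (opc (sof (rh x)) (sof (rh y))) = rh (f x y)" if "x \<in> RR" "y \<in> RR" for x y
    using that by (simp add: f rh_def[of "f x y"])
  have pe: "pr (pr (rh x) (rh y)) c \<in> el p \<longleftrightarrow> c = rh (f x y)" if "x \<in> RR" "y \<in> RR" for x y c
  proof -
    have "pr (rh x) (rh y) \<in> C" unfolding C_def using that by blast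
    moreover have "Q (pr (rh x) (rh y)) c \<longleftrightarrow> c = rh (f x y)" unfolding Q_def pr_inj using opr[OF that] by auto
    ultimately show ?thesis unfolding p using fR[OF that] by auto
  qed
  have zC: "\<exists>x\<in>RR. \<exists>y\<in>RR. z = pr (rh x) (rh y)" if "z \<in> C" for z using that unfolding C_def by blast
  have pC: "z \<in> C" if "pr z c \<in> el p" for z c using that unfolding p by auto
  have "fun_on E p (mk C)" unfolding fun_on_iff el_mk[OF C]
  proof (intro conjI ballI allI impI)
    show "\<exists>a b. e = pr a b" if "e \<in> el p" for e using that unfolding p by blast
    show "(\<exists>b. pr z b \<in> el p) \<longleftrightarrow> z \<in> C" for z
    proof
      assume z: "z \<in> C"
      obtain x y where xy: "x \<in> RR" "y \<in> RR" "z = pr (rh x) (rh y)" using zC[OF z] by (elim bexE)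
      show "\<exists>b. pr z b \<in> el p" unfolding xy(3) pe[OF xy(1,2)] by simp
    qed (elim exE, rule pC)
    show "b = b'" if bb: "pr z b \<in> el p" "pr z b' \<in> el p" for z b b'
    proof -
      obtain x y where xy: "x \<in> RR" "y \<in> RR" "z = pr (rh x) (rh y)" using zC[OF pC[OF bb(1)]] by (elim bexE)
      show ?thesis using bb unfolding xy(3) pe[OF xy(1,2)] by simp
    qed
  qed
  moreover have "Range (graph E p) \<subseteq> el Re"
  proof
    fix c assume "c \<in> Range (graph E p)"
    then obtain z where "pr z c \<in> el p" unfolding Range_iff graph_iff by (elim exE)
    then show "c \<in> el Re" unfolding el_Re p mem_Collect_eq pr_inj by blast
  qed
  moreover have "is_prod E Re Re (mk C)" unfolding is_prod_def el_mk[OF C] el_Re is_pair_iff unfolding C_def by blast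
  ultimately have "is_binop E p Re" unfolding is_binop_def is_map_def by blast
  moreover have "binop E p (rh x) (rh y) = rh (f x y)" if "x \<in> RR" "y \<in> RR" for x y
    unfolding binop_def is_pair_iff graph_iff using pe[OF that] by (intro the_equality) auto
  ultimately show ?thesis using fR by blast
qed

lemma real_line: obtains pl tm ze un where "is_real_line E Re pl tm ze un le_el"
proof -
  obtain pl where pl: "is_binop E pl Re" "\<And>x y. x \<in> RR \<Longrightarrow> y \<in> RR \<Longrightarrow> binop E pl (rh x) (rh y) = rh (x + y)"
    using binop_ex[of addc "(+)"] stm_addc addc_cut by blast
  obtain tm where tm: "is_binop E tm Re" "\<And>x y. x \<in> RR \<Longrightarrow> y \<in> RR \<Longrightarrow> binop E tm (rh x) (rh y) = rh (x * y)"
    using binop_ex[of mulc "(*)"] stm_mulc mulc_cut by blast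
  have R0: "0 \<in> RR" "1 \<in> RR" by (auto intro: RR_Rats)
  note ops = pl(2) tm(2) RR_ops R0
  let ?F = "\<lparr>carrier = el Re, monoid.mult = binop E tm, one = rh 1, zero = rh 0, add = binop E pl\<rparr>"
  have ag: "abelian_group ?F"
  proof (rule abelian_groupI)
    show "\<exists>y\<in>carrier ?F. y \<oplus>\<^bsub>?F\<^esub> x = \<zero>\<^bsub>?F\<^esub>" if xc: "x \<in> carrier ?F" for x
    proof -
      obtain a where a: "a \<in> RR" "x = rh a" using xc unfolding el_Re by auto
      then show ?thesis using RR_ops(3)[OF a(1) a(1)] by (intro bexI[of _ "rh (- a)"]) (auto simp: el_Re pl(2))
    qed
  qed (auto simp: el_Re ops ac_simps)
  have cm: "comm_monoid ?F" by (rule comm_monoidI) (auto simp: el_Re ops ac_simps)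
  have cr: "cring ?F" by (rule cringI[OF ag cm]) (auto simp: el_Re ops algebra_simps)
  have fl: "field ?F"
  proof (rule cring.cring_fieldI2[OF cr])
    show "\<zero>\<^bsub>?F\<^esub> \<noteq> \<one>\<^bsub>?F\<^esub>" using rh_inj[OF R0] by simp
    fix a assume a: "a \<in> carrier ?F" "a \<noteq> \<zero>\<^bsub>?F\<^esub>"
    then obtain x where x: "x \<in> RR" "a = rh x" "x \<noteq> 0" unfolding el_Re by auto
    then have i: "1 / x \<in> RR" using RR_ops(5)[OF x(1) x(1)] by blast
    show "\<exists>b\<in>carrier ?F. a \<otimes>\<^bsub>?F\<^esub> b = \<one>\<^bsub>?F\<^esub>"
      using x i tm(2)[OF x(1) i] by (intro bexI[of _ "rh (1 / x)"]) (auto simp: el_Re)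
  qed
  have "is_real_line E Re pl tm (rh 0) (rh 1) le_el" unfolding is_real_line_def
  proof (intro conjI pl(1) tm(1) fl ballI allI impI)
    show "\<exists>a b. is_pair E a b p" if "p \<in> el le_el" for p using that unfolding el_le is_pair_iff by blast
    show "linear_order_on (el Re) (graph E le_el)"
      unfolding linear_order_on_def partial_order_on_def preorder_on_def refl_on_def trans_def antisym_def total_on_def el_Re
    proof (intro conjI allI impI ballI subsetI)
      show "(a, c) \<in> graph E le_el" if ab: "(a, b) \<in> graph E le_el" "(b, c) \<in> graph E le_el" for a b c
      proof -
        obtain x y z where "x \<in> RR" "y \<in> RR" "z \<in> RR" "a = rh x" "b = rh y" "c = rh z" using le_RR[OF ab(1)] le_RR[OF ab(2)] by blast
        then show ?thesis using ab le_iff by auto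
      qed
      show "a = b" if ab: "(a, b) \<in> graph E le_el" "(b, a) \<in> graph E le_el" for a b
      proof -
        obtain x y where "x \<in> RR" "y \<in> RR" "a = rh x" "b = rh y" using le_RR[OF ab(1)] by blast
        then show ?thesis using ab le_iff by auto
      qed
    qed (use le_RR le_iff in \<open>auto simp: linear\<close>)
  next
    fix a b c assume "a \<in> el Re" "b \<in> el Re" "c \<in> el Re" "(a, b) \<in> graph E le_el"
    then show "(binop E pl a c, binop E pl b c) \<in> graph E le_el" unfolding el_Re using le_iff by (auto simp: ops)
  next
    fix a b assume "a \<in> el Re" "b \<in> el Re" "(rh 0, a) \<in> graph E le_el \<and> (rh 0, b) \<in> graph E le_el"
    then show "(rh 0, binop E tm a b) \<in> graph E le_el" unfolding el_Re using le_iff R0 by (auto simp: ops)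
  next
    fix S assume "el S \<subseteq> el Re \<and> el S \<noteq> {} \<and> (\<exists>b\<in>el Re. \<forall>x\<in>el S. (x, b) \<in> graph E le_el)"
    then obtain b where S: "el S \<subseteq> rh ` RR" "el S \<noteq> {}" "b \<in> RR" "\<forall>x\<in>el S. (x, rh b) \<in> graph E le_el" unfolding el_Re by blast
    define T where "T = {x \<in> RR. rh x \<in> el S}"
    have T: "T \<noteq> {}" "\<And>x. x \<in> T \<Longrightarrow> x \<le> b" "el S = rh ` T" unfolding T_def using S le_iff by auto
    have bdd: "bdd_above T" by (rule bdd_aboveI[of T b]) (rule T(2))
    \<comment> \<open>The supremum taken in HOL belongs to the model: its cut is the union of the
      cuts in \<open>S\<close>, which is definable from \<open>S\<close>.\<close>
    have "cut (Sup T) = {z. \<exists>a\<in>el S. z \<in> sof a}"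
    proof (intro equalityI subsetI)
      fix z assume "z \<in> cut (Sup T)"
      then obtain x where "x \<in> T" "qv z < x" using less_cSup_iff[OF T(1) bdd] by auto
      then show "z \<in> {z. \<exists>a\<in>el S. z \<in> sof a}" unfolding T(3) using T_def by auto
    next
      fix z assume "z \<in> {z. \<exists>a\<in>el S. z \<in> sof a}"
      then obtain x where "x \<in> T" "qv z < x" unfolding T(3) using T_def by auto
      then show "z \<in> cut (Sup T)" using cSup_upper[OF _ bdd, of x] by simp
    qed
    moreover have "{z. \<exists>a\<in>el S. z \<in> sof a} \<in> AA" by (rule AA_I) (intro dfi)
    ultimately have c: "Sup T \<in> RR" by (simp add: RR_def)
    show "\<exists>c\<in>el Re. (\<forall>x\<in>el S. (x, c) \<in> graph E le_el) \<and>
             (\<forall>b\<in>el Re. (\<forall>x\<in>el S. (x, b) \<in> graph E le_el) \<longrightarrow> (c, b) \<in> graph E le_el)"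
    proof (intro bexI[of _ "rh (Sup T)"] conjI ballI impI)
      show "(x, rh (Sup T)) \<in> graph E le_el" if x: "x \<in> el S" for x
      proof -
        obtain a where a: "a \<in> T" "x = rh a" using x unfolding T(3) by blast
        then have "a \<le> Sup T" "a \<in> RR" using cSup_upper[OF _ bdd] T_def by auto
        then show ?thesis using le_iff[OF _ c] a by simp
      qed
      show "(rh (Sup T), d) \<in> graph E le_el" if d: "d \<in> el Re" "\<forall>x\<in>el S. (x, d) \<in> graph E le_el" for d
      proof -
        obtain y where y: "y \<in> RR" "d = rh y" using d(1) unfolding el_Re by blast
        have "a \<le> y" if a: "a \<in> T" for a
        proof -
          have "a \<in> RR" "rh a \<in> el S" using a unfolding T_def by auto
          then show ?thesis using d(2) le_iff y by blast
        qed
        then have "Sup T \<le> y" using T(1) by (intro cSup_least)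
        then show ?thesis using le_iff[OF c y(1)] y(2) by simp
      qed
    qed (use c el_Re in auto)
  qed
  then show ?thesis by (rule that)
qed

end

subsection \<open>Topology of sets of reals in terms of cylinders\<close>

lemma cyl_mono: "cyl x l = cyl y l \<Longrightarrow> k \<le> l \<Longrightarrow> cyl x k = cyl y k"
proof -
  assume 1: "cyl x l = cyl y l" "k \<le> l"
  have "x \<inter> {..<k} = (x \<inter> {..<l}) \<inter> {..<k}" "y \<inter> {..<k} = (y \<inter> {..<l}) \<inter> {..<k}" using 1(2) by auto
  then show ?thesis using 1(1) unfolding cyl_eq by simp
qed

lemma cyl_mem: "cyl x l = cyl y l \<Longrightarrow> k < l \<Longrightarrow> k \<in> x \<longleftrightarrow> k \<in> y"
  unfolding cyl_eq by (metis Int_iff lessThan_iff)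

context zm
begin

definition pt :: "nat set \<Rightarrow> 'a" where "pt x = rh (cm x)"

lemma pt_re: "pt x = re (ccm x)" unfolding pt_def rh_def cut_cm ..

lemma cm_RR: "x \<in> AA \<Longrightarrow> cm x \<in> RR" unfolding RR_def mem_Collect_eq cut_cm by (rule AA_stm) (intro stm_ccm stm_const)

lemma pt_RR: "x \<in> AA \<Longrightarrow> pt x \<in> rh ` RR" unfolding pt_def by (intro imageI cm_RR)

lemma pt_inj: "x \<in> AA \<Longrightarrow> y \<in> AA \<Longrightarrow> pt x = pt y \<longleftrightarrow> x = y"
  unfolding pt_def by (auto simp: rh_inj cm_RR dest: cm_inj)

lemma dt_pt [dfi]: "stm S \<Longrightarrow> dt E (\<lambda>e. pt (S e))" unfolding pt_re by (intro dfi)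

lemma isset_re_sep: assumes "X \<subseteq> AA" "isset (re ` X)" "dfn E (\<lambda>e. Q (sof (e 0)))" shows "isset (re ` {x \<in> X. Q x})"
proof -
  have "isset {a \<in> re ` X. Q (sof a)}" by (rule isset_sep[OF assms(2,3)])
  moreover have "{a \<in> re ` X. Q (sof a)} = re ` {x \<in> X. Q x}"
    using assms(1) by (auto simp: image_iff subset_iff)
  ultimately show ?thesis by simp
qed

lemma isset_pt: assumes "X \<subseteq> AA" "isset (re ` X)" shows "isset (pt ` X)"
proof -
  obtain r where r: "el r = re ` X" using assms(2) by (auto simp: isset_def)
  have "isset {a \<in> {y. el y \<subseteq> el Om}. \<exists>b\<in>el r. a = pt (sof b)}" by (intro isset_sep isset_rules dfi)
  moreover have "{a \<in> {y. el y \<subseteq> el Om}. \<exists>b\<in>el r. a = pt (sof b)} = pt ` X"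
  proof (intro equalityI subsetI)
    fix a assume "a \<in> {a \<in> {y. el y \<subseteq> el Om}. \<exists>b\<in>el r. a = pt (sof b)}"
    then obtain x where "x \<in> X" "a = pt (sof (re x))" unfolding r by blast
    then show "a \<in> pt ` X" using assms(1) by (auto simp: subset_iff)
  next
    fix a assume "a \<in> pt ` X"
    then obtain x where x: "x \<in> X" "a = pt x" by blast
    then have xA: "x \<in> AA" using assms(1) by blast
    have "ccm x \<in> AA" by (rule AA_stm) (intro dfi xA)
    then have "el a \<subseteq> el Om" unfolding x(2) pt_re re_AA[OF \<open>ccm x \<in> AA\<close>] by auto
    moreover have "\<exists>b\<in>el r. a = pt (sof b)" unfolding r using x xA by (intro bexI[of _ "re x"]) auto
    ultimately show "a \<in> {a \<in> {y. el y \<subseteq> el Om}. \<exists>b\<in>el r. a = pt (sof b)}" by blast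
  qed
  ultimately show ?thesis by simp
qed

definition lt :: "'a \<Rightarrow> 'a \<Rightarrow> bool" where "lt a b \<longleftrightarrow> pr a b \<in> el le_el \<and> a \<noteq> b"

lemma lt_rh: "x \<in> RR \<Longrightarrow> y \<in> RR \<Longrightarrow> lt (rh x) (rh y) \<longleftrightarrow> x < y"
  using lt_iff[of x y] unfolding lt_def graph_iff[symmetric] by blast

lemma lt_graph: "(a, b) \<in> graph E le_el - Id \<longleftrightarrow> lt a b" unfolding lt_def graph_iff[symmetric] by blast

lemma dfn_lt [dfi]: "dt E s \<Longrightarrow> dt E t \<Longrightarrow> dfn E (\<lambda>e. lt (s e) (t e))" unfolding lt_def by (intro dfi)

lemma real_open_iff: "real_open E Re le_el V \<longleftrightarrow> el V \<subseteq> rh ` RR \<and>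
  (\<forall>v\<in>el V. \<exists>a\<in>rh ` RR. \<exists>b\<in>rh ` RR. lt a v \<and> lt v b \<and> (\<forall>y\<in>rh ` RR. lt a y \<and> lt y b \<longrightarrow> y \<in> el V))"
  unfolding real_open_def lt_graph el_Re by (rule refl)

text \<open>\<open>cm_near\<close> puts cylinders into intervals and \<open>cm_far\<close> intervals
  into cylinders. The open set of the line is the union of all intervals whose trace on
  \<open>XR\<close> lies in \<open>U\<close>, which is definable.\<close>

lemma sub_open_iff:
  assumes X: "X \<subseteq> AA" and XR: "el XR = pt ` X"
  shows "sub_open E (real_open E Re le_el) XR U \<longleftrightarrow> el U \<subseteq> pt ` X \<and>
    (\<forall>x\<in>X. pt x \<in> el U \<longrightarrow> (\<exists>k. \<forall>x'\<in>X. cyl x' k = cyl x k \<longrightarrow> pt x' \<in> el U))"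
proof
  assume "sub_open E (real_open E Re le_el) XR U"
  then obtain V where V: "real_open E Re le_el V" "el U = el V \<inter> pt ` X" unfolding sub_open_def XR by blast
  have "\<exists>k. \<forall>x'\<in>X. cyl x' k = cyl x k \<longrightarrow> pt x' \<in> el U" if x: "x \<in> X" "pt x \<in> el U" for x
  proof -
    have xA: "x \<in> AA" using x X by blast
    have "pt x \<in> el V" using x(2) V(2) by blast
    then obtain a b where ab: "a \<in> RR" "b \<in> RR" "lt (rh a) (pt x)" "lt (pt x) (rh b)"
      and in_V: "\<And>y. y \<in> RR \<Longrightarrow> lt (rh a) (rh y) \<Longrightarrow> lt (rh y) (rh b) \<Longrightarrow> rh y \<in> el V"
      using V(1) unfolding real_open_iff by blast
    have a: "a < cm x" "cm x < b" using ab lt_rh cm_RR[OF xA] unfolding pt_def by blast+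
    obtain k where k: "(1/4) ^ k < min (cm x - a) (b - cm x)"
      using real_arch_pow_inv[of "min (cm x - a) (b - cm x)" "1/4"] a by auto
    have "pt x' \<in> el U" if x': "x' \<in> X" "cyl x' k = cyl x k" for x'
    proof -
      have x'A: "x' \<in> AA" using x' X by blast
      have "\<bar>cm x' - cm x\<bar> < 1 / 4 ^ k" using x'(2) by (intro cm_near) (simp add: cyl_eq)
      then have "a < cm x'" "cm x' < b" using k by (auto simp: power_divide)
      then have "rh (cm x') \<in> el V" using cm_RR[OF x'A] ab lt_rh by (intro in_V) auto
      then show ?thesis unfolding V(2) pt_def[symmetric] using x'(1) by blast
    qed
    then show ?thesis by blast
  qed
  then show "el U \<subseteq> pt ` X \<and> (\<forall>x\<in>X. pt x \<in> el U \<longrightarrow> (\<exists>k. \<forall>x'\<in>X. cyl x' k = cyl x k \<longrightarrow> pt x' \<in> el U))"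
    using V(2) by blast
next
  assume U: "el U \<subseteq> pt ` X \<and> (\<forall>x\<in>X. pt x \<in> el U \<longrightarrow> (\<exists>k. \<forall>x'\<in>X. cyl x' k = cyl x k \<longrightarrow> pt x' \<in> el U))"
  define good where "good = (\<lambda>a b. \<forall>w\<in>el XR. lt a w \<and> lt w b \<longrightarrow> w \<in> el U)"
  have "isset {v \<in> el Re. \<exists>a\<in>el Re. \<exists>b\<in>el Re. lt a v \<and> lt v b \<and> good a b}" unfolding good_def by (intro isset_sep isset_rules dfi)
  then obtain V where V: "el V = {v \<in> rh ` RR. \<exists>a\<in>rh ` RR. \<exists>b\<in>rh ` RR. lt a v \<and> lt v b \<and> good a b}"
    unfolding el_Re by (auto simp: isset_def)
  have "real_open E Re le_el V" unfolding real_open_iff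
  proof (intro conjI ballI)
    show "el V \<subseteq> rh ` RR" unfolding V by blast
    fix v assume "v \<in> el V"
    then obtain a b where "a \<in> rh ` RR" "b \<in> rh ` RR" "lt a v" "lt v b" "good a b" unfolding V by blast
    then show "\<exists>a\<in>rh ` RR. \<exists>b\<in>rh ` RR. lt a v \<and> lt v b \<and> (\<forall>y\<in>rh ` RR. lt a y \<and> lt y b \<longrightarrow> y \<in> el V)"
      unfolding V by blast
  qed
  moreover have "el U = el V \<inter> el XR"
  proof (intro equalityI subsetI)
    fix u assume u: "u \<in> el U"
    then obtain x where x: "x \<in> X" "u = pt x" using U by blast
    obtain k where k: "\<forall>x'\<in>X. cyl x' k = cyl x k \<longrightarrow> pt x' \<in> el U" using U x u by blast
    have xA: "x \<in> AA" using x X by blast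
    \<comment> \<open>The radius of \<open>cm_far\<close>; being rational it keeps the end points in
      the model.\<close>
    define d :: real where "d = 1 / (2 * 4 ^ k)"
    have "d \<in> \<rat>" unfolding d_def by (intro Rats_divide Rats_mult Rats_power) auto
    then have dR: "d \<in> RR" by (rule RR_Rats)
    have d0: "0 < d" unfolding d_def by simp
    have R: "cm x - d \<in> RR" "cm x + d \<in> RR" using RR_ops(1,4)[OF cm_RR[OF xA] dR] by blast+
    have "lt (rh (cm x - d)) u" "lt u (rh (cm x + d))" unfolding x(2) pt_def using R cm_RR[OF xA] d0 by (simp_all add: lt_rh)
    moreover have "good (rh (cm x - d)) (rh (cm x + d))" unfolding good_def XR
    proof (intro ballI impI)
      fix w assume "w \<in> pt ` X" and l: "lt (rh (cm x - d)) w \<and> lt w (rh (cm x + d))"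
      then obtain x' where x': "x' \<in> X" "w = pt x'" by blast
      then have x'A: "x' \<in> AA" using X by blast
      have "cm x - d < cm x'" "cm x' < cm x + d" using l R cm_RR[OF x'A] unfolding x'(2) pt_def by (simp_all add: lt_rh)
      then have "\<bar>cm x' - cm x\<bar> < 1 / (2 * 4 ^ k)" unfolding d_def by linarith
      then have "cyl x' k = cyl x k" unfolding cyl_eq using cm_far by blast
      then show "w \<in> el U" using k x' by blast
    qed
    ultimately have "u \<in> el V" unfolding V using R pt_RR[OF xA] x(2) by blast
    then show "u \<in> el V \<inter> el XR" unfolding XR using x by blast
  next
    fix u assume "u \<in> el V \<inter> el XR"
    then show "u \<in> el U" unfolding V good_def by blast
  qed
  ultimately show "sub_open E (real_open E Re le_el) XR U" unfolding sub_open_def by blast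
qed

abbreviation topn :: "'a \<Rightarrow> 'a \<Rightarrow> bool" where "topn XR \<equiv> sub_open E (real_open E Re le_el) XR"

lemma prod_open_iff:
  assumes X: "X \<subseteq> AA" "isset (re ` X)" "el XR = pt ` X" and Y: "Y \<subseteq> AA" "isset (re ` Y)" "el YR = pt ` Y"
  shows "prod_open E XR (topn XR) YR (topn YR) U \<longleftrightarrow> el U \<subseteq> {pr (pt x) (pt y) | x y. x \<in> X \<and> y \<in> Y} \<and>
    (\<forall>x\<in>X. \<forall>y\<in>Y. pr (pt x) (pt y) \<in> el U \<longrightarrow>
      (\<exists>k. \<forall>x'\<in>X. \<forall>y'\<in>Y. cyl x' k = cyl x k \<longrightarrow> cyl y' k = cyl y k \<longrightarrow> pr (pt x') (pt y') \<in> el U))"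
    (is "_ \<longleftrightarrow> el U \<subseteq> ?P \<and> ?Q")
proof
  assume *: "prod_open E XR (topn XR) YR (topn YR) U"
  have "el U \<subseteq> ?P" using * unfolding prod_open_def X(3) Y(3) is_pair_iff by blast
  moreover have "\<exists>k. \<forall>x'\<in>X. \<forall>y'\<in>Y. cyl x' k = cyl x k \<longrightarrow> cyl y' k = cyl y k \<longrightarrow> pr (pt x') (pt y') \<in> el U"
    if xy: "x \<in> X" "y \<in> Y" "pr (pt x) (pt y) \<in> el U" for x y
  proof -
    obtain V W C where V: "topn XR V" "topn YR W" "is_prod E V W C" "pr (pt x) (pt y) \<in> el C" "el C \<subseteq> el U"
      using * xy(3) unfolding prod_open_def by blast
    have C: "pr a b \<in> el C \<longleftrightarrow> a \<in> el V \<and> b \<in> el W" for a b using V(3) unfolding is_prod_def is_pair_iff by auto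
    obtain k where k: "\<forall>x'\<in>X. cyl x' k = cyl x k \<longrightarrow> pt x' \<in> el V" using V(1,4) xy unfolding sub_open_iff[OF X(1,3)] C by blast
    obtain l where l: "\<forall>y'\<in>Y. cyl y' l = cyl y l \<longrightarrow> pt y' \<in> el W" using V(2,4) xy unfolding sub_open_iff[OF Y(1,3)] C by blast
    have "pr (pt x') (pt y') \<in> el U" if "x' \<in> X" "y' \<in> Y" "cyl x' (max k l) = cyl x (max k l)" "cyl y' (max k l) = cyl y (max k l)" for x' y'
    proof -
      have "pt x' \<in> el V" using k cyl_mono[OF that(3)] that(1) by simp
      moreover have "pt y' \<in> el W" using l cyl_mono[OF that(4)] that(2) by simp
      ultimately show ?thesis using C V(5) by blast
    qed
    then show ?thesis by blast
  qed
  ultimately show "el U \<subseteq> ?P \<and> ?Q" by blast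
next
  assume *: "el U \<subseteq> ?P \<and> ?Q"
  have o: "\<exists>V. topn XR V \<and> el V = pt ` {x' \<in> X. cyl x' k = c}"
    if X: "X \<subseteq> AA" "isset (re ` X)" "el XR = pt ` X" for X XR k c
  proof -
    have s: "{x' \<in> X. cyl x' k = c} \<subseteq> AA" using X(1) by blast
    have "isset (re ` {x' \<in> X. cyl x' k = c})" by (rule isset_re_sep[OF X(1,2)]) (intro dfi)
    from isset_pt[OF s this] obtain V where V: "el V = pt ` {x' \<in> X. cyl x' k = c}" by (auto simp: isset_def)
    have m: "pt x \<in> el V \<longleftrightarrow> cyl x k = c" if x: "x \<in> X" for x
    proof -
      have "pt x = pt y \<longleftrightarrow> x = y" if "y \<in> X" for y using pt_inj x that X(1) by blast
      then show ?thesis unfolding V using x by blast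
    qed
    have "topn XR V" unfolding sub_open_iff[OF X(1,3)]
    proof (intro conjI ballI impI)
      show "el V \<subseteq> pt ` X" unfolding V by blast
      fix x assume x: "x \<in> X" "pt x \<in> el V"
      show "\<exists>k. \<forall>x'\<in>X. cyl x' k = cyl x k \<longrightarrow> pt x' \<in> el V" using x m by (intro exI[of _ k]) auto
    qed
    then show ?thesis using V by blast
  qed
  show "prod_open E XR (topn XR) YR (topn YR) U" unfolding prod_open_def is_pair_iff X(3) Y(3)
  proof (intro conjI ballI)
    fix p assume p: "p \<in> el U"
    then obtain x y where xy: "p = pr (pt x) (pt y)" "x \<in> X" "y \<in> Y" using * by blast
    then show "\<exists>x\<in>pt ` X. \<exists>y\<in>pt ` Y. p = pr x y" by blast
    obtain k where k: "\<forall>x'\<in>X. \<forall>y'\<in>Y. cyl x' k = cyl x k \<longrightarrow> cyl y' k = cyl y k \<longrightarrow> pr (pt x') (pt y') \<in> el U"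
      using * p xy by blast
    obtain V where V: "topn XR V" "el V = pt ` {x' \<in> X. cyl x' k = cyl x k}" using o[OF X] by blast
    obtain W where W: "topn YR W" "el W = pt ` {y' \<in> Y. cyl y' k = cyl y k}" using o[OF Y] by blast
    obtain C where C: "el C = {pr a b | a b. a \<in> el V \<and> b \<in> el W}"
      using isset_prod[OF isset_el isset_el, of V W] by (auto simp: isset_def)
    have "is_prod E V W C" unfolding is_prod_def is_pair_iff C by blast
    moreover have "p \<in> el C" unfolding C xy(1) V(2) W(2) using xy by blast
    moreover have "el C \<subseteq> el U" unfolding C V(2) W(2) using k by blast
    ultimately show "\<exists>V W C. topn XR V \<and> topn YR W \<and> is_prod E V W C \<and> p \<in> el C \<and> el C \<subseteq> el U" using V(1) W(1) by blast
  qed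
qed

end

section \<open>Selection principles in terms of codes\<close>

text \<open>A space of the model whose points are named by \<open>W\<close> and whose open sets are approximated on finite
  sets by basic sets with codes: \<open>K b\<close> is the basic set coded by \<open>b\<close>.\<close>

locale coded_space = zmc E for E :: "'a \<Rightarrow> 'a \<Rightarrow> bool" +
  fixes Z :: 'a and W :: "'i set" and p :: "'i \<Rightarrow> 'a" and K :: "nat \<Rightarrow> 'i set" and opn :: "'a \<Rightarrow> bool"
  assumes p_inj: "inj_on p W" and el_Z: "el Z = p ` W"
    and opn_sub: "opn U \<Longrightarrow> el U \<subseteq> el Z"
    and opn_code: "opn U \<Longrightarrow> finite F \<Longrightarrow> F \<subseteq> W \<Longrightarrow> p ` F \<subseteq> el U \<Longrightarrow> \<exists>b. F \<subseteq> K b \<and> p ` (K b \<inter> W) \<subseteq> el U"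
    and isset_K: "isset {pr (num b) (p w) | b w. w \<in> W \<and> w \<in> K b}"
begin

definition Kel :: 'a where "Kel = mk {pr (num b) (p w) | b w. w \<in> W \<and> w \<in> K b}"
definition fits :: "nat \<Rightarrow> 'a \<Rightarrow> bool" where "fits b u \<longleftrightarrow> (\<forall>v. pr (num b) v \<in> el Kel \<longrightarrow> v \<in> el u)"
text \<open>The real that stands for the cover: the selection arguments see \<open>U\<close> only
  through it.\<close>

definition codes :: "'a \<Rightarrow> nat set" where "codes U = {b. \<exists>u\<in>el U. fits b u}"

lemma fits_iff: "fits b u \<longleftrightarrow> p ` (K b \<inter> W) \<subseteq> el u"
  unfolding fits_def Kel_def el_mk[OF isset_K] by auto

lemma dfn_fits [dfi]: "ntm t \<Longrightarrow> dt E s \<Longrightarrow> dfn E (\<lambda>e. fits (t e) (s e))"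
  by (rule dfn_sub2[of E "\<lambda>x y. fits (nof x) y" "\<lambda>e. num (t e)" s, simplified]) (unfold fits_def, intro dfi, simp_all add: ntm_def)

lemma stm_codes [dfi]: assumes "dt E s" shows "stm (\<lambda>e. codes (s e))"
  unfolding codes_def by (intro dfi dt_rename[OF assms])

lemma codes_cover: assumes U: "omega_cover E Z opn U" and F: "finite F" "F \<subseteq> W" shows "\<exists>b\<in>codes U. F \<subseteq> K b"
proof -
  have e: "el (mk (p ` F)) = p ` F" using F by (intro el_mk isset_finite) simp
  have "is_finite E (mk (p ` F))" unfolding is_finite_iff e using F by simp
  moreover have "el (mk (p ` F)) \<subseteq> el Z" unfolding e el_Z using F by blast
  ultimately obtain u where u: "u \<in> el U" "p ` F \<subseteq> el u" 
    using U[unfolded omega_cover_def, THEN conjunct2, rule_format, of "mk (p ` F)"] unfolding e by blast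
  have o: "opn u" using U u(1) unfolding omega_cover_def open_cover_def by blast
  obtain b where "F \<subseteq> K b" "p ` (K b \<inter> W) \<subseteq> el u" using opn_code[OF o F u(2)] by (elim exE conjE)
  then show ?thesis unfolding codes_def fits_iff using u(1) by blast
qed

text \<open>The way back from codes to covers: a member around the basic set \<open>h n\<close> is
  chosen internally for all \<open>n\<close> at once.\<close>

lemma pick: assumes g: "efun g" and h: "nfun h" and A: "\<And>n. el (g n) \<subseteq> el A"
  obtains t where "efun t" "\<And>n. h n \<in> codes (g n) \<Longrightarrow> t n \<in> el (g n) \<and> p ` (K (h n) \<inter> W) \<subseteq> el (t n)"
proof -
  define Q where "Q = (\<lambda>z u. u \<in> el (g (nof z)) \<and> fits (h (nof z)) u)"
  have Qd: "dfn E (\<lambda>e. Q (e 0) (e 1))" unfolding Q_def by (intro dfi dt_efun[OF g] ntm_nfun[OF h])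
  obtain t where t: "dt E (\<lambda>e. t (e 0))" "\<And>z. \<exists>y\<in>el A. Q z y \<Longrightarrow> t z \<in> el A \<and> Q z (t z)"
    "\<And>z. \<not> (\<exists>y\<in>el A. Q z y) \<Longrightarrow> t z = mk {}" by (rule uniformize[OF Qd, of A]) (rule that, assumption, blast, blast)
  have "efun (\<lambda>n. t (num n))" unfolding efun_def by (rule dt_sub[OF t(1)]) (intro dfi)
  moreover have "t (num n) \<in> el (g n) \<and> p ` (K (h n) \<inter> W) \<subseteq> el (t (num n))" if n: "h n \<in> codes (g n)" for n
  proof -
    obtain u where u: "u \<in> el (g n)" "fits (h n) u" using n unfolding codes_def by blast
    then have "u \<in> el A" "Q (num n) u" using A[of n] unfolding Q_def nof_num by blast+
    then have "Q (num n) (t (num n))" using t(2) by blast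
    then show ?thesis unfolding Q_def nof_num fits_iff .
  qed
  ultimately show ?thesis by (rule that)
qed

lemma cover_member: "is_cover E Z V \<Longrightarrow> u \<in> el V \<Longrightarrow> \<not> p ` W \<subseteq> el u"
  unfolding is_cover_def el_Z by blast

lemma gamma_spaceI:
  assumes gam: "\<And>B. B \<in> AA \<Longrightarrow> (\<And>F. finite F \<Longrightarrow> F \<subseteq> W \<Longrightarrow> \<exists>b\<in>B. F \<subseteq> K b) \<Longrightarrow>
    \<exists>h S. nfun h \<and> S \<in> AA \<and> infinite S \<and> (\<forall>i\<in>S. h i \<in> B) \<and> (\<forall>w\<in>W. \<exists>i0. \<forall>i\<in>S. i0 \<le> i \<longrightarrow> w \<in> K (h i))"
  shows "gamma_space E Z opn"
  unfolding gamma_space_def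
proof (intro allI impI)
  fix U assume U: "omega_cover E Z opn U"
  have cA: "codes U \<in> AA" by (rule AA_stm) (intro dfi)
  have ex: "\<exists>h S. nfun h \<and> S \<in> AA \<and> infinite S \<and> (\<forall>i\<in>S. h i \<in> codes U) \<and>
    (\<forall>w\<in>W. \<exists>i0. \<forall>i\<in>S. i0 \<le> i \<longrightarrow> w \<in> K (h i))"
    by (rule gam[OF cA]) (rule codes_cover[OF U])
  obtain h S where h: "nfun h" "S \<in> AA" "infinite S" "\<forall>i\<in>S. h i \<in> codes U"
    "\<forall>w\<in>W. \<exists>i0. \<forall>i\<in>S. i0 \<le> i \<longrightarrow> w \<in> K (h i)"
    using ex by (elim exE conjE) (rule that; assumption)
  have "efun (\<lambda>_. U)" unfolding efun_def by (intro dfi)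
  then obtain t where t: "efun t" "\<And>n. h n \<in> codes U \<Longrightarrow> t n \<in> el U \<and> p ` (K (h n) \<inter> W) \<subseteq> el (t n)"
    using pick[of "\<lambda>_. U" h U] h(1) by blast
  have tS: "t i \<in> el U" "p ` (K (h i) \<inter> W) \<subseteq> el (t i)" if "i \<in> S" for i using t(2) h(4) that by blast+
  have "isset {u \<in> el U. \<exists>i. i \<in> S \<and> u = t i}" by (intro isset_sep isset_rules dfi h(2) dt_efun[OF t(1)])
  then obtain V where "el V = {u \<in> el U. \<exists>i. i \<in> S \<and> u = t i}" by (auto simp: isset_def)
  then have V: "el V = t ` S" using tS(1) by blast
  have VU: "el V \<subseteq> el U" unfolding V using tS(1) by blast
  have U2: "is_cover E Z U" "\<And>u. u \<in> el U \<Longrightarrow> opn u" using U unfolding omega_cover_def open_cover_def by blast+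
  have big: "p w \<in> el (t i)" if "w \<in> W" "i \<in> S" "w \<in> K (h i)" for w i using tS(2) that by blast
  have e1: "el Z = (\<Union>u\<in>el V. el u)"
  proof (intro equalityI subsetI)
    fix z assume "z \<in> el Z"
    then obtain w where w: "w \<in> W" "z = p w" unfolding el_Z by blast
    obtain i0 where i0: "\<forall>i\<in>S. i0 \<le> i \<longrightarrow> w \<in> K (h i)" using h(5) w(1) by blast
    obtain i where "i \<in> S" "i0 \<le> i" using h(3) unfolding infinite_nat_iff_unbounded_le by blast
    then show "z \<in> (\<Union>u\<in>el V. el u)" unfolding V w(2) using big w(1) i0 by blast
  next
    fix z assume "z \<in> (\<Union>u\<in>el V. el u)"
    then show "z \<in> el Z" using VU U2(2) opn_sub by blast
  qed
  have e2: "infinite (el V)"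
  proof
    assume "finite (el V)"
    \<comment> \<open>A member repeated for infinitely many indices would contain every point,
      against the definition of a cover.\<close>
    then obtain i where i: "i \<in> S" "infinite {j \<in> S. t j = t i}" using pigeonhole_infinite[OF h(3), of t] unfolding V by blast
    have "p w \<in> el (t i)" if w: "w \<in> W" for w
    proof -
      obtain i0 where i0: "\<forall>i\<in>S. i0 \<le> i \<longrightarrow> w \<in> K (h i)" using h(5) w by blast
      obtain j where "j \<in> S" "t j = t i" "i0 \<le> j" using i(2) unfolding infinite_nat_iff_unbounded_le by blast
      then show ?thesis using big[OF w, of j] i0 by simp
    qed
    then show False using cover_member[OF U2(1) tS(1)[OF i(1)]] by blast
  qed
  have e3: "\<exists>A. el A = {u \<in> el V. z \<notin> el u} \<and> is_finite E A" if z: "z \<in> el Z" for z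
  proof -
    obtain w where w: "w \<in> W" "z = p w" using z unfolding el_Z by blast
    obtain i0 where i0: "\<forall>i\<in>S. i0 \<le> i \<longrightarrow> w \<in> K (h i)" using h(5) w(1) by blast
    have "{u \<in> el V. z \<notin> el u} \<subseteq> t ` {..<i0}"
    proof
      fix u assume "u \<in> {u \<in> el V. z \<notin> el u}"
      then obtain i where i: "i \<in> S" "u = t i" "p w \<notin> el (t i)" unfolding V w(2) by blast
      then have "i < i0" using big[OF w(1), of i] i0 by (meson not_le)
      then show "u \<in> t ` {..<i0}" using i(2) by blast
    qed
    then have f: "finite {u \<in> el V. z \<notin> el u}" by (rule finite_subset) simp
    then show ?thesis by (intro exI[of _ "mk {u \<in> el V. z \<notin> el u}"]) (simp add: is_finite_iff isset_finite)
  qed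
  have e4: "\<not> (\<exists>u\<in>el V. el Z \<subseteq> el u)" using cover_member[OF U2(1)] VU unfolding el_Z by blast
  have e5: "\<forall>u\<in>el V. opn u" using U2(2) VU by blast
  have "gamma_cover E Z opn V" unfolding gamma_cover_def open_cover_def is_cover_def
    by (intro conjI e1 e4 e5 e2[folded is_finite_iff] ballI e3)
  then show "\<exists>V. el V \<subseteq> el U \<and> gamma_cover E Z opn V" using VU by blast
qed

lemma S1I:
  assumes sel: "\<And>B. B \<in> AA \<Longrightarrow> (\<And>n F. finite F \<Longrightarrow> F \<subseteq> W \<Longrightarrow> \<exists>j\<in>col n B. F \<subseteq> K j) \<Longrightarrow>
    \<exists>h. nfun h \<and> (\<forall>n. h n \<in> col n B) \<and> (\<forall>F. finite F \<longrightarrow> F \<subseteq> W \<longrightarrow> (\<exists>n. F \<subseteq> K (h n)))"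
  shows "S1_Omega_Omega E Z opn"
  unfolding S1_Omega_Omega_def
proof (intro allI impI, elim conjE)
  fix s assume s: "is_seq E s" and om: "\<forall>(n, U)\<in>graph E s. omega_cover E Z opn U"
  obtain g where g: "graph E s = {(num n, g n) | n. True}" "efun g" using s by (rule is_seqE)
  have gs: "(num n, g n) \<in> graph E s" for n unfolding g(1) by blast
  have go: "omega_cover E Z opn (g n)" for n using om gs[of n] by blast
  define B where "B = {q. snd (prod_decode q) \<in> codes (g (fst (prod_decode q)))}"
  have B: "B \<in> AA" unfolding B_def by (rule AA_I) (intro dfi dt_efun[OF g(2)])
  have colB: "col n B = codes (g n)" for n unfolding B_def by (auto simp: col_def)
  have "\<exists>j\<in>col n B. F \<subseteq> K j" if "finite F" "F \<subseteq> W" for n F unfolding colB by (rule codes_cover[OF go that])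
  with sel[OF B] obtain h where h: "nfun h" "\<forall>n. h n \<in> codes (g n)" "\<And>F. finite F \<Longrightarrow> F \<subseteq> W \<Longrightarrow> \<exists>n. F \<subseteq> K (h n)"
    unfolding colB by blast
  obtain A where "el A = (\<Union>u\<in>{b. \<exists>a. pr a b \<in> el s}. el u)"
    using isset_Union[OF isset_Range(1)[OF isset_el[of s]]] unfolding isset_def by (elim exE)
  then have A: "el (g n) \<subseteq> el A" for n using gs[of n] unfolding graph_iff by blast
  obtain t where t: "efun t" "\<And>n. h n \<in> codes (g n) \<Longrightarrow> t n \<in> el (g n) \<and> p ` (K (h n) \<inter> W) \<subseteq> el (t n)"
    using pick[OF g(2) h(1) A] by blast
  have tg: "t n \<in> el (g n)" "p ` (K (h n) \<inter> W) \<subseteq> el (t n)" for n using t(2) h(2) by blast+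
  have tA: "t n \<in> el A" for n using tg(1) A by blast
  obtain T where T: "is_seq E T" "graph E T = {(num n, t n) | n. True}" using is_seqI[OF t(1) tA] by blast
  obtain V where V: "el V = range t" using isset_efun(2)[OF t(1) tA] unfolding isset_def by (elim exE)
  have tc: "is_cover E Z (g n)" "opn (t n)" for n using go[of n] tg(1)[of n] unfolding omega_cover_def open_cover_def by blast+
  have fin: "\<exists>n. p ` F \<subseteq> el (t n)" if F: "finite F" "F \<subseteq> W" for F
  proof -
    obtain n where "F \<subseteq> K (h n)" using h(3) F by blast
    then show ?thesis using tg(2)[of n] F(2) by blast
  qed
  have "omega_cover E Z opn V" unfolding omega_cover_def open_cover_def is_cover_def V is_finite_iff
  proof (intro conjI ballI allI impI)
    show "el Z = (\<Union>u\<in>range t. el u)"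
    proof (intro equalityI subsetI)
      fix z assume "z \<in> el Z"
      then obtain w where w: "w \<in> W" "z = p w" unfolding el_Z by blast
      then show "z \<in> (\<Union>u\<in>range t. el u)" using fin[of "{w}"] by auto
    next
      fix z assume "z \<in> (\<Union>u\<in>range t. el u)"
      then show "z \<in> el Z" using tc(2) opn_sub by blast
    qed
    show "\<not> (\<exists>u\<in>range t. el Z \<subseteq> el u)" using cover_member[OF tc(1) tg(1)] unfolding el_Z by blast
    show "opn u" if "u \<in> range t" for u using that tc(2) by blast
    fix F assume F: "finite (el F) \<and> el F \<subseteq> el Z"
    define F' where "F' = {w \<in> W. p w \<in> el F}"
    have im: "p ` F' = el F"
    proof (intro equalityI subsetI)
      fix z assume z: "z \<in> el F"
      then have "z \<in> p ` W" using F el_Z by blast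
      then obtain w where "w \<in> W" "z = p w" by blast
      then show "z \<in> p ` F'" using z unfolding F'_def by blast
    qed (auto simp: F'_def)
    have "inj_on p F'" using p_inj by (rule inj_on_subset) (auto simp: F'_def)
    then have "finite F'" using F im by (metis finite_imageD)
    then obtain n where "p ` F' \<subseteq> el (t n)" using fin[of F'] F'_def by blast
    then show "\<exists>u\<in>range t. el F \<subseteq> el u" unfolding im by blast
  qed
  moreover have "U' \<in> el U" if "(n, U) \<in> graph E s \<and> (n, U') \<in> graph E T" for n U U'
    using that tg(1) unfolding g(1) T(2) by auto
  moreover have "el V = Range (graph E T)" unfolding V T(2) by auto
  ultimately show "\<exists>t V. is_seq E t \<and> (\<forall>n U U'. (n, U) \<in> graph E s \<and> (n, U') \<in> graph E t \<longrightarrow> U' \<in> el U) \<and>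
      el V = Range (graph E t) \<and> omega_cover E Z opn V" using T(1) by blast
qed

end

lemma finite_common_bound:
  assumes "finite F" "\<And>w. w \<in> F \<Longrightarrow> \<exists>k. Q k w" "\<And>w k l. Q k w \<Longrightarrow> k \<le> l \<Longrightarrow> Q l w"
  shows "\<exists>k::nat. \<forall>w\<in>F. Q k w"
proof -
  obtain f where f: "\<forall>w\<in>F. Q (f w) w" using bchoice[of F "\<lambda>w k. Q k w"] assms(2) by blast
  have "f w \<le> Max (insert 0 (f ` F))" if "w \<in> F" for w using assms(1) that by (intro Max_ge) auto
  then show ?thesis using f assms(3) by blast
qed

definition pcov :: "nat \<Rightarrow> (nat set \<times> nat set) set" where
  "pcov b = {w. \<exists>k. prod_encode (cyl (fst w) k, cyl (snd w) k) \<in> set_decode b}"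

context zm
begin

definition pp :: "nat set \<times> nat set \<Rightarrow> 'a" where "pp w = pr (pt (fst w)) (pt (snd w))"

text \<open>The points lie in the model, so it knows which codes cover finitely many of them.
  Applied in \<open>M\<close> to pairs from \<open>X\<close> and \<open>Y\<close>, this is what
  \<open>S1_preserved\<close> asks of the basic sets.\<close>

lemma pcov_AA: "finite F \<Longrightarrow> F \<subseteq> AA \<times> AA \<Longrightarrow> {j. F \<subseteq> pcov j} \<in> AA"
proof (induction rule: finite_induct)
  case empty
  have "{j::nat. True} \<in> AA" by (rule AA_I) (intro dfi)
  then show ?case by simp
next
  case (insert w F)
  then have F: "{j. F \<subseteq> pcov j} \<in> AA" by blast
  have w: "fst w \<in> AA" "snd w \<in> AA" using insert.prems by auto
  have "{j. (\<exists>k. prod_encode (cyl (fst w) k, cyl (snd w) k) \<in> set_decode j) \<and> j \<in> {j. F \<subseteq> pcov j}} \<in> AA"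
    by (rule AA_I) (intro dfi F w)
  moreover have "{j. (\<exists>k. prod_encode (cyl (fst w) k, cyl (snd w) k) \<in> set_decode j) \<and> j \<in> {j. F \<subseteq> pcov j}} = {j. insert w F \<subseteq> pcov j}"
    unfolding insert_subset pcov_def[of j for j] mem_Collect_eq by (rule refl)
  ultimately show ?case by simp
qed

end

context zmc
begin

lemma coded_subset:
  assumes X: "X \<subseteq> AA" "isset (re ` X)" "el XR = pt ` X"
  shows "coded_space E XR X pt cov (topn XR)"
proof unfold_locales
  show "inj_on pt X" using X(1) pt_inj by (intro inj_onI) blast
  show "el XR = pt ` X" by (rule X(3))
  show "el U \<subseteq> el XR" if "topn XR U" for U using that unfolding sub_open_iff[OF X(1,3)] X(3) by blast
  show "\<exists>b. F \<subseteq> cov b \<and> pt ` (cov b \<inter> X) \<subseteq> el U" if U: "topn XR U" "finite F" "F \<subseteq> X" "pt ` F \<subseteq> el U" for U F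
  proof -
    have "\<exists>k. \<forall>x\<in>F. \<forall>x'\<in>X. cyl x' k = cyl x k \<longrightarrow> pt x' \<in> el U"
    proof (rule finite_common_bound[OF U(2)])
      show "\<exists>k. \<forall>x'\<in>X. cyl x' k = cyl x k \<longrightarrow> pt x' \<in> el U" if x: "x \<in> F" for x
      proof -
        have "x \<in> X" "pt x \<in> el U" using x U(3,4) by blast+
        then show ?thesis using U(1) unfolding sub_open_iff[OF X(1,3)] by blast
      qed
      show "\<forall>x'\<in>X. cyl x' l = cyl x l \<longrightarrow> pt x' \<in> el U" if "\<forall>x'\<in>X. cyl x' k = cyl x k \<longrightarrow> pt x' \<in> el U" "k \<le> l" for x k l
        using that cyl_mono[OF _ that(2)] by blast
    qed
    then obtain k where k: "\<And>x x'. x \<in> F \<Longrightarrow> x' \<in> X \<Longrightarrow> cyl x' k = cyl x k \<Longrightarrow> pt x' \<in> el U" by blast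
    define b where "b = set_encode ((\<lambda>x. cyl x k) ` F)"
    have b: "set_decode b = (\<lambda>x. cyl x k) ` F" unfolding b_def using U(2) by (intro set_encode_inverse) simp
    have "F \<subseteq> cov b" unfolding cov_def b by blast
    moreover have "pt x' \<in> el U" if x': "x' \<in> cov b" "x' \<in> X" for x'
    proof -
      obtain l x where l: "x \<in> F" "cyl x' l = cyl x k" using x'(1) unfolding cov_def b by blast
      then have "cyl x' k = cyl x k" unfolding cyl_eq by auto
      then show ?thesis using k[OF l(1) x'(2)] by blast
    qed
    ultimately show ?thesis by blast
  qed
  obtain r where r: "el r = re ` X" using X(2) unfolding isset_def by (elim exE)
  have re_X: "sof (re x) = x" if "x \<in> X" for x using that X(1) by (intro sof_re) blast
  define Q where "Q = (\<lambda>a v. \<exists>c\<in>el r. v = pt (sof c) \<and> sof c \<in> cov (nof a))"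
  have Q: "Q a v \<longleftrightarrow> (\<exists>x\<in>X. v = pt x \<and> x \<in> cov (nof a))" for a v
    unfolding Q_def r using re_X by auto
  have "dfn E (\<lambda>e. Q (e 0) (e 1))" unfolding Q_def by (intro dfi)
  then have "isset {pr a v | a v. a \<in> el Om \<and> v \<in> el XR \<and> Q a v}" by (intro isset_rel isset_el)
  moreover have "{pr a v | a v. a \<in> el Om \<and> v \<in> el XR \<and> Q a v} = {pr (num b) (pt w) | b w. w \<in> X \<and> w \<in> cov b}"
  proof (intro equalityI subsetI)
    fix z assume "z \<in> {pr a v | a v. a \<in> el Om \<and> v \<in> el XR \<and> Q a v}"
    then obtain b v where 1: "z = pr (num b) v" "Q (num b) v" by auto
    then obtain x where "x \<in> X" "v = pt x" "x \<in> cov b" unfolding Q nof_num by blast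
    then show "z \<in> {pr (num b) (pt w) | b w. w \<in> X \<and> w \<in> cov b}" using 1(1) by blast
  next
    fix z assume "z \<in> {pr (num b) (pt w) | b w. w \<in> X \<and> w \<in> cov b}"
    then obtain b x where 1: "z = pr (num b) (pt x)" "x \<in> X" "x \<in> cov b" by blast
    then have "Q (num b) (pt x)" unfolding Q nof_num by blast
    moreover have "num b \<in> el Om" "pt x \<in> el XR" using 1(2) X(3) by auto
    ultimately show "z \<in> {pr a v | a v. a \<in> el Om \<and> v \<in> el XR \<and> Q a v}" using 1(1) by blast
  qed
  ultimately show "isset {pr (num b) (pt w) | b w. w \<in> X \<and> w \<in> cov b}" by simp
qed

lemma coded_product:
  assumes X: "X \<subseteq> AA" "isset (re ` X)" "el XR = pt ` X" and Y: "Y \<subseteq> AA" "isset (re ` Y)" "el YR = pt ` Y"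
    and XY: "el XY = {pr (pt x) (pt y) | x y. x \<in> X \<and> y \<in> Y}"
  shows "coded_space E XY (X \<times> Y) pp pcov (prod_open E XR (topn XR) YR (topn YR))"
proof unfold_locales
  show "inj_on pp (X \<times> Y)"
  proof (rule inj_onI)
    fix v w assume vw: "v \<in> X \<times> Y" "w \<in> X \<times> Y" "pp v = pp w"
    have "fst v \<in> AA" "fst w \<in> AA" "snd v \<in> AA" "snd w \<in> AA" using vw(1,2) X(1) Y(1) by auto
    then show "v = w" using vw(3) unfolding pp_def pr_inj by (simp add: pt_inj prod_eq_iff)
  qed
  show elXY: "el XY = pp ` (X \<times> Y)"
  proof (intro equalityI subsetI)
    fix z assume "z \<in> el XY"
    then obtain x y where "z = pr (pt x) (pt y)" "x \<in> X" "y \<in> Y" unfolding XY by blast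
    then have "z = pp (x, y)" "(x, y) \<in> X \<times> Y" unfolding pp_def by simp_all
    then show "z \<in> pp ` (X \<times> Y)" by blast
  next
    fix z assume "z \<in> pp ` (X \<times> Y)"
    then obtain w where w: "w \<in> X \<times> Y" "z = pp w" by blast
    have "fst w \<in> X" "snd w \<in> Y" using w(1) by auto
    then show "z \<in> el XY" unfolding XY w(2) pp_def by blast
  qed
  show "el U \<subseteq> el XY" if "prod_open E XR (topn XR) YR (topn YR) U" for U using that unfolding prod_open_iff[OF X Y] XY by blast
  show "\<exists>b. F \<subseteq> pcov b \<and> pp ` (pcov b \<inter> X \<times> Y) \<subseteq> el U"
    if U: "prod_open E XR (topn XR) YR (topn YR) U" "finite F" "F \<subseteq> X \<times> Y" "pp ` F \<subseteq> el U" for U F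
  proof -
    define N where "N = (\<lambda>k w. \<forall>x'\<in>X. \<forall>y'\<in>Y. cyl x' k = cyl (fst w) k \<longrightarrow> cyl y' k = cyl (snd w) k \<longrightarrow> pr (pt x') (pt y') \<in> el U)"
    have "\<exists>k. \<forall>w\<in>F. N k w"
    proof (rule finite_common_bound[OF U(2)])
      show "\<exists>k. N k w" if w: "w \<in> F" for w
      proof -
        have "fst w \<in> X" "snd w \<in> Y" "pr (pt (fst w)) (pt (snd w)) \<in> el U" using w U(3,4) unfolding pp_def by auto
        then show ?thesis using U(1)[unfolded prod_open_iff[OF X Y], THEN conjunct2] unfolding N_def by blast
      qed
      show "N l w" if "N k w" "k \<le> l" for w k l
        using that(1) cyl_mono[OF _ that(2)] unfolding N_def by blast
    qed
    then obtain k where k: "\<forall>w\<in>F. N k w" by blast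
    define b where "b = set_encode ((\<lambda>w. prod_encode (cyl (fst w) k, cyl (snd w) k)) ` F)"
    have b: "set_decode b = (\<lambda>w. prod_encode (cyl (fst w) k, cyl (snd w) k)) ` F"
      unfolding b_def using U(2) by (intro set_encode_inverse) simp
    have "F \<subseteq> pcov b" unfolding pcov_def b by blast
    moreover have "pp w' \<in> el U" if w': "w' \<in> pcov b" "w' \<in> X \<times> Y" for w'
    proof -
      obtain l w where l: "w \<in> F" "prod_encode (cyl (fst w') l, cyl (snd w') l) = prod_encode (cyl (fst w) k, cyl (snd w) k)"
        using w'(1) unfolding pcov_def b by blast
      then have "cyl (fst w') l = cyl (fst w) k" "cyl (snd w') l = cyl (snd w) k" by simp_all
      then have "cyl (fst w') k = cyl (fst w) k" "cyl (snd w') k = cyl (snd w) k" unfolding cyl_eq by auto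
      moreover have "fst w' \<in> X" "snd w' \<in> Y" using w'(2) by auto
      ultimately show ?thesis using bspec[OF k l(1)] unfolding N_def pp_def by blast
    qed
    ultimately show ?thesis by blast
  qed
  obtain r where r: "el r = re ` X" using X(2) unfolding isset_def by (elim exE)
  obtain s where s: "el s = re ` Y" using Y(2) unfolding isset_def by (elim exE)
  have re_X: "sof (re x) = x" if "x \<in> X" for x using that X(1) by (intro sof_re) blast
  have re_Y: "sof (re y) = y" if "y \<in> Y" for y using that Y(1) by (intro sof_re) blast
  define Q where "Q = (\<lambda>a v. \<exists>c\<in>el r. \<exists>d\<in>el s. v = pr (pt (sof c)) (pt (sof d)) \<and>
    (\<exists>k. prod_encode (cyl (sof c) k, cyl (sof d) k) \<in> set_decode (nof a)))"
  have Q: "Q a v \<longleftrightarrow> (\<exists>w\<in>X \<times> Y. v = pp w \<and> w \<in> pcov (nof a))" for a v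
    unfolding Q_def r s pp_def pcov_def using re_X re_Y by auto
  have "dfn E (\<lambda>e. Q (e 0) (e 1))" unfolding Q_def by (intro dfi)
  then have "isset {pr a v | a v. a \<in> el Om \<and> v \<in> el XY \<and> Q a v}" by (intro isset_rel isset_el)
  moreover have "{pr a v | a v. a \<in> el Om \<and> v \<in> el XY \<and> Q a v} = {pr (num b) (pp w) | b w. w \<in> X \<times> Y \<and> w \<in> pcov b}"
  proof (intro equalityI subsetI)
    fix z assume "z \<in> {pr a v | a v. a \<in> el Om \<and> v \<in> el XY \<and> Q a v}"
    then obtain b v where 1: "z = pr (num b) v" "Q (num b) v" by auto
    then obtain w where "w \<in> X \<times> Y" "v = pp w" "w \<in> pcov b" unfolding Q nof_num by blast
    then show "z \<in> {pr (num b) (pp w) | b w. w \<in> X \<times> Y \<and> w \<in> pcov b}" using 1(1) by blast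
  next
    fix z assume "z \<in> {pr (num b) (pp w) | b w. w \<in> X \<times> Y \<and> w \<in> pcov b}"
    then obtain b w where 1: "z = pr (num b) (pp w)" "w \<in> X \<times> Y" "w \<in> pcov b" by blast
    then have "Q (num b) (pp w)" unfolding Q nof_num by blast
    moreover have "num b \<in> el Om" "pp w \<in> el XY" using 1(2) elXY by auto
    ultimately show "z \<in> {pr a v | a v. a \<in> el Om \<and> v \<in> el XY \<and> Q a v}" using 1(1) by blast
  qed
  ultimately show "isset {pr (num b) (pp w) | b w. w \<in> X \<times> Y \<and> w \<in> pcov b}" by simp
qed

end

section \<open>Failure of the Hurewicz property\<close>

context zm
begin

text \<open>The \<open>n\<close>-th cover consists of the sets of pairs that differ at some point of \<open>[n, k)\<close>.  A selection
  that is a \<open>\<gamma>\<close>-cover would yield an increasing sequence such that every symmetric difference meets almost all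
  of its intervals.\<close>

lemma not_Ufin:
  assumes X: "X \<subseteq> AA" "isset (re ` X)" "el XR = pt ` X" and Y: "Y \<subseteq> AA" "isset (re ` Y)" "el YR = pt ` Y"
    and XY: "el XY = {pr (pt x) (pt y) | x y. x \<in> X \<and> y \<in> Y}"
    and inf: "\<And>x y. x \<in> X \<Longrightarrow> y \<in> Y \<Longrightarrow> infinite (sd x y)"
    and mdc: "\<And>x s k. x \<in> X \<Longrightarrow> md x s k \<in> X"
    and unb: "\<And>m. nfun m \<Longrightarrow> \<forall>n. m n < m (Suc n) \<Longrightarrow> \<exists>x\<in>X. \<exists>y\<in>Y. \<forall>k. \<exists>n. k \<le> n \<and> sd x y \<inter> {m n..<m (Suc n)} = {}"
  shows "\<not> Ufin_O_Gamma E XY (prod_open E XR (topn XR) YR (topn YR))"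
proof
  assume U: "Ufin_O_Gamma E XY (prod_open E XR (topn XR) YR (topn YR))"
  define opn where "opn = prod_open E XR (topn XR) YR (topn YR)"
  obtain rx where rx: "el rx = re ` X" using X(2) unfolding isset_def by (elim exE)
  obtain ry where ry: "el ry = re ` Y" using Y(2) unfolding isset_def by (elim exE)
  have re_X: "sof (re x) = x" if "x \<in> X" for x using that X(1) by (intro sof_re) blast
  have re_Y: "sof (re y) = y" if "y \<in> Y" for y using that Y(1) by (intro sof_re) blast
  have pj: "pt x = pt x' \<longleftrightarrow> x = x'" if "x \<in> X" "x' \<in> X" for x x' using that X(1) by (intro pt_inj) blast+
  have qj: "pt y = pt y' \<longleftrightarrow> y = y'" if "y \<in> Y" "y' \<in> Y" for y y' using that Y(1) by (intro pt_inj) blast+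
  define D where "D = (\<lambda>n k v. \<exists>c\<in>el rx. \<exists>d\<in>el ry. v = pr (pt (sof c)) (pt (sof d)) \<and>
    (\<exists>i. i \<in> sd (sof c) (sof d) \<and> n \<le> i \<and> i < k))"
  have dfD: "dfn E (\<lambda>e. D (a e) (b e) (v e))" if "ntm a" "ntm b" "dt E v" for a b v
    unfolding D_def by (intro dfi dt_rename[OF that(3)] ntm_rename[OF that(1)] ntm_rename[OF that(2)])
  have D0: "D n k v \<longleftrightarrow> (\<exists>x\<in>X. \<exists>y\<in>Y. v = pr (pt x) (pt y) \<and> (\<exists>i. i \<in> sd x y \<and> n \<le> i \<and> i < k))" for n k v
    unfolding D_def rx ry by (simp add: re_X re_Y cong: bex_cong)
  have D: "D n k (pr (pt x) (pt y)) \<longleftrightarrow> (\<exists>i. i \<in> sd x y \<and> n \<le> i \<and> i < k)" if xy: "x \<in> X" "y \<in> Y" for n k x y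
  proof
    assume "D n k (pr (pt x) (pt y))"
    then obtain x' y' where "x' \<in> X" "y' \<in> Y" "pt x = pt x'" "pt y = pt y'" "\<exists>i. i \<in> sd x' y' \<and> n \<le> i \<and> i < k"
      unfolding D0 pr_inj by blast
    then show "\<exists>i. i \<in> sd x y \<and> n \<le> i \<and> i < k" using pj[OF xy(1)] qj[OF xy(2)] by simp
  qed (use xy D0 in blast)
  have D_up: "D n l v" if "D n k v" "k \<le> l" for n k l v using that unfolding D0 by (meson less_le_trans)
  have D_XY: "v \<in> el XY" if "D n k v" for n k v using that unfolding D0 XY by blast
  define P where "P = (\<lambda>n k. mk {v. D n k v})"
  have P: "el (P n k) = {v. D n k v}" for n k unfolding P_def
  proof (rule el_mk, rule isset_sub[OF _ isset_el[of XY]])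
    show "dfn E (\<lambda>e. D n k (e 0))" by (intro dfD ntm_const dt_var)
    show "v \<in> el XY" if v: "D n k v" for v using D_XY[OF v] .
  qed
  have P_iff: "(\<forall>v. v \<in> el u \<longleftrightarrow> D n k v) \<longleftrightarrow> u = P n k" for u n k
    using ext[of u "P n k"] P[of n k] by blast
  define g where "g = (\<lambda>n. mk {u. \<exists>k. \<forall>v. v \<in> el u \<longleftrightarrow> D n k v})"
  have g0: "el (g n) = {u. \<exists>k. \<forall>v. v \<in> el u \<longleftrightarrow> D n k v}" for n unfolding g_def
  proof (rule el_mk, rule isset_sub[OF _ isset_Pow[OF isset_el[of XY]]])
    show "dfn E (\<lambda>e. \<exists>k. \<forall>v. v \<in> el (e 0) \<longleftrightarrow> D n k v)" by (intro dfi dfD)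
    show "u \<in> {y. el y \<subseteq> el XY}" if u: "\<exists>k. \<forall>v. v \<in> el u \<longleftrightarrow> D n k v" for u
      using u D_XY by blast
  qed
  then have g: "el (g n) = range (P n)" for n unfolding P_iff by blast
  have "dfn E (\<lambda>e. el (e 0) = {u. \<exists>k. \<forall>v. v \<in> el u \<longleftrightarrow> D (nof (e (Suc 0))) k v})" by (intro dfi dfD)
  moreover have "e 0 = g (nof (e (Suc 0))) \<longleftrightarrow> el (e 0) = {u. \<exists>k. \<forall>v. v \<in> el u \<longleftrightarrow> D (nof (e (Suc 0))) k v}" for e
    using ext[of "e 0" "g (nof (e (Suc 0)))"] g0[of "nof (e (Suc 0))"] by auto
  ultimately have ge: "efun g" unfolding efun_def by (intro dtI) simp
  obtain A where A: "el A = {y. el y \<subseteq> {y. el y \<subseteq> el XY}}"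
    using isset_Pow[OF isset_Pow[OF isset_el[of XY]]] unfolding isset_def by (elim exE)
  have PXY: "el (P n k) \<subseteq> el XY" for n k
  proof
    fix z assume "z \<in> el (P n k)"
    then have "D n k z" unfolding P by (rule CollectD)
    then show "z \<in> el XY" by (rule D_XY)
  qed
  have gA: "g n \<in> el A" for n
  proof -
    have "el (g n) \<subseteq> {y. el y \<subseteq> el XY}" unfolding g using PXY by (intro image_subsetI CollectI)
    then show ?thesis unfolding A by (rule CollectI)
  qed
  obtain s where s: "is_seq E s" "graph E s = {(num n, g n) | n. True}" using is_seqI[OF ge gA] by blast
  have "nfun (\<lambda>n. n)" by (intro nfunI dfi)
  then obtain x0 y0 where x0: "x0 \<in> X" "y0 \<in> Y" using unb[of "\<lambda>n. n"] by auto
  have nc: "\<not> el XY \<subseteq> el (P n k)" for n k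
  proof
    assume sub: "el XY \<subseteq> el (P n k)"
    \<comment> \<open>Changed below \<open>k\<close> to agree with \<open>y0\<close>, the point
      \<open>x\<close> forms with \<open>y0\<close> a pair outside \<open>P n k\<close>. This
      excludes finite subcovers too, as a finite union of these sets lies in one of them.\<close>
    define x where "x = md x0 (set_encode (y0 \<inter> {..<k})) k"
    have "x \<in> X" unfolding x_def by (rule mdc[OF x0(1)])
    moreover have "i \<notin> sd x y0" if "i < k" for i using that unfolding x_def by (auto simp: md_def)
    ultimately have "\<not> D n k (pr (pt x) (pt y0))" using D x0(2) by blast
    moreover have "pr (pt x) (pt y0) \<in> el XY" unfolding XY using \<open>x \<in> X\<close> x0(2) by blast
    ultimately show False using sub P by blast
  qed
  have oc: "open_cover E XY opn (g n)" for n unfolding open_cover_def is_cover_def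
  proof (intro conjI ballI)
    show "el XY = (\<Union>u\<in>el (g n). el u)"
    proof (intro equalityI subsetI)
      fix z assume "z \<in> el XY"
      then obtain x y where xy: "x \<in> X" "y \<in> Y" "z = pr (pt x) (pt y)" unfolding XY by blast
      obtain i where i: "i \<in> sd x y" "n \<le> i" using inf[OF xy(1,2)] unfolding infinite_nat_iff_unbounded_le by blast
      have "D n (Suc i) z" unfolding xy(3) D[OF xy(1,2)] using i by blast
      then have "z \<in> el (P n (Suc i))" unfolding P by blast
      then show "z \<in> (\<Union>u\<in>el (g n). el u)" unfolding g by blast
    next
      fix z assume "z \<in> (\<Union>u\<in>el (g n). el u)"
      then show "z \<in> el XY" unfolding g using PXY by (elim UN_E imageE) (simp, blast)
    qed
    show "\<not> (\<exists>u\<in>el (g n). el XY \<subseteq> el u)" unfolding g using nc by blast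
    fix u assume "u \<in> el (g n)"
    then obtain k where u: "u = P n k" unfolding g by blast
    show "opn u" unfolding opn_def prod_open_iff[OF X Y] u
    proof (intro conjI ballI impI)
      show "el (P n k) \<subseteq> {pr (pt x) (pt y) | x y. x \<in> X \<and> y \<in> Y}" unfolding P D0 by blast
      fix x y assume xy: "x \<in> X" "y \<in> Y" "pr (pt x) (pt y) \<in> el (P n k)"
      then obtain i where i: "i \<in> sd x y" "n \<le> i" "i < k" unfolding P using D[OF xy(1,2)] by blast
      have "pr (pt x') (pt y') \<in> el (P n k)" if x': "x' \<in> X" "y' \<in> Y" "cyl x' k = cyl x k" "cyl y' k = cyl y k" for x' y'
      proof -
        have "i \<in> sd x' y'" using i(1) cyl_mem[OF x'(3) i(3)] cyl_mem[OF x'(4) i(3)] by simp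
        then show ?thesis unfolding P mem_Collect_eq D[OF x'(1,2)] using i by blast
      qed
      then show "\<exists>k'. \<forall>x'\<in>X. \<forall>y'\<in>Y. cyl x' k' = cyl x k' \<longrightarrow> cyl y' k' = cyl y k' \<longrightarrow> pr (pt x') (pt y') \<in> el (P n k)"
        by blast
    qed
  qed
  have fin: "\<exists>k. \<forall>u\<in>F. el u \<subseteq> el (P n k)" if F: "finite F" "F \<subseteq> el (g n)" for F n
  proof (rule finite_common_bound[OF F(1)])
    show "\<exists>k. el u \<subseteq> el (P n k)" if "u \<in> F" for u using that F(2) unfolding g by blast
    show "el u \<subseteq> el (P n l)" if "el u \<subseteq> el (P n k)" "k \<le> l" for u k l using that D_up unfolding P by blast
  qed
  have nf: "\<not> (\<exists>F. is_finite E F \<and> el F \<subseteq> el (g n) \<and> is_cover E XY F)" for n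
  proof (intro notI, elim exE conjE)
    fix F assume F: "is_finite E F" "el F \<subseteq> el (g n)" "is_cover E XY F"
    obtain k where "\<forall>u\<in>el F. el u \<subseteq> el (P n k)" using fin[OF F(1)[unfolded is_finite_iff] F(2)] by blast
    then have "el XY \<subseteq> el (P n k)" using F(3) unfolding is_cover_def by blast
    then show False using nc by blast
  qed
  have pre: "\<forall>(n, V)\<in>graph E s. open_cover E XY opn V \<and> \<not> (\<exists>F. is_finite E F \<and> el F \<subseteq> el V \<and> is_cover E XY F)"
    unfolding s(2) using oc nf by auto
  obtain t V where t: "is_seq E t"
    "\<forall>n V F. (n, V) \<in> graph E s \<and> (n, F) \<in> graph E t \<longrightarrow> is_finite E F \<and> el F \<subseteq> el V"
    and V: "el V = {u. \<exists>F\<in>Range (graph E t). is_Union E F u}" "gamma_cover E XY opn V"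
    using mp[OF spec[OF U[folded opn_def, unfolded Ufin_O_Gamma_def], of s] conjI[OF s(1) pre]] by (elim exE conjE)
  obtain f where f: "graph E t = {(num n, f n) | n. True}" "efun f" using t(1) by (rule is_seqE)
  have fg: "finite (el (f n))" "el (f n) \<subseteq> el (g n)" for n
    using t(2)[rule_format, of "num n" "g n" "f n"] unfolding s(2) f(1) is_finite_iff by blast+
  define v where "v = (\<lambda>n. mk (\<Union>u\<in>el (f n). el u))"
  have v: "el (v n) = (\<Union>u\<in>el (f n). el u)" for n unfolding v_def by (intro el_mk isset_Union isset_el)
  have vU: "is_Union E (f n) u \<longleftrightarrow> u = v n" for n u unfolding is_Union_def using v[of n] ext[of u "v n"] by auto
  have Vv: "el V = range v" unfolding V(1) f(1) using vU by auto
  have "dfn E (\<lambda>e. el (e 0) = {y. \<exists>u\<in>el (f (nof (e (Suc 0)))). y \<in> el u})" by (intro dfi dt_efun[OF f(2)])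
  moreover have "e 0 = v (nof (e (Suc 0))) \<longleftrightarrow> el (e 0) = {y. \<exists>u\<in>el (f (nof (e (Suc 0)))). y \<in> el u}" for e

  proof -
    have "el (v (nof (e (Suc 0)))) = {y. \<exists>u\<in>el (f (nof (e (Suc 0)))). y \<in> el u}" unfolding v by blast
    then show ?thesis using ext[of "e 0" "v (nof (e (Suc 0)))"] by auto
  qed
  ultimately have ve: "efun v" unfolding efun_def by (intro dtI) simp
  \<comment> \<open>The sets \<open>P n k\<close> increase with \<open>k\<close>, so the union of a
    finite selection lies inside one of them.\<close>
  define kk where "kk = (\<lambda>n. mu (\<lambda>k. \<forall>z. z \<in> el (v n) \<longrightarrow> D n k z))"
  have kn: "nfun kk" unfolding kk_def by (intro nfunI dfi dfD dt_efun[OF ve])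
  have kk: "D n (kk n) z" if "z \<in> el (v n)" for n z
  proof -
    obtain k where k: "\<forall>u\<in>el (f n). el u \<subseteq> el (P n k)" using fin[OF fg] by blast
    have "\<forall>z. z \<in> el (v n) \<longrightarrow> D n k z"
    proof (intro allI impI)
      fix z assume "z \<in> el (v n)"
      then obtain u where "u \<in> el (f n)" "z \<in> el u" unfolding v by blast
      then have "z \<in> el (P n k)" using k by blast
      then show "D n k z" unfolding P by blast
    qed
    from muI[of "\<lambda>k. \<forall>z. z \<in> el (v n) \<longrightarrow> D n k z", OF this] show ?thesis using that unfolding kk_def by blast
  qed
  have inv: "infinite (range v)" using V(2) unfolding gamma_cover_def is_finite_iff Vv by blast
  \<comment> \<open>A \<gamma>-cover is a set, and infinitely many indices may give the same member.
    A subsequence with distinct members is taken, so that a point is missed at finitely many indices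
    only; each next index is at least \<open>kk a\<close>, so pairs in \<open>v a\<close> differ
    somewhere between the two.\<close>
  define R where "R = (\<lambda>(i::nat) a b. a < b \<and> kk a \<le> b \<and> (\<forall>l. l \<le> a \<longrightarrow> v b \<noteq> v l))"
  have Rd: "dfn E (\<lambda>e. R (nof (e 0)) (nof (e 1)) (nof (e 2)))" unfolding R_def
    by (intro dfi dt_efun[OF ve] ntm_nfun[OF kn])
  have Rex: "\<exists>b. R i a b" for i a
  proof (rule ccontr)
    assume no: "\<nexists>b. R i a b"
    have "range v \<subseteq> v ` {..a + kk a}"
    proof
      fix w assume "w \<in> range v"
      then obtain b where b: "w = v b" by blast
      show "w \<in> v ` {..a + kk a}"
      proof (cases "b \<le> a + kk a")
        case False
        then have "a < b" "kk a \<le> b" by linarith+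
        then obtain l where "l \<le> a" "v b = v l" using no unfolding R_def by blast
        then show ?thesis unfolding b by auto
      qed (simp add: b)
    qed
    then show False using inv finite_subset by blast
  qed
  obtain m where m: "nfun m" "m 0 = 0" "\<And>i. R i (m i) (m (Suc i))"
    by (rule nat_dc[OF Rd, of "\<lambda>_ _. True" 0]) (use Rex in simp_all)
  have m2: "\<forall>i. m i < m (Suc i)" "\<And>i. kk (m i) \<le> m (Suc i)" "\<And>i l. l \<le> m i \<Longrightarrow> v (m (Suc i)) \<noteq> v l"
    using m(3) unfolding R_def by blast+
  have sm: "strict_mono m" using m2(1) unfolding strict_mono_Suc_iff .
  have vne: "v (m j) \<noteq> v (m i)" if ij: "i < j" for i j
  proof -
    obtain j' where j': "j = Suc j'" "i \<le> j'" using ij by (cases j) auto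
    then have "m i \<le> m j'" using sm by (simp add: strict_mono_less_eq)
    then show ?thesis unfolding j'(1) by (rule m2(3))
  qed
  have vinj: "inj (\<lambda>i. v (m i))" unfolding inj_def using vne by (metis linorder_neqE_nat)
  obtain x y where xy: "x \<in> X" "y \<in> Y" "\<forall>k. \<exists>n. k \<le> n \<and> sd x y \<inter> {m n..<m (Suc n)} = {}" using unb[OF m(1) m2(1)] by blast
  define z where "z = pr (pt x) (pt y)"
  have "z \<in> el XY" unfolding z_def XY using xy by blast
  then obtain C where C: "el C = {u \<in> el V. z \<notin> el u}" "is_finite E C" using V(2) unfolding gamma_cover_def by blast
  have "(\<lambda>i. v (m i)) ` {i. z \<notin> el (v (m i))} \<subseteq> el C" unfolding C(1) Vv by blast
  then have "finite ((\<lambda>i. v (m i)) ` {i. z \<notin> el (v (m i))})" using C(2) finite_subset unfolding is_finite_iff by blast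
  then have "finite {i. z \<notin> el (v (m i))}" by (rule finite_imageD) (rule inj_on_subset[OF vinj subset_UNIV])
  then obtain k where k: "\<forall>i\<in>{i. z \<notin> el (v (m i))}. i < k" unfolding finite_nat_set_iff_bounded by blast
  obtain n where n: "k \<le> n" "sd x y \<inter> {m n..<m (Suc n)} = {}" using xy(3) by blast
  have "z \<in> el (v (m n))"
  proof (rule ccontr)
    assume "z \<notin> el (v (m n))"
    then have "n < k" using k by simp
    then show False using n(1) by simp
  qed
  from D_up[OF kk[OF this] m2(2)] obtain i where "i \<in> sd x y" "m n \<le> i" "i < m (Suc n)"
    unfolding z_def D[OF xy(1,2)] by blast
  then show False using n(2) by auto
qed

end

section \<open>The product of two \<open>\<gamma>\<close>-spaces in a Cohen extension\<close>

theorem theorem6p6: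
  fixes M :: "'m \<Rightarrow> 'm \<Rightarrow> bool" and N :: "'n \<Rightarrow> 'n \<Rightarrow> bool" and I :: 'm
  assumes "wfp M" and "ZFC M" and "CH M"
    and "\<not> is_countable M I"
    and "Cohen_extension M I N"
  shows "\<exists>R pl tm ze un leq X Y XY.
           is_real_line N R pl tm ze un leq
         \<and> elts N X \<subseteq> elts N R \<and> elts N Y \<subseteq> elts N R \<and> is_prod N X Y XY
         \<and> gamma_space N X (sub_open N (real_open N R leq) X)
         \<and> gamma_space N Y (sub_open N (real_open N R leq) Y)
         \<and> S1_Omega_Omega N XY
             (prod_open N X (sub_open N (real_open N R leq) X) Y (sub_open N (real_open N R leq) Y))
         \<and> \<not> Ufin_O_Gamma N XY
             (prod_open N X (sub_open N (real_open N R leq) X) Y (sub_open N (real_open N R leq) Y))"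
proof -
  obtain G where G: "generic_filter M (Cohen_conditions M I) (Cohen_le M) G"
    "generic_extension M (Cohen_conditions M I) G N" using assms(5) unfolding Cohen_extension_def by (elim exE conjE)
  obtain vl where extN: "extensional_model N" and vl: "vl ` {t. name M (Cohen_conditions M I) t} = UNIV"
    "\<forall>t. name M (Cohen_conditions M I) t \<longrightarrow> elts N (vl t) =
      {vl s | s p e. name M (Cohen_conditions M I) s \<and> p \<in> G \<and> is_pair M s p e \<and> e \<in> elts M t}"
    using G(2) unfolding generic_extension_def by (elim exE conjE)
  note z = assms(2)[unfolded ZFC_def]
  have z1: "extensional_model M" using z by (elim conjE)
  have z2: "\<forall>a b. \<exists>c. elts M c = {a, b}" using z by (elim conjE)
  have z3: "\<forall>x. \<exists>u. is_Union M x u" using z by (elim conjE)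
  have z4: "\<forall>x. \<exists>p. is_Pow M x p" using z by (elim conjE)
  have z5: "\<exists>w. is_inductive M w" using z by (elim conjE)
  have z6: "separation M" "replacement M" "choice M" using z by blast+
  interpret cohen M N I G vl
  proof
    show "wfp M" by (rule assms(1))
    show "\<And>x y. elts M x = elts M y \<Longrightarrow> x = y" using z1 unfolding extensional_model_def by blast
    show "separation M" "replacement M" "choice M" by (rule z6)+
    show "\<exists>c. a \<in> elts M c \<and> b \<in> elts M c" for a b
    proof -
      obtain c where "elts M c = {a, b}" using z2 by blast
      then show ?thesis by (intro exI[of _ c]) simp
    qed
    show "\<exists>u. \<forall>y\<in>elts M x. elts M y \<subseteq> elts M u" for x
    proof -
      obtain u where "elts M u = (\<Union>y\<in>elts M x. elts M y)" using z3 unfolding is_Union_def by blast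
      then show ?thesis by (intro exI[of _ u]) blast
    qed
    show "\<exists>p. \<forall>y. elts M y \<subseteq> elts M x \<longrightarrow> y \<in> elts M p" for x
    proof -
      obtain p where "elts M p = {y. elts M y \<subseteq> elts M x}" using z4 unfolding is_Pow_def by blast
      then show ?thesis by (intro exI[of _ p]) simp
    qed
    show "\<exists>w. is_inductive M w" by (rule z5)
    show "CH M" by (rule assms(3))
    show "\<not> is_countable M I" by (rule assms(4))
    show "generic_filter M (Cohen_conditions M I) (Cohen_le M) G" by (rule G(1))
    show "\<And>x y. elts N x = elts N y \<Longrightarrow> x = y" using extN unfolding extensional_model_def by blast
    show "\<exists>t. name M (Cohen_conditions M I) t \<and> vl t = x" for x
    proof -
      have "x \<in> vl ` {t. name M (Cohen_conditions M I) t}" unfolding vl(1) by (rule UNIV_I)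
      then show ?thesis by blast
    qed
    show "elts N (vl t) = {vl s | s p e. name M (Cohen_conditions M I) s \<and> p \<in> G \<and> is_pair M s p e \<and> e \<in> elts M t}"
      if "name M (Cohen_conditions M I) t" for t using vl(2) that by blast
  qed
  obtain X Y where X0: "X \<subseteq> AA" "Y \<subseteq> AA" "isset (re ` X)" "isset (re ` Y)" and sg: "sgam X" "sgam Y"
    and inf0: "\<forall>x\<in>X. \<forall>y\<in>Y. infinite (sd x y)" and mdc0: "\<forall>x s k. x \<in> X \<longrightarrow> md x s k \<in> X"
    and un0: "\<forall>m. nfun m \<longrightarrow> (\<forall>n. m n < m (Suc n)) \<longrightarrow> (\<exists>x\<in>X. \<exists>y\<in>Y. \<forall>k. \<exists>n. k \<le> n \<and> sd x y \<inter> {m n..<m (Suc n)} = {})"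
  proof (rule XY_exist)
    fix X Y assume a: "X \<subseteq> AA" "Y \<subseteq> AA" "isset (re ` X)" "isset (re ` Y)" "sgam X" "sgam Y"
      and b: "\<And>x y. x \<in> X \<Longrightarrow> y \<in> Y \<Longrightarrow> infinite (sd x y)" and c: "\<And>x s k. x \<in> X \<Longrightarrow> md x s k \<in> X"
      and d: "\<And>m. nfun m \<Longrightarrow> \<forall>n. m n < m (Suc n) \<Longrightarrow> \<exists>x\<in>X. \<exists>y\<in>Y. \<forall>k. \<exists>n. k \<le> n \<and> sd x y \<inter> {m n..<m (Suc n)} = {}"
    show thesis by (rule that[OF a])
      ((intro ballI, rule b; assumption), (intro allI impI, rule c, assumption), (intro allI impI, rule d; assumption))
  qed
  note inf = inf0[rule_format] and mdc = mdc0[rule_format] and un = un0[THEN spec, THEN mp, THEN mp]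
  \<comment> \<open>The sets built in \<open>M\<close> are now viewed in \<open>N\<close>: their
    points are reals of \<open>N\<close>, and \<open>N.pt\<close> moves them to the line of
    \<open>N\<close>.\<close>
  have NX: "X \<subseteq> N.AA" "N.isset (N.re ` X)" using X0 AA_sub reals_name by blast+
  have NY: "Y \<subseteq> N.AA" "N.isset (N.re ` Y)" using X0 AA_sub reals_name by blast+
  obtain XR where XR: "elts N XR = N.pt ` X" using N.isset_pt[OF NX] unfolding N.isset_def by (elim exE)
  obtain YR where YR: "elts N YR = N.pt ` Y" using N.isset_pt[OF NY] unfolding N.isset_def by (elim exE)
  obtain XY where XY0: "elts N XY = {N.pr a b | a b. a \<in> elts N XR \<and> b \<in> elts N YR}"
    using N.isset_prod[OF N.isset_el N.isset_el, of XR YR] unfolding N.isset_def by (elim exE)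
  then have XY: "elts N XY = {N.pr (N.pt x) (N.pt y) | x y. x \<in> X \<and> y \<in> Y}" unfolding XR YR by blast
  obtain pl tm ze un' where rl: "is_real_line N N.Re pl tm ze un' N.le_el" by (rule N.real_line)
  have gam: "gamma_space N ZR (N.topn ZR)"
    if Z: "Z \<subseteq> N.AA" "N.isset (N.re ` Z)" "elts N ZR = N.pt ` Z" "sgam Z" for Z ZR
  proof (rule coded_space.gamma_spaceI[OF N.coded_subset[OF Z(1-3)]])
    fix B assume B: "B \<in> N.AA" and om: "\<And>F. finite F \<Longrightarrow> F \<subseteq> Z \<Longrightarrow> \<exists>b\<in>B. F \<subseteq> cov b"
    have "omc Z B" unfolding omc_def using om by blast
    then obtain h S where h: "nfun h" "S \<in> N.AA" "infinite S" "\<And>i. i \<in> S \<Longrightarrow> h i \<in> B"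
      "\<And>x. x \<in> Z \<Longrightarrow> \<exists>i0. \<forall>i\<in>S. i0 \<le> i \<longrightarrow> x \<in> cov (h i)" using gamma_preserved[OF Z(4) B] by blast
    then show "\<exists>h S. N.nfun h \<and> S \<in> N.AA \<and> infinite S \<and> (\<forall>i\<in>S. h i \<in> B) \<and> (\<forall>w\<in>Z. \<exists>i0. \<forall>i\<in>S. i0 \<le> i \<longrightarrow> w \<in> cov (h i))"
      using nfun_N by (intro exI[of _ h] exI[of _ S]) blast
  qed
  have S1: "S1_Omega_Omega N XY (prod_open N XR (N.topn XR) YR (N.topn YR))"
  proof (rule coded_space.S1I[OF N.coded_product[OF NX XR NY YR XY]])
    fix B assume B: "B \<in> N.AA" and om: "\<And>n F. finite F \<Longrightarrow> F \<subseteq> X \<times> Y \<Longrightarrow> \<exists>j\<in>col n B. F \<subseteq> pcov j"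
    have KA: "{j. F \<subseteq> pcov j} \<in> AA" if "finite F" "F \<subseteq> X \<times> Y" for F
      using that X0(1,2) by (intro pcov_AA) auto
    show "\<exists>h. N.nfun h \<and> (\<forall>n. h n \<in> col n B) \<and> (\<forall>F. finite F \<longrightarrow> F \<subseteq> X \<times> Y \<longrightarrow> (\<exists>n. F \<subseteq> pcov (h n)))"
    proof (rule S1_preserved[OF B, where W="X \<times> Y" and K=pcov])
      show "{j. F \<subseteq> pcov j} \<in> AA" if "finite F" "F \<subseteq> X \<times> Y" for F using that by (rule KA)
      show "\<exists>j\<in>col n B. F \<subseteq> pcov j" if "finite F" "F \<subseteq> X \<times> Y" for n F using that by (rule om)
      fix h assume h: "N.nfun h" "\<And>n. h n \<in> col n B" and hF: "\<And>F. finite F \<Longrightarrow> F \<subseteq> X \<times> Y \<Longrightarrow> \<exists>n. F \<subseteq> pcov (h n)"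
      show ?thesis by (intro exI[of _ h] conjI allI impI h hF; assumption)
    qed
  qed
  have "\<not> Ufin_O_Gamma N XY (prod_open N XR (N.topn XR) YR (N.topn YR))"
    by (rule N.not_Ufin[OF NX XR NY YR XY inf mdc unbounded_preserved[OF un X0(1,2)]])
  moreover have "is_prod N XR YR XY" unfolding is_prod_def N.is_pair_iff XY0 by blast
  moreover have "elts N XR \<subseteq> elts N N.Re" "elts N YR \<subseteq> elts N N.Re"
    unfolding XR YR N.el_Re using N.pt_RR NX(1) NY(1) by blast+
  ultimately show ?thesis using rl gam[OF NX XR sg(1)] gam[OF NY YR sg(2)] S1 by blast
qed

end
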